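(* Let $\psi^0$ be a stochastic flow of measurable mappings in $M$ associated to a consistent sequence $(\mathsf P^{(n)}_\bullet:n\in\mathbb N)$ of coalescing Feller transition functions on $M$ satisfying (TF1), (TF2), (TF3) and (TF4). Let $\varPhi$ be the associated random skeleton, $\theta$ the measurable continuous modification of $\psi^0$ constructed from $\varPhi$, $F\subset\mathbb R\times M$ a closed shell of the set of bifurcation points of $\varPhi$, and let $\sigma^s_x(k),z^s_x(k),k^s_x,\psi_{s,t}(x)$ be constructed from $\theta$ and $F$ (all as in the context). Assume that almost surely: (a) for all $(s,x)\in\mathbb R\times M$, $k^s_x<\infty$; (b) for all $(s,x)\in\mathbb R\times M$, if $k^s_x=0$ then for every $t>s$ there is $n\in I^t$ such that $\theta_{s,\cdot}(x)[t,\infty)=\varPhi_n[t,\infty)$. Then $\psi$ is a strong measurable continuous modification of $\psi^0$.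
   Context: $(M,\rho)$ is a locally compact separable metric space, with $\rho$ complete and all bounded sets relatively compact; $B(x,r)$, $\overline B(x,r)$ are open/closed balls. Transition functions. For each $n$, $\mathsf P^{(n)}_\bullet=(\mathsf P^{(n)}_t)_{t\ge0}$ is a Feller transition function on $M^n$; conditions: (TF1) for $\{i_1,\dots,i_k\}\subset\{1,\dots,n\}$, $\mathsf P^{(n)}_t(x,\pi^{-1}_{i_1,\dots,i_k}B)=\mathsf P^{(k)}_t(\pi_{i_1,\dots,i_k}x,B)$, where $\pi_{i_1,\dots,i_k}x=(x_{i_1},\dots,x_{i_k})$; (TF2) $\mathsf P^{(2)}_t((x,x),\Delta)=1$ with $\Delta$ the diagonal of $M^2$; a sequence satisfying (TF1),(TF2) is a consistent sequence of coalescing Feller transition functions. (TF3) for every compact $K\subset M$ and $r>0$, $\lim_{t\downarrow0}t^{-1}\sup_{x\in K}\mathsf P^{(1)}_t(x,\{y:\rho(x,y)>r\})=0$. $\mathbb P^{(n)}_x$ is the law on $C([0,\infty):M^n)$ of the Markov process with transition function $\mathsf P^{(n)}_\bullet$ started at $x$; for $n=2$ the canonical process is $(X,Y)$. Flows. A stochastic flow of measurable mappings associated to $(\mathsf P^{(n)}_\bullet)$ is a family $\psi=(\psi_{s,t})_{s\le t}$ of random elements, on a probability space $(\Omega,\mathcal A,\mathbb P)$, of the space $\mathsf F$ of measurable maps $M\to M$ (with the cylindrical $\sigma$-field) such that: (SF1) $\mathbb E f(\psi_{s,t}(x_1),\dots,\psi_{s,t}(x_n))=\mathsf P^{(n)}_{t-s}f(x)$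 for $f\in C_0(M^n)$; (SF2) there are measurable $\mathcal J_t:\mathsf F\times M\to M$, $t\ge0$, such that for all $s\le t\le u$, $x$: $\mathcal J_{t-s}(\psi_{s,t})(x)=\psi_{s,t}(x)$ a.s., $\psi_{s,u}(x)=\mathcal J_{u-t}(\psi_{t,u})\circ\psi_{s,t}(x)$ a.s., $\psi_{s,s}(x)=x$; (SF3) $\psi_{t_1,t_2},\dots,\psi_{t_{n-1},t_n}$ are independent for $t_1\le\dots\le t_n$; (SF4) for $f\in C_0(M)$, $\lim_{(u,v)\to(s,t)}\sup_x\mathbb E[(f(\psi_{u,v}(x))-f(\psi_{s,t}(x)))^2]=0$; (SF5) for $f\in C_0(M)$, $\lim_{y\to x}\mathbb E[(f(\psi_{s,t}(y))-f(\psi_{s,t}(x)))^2]=0$ and $\lim_{y\to\infty}\mathbb E[f(\psi_{s,t}(y))^2]=0$. A strong measurable continuous modification of $\psi^0$ is a family $\psi$ of random elements of $\mathsf F$ with $\psi_{s,s}(\omega,x)=x$ always, $\mathbb P[\psi_{s,t}(x)=\psi^0_{s,t}(x)]=1$ for all $s\le t,x$, $(s,t,x,\omega)\mapsto\psi_{s,t}(\omega,x)$ measurable, $t\mapsto\psi_{s,t}(x)$ continuous for all $(s,x,\omega)$, and $\psi_{s,u}=\psi_{t,u}\circ\psi_{s,t}$ for all $s\le t\le u$ and all $\omega$. Convention: properties required for all $\omega$ are understood after restricting to an event of probability one (on which $\varPhi$ is a skeleton and the a.s. hypotheses hold). Path space and skeletons. $X=\bigcup_{s}C([s,\infty):M)$;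 for $f\in C([s,\infty):M)$, $i(f)=s$, $e(f)(t)=f(s\vee t)$; metric $d(f,g)=|i(f)-i(g)|+\delta(e(f),e(g))$ with $\delta$ a metric of locally uniform convergence on $C(\mathbb R:M)$; $d_0$ is the restriction of $d$ to $C([0,\infty):M)$; $fI$ is the restriction of $e(f)$ to $I$. For $\varphi\in X^{\mathbb N}$: $s_n=i(\varphi_n)$, $x_n=\varphi_n(s_n)$, $I^s=\{n:s_n\le s\}$. $\varphi$ is a skeleton ($\varphi\in\mathcal S(M)$) if (1) $m,n\in I^s$, $\varphi_m(s)=\varphi_n(s)$ imply $\varphi_m=\varphi_n$ on $[s,\infty)$; (2) $\{(s_n,x_n)\}$ is dense in $\mathbb R\times M$; (3) for every compact $L\subset\mathbb R\times M$, $\{\varphi_n[s,\infty):n\in I^s,(s,\varphi_n(s))\in L\}$ is relatively compact in $X$. Random skeleton. Fix a countable dense set $\mathcal D=\{(s_n,x_n):n\in\mathbb N\}$ of $\mathbb R\times M$; $\varPhi=(\varPhi_n)$, where $\varPhi_n$ is a continuous modification of $\psi^0_{s_n,\cdot}(x_n)$ with $\varPhi_n(s_n)=x_n$. (TF4): $\varPhi\in\mathcal S(M)$ a.s. $\theta$. Fix a measurable $\ell:X^{\mathbb N}\to X$ sending each relatively compact sequence to one of its limit points. Let $\varepsilon_k(x)=2^{-k}\wedge\inf\{r>0:\sup_{y\in\overline B(x,r)}\mathbb P^{(2)}_{(x,y)}[d_0(X,Y)\ge2^{-k}]>2^{-k}\}$, $n^{s,x}_k=\inf\{n\in I^s:\rho(\varPhi_n(s),x)<\varepsilon_k(x)\}$,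 $\varPhi^{s,x}_k=\varPhi_{n^{s,x}_k}[s,\infty)$ and $\theta_{s,\cdot}(x)=\ell((\varPhi^{s,x}_k)_k)$. Bifurcation points of a skeleton $\varphi$. $\mathcal K^{s,t}_{x}=\bigcap_{\varepsilon>0}\overline{\{\varphi_n[s,t]:n\in I^s,\varphi_n(s)\in B(x,\varepsilon)\}}$ (closure in $C([s,t]:M)$), $\tau^s_x=\inf\{t>s:\#\mathcal K^{s,t}_x\ge2\}$, $B(\varphi)=\{(s,x):\tau^s_x=s\}$. A closed set $F\subset\mathbb R\times M$ is a closed shell of the set of bifurcation points of $\varPhi$ if a.s. $B(\varPhi)\subset F$. Construction of $\psi$. $\sigma^s_x(0)=s$, $z^s_x(0)=x$; if $\sigma^s_x(k)<\infty$, $\sigma^s_x(k+1)=\inf\{t>\sigma^s_x(k):(t,\theta_{\sigma^s_x(k),t}(z^s_x(k)))\in F\}$, and $\sigma^s_x(k+1)=\infty$ if $\sigma^s_x(k)=\infty$; $z^s_x(k+1)=\theta_{\sigma^s_x(k),\sigma^s_x(k+1)}(z^s_x(k))$ if $\sigma^s_x(k+1)<\infty$, else $z^s_x(k+1)=x$. $k^s_x=\inf\{k\ge0:\sigma^s_x(k)=\sigma^s_x(k+1)\}$, $\sigma^s_x(\infty)=\lim_k\sigma^s_x(k)$. For $t\ge s$: if $t<\sigma^s_x(\infty)$, $\psi_{s,t}(x)=\theta_{\sigma^s_x(k),t}(z^s_x(k))$ for the $k<k^s_x$ with $t\in[\sigma^s_x(k),\sigma^s_x(k+1))$; if $t\ge\sigma^s_x(\infty)$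 and $k^s_x<\infty$, $\psi_{s,t}(x)=\theta_{\sigma^s_x(k^s_x),t}(z^s_x(k^s_x))$; if $t\ge\sigma^s_x(\infty)$ and $k^s_x=\infty$, $\psi_{s,t}(x)=x$. *)

theory Defs
  imports "HOL-Probability.Probability"
begin

text \<open>
  The metric space M is a type of sort \<open>{heine_borel, polish_space}\<close>: class \<open>heine_borel\<close> says that
  bounded sets are relatively compact (so M is proper, hence locally compact), and
  class \<open>polish_space\<close> adds completeness and separability.
\<close>

section \<open>Transition functions on finite powers of M\<close>

text \<open>
  A point of \<open>M^n\<close> is a function \<open>nat \<Rightarrow> 'm\<close> that is extensional on \<open>{..<n}\<close>; the coordinates
  \<open>1, \<dots>, n\<close> of the informal text are numbered \<open>0, \<dots>, n - 1\<close>.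
\<close>

definition power_measure :: "nat \<Rightarrow> (nat \<Rightarrow> 'm::topological_space) measure" where
  "power_measure n = (\<Pi>\<^sub>M i\<in>{..<n}. borel)"

definition power_topology :: "nat \<Rightarrow> (nat \<Rightarrow> 'm::topological_space) topology" where
  "power_topology n = product_topology (\<lambda>_. euclidean) {..<n}"

definition coord_proj :: "nat \<Rightarrow> (nat \<Rightarrow> nat) \<Rightarrow> (nat \<Rightarrow> 'm) \<Rightarrow> nat \<Rightarrow> 'm" where
  "coord_proj k \<iota> x = (\<lambda>j\<in>{..<k}. x (\<iota> j))"

definition single_point :: "'m \<Rightarrow> nat \<Rightarrow> 'm" where
  "single_point x = (\<lambda>i\<in>{..<1}. x)"

definition pair_point :: "'m \<Rightarrow> 'm \<Rightarrow> nat \<Rightarrow> 'm" where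
  "pair_point x y = (\<lambda>i\<in>{..<2}. if i = 0 then x else y)"

definition vanishes_at_infinity :: "'b topology \<Rightarrow> ('b \<Rightarrow> real) \<Rightarrow> bool" where
  "vanishes_at_infinity T f \<longleftrightarrow>
     (\<forall>e>0. \<exists>K. compactin T K \<and> (\<forall>x\<in>topspace T - K. \<bar>f x\<bar> < e))"

definition C0 :: "'b topology \<Rightarrow> ('b \<Rightarrow> real) set" where
  "C0 T = {f. continuous_map T euclideanreal f \<and> vanishes_at_infinity T f}"

definition transition_function ::
    "nat \<Rightarrow> (real \<Rightarrow> (nat \<Rightarrow> 'm::topological_space) \<Rightarrow> (nat \<Rightarrow> 'm) measure) \<Rightarrow> bool" where
  "transition_function n Q \<longleftrightarrow>
     (\<forall>t\<ge>0. Q t \<in> power_measure n \<rightarrow>\<^sub>M prob_algebra (power_measure n)) \<and>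
     (\<forall>x\<in>space (power_measure n). Q 0 x = return (power_measure n) x) \<and>
     (\<forall>s\<ge>0. \<forall>t\<ge>0. \<forall>x\<in>space (power_measure n). Q (s + t) x = Q s x \<bind> Q t)"

definition Feller_transition_function ::
    "nat \<Rightarrow> (real \<Rightarrow> (nat \<Rightarrow> 'm::topological_space) \<Rightarrow> (nat \<Rightarrow> 'm) measure) \<Rightarrow> bool" where
  "Feller_transition_function n Q \<longleftrightarrow>
     transition_function n Q \<and>
     (\<forall>f\<in>C0 (power_topology n).
        (\<forall>t\<ge>0. (\<lambda>x. \<integral>y. f y \<partial>Q t x) \<in> C0 (power_topology n)) \<and>
        uniform_limit (topspace (power_topology n)) (\<lambda>t x. \<integral>y. f y \<partial>Q t x) f (at_right 0))"

text \<open>In (TF1) an ordered choice of distinct indices is an injection \<open>\<iota>\<close> from \<open>{..<k}\<close> to \<open>{..<n}\<close>.\<close>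

definition TF1 :: "(nat \<Rightarrow> real \<Rightarrow> (nat \<Rightarrow> 'm::topological_space) \<Rightarrow> (nat \<Rightarrow> 'm) measure) \<Rightarrow> bool" where
  "TF1 P \<longleftrightarrow>
     (\<forall>n k \<iota> t. 1 \<le> k \<and> inj_on \<iota> {..<k} \<and> \<iota> ` {..<k} \<subseteq> {..<n} \<and> 0 \<le> t \<longrightarrow>
        (\<forall>x\<in>space (power_measure n). \<forall>B\<in>sets (power_measure k).
           measure (P n t x) {y\<in>space (power_measure n). coord_proj k \<iota> y \<in> B} =
           measure (P k t (coord_proj k \<iota> x)) B))"

definition TF2 :: "(nat \<Rightarrow> real \<Rightarrow> (nat \<Rightarrow> 'm::topological_space) \<Rightarrow> (nat \<Rightarrow> 'm) measure) \<Rightarrow> bool" where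
  "TF2 P \<longleftrightarrow>
     (\<forall>t\<ge>0. \<forall>x. measure (P 2 t (pair_point x x)) {y\<in>space (power_measure 2). y 0 = y 1} = 1)"

definition consistent_coalescing_Feller ::
    "(nat \<Rightarrow> real \<Rightarrow> (nat \<Rightarrow> 'm::topological_space) \<Rightarrow> (nat \<Rightarrow> 'm) measure) \<Rightarrow> bool" where
  "consistent_coalescing_Feller P \<longleftrightarrow>
     (\<forall>n\<ge>1. Feller_transition_function n (P n)) \<and> TF1 P \<and> TF2 P"

text \<open>The empty compact set is excluded because \<open>Sup {}\<close> is unspecified for reals.\<close>

definition TF3 :: "(nat \<Rightarrow> real \<Rightarrow> (nat \<Rightarrow> 'm::metric_space) \<Rightarrow> (nat \<Rightarrow> 'm) measure) \<Rightarrow> bool" where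
  "TF3 P \<longleftrightarrow>
     (\<forall>K r. compact K \<and> K \<noteq> {} \<and> 0 < r \<longrightarrow>
        ((\<lambda>t. (1 / t) * (SUP x\<in>K. measure (P 1 t (single_point x))
                                   {y\<in>space (power_measure 1). dist x (y 0) > r})) \<longlongrightarrow> 0)
          (at_right 0))"


section \<open>Stochastic flows of measurable mappings\<close>

definition maps_measure :: "('m::topological_space \<Rightarrow> 'm) measure" where
  "maps_measure = restrict_space (\<Pi>\<^sub>M x\<in>UNIV. borel) (borel \<rightarrow>\<^sub>M borel)"

definition SF1 where
  "SF1 Pr P \<psi> \<longleftrightarrow>
     (\<forall>n s t. \<forall>x\<in>space (power_measure n). \<forall>f\<in>C0 (power_topology n). 1 \<le> n \<and> s \<le> t \<longrightarrow>
        (\<integral>\<omega>. f (\<lambda>i\<in>{..<n}. \<psi> s t \<omega> (x i)) \<partial>Pr) = (\<integral>y. f y \<partial>P n (t - s) x))"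
  for Pr :: "'w measure"
    and P :: "nat \<Rightarrow> real \<Rightarrow> (nat \<Rightarrow> 'm::topological_space) \<Rightarrow> (nat \<Rightarrow> 'm) measure"
    and \<psi> :: "real \<Rightarrow> real \<Rightarrow> 'w \<Rightarrow> 'm \<Rightarrow> 'm"

definition SF2 where
  "SF2 Pr \<psi> \<longleftrightarrow>
     (\<exists>J. (\<forall>t\<ge>0. (\<lambda>(f, x). J t f x) \<in> maps_measure \<Otimes>\<^sub>M borel \<rightarrow>\<^sub>M borel) \<and>
        (\<forall>s t u x. s \<le> t \<and> t \<le> u \<longrightarrow>
           (AE \<omega> in Pr. J (t - s) (\<psi> s t \<omega>) x = \<psi> s t \<omega> x) \<and>
           (AE \<omega> in Pr. \<psi> s u \<omega> x = J (u - t) (\<psi> t u \<omega>) (\<psi> s t \<omega> x)) \<and>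
           (\<forall>\<omega>\<in>space Pr. \<psi> s s \<omega> x = x)))"
  for Pr :: "'w measure" and \<psi> :: "real \<Rightarrow> real \<Rightarrow> 'w \<Rightarrow> 'm::topological_space \<Rightarrow> 'm"

definition SF3 where
  "SF3 Pr \<psi> \<longleftrightarrow>
     (\<forall>n (t :: nat \<Rightarrow> real). mono_on {..n} t \<longrightarrow>
        prob_space.indep_vars Pr (\<lambda>_. maps_measure) (\<lambda>i. \<psi> (t i) (t (Suc i))) {..<n})"
  for Pr :: "'w measure" and \<psi> :: "real \<Rightarrow> real \<Rightarrow> 'w \<Rightarrow> 'm::topological_space \<Rightarrow> 'm"

definition SF4 where
  "SF4 Pr \<psi> \<longleftrightarrow>
     (\<forall>f\<in>C0 euclidean. \<forall>s t. s \<le> t \<longrightarrow>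
        ((\<lambda>(u, v). SUP x. \<integral>\<omega>. (f (\<psi> u v \<omega> x) - f (\<psi> s t \<omega> x))\<^sup>2 \<partial>Pr) \<longlongrightarrow> 0)
          (at (s, t) within {(u, v). u \<le> v}))"
  for Pr :: "'w measure" and \<psi> :: "real \<Rightarrow> real \<Rightarrow> 'w \<Rightarrow> 'm::topological_space \<Rightarrow> 'm"

definition SF5 where
  "SF5 Pr \<psi> \<longleftrightarrow>
     (\<forall>f\<in>C0 euclidean. \<forall>s t. s \<le> t \<longrightarrow>
        (\<forall>x. ((\<lambda>y. \<integral>\<omega>. (f (\<psi> s t \<omega> y) - f (\<psi> s t \<omega> x))\<^sup>2 \<partial>Pr) \<longlongrightarrow> 0) (at x)) \<and>
        vanishes_at_infinity euclidean (\<lambda>y. \<integral>\<omega>. (f (\<psi> s t \<omega> y))\<^sup>2 \<partial>Pr))"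
  for Pr :: "'w measure" and \<psi> :: "real \<Rightarrow> real \<Rightarrow> 'w \<Rightarrow> 'm::topological_space \<Rightarrow> 'm"

definition stochastic_flow where
  "stochastic_flow Pr P \<psi> \<longleftrightarrow>
     prob_space Pr \<and>
     (\<forall>s t. s \<le> t \<longrightarrow> \<psi> s t \<in> Pr \<rightarrow>\<^sub>M maps_measure) \<and>
     SF1 Pr P \<psi> \<and> SF2 Pr \<psi> \<and> SF3 Pr \<psi> \<and> SF4 Pr \<psi> \<and> SF5 Pr \<psi>"
  for Pr :: "'w measure"
    and P :: "nat \<Rightarrow> real \<Rightarrow> (nat \<Rightarrow> 'm::topological_space) \<Rightarrow> (nat \<Rightarrow> 'm) measure"
    and \<psi> :: "real \<Rightarrow> real \<Rightarrow> 'w \<Rightarrow> 'm \<Rightarrow> 'm"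

definition strong_measurable_continuous_modification where
  "strong_measurable_continuous_modification Pr \<psi>0 \<psi> \<longleftrightarrow>
     (\<forall>s t. s \<le> t \<longrightarrow> \<psi> s t \<in> Pr \<rightarrow>\<^sub>M maps_measure) \<and>
     (\<forall>s x. \<forall>\<omega>\<in>space Pr. \<psi> s s \<omega> x = x) \<and>
     (\<forall>s t x. s \<le> t \<longrightarrow> (AE \<omega> in Pr. \<psi> s t \<omega> x = \<psi>0 s t \<omega> x)) \<and>
     (\<lambda>((s, t), x, \<omega>). \<psi> s t \<omega> x)
        \<in> restrict_space borel {(s, t). s \<le> t} \<Otimes>\<^sub>M borel \<Otimes>\<^sub>M Pr \<rightarrow>\<^sub>M borel \<and>
     (\<forall>s x. \<forall>\<omega>\<in>space Pr. continuous_on {s..} (\<lambda>t. \<psi> s t \<omega> x)) \<and>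
     (\<forall>s t u. \<forall>\<omega>\<in>space Pr. s \<le> t \<and> t \<le> u \<longrightarrow> \<psi> s u \<omega> = \<psi> t u \<omega> \<circ> \<psi> s t \<omega>)"
  for Pr :: "'w measure" and \<psi>0 \<psi> :: "real \<Rightarrow> real \<Rightarrow> 'w \<Rightarrow> 'm::topological_space \<Rightarrow> 'm"


section \<open>Path space and skeletons\<close>

text \<open>
  A path \<open>f \<in> C([s,\<infinity>):M)\<close> is encoded as the pair \<open>(i(f), e(f)) = (s, \<lambda>t. f (max s t))\<close>. Hence
  \<^term>\<open>fst\<close> is \<open>i\<close>, \<^term>\<open>snd\<close> is \<open>e\<close>, and the restriction \<open>f[s,\<infinity>)\<close> of \<open>e(f)\<close> is \<open>path_tail s f\<close>.
\<close>

type_synonym 'm path = "real \<times> (real \<Rightarrow> 'm)"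

definition paths :: "'m::topological_space path set" where
  "paths = {(s, g). continuous_on UNIV g \<and> (\<forall>t\<le>s. g t = g s)}"

definition paths_from :: "real \<Rightarrow> 'm::topological_space path set" where
  "paths_from s = {f\<in>paths. fst f = s}"

definition path_tail :: "real \<Rightarrow> 'm path \<Rightarrow> 'm path" where
  "path_tail s f = (s, \<lambda>t. snd f (max s t))"

text \<open>
  \<open>\<delta>\<close> is an arbitrary metric of locally uniform convergence on \<open>C(\<real>:M)\<close>; a metrizable topology is
  determined by its convergent sequences.
\<close>

definition locally_uniform_metric ::
    "((real \<Rightarrow> 'm::metric_space) \<Rightarrow> (real \<Rightarrow> 'm) \<Rightarrow> real) \<Rightarrow> bool" where
  "locally_uniform_metric \<delta> \<longleftrightarrow>
     Metric_space {g. continuous_on UNIV g} \<delta> \<and>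
     (\<forall>G g. (\<forall>n. continuous_on UNIV (G n)) \<and> continuous_on UNIV g \<longrightarrow>
        ((\<lambda>n. \<delta> (G n) g) \<longlonglongrightarrow> 0) \<longleftrightarrow> (\<forall>K. compact K \<longrightarrow> uniform_limit K G g sequentially))"

definition path_dist ::
    "((real \<Rightarrow> 'm) \<Rightarrow> (real \<Rightarrow> 'm) \<Rightarrow> real) \<Rightarrow> 'm path \<Rightarrow> 'm path \<Rightarrow> real" where
  "path_dist \<delta> f g = \<bar>fst f - fst g\<bar> + \<delta> (snd f) (snd g)"

definition path_topology ::
    "((real \<Rightarrow> 'm::metric_space) \<Rightarrow> (real \<Rightarrow> 'm) \<Rightarrow> real) \<Rightarrow> 'm path topology" where
  "path_topology \<delta> = Metric_space.mtopology paths (path_dist \<delta>)"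

definition path_measure ::
    "((real \<Rightarrow> 'm::metric_space) \<Rightarrow> (real \<Rightarrow> 'm) \<Rightarrow> real) \<Rightarrow> 'm path measure" where
  "path_measure \<delta> = sigma paths {U. openin (path_topology \<delta>) U}"

definition relatively_compact_in :: "'b topology \<Rightarrow> 'b set \<Rightarrow> bool" where
  "relatively_compact_in T S \<longleftrightarrow> S \<subseteq> topspace T \<and> compactin T (T closure_of S)"

definition started :: "(nat \<Rightarrow> 'm path) \<Rightarrow> real \<Rightarrow> nat set" where
  "started \<phi> s = {n. fst (\<phi> n) \<le> s}"

definition skeleton ::
    "((real \<Rightarrow> 'm::metric_space) \<Rightarrow> (real \<Rightarrow> 'm) \<Rightarrow> real) \<Rightarrow> (nat \<Rightarrow> 'm path) \<Rightarrow> bool" where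
  "skeleton \<delta> \<phi> \<longleftrightarrow>
     (\<forall>n. \<phi> n \<in> paths) \<and>
     (\<forall>s. \<forall>m\<in>started \<phi> s. \<forall>n\<in>started \<phi> s.
        snd (\<phi> m) s = snd (\<phi> n) s \<longrightarrow> (\<forall>t\<ge>s. snd (\<phi> m) t = snd (\<phi> n) t)) \<and>
     closure (range (\<lambda>n. (fst (\<phi> n), snd (\<phi> n) (fst (\<phi> n))))) = UNIV \<and>
     (\<forall>L. compact L \<longrightarrow>
        relatively_compact_in (path_topology \<delta>)
          {path_tail s (\<phi> n) | s n. n \<in> started \<phi> s \<and> (s, snd (\<phi> n) s) \<in> L})"

text \<open>
  \<open>D n = (s_n, x_n)\<close> enumerates the dense set, and \<open>\<Phi> \<omega> n\<close> is the path \<open>\<Phi>_n(\<omega>)\<close>.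
\<close>

definition continuous_modifications where
  "continuous_modifications Pr \<psi>0 D \<Phi> \<longleftrightarrow>
     (\<forall>n. (\<forall>\<omega>\<in>space Pr. \<Phi> \<omega> n \<in> paths_from (fst (D n)) \<and> snd (\<Phi> \<omega> n) (fst (D n)) = snd (D n)) \<and>
        (\<forall>t\<ge>fst (D n). (\<lambda>\<omega>. snd (\<Phi> \<omega> n) t) \<in> borel_measurable Pr \<and>
           (AE \<omega> in Pr. snd (\<Phi> \<omega> n) t = \<psi>0 (fst (D n)) t \<omega> (snd (D n)))))"
  for Pr :: "'w measure" and \<psi>0 :: "real \<Rightarrow> real \<Rightarrow> 'w \<Rightarrow> 'm::topological_space \<Rightarrow> 'm"
    and D :: "nat \<Rightarrow> real \<times> 'm" and \<Phi> :: "'w \<Rightarrow> nat \<Rightarrow> 'm path"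


section \<open>Laws of the n-point motions\<close>

text \<open>
  \<open>C([0,\<infinity>):M^n)\<close> is identified with \<open>C([0,\<infinity>):M)^n\<close>. The law of the Markov process with transition
  function \<open>Q\<close> started at \<open>x\<close> is the unique measure on this space for which the canonical process starts
  at \<open>x\<close> and has the Markov property with respect to its natural filtration.
\<close>

definition path_power_measure ::
    "((real \<Rightarrow> 'm::metric_space) \<Rightarrow> (real \<Rightarrow> 'm) \<Rightarrow> real) \<Rightarrow> nat \<Rightarrow> (nat \<Rightarrow> 'm path) measure" where
  "path_power_measure \<delta> n = (\<Pi>\<^sub>M i\<in>{..<n}. restrict_space (path_measure \<delta>) (paths_from 0))"

definition path_position :: "nat \<Rightarrow> real \<Rightarrow> (nat \<Rightarrow> 'm path) \<Rightarrow> nat \<Rightarrow> 'm" where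
  "path_position n t w = (\<lambda>i\<in>{..<n}. snd (w i) t)"

definition past_events ::
    "((real \<Rightarrow> 'm::metric_space) \<Rightarrow> (real \<Rightarrow> 'm) \<Rightarrow> real) \<Rightarrow> nat \<Rightarrow> real \<Rightarrow> (nat \<Rightarrow> 'm path) set set" where
  "past_events \<delta> n s = sigma_sets (space (path_power_measure \<delta> n))
     {{w\<in>space (path_power_measure \<delta> n). path_position n u w \<in> B} | u B.
        0 \<le> u \<and> u \<le> s \<and> B \<in> sets (power_measure n)}"

definition is_Markov_law ::
    "((real \<Rightarrow> 'm::metric_space) \<Rightarrow> (real \<Rightarrow> 'm) \<Rightarrow> real) \<Rightarrow> nat \<Rightarrow>
     (real \<Rightarrow> (nat \<Rightarrow> 'm) \<Rightarrow> (nat \<Rightarrow> 'm) measure) \<Rightarrow> (nat \<Rightarrow> 'm) \<Rightarrow> (nat \<Rightarrow> 'm path) measure \<Rightarrow> bool" where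
  "is_Markov_law \<delta> n Q x \<mu> \<longleftrightarrow>
     prob_space \<mu> \<and> sets \<mu> = sets (path_power_measure \<delta> n) \<and>
     (AE w in \<mu>. path_position n 0 w = x) \<and>
     (\<forall>s\<ge>0. \<forall>t\<ge>0. \<forall>A\<in>past_events \<delta> n s. \<forall>B\<in>sets (power_measure n).
        emeasure \<mu> (A \<inter> {w\<in>space \<mu>. path_position n (s + t) w \<in> B}) =
        (\<integral>\<^sup>+w\<in>A. emeasure (Q t (path_position n s w)) B \<partial>\<mu>))"

definition Markov_law ::
    "((real \<Rightarrow> 'm::metric_space) \<Rightarrow> (real \<Rightarrow> 'm) \<Rightarrow> real) \<Rightarrow>
     (nat \<Rightarrow> real \<Rightarrow> (nat \<Rightarrow> 'm) \<Rightarrow> (nat \<Rightarrow> 'm) measure) \<Rightarrow> nat \<Rightarrow> (nat \<Rightarrow> 'm) \<Rightarrow> (nat \<Rightarrow> 'm path) measure" where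
  "Markov_law \<delta> P n x = (THE \<mu>. is_Markov_law \<delta> n (P n) x \<mu>)"


section \<open>The modification \<open>\<theta>\<close>\<close>

definition limit_point_selector ::
    "((real \<Rightarrow> 'm::metric_space) \<Rightarrow> (real \<Rightarrow> 'm) \<Rightarrow> real) \<Rightarrow> ((nat \<Rightarrow> 'm path) \<Rightarrow> 'm path) \<Rightarrow> bool" where
  "limit_point_selector \<delta> l \<longleftrightarrow>
     l \<in> (\<Pi>\<^sub>M n\<in>UNIV. path_measure \<delta>) \<rightarrow>\<^sub>M path_measure \<delta> \<and>
     (\<forall>f. relatively_compact_in (path_topology \<delta>) (range f) \<longrightarrow>
        (\<exists>r. strict_mono r \<and> limitin (path_topology \<delta>) (f \<circ> r) (l f) sequentially))"

text \<open>Infima of sets of reals are taken in \<^typ>\<open>ereal\<close>, so that the infimum of the empty set is \<open>\<infinity>\<close>.\<close>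

definition theta_radius ::
    "((real \<Rightarrow> 'm::metric_space) \<Rightarrow> (real \<Rightarrow> 'm) \<Rightarrow> real) \<Rightarrow>
     (nat \<Rightarrow> real \<Rightarrow> (nat \<Rightarrow> 'm) \<Rightarrow> (nat \<Rightarrow> 'm) measure) \<Rightarrow> nat \<Rightarrow> 'm \<Rightarrow> ereal" where
  "theta_radius \<delta> P k x =
     min (ereal ((1 / 2) ^ k))
       (Inf {ereal r | r. 0 < r \<and>
          (SUP y\<in>cball x r. measure (Markov_law \<delta> P 2 (pair_point x y))
             {w\<in>space (path_power_measure \<delta> 2). path_dist \<delta> (w 0) (w 1) \<ge> (1 / 2) ^ k}) > (1 / 2) ^ k})"

definition theta_index ::
    "((real \<Rightarrow> 'm::metric_space) \<Rightarrow> (real \<Rightarrow> 'm) \<Rightarrow> real) \<Rightarrow>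
     (nat \<Rightarrow> real \<Rightarrow> (nat \<Rightarrow> 'm) \<Rightarrow> (nat \<Rightarrow> 'm) measure) \<Rightarrow>
     (nat \<Rightarrow> 'm path) \<Rightarrow> real \<Rightarrow> 'm \<Rightarrow> nat \<Rightarrow> nat" where
  "theta_index \<delta> P \<phi> s x k =
     (LEAST n. n \<in> started \<phi> s \<and> ereal (dist (snd (\<phi> n) s) x) < theta_radius \<delta> P k x)"

text \<open>\<open>theta \<delta> P l \<phi> s x\<close> is the path \<open>\<theta>_{s,\<cdot>}(x)\<close> for the realization \<open>\<phi>\<close> of the random skeleton.\<close>

definition theta ::
    "((real \<Rightarrow> 'm::metric_space) \<Rightarrow> (real \<Rightarrow> 'm) \<Rightarrow> real) \<Rightarrow>
     (nat \<Rightarrow> real \<Rightarrow> (nat \<Rightarrow> 'm) \<Rightarrow> (nat \<Rightarrow> 'm) measure) \<Rightarrow> ((nat \<Rightarrow> 'm path) \<Rightarrow> 'm path) \<Rightarrow>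
     (nat \<Rightarrow> 'm path) \<Rightarrow> real \<Rightarrow> 'm \<Rightarrow> 'm path" where
  "theta \<delta> P l \<phi> s x = l (\<lambda>k. path_tail s (\<phi> (theta_index \<delta> P \<phi> s x k)))"


section \<open>Bifurcation points\<close>

definition local_limits ::
    "(nat \<Rightarrow> 'm::metric_space path) \<Rightarrow> real \<Rightarrow> real \<Rightarrow> 'm \<Rightarrow> (real \<Rightarrow> 'm) set" where
  "local_limits \<phi> s t x =
     (\<Inter>\<epsilon>\<in>{0<..}. mtopology_of (cfunspace (top_of_set {s..t}) euclidean_metric) closure_of
        {restrict (snd (\<phi> n)) {s..t} | n. n \<in> started \<phi> s \<and> snd (\<phi> n) s \<in> ball x \<epsilon>})"

definition bifurcation_time :: "(nat \<Rightarrow> 'm::metric_space path) \<Rightarrow> real \<Rightarrow> 'm \<Rightarrow> ereal" where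
  "bifurcation_time \<phi> s x =
     Inf {ereal t | t. t > s \<and> (\<exists>f\<in>local_limits \<phi> s t x. \<exists>g\<in>local_limits \<phi> s t x. f \<noteq> g)}"

definition bifurcation_points :: "(nat \<Rightarrow> 'm::metric_space path) \<Rightarrow> (real \<times> 'm) set" where
  "bifurcation_points \<phi> = {(s, x). bifurcation_time \<phi> s x = ereal s}"

definition closed_shell :: "'w measure \<Rightarrow> ('w \<Rightarrow> nat \<Rightarrow> 'm::metric_space path) \<Rightarrow> (real \<times> 'm) set \<Rightarrow> bool" where
  "closed_shell Pr \<Phi> F \<longleftrightarrow> closed F \<and> (AE \<omega> in Pr. bifurcation_points (\<Phi> \<omega>) \<subseteq> F)"


section \<open>Construction of \<open>\<psi>\<close>\<close>

text \<open>
  Here \<open>th s x\<close> is the path \<open>\<theta>_{s,\<cdot>}(x)\<close> for a fixed \<open>\<omega>\<close>. The pair \<open>(\<sigma>^s_x(k), z^s_x(k))\<close> is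
  computed by simultaneous recursion.
\<close>

primrec stage :: "(real \<Rightarrow> 'm \<Rightarrow> 'm path) \<Rightarrow> (real \<times> 'm) set \<Rightarrow> real \<Rightarrow> 'm \<Rightarrow> nat \<Rightarrow> ereal \<times> 'm" where
  "stage th F s x 0 = (ereal s, x)"
| "stage th F s x (Suc k) =
     (let (\<sigma>, z) = stage th F s x k;
          f = snd (th (real_of_ereal \<sigma>) z);
          \<sigma>' = (if \<sigma> = \<infinity> then \<infinity> else Inf {ereal t | t. ereal t > \<sigma> \<and> (t, f t) \<in> F})
      in (\<sigma>', if \<sigma>' < \<infinity> then f (real_of_ereal \<sigma>') else x))"

definition sigma_time :: "(real \<Rightarrow> 'm \<Rightarrow> 'm path) \<Rightarrow> (real \<times> 'm) set \<Rightarrow> real \<Rightarrow> 'm \<Rightarrow> nat \<Rightarrow> ereal" where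
  "sigma_time th F s x k = fst (stage th F s x k)"

definition z_point :: "(real \<Rightarrow> 'm \<Rightarrow> 'm path) \<Rightarrow> (real \<times> 'm) set \<Rightarrow> real \<Rightarrow> 'm \<Rightarrow> nat \<Rightarrow> 'm" where
  "z_point th F s x k = snd (stage th F s x k)"

definition k_stop :: "(real \<Rightarrow> 'm \<Rightarrow> 'm path) \<Rightarrow> (real \<times> 'm) set \<Rightarrow> real \<Rightarrow> 'm \<Rightarrow> enat" where
  "k_stop th F s x = Inf {enat k | k. sigma_time th F s x k = sigma_time th F s x (Suc k)}"

definition sigma_infinity :: "(real \<Rightarrow> 'm \<Rightarrow> 'm path) \<Rightarrow> (real \<times> 'm) set \<Rightarrow> real \<Rightarrow> 'm \<Rightarrow> ereal" where
  "sigma_infinity th F s x = lim (sigma_time th F s x)"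

definition glued_flow :: "(real \<Rightarrow> 'm \<Rightarrow> 'm path) \<Rightarrow> (real \<times> 'm) set \<Rightarrow> real \<Rightarrow> real \<Rightarrow> 'm \<Rightarrow> 'm" where
  "glued_flow th F s t x =
     (let piece = (\<lambda>k. snd (th (real_of_ereal (sigma_time th F s x k)) (z_point th F s x k)) t)
      in if ereal t < sigma_infinity th F s x
         then piece (THE k. enat k < k_stop th F s x \<and>
                sigma_time th F s x k \<le> ereal t \<and> ereal t < sigma_time th F s x (Suc k))
         else if k_stop th F s x < \<infinity> then piece (the_enat (k_stop th F s x))
         else x)"

end

theory Submission
  imports Defs
begin

text \<open>
  For fixed \<open>\<omega>\<close>, \<open>\<theta>\<close> follows every path of the skeleton that it meets: the minimal indices in its
  definition are then bounded, so the approximating paths eventually coalesce with that path. Away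
  from bifurcation points all limits of skeleton paths agree, so a path of \<open>\<theta>\<close> may be restarted at any
  time before it next visits \<open>F\<close>. By (a), \<open>\<psi>\<close> consists of finitely many pieces of \<open>\<theta>\<close>; the flow
  property and continuity follow by induction on their number, the last piece being dealt with by (b).

  That \<open>\<psi>\<close> modifies \<open>\<psi>\<^sup>0\<close> is the strong Markov property. Let \<open>Z\<close> be a continuous version of
  \<open>\<psi>\<^sup>0\<close> started at \<open>(s, x)\<close>, and let \<open>\<sigma>\<close> be one of its successive hitting times of \<open>F\<close>. The paths
  approximating \<open>\<theta>\<close> at \<open>(\<sigma>, Z(\<sigma>))\<close> form with \<open>Z\<close> a two-point motion after \<open>\<sigma>\<close>, so by the choice of the
  radii their distance to \<open>Z\<close> is at least \<open>2^{-k}\<close> with probability at most \<open>2^{-k}\<close>. By the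
  Borel--Cantelli lemma \<open>\<theta>\<close> started at \<open>(\<sigma>, Z(\<sigma>))\<close> coincides with \<open>Z\<close> after \<open>\<sigma>\<close>. Continuity of
  the two-point motions in their starting points, which makes the radii positive and measurable and
  yields the strong Markov property, follows from (SF4), (SF5) and the relative compactness in the
  definition of a skeleton.
\<close>

section \<open>Path space\<close>

text \<open>The law in the definition of the radii is given by a definite description, so nothing is
  known about it before existence and uniqueness. Existence comes from the flow itself: a pair of
  continuous versions of \<open>\<psi>\<^sup>0\<close> realises it, and its dependence on the
  starting points is studied by letting such versions converge. (SF3) gives independence only for
  increments over finitely many times, and (SF2) holds only almost surely for each fixed point.
  Hence the Markov property is proved first on cylinder events of countably many versions, and
  \<open>J\<close> is evaluated at random points by Fubini's theorem under a product law. The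
  probability that two paths have distance at least c is merely upper semicontinuous in the starting
  points, so limits are taken for continuous functions of the distance and indicators come last. The
  index chosen at a random time is itself random: for each k the events that index i is chosen are
  disjoint and known at that time, so the bounds add up to 2^(-k) whatever the number of indices.
  Measurability of path-valued maps is reduced to evaluations at countably many times.\<close>

text \<open>The rationals of an open interval are dense in the closed one, and a continuous map
  sends the closure of a set into every closed set containing its image. This is the standard
  passage from countably many times to all times.\<close>

lemma closed_rational_extension:
  fixes h :: "real \<Rightarrow> 'b::topological_space"
  assumes h: "continuous_on UNIV h" and C: "closed C" and "a < b"
    and q: "\<And>q. q \<in> \<rat> \<Longrightarrow> a < q \<Longrightarrow> q < b \<Longrightarrow> h q \<in> C"
    and t: "a \<le> t" "t \<le> b"
  shows "h t \<in> C"
proof -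
  have "closure ({a<..<b} \<inter> \<rat>) = closure {a<..<b}"
    by (rule closure_open_Int_superset) (auto simp: Rats_closure_real)
  also have "\<dots> = {a..b}"
    using \<open>a < b\<close> by simp
  finally have *: "closure ({a<..<b} \<inter> \<rat>) = {a..b}" .
  have "h ` closure ({a<..<b} \<inter> \<rat>) \<subseteq> C"
    by (rule image_closure_subset) (use h C q in \<open>auto intro: continuous_on_subset\<close>)
  then show ?thesis using t unfolding * by auto
qed

section \<open>Restriction and equality of paths\<close>

lemma path_tail_simps [simp]:
  "fst (path_tail s f) = s" "snd (path_tail s f) t = snd f (max s t)"
  by (auto simp: path_tail_def)

lemma paths_continuous: "f \<in> paths \<Longrightarrow> continuous_on UNIV (snd f)"
  by (auto simp: paths_def)

lemma paths_before:
  assumes "f \<in> paths" "t \<le> fst f"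
  shows "snd f t = snd f (fst f)"
proof -
  from assms(1) have "\<forall>t\<le>fst f. snd f t = snd f (fst f)"
    unfolding paths_def mem_Collect_eq split_beta by (rule conjunct2)
  from spec[OF this, of t] assms(2) show ?thesis by (rule mp)
qed

lemma path_tail_paths:
  assumes "f \<in> paths"
  shows "path_tail s f \<in> paths_from s"
proof -
  have "continuous_on UNIV (\<lambda>t. snd f (max s t))"
    by (rule continuous_on_compose2[OF paths_continuous[OF assms]]) (auto intro!: continuous_intros)
  then show ?thesis
    by (simp add: path_tail_def paths_from_def paths_def)
qed

lemma paths_fromD: "f \<in> paths_from s \<Longrightarrow> f \<in> paths" "f \<in> paths_from s \<Longrightarrow> fst f = s"
  by (auto simp: paths_from_def)

lemma path_tail_self:
  assumes "f \<in> paths_from s"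
  shows "path_tail s f = f"
proof (rule prod_eqI)
  show "snd (path_tail s f) = snd f"
  proof
    fix t
    show "snd (path_tail s f) t = snd f t"
      using paths_before[of f t] assms by (cases "t \<le> s") (auto simp: paths_from_def max_def)
  qed
qed (use assms in \<open>simp add: paths_from_def\<close>)

lemma path_eqI:
  assumes "f \<in> paths_from s" "g \<in> paths_from s" "\<And>t. t \<ge> s \<Longrightarrow> snd f t = snd g t"
  shows "f = g"
proof (rule prod_eqI)
  show "snd f = snd g"
  proof
    fix t
    show "snd f t = snd g t"
      using assms(3)[of t] assms(3)[of s] paths_before[of f t] paths_before[of g t] assms(1,2)
      by (cases "t \<ge> s") (auto simp: paths_from_def)
  qed
qed (use assms in \<open>auto simp: paths_from_def\<close>)

lemma path_tail_eq_iff: "path_tail t f = path_tail t g \<longleftrightarrow> (\<forall>u\<ge>t. snd f u = snd g u)"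
  by (auto simp: path_tail_def fun_eq_iff max_def)

section \<open>The metric on the path space and its convergent sequences\<close>

locale path_space =
  fixes \<delta> :: "(real \<Rightarrow> 'm::{heine_borel, polish_space}) \<Rightarrow> (real \<Rightarrow> 'm) \<Rightarrow> real"
  assumes metric: "locally_uniform_metric \<delta>"
begin

lemma metric_delta: "Metric_space {g. continuous_on UNIV g} \<delta>"
  using metric by (simp add: locally_uniform_metric_def)

sublocale paths: Metric_space "paths :: 'm path set" "path_dist \<delta>"
proof
  interpret D: Metric_space "{g. continuous_on UNIV g}" \<delta> by (rule metric_delta)
  show "0 \<le> path_dist \<delta> f g" for f g
    by (simp add: path_dist_def)
  show "path_dist \<delta> f g = path_dist \<delta> g f" for f g
    by (simp add: path_dist_def D.commute abs_minus_commute)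
  fix f g h :: "'m path"
  assume fg: "f \<in> paths" "g \<in> paths"
  show "(path_dist \<delta> f g = 0) = (f = g)"
    using fg D.zero[of "snd f" "snd g"] D.nonneg[of "snd f" "snd g"]
    by (auto simp: path_dist_def paths_continuous prod_eq_iff add_nonneg_eq_0_iff)
  assume "h \<in> paths"
  then show "path_dist \<delta> f h \<le> path_dist \<delta> f g + path_dist \<delta> g h"
    using fg D.triangle[of "snd f" "snd g" "snd h"] by (auto simp: path_dist_def paths_continuous)
qed

lemma topspace_path [simp]: "topspace (path_topology \<delta>) = paths"
  by (simp add: path_topology_def)

lemma limitin_path_iff:
  "limitin (path_topology \<delta>) G f F \<longleftrightarrow>
     f \<in> paths \<and> (\<forall>\<^sub>F n in F. G n \<in> paths) \<and> ((\<lambda>n. path_dist \<delta> (G n) f) \<longlongrightarrow> 0) F"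
  unfolding path_topology_def paths.limitin_metric_dist_null by simp

text \<open>What is used of \<open>\<delta>\<close> is that it is a metric and this description of
  its convergent sequences.\<close>

lemma path_dist_tendsto_iff:
  assumes "\<And>n. G n \<in> paths" "f \<in> paths"
  shows "(\<lambda>n. path_dist \<delta> (G n) f) \<longlonglongrightarrow> 0 \<longleftrightarrow>
    (\<lambda>n. fst (G n)) \<longlonglongrightarrow> fst f \<and>
      (\<forall>K. compact K \<longrightarrow> uniform_limit K (\<lambda>n. snd (G n)) (snd f) sequentially)"
proof -
  interpret D: Metric_space "{g. continuous_on UNIV g}" \<delta> by (rule metric_delta)
  have *: "(\<lambda>n. \<delta> (snd (G n)) (snd f)) \<longlonglongrightarrow> 0 \<longleftrightarrow>
    (\<forall>K. compact K \<longrightarrow> uniform_limit K (\<lambda>n. snd (G n)) (snd f) sequentially)"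
    using metric assms by (simp add: locally_uniform_metric_def paths_continuous)
  have "(\<lambda>n. path_dist \<delta> (G n) f) \<longlonglongrightarrow> 0 \<longleftrightarrow>
    (\<lambda>n. \<bar>fst (G n) - fst f\<bar>) \<longlonglongrightarrow> 0 \<and> (\<lambda>n. \<delta> (snd (G n)) (snd f)) \<longlonglongrightarrow> 0"
  proof safe
    assume a: "(\<lambda>n. path_dist \<delta> (G n) f) \<longlonglongrightarrow> 0"
    show "(\<lambda>n. \<bar>fst (G n) - fst f\<bar>) \<longlonglongrightarrow> 0"
      by (rule tendsto_sandwich[OF _ _ tendsto_const a]) (auto simp: path_dist_def)
    show "(\<lambda>n. \<delta> (snd (G n)) (snd f)) \<longlonglongrightarrow> 0"
      by (rule tendsto_sandwich[OF _ _ tendsto_const a]) (auto simp: path_dist_def)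
  next
    assume "(\<lambda>n. \<bar>fst (G n) - fst f\<bar>) \<longlonglongrightarrow> 0" "(\<lambda>n. \<delta> (snd (G n)) (snd f)) \<longlonglongrightarrow> 0"
    from tendsto_add[OF this] show "(\<lambda>n. path_dist \<delta> (G n) f) \<longlonglongrightarrow> 0"
      by (simp add: path_dist_def)
  qed
  also have "(\<lambda>n. \<bar>fst (G n) - fst f\<bar>) \<longlonglongrightarrow> 0 \<longleftrightarrow> (\<lambda>n. fst (G n)) \<longlonglongrightarrow> fst f"
    unfolding tendsto_rabs_zero_iff by (simp add: LIM_zero_iff)
  finally show ?thesis using * by simp
qed

text \<open>Membership in a tube depends on countably many evaluations, and open sets are countable unions
  of tubes. This replaces separability of the path space.\<close>

definition tube :: "nat \<Rightarrow> nat \<times> real \<times> 'm list \<Rightarrow> 'm path set" where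
  "tube m = (\<lambda>(k, a, cs). {f\<in>paths. \<bar>fst f - a\<bar> \<le> 1 / Suc m \<and> length cs = 2 * m * Suc k \<and>
     (\<forall>i<length cs. \<forall>q\<in>\<rat>. - m + i / Suc k < q \<and> q < - m + Suc i / Suc k \<longrightarrow>
        dist (snd f q) (cs ! i) \<le> 1 / Suc m)})"

definition dense_pts :: "'m set" where
  "dense_pts = (SOME D. countable D \<and> (\<forall>X. open X \<longrightarrow> X \<noteq> {} \<longrightarrow> (\<exists>d\<in>D. d \<in> X)))"

lemma dense_pts: "countable dense_pts" "open X \<Longrightarrow> X \<noteq> {} \<Longrightarrow> \<exists>d\<in>dense_pts. d \<in> X"
proof -
  have "\<exists>D::'m set. countable D \<and> (\<forall>X. open X \<longrightarrow> X \<noteq> {} \<longrightarrow> (\<exists>d\<in>D. d \<in> X))"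
    by (metis countable_dense_setE)
  from someI_ex[OF this] show "countable dense_pts" "open X \<Longrightarrow> X \<noteq> {} \<Longrightarrow> \<exists>d\<in>dense_pts. d \<in> X"
    unfolding dense_pts_def[symmetric] by auto
qed

definition tubes :: "'m path set set" where
  "tubes = (\<Union>m. tube m ` (UNIV \<times> \<rat> \<times> lists dense_pts))"

lemma countable_tubes: "countable tubes"
  unfolding tubes_def by (auto intro!: countable_SIGMA countable_rat dense_pts simp: countable_lists)

text \<open>Uniform continuity on [-m, m] supplies a mesh 1 / Suc k on which the path oscillates by
  less than half of the tolerance 1 / Suc m; the other half pays for replacing its values by points
  of \<open>dense_pts\<close>.\<close>

lemma ex_tube:
  assumes f: "f \<in> paths"
  shows "\<exists>N\<in>tube m ` (UNIV \<times> \<rat> \<times> lists dense_pts). f \<in> N"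
proof -
  obtain a where a: "a \<in> \<rat>" "fst f - 1 / Suc m < a" "a < fst f + 1 / Suc m"
    using Rats_dense_in_real[of "fst f - 1 / Suc m" "fst f + 1 / Suc m"] by auto
  have "uniformly_continuous_on {- real m..real m} (snd f)"
    by (rule compact_uniformly_continuous) (auto intro: continuous_on_subset paths_continuous[OF f])
  then obtain d where d: "d > 0"
    "\<And>x y. x \<in> {- real m..real m} \<Longrightarrow> y \<in> {- real m..real m} \<Longrightarrow> dist x y < d \<Longrightarrow>
       dist (snd f x) (snd f y) < 1 / (2 * Suc m)"
    unfolding uniformly_continuous_on_def by (metis divide_pos_pos mult_pos_pos of_nat_0_less_iff
        zero_less_Suc zero_less_numeral zero_less_one)
  obtain k where k: "1 / real (Suc k) < d"
    using d(1) nat_approx_posE by blast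
  have "\<exists>c\<in>dense_pts. dist (snd f t) c < 1 / (2 * Suc m)" for t
    using dense_pts(2)[of "ball (snd f t) (1 / (2 * Suc m))"] by auto
  then obtain c where c: "\<And>t. c t \<in> dense_pts" "\<And>t. dist (snd f t) (c t) < 1 / (2 * Suc m)"
    by metis
  \<comment> \<open>One centre per cell, chosen for its left end point; [-m, m] consists of 2 m (k +
    1) cells of length 1 / Suc k.\<close>
  define cs where "cs = map (\<lambda>i. c (- m + i / Suc k)) [0..<2 * m * Suc k]"
  have "dist (snd f q) (cs ! i) \<le> 1 / Suc m"
    if i: "i < length cs" and q: "- m + i / Suc k < q" "q < - m + Suc i / Suc k" for i q
  proof -
    have i': "Suc i \<le> 2 * m * Suc k" using i by (simp add: cs_def)
    then have "real (Suc i) \<le> real (2 * m * Suc k)"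
      by (simp only: of_nat_le_iff)
    then have "real (Suc i) / Suc k \<le> 2 * m"
      by (simp add: field_simps)
    moreover have "real i / Suc k \<ge> 0" "real i / Suc k \<le> real (Suc i) / Suc k"
      by (auto simp: divide_right_mono)
    ultimately have r: "- m + i / Suc k \<in> {- real m..real m}" "q \<in> {- real m..real m}"
      using q unfolding atLeastAtMost_iff by linarith+
    have "real (Suc i) / Suc k = real i / Suc k + 1 / Suc k"
      by (simp add: add_divide_distrib)
    then have "dist (- m + i / Suc k) q < d"
      using q k by (auto simp: dist_real_def)
    from d(2)[OF r this] have "dist (snd f (- m + i / Suc k)) (snd f q) < 1 / (2 * Suc m)" .
    moreover have "dist (snd f (- m + i / Suc k)) (cs ! i) < 1 / (2 * Suc m)"
      using c(2) i by (simp add: cs_def)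
    moreover have "1 / real (2 * Suc m) + 1 / real (2 * Suc m) = 1 / real (Suc m)"
      by (simp add: field_simps)
    ultimately show ?thesis
      using dist_triangle2[of "snd f q" "cs ! i" "snd f (- m + i / Suc k)"]
      by (smt (verit) dist_commute dist_triangle)
  qed
  moreover have "cs \<in> lists dense_pts" using c(1) by (auto simp: cs_def)
  moreover have "\<bar>fst f - a\<bar> \<le> 1 / Suc m" using a by (auto simp: abs_le_iff)
  ultimately have "f \<in> tube m (k, a, cs)"
    using f by (auto simp: tube_def cs_def)
  then show ?thesis using a \<open>cs \<in> _\<close> by blast
qed

text \<open>Both paths are within 1 / Suc m of the same centre on the cell containing t; the bound
  known at rational times extends to t by continuity.\<close>

lemma tube_close:
  assumes f: "f \<in> tube m p" and g: "g \<in> tube m p"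
  shows "\<bar>fst f - fst g\<bar> \<le> 2 / Suc m" "\<And>t. \<bar>t\<bar> < m \<Longrightarrow> dist (snd f t) (snd g t) \<le> 2 / Suc m"
proof -
  obtain k a cs where p: "p = (k, a, cs)" by (cases p)
  have fg: "f \<in> paths" "g \<in> paths" using f g by (auto simp: tube_def p)
  show "\<bar>fst f - fst g\<bar> \<le> 2 / Suc m"
    using f g by (auto simp: tube_def p abs_le_iff)
  fix t :: real assume t: "\<bar>t\<bar> < m"
  \<comment> \<open>The number of the cell that contains t, counted from -m; |t| < m makes it a
    valid position in \<open>cs\<close>.\<close>
  define i where "i = nat \<lfloor>(t + m) * Suc k\<rfloor>"
  have i0: "real i = of_int \<lfloor>(t + m) * Suc k\<rfloor>" using t by (simp add: i_def)
  then have i: "i \<le> (t + m) * Suc k" "(t + m) * Suc k < Suc i" by linarith+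
  then have i1: "- m + i / Suc k \<le> t" "t < - m + Suc i / Suc k"
    by (auto simp: field_simps)
  have "real i < real (2 * m * Suc k)"
  proof -
    have "(t + m) * real (Suc k) < (2 * real m) * real (Suc k)"
      by (rule mult_strict_right_mono) (use t in auto)
    with i(1) have "real i < (2 * real m) * real (Suc k)" by (rule le_less_trans)
    then show ?thesis by (simp only: of_nat_mult of_nat_numeral)
  qed
  then have ii: "i < 2 * m * Suc k"
    by (simp only: of_nat_less_iff[symmetric, where 'a=real])
  have *: "dist (snd h t) (cs ! i) \<le> 1 / Suc m" if h: "h \<in> tube m p" for h
  proof -
    have "snd h t \<in> cball (cs ! i) (1 / Suc m)"
    proof (rule closed_rational_extension[where a="- m + i / Suc k" and b="- m + Suc i / Suc k"])
      show "continuous_on UNIV (snd h)" using h by (auto simp: tube_def p paths_continuous)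
      show "- m + i / Suc k < - m + Suc i / Suc k" by (simp add: field_simps)
    qed (use h i1 ii in \<open>auto simp: tube_def p dist_commute\<close>)
    then show ?thesis by (simp add: dist_commute)
  qed
  have "dist (snd f t) (snd g t) \<le> dist (snd f t) (cs ! i) + dist (snd g t) (cs ! i)"
    by (rule dist_triangle2)
  then show "dist (snd f t) (snd g t) \<le> 2 / Suc m"
    using *[OF f] *[OF g] by simp
qed

text \<open>Only the convergent sequences of the metric are known, hence the indirect proof:
  otherwise, for every m, a tube of level m around f contains a path at distance at least e from f,
  and these paths converge to f by \<open>tube_close\<close>.\<close>

lemma ex_small_tube:
  assumes f: "f \<in> paths" and e: "e > 0"
  shows "\<exists>N\<in>tubes. f \<in> N \<and> (\<forall>g\<in>N. path_dist \<delta> f g < e)"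
proof (rule ccontr)
  assume contra: "\<not> ?thesis"
  have "\<exists>N g. N \<in> tube m ` (UNIV \<times> \<rat> \<times> lists dense_pts) \<and> f \<in> N \<and> g \<in> N \<and> path_dist \<delta> f g \<ge> e" for m
  proof -
    obtain N where N: "N \<in> tube m ` (UNIV \<times> \<rat> \<times> lists dense_pts)" "f \<in> N"
      using ex_tube[OF f, of m] by (rule bexE)
    then have "N \<in> tubes" by (auto simp: tubes_def)
    with contra N(2) obtain g where "g \<in> N" "\<not> path_dist \<delta> f g < e" by blast
    with N show ?thesis unfolding not_less by blast
  qed
  then obtain N G where N: "\<And>m. N m \<in> tube m ` (UNIV \<times> \<rat> \<times> lists dense_pts)"
    "\<And>m. f \<in> N m" "\<And>m. G m \<in> N m" "\<And>m. path_dist \<delta> f (G m) \<ge> e"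
    by metis
  have close: "\<bar>fst (G m) - fst f\<bar> \<le> 2 / Suc m"
    "\<And>t. \<bar>t\<bar> < m \<Longrightarrow> dist (snd (G m) t) (snd f t) \<le> 2 / Suc m" for m
    using tube_close[of "G m" m _ f] N(1)[of m] N(2)[of m] N(3)[of m] by auto
  have lim: "(\<lambda>m. 2 / real (Suc m)) \<longlonglongrightarrow> 0"
    using LIMSEQ_Suc[OF lim_const_over_n[of 2]] by simp
  have "(\<lambda>m. path_dist \<delta> (G m) f) \<longlonglongrightarrow> 0"
  proof (subst path_dist_tendsto_iff)
    show "G m \<in> paths" for m using N(1)[of m] N(3)[of m] by (auto simp: tube_def)
    show "f \<in> paths" by fact
    have "(\<lambda>n. fst (G n)) \<longlonglongrightarrow> fst f"
      by (rule metric_tendsto_imp_tendsto[OF lim]) (use close(1) in \<open>auto simp: dist_real_def\<close>)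
    moreover have "uniform_limit K (\<lambda>n. snd (G n)) (snd f) sequentially" if K: "compact K" for K
    proof (rule uniform_limitI)
      fix e :: real assume "e > 0"
      obtain R where R: "\<And>x. x \<in> K \<Longrightarrow> \<bar>x\<bar> \<le> R"
        using compact_imp_bounded[OF K] by (auto simp: bounded_iff)
      have "\<forall>\<^sub>F m in sequentially. 2 / real (Suc m) < e"
        using order_tendstoD(2)[OF lim \<open>e > 0\<close>] .
      moreover have "\<forall>\<^sub>F m in sequentially. R < real m"
        using filterlim_real_sequentially by (simp add: filterlim_at_top_dense)
      ultimately show "\<forall>\<^sub>F n in sequentially. \<forall>x\<in>K. dist (snd (G n) x) (snd f x) < e"
      proof eventually_elim
        case (elim m)
        then show ?case using R close(2)[of _ m] by (meson le_less_trans)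
      qed
    qed
    ultimately show "(\<lambda>n. fst (G n)) \<longlonglongrightarrow> fst f \<and>
        (\<forall>K. compact K \<longrightarrow> uniform_limit K (\<lambda>n. snd (G n)) (snd f) sequentially)"
      by blast
  qed
  from order_tendstoD(2)[OF this e] show False
    using N(4) by (auto simp: eventually_sequentially paths.commute not_less[symmetric])
qed

section \<open>The Borel sets of the path space\<close>

lemma space_path_measure [simp]: "space (path_measure \<delta>) = paths"
  unfolding path_measure_def
  by (rule space_measure_of) (use openin_subset[of "path_topology \<delta>"] in auto)

lemma sets_path_measure: "sets (path_measure \<delta>) = sigma_sets paths {U. openin (path_topology \<delta>) U}"
  unfolding path_measure_def
  by (rule sets_measure_of) (use openin_subset[of "path_topology \<delta>"] in auto)

lemma open_path_iff:
  "openin (path_topology \<delta>) U \<longleftrightarrow> U \<subseteq> paths \<and> (\<forall>f\<in>U. \<exists>e>0. \<forall>g\<in>paths. path_dist \<delta> f g < e \<longrightarrow> g \<in> U)"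
proof -
  have "paths.mball f e \<subseteq> U \<longleftrightarrow> (\<forall>g\<in>paths. path_dist \<delta> f g < e \<longrightarrow> g \<in> U)" if "f \<in> paths" for f e
    using that by (auto simp: paths.in_mball simp del: split_paired_All)
  then have "(\<forall>f. f \<in> U \<longrightarrow> (\<exists>r>0. paths.mball f r \<subseteq> U)) \<longleftrightarrow>
      (\<forall>f\<in>U. \<exists>e>0. \<forall>g\<in>paths. path_dist \<delta> f g < e \<longrightarrow> g \<in> U)" if "U \<subseteq> paths"
    using that unfolding Ball_def[of U] by (intro all_cong) blast
  then show ?thesis
    unfolding path_topology_def paths.openin_mtopology by (intro conj_cong refl)
qed

lemma tube_vimage_measurable:
  assumes X: "\<And>x. x \<in> space M \<Longrightarrow> X x \<in> paths" and [measurable]: "(\<lambda>x. fst (X x)) \<in> borel_measurable M"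
    and ev [measurable]: "\<And>t. (\<lambda>x. snd (X x) t) \<in> borel_measurable M" and N: "N \<in> tubes"
  shows "{x\<in>space M. X x \<in> N} \<in> sets M"
proof -
  obtain m k a cs where N: "N = tube m (k, a, cs)" using N by (auto simp: tubes_def)
  have "{x\<in>space M. X x \<in> N} = {x\<in>space M. \<bar>fst (X x) - a\<bar> \<le> 1 / Suc m \<and> length cs = 2 * m * Suc k \<and>
     (\<forall>i\<in>{..<length cs}. \<forall>q\<in>{q\<in>\<rat>. - m + i / Suc k < q \<and> q < - m + Suc i / Suc k}.
        dist (snd (X x) q) (cs ! i) \<le> 1 / Suc m)}"
    using X by (auto simp: N tube_def)
  also have "\<dots> \<in> sets M"
    by (intro sets.sets_Collect sets.sets_Collect_countable_All')
      (auto intro: countable_subset[OF _ countable_rat])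
  finally show ?thesis .
qed

text \<open>The preimage of an open set U is the union of the preimages of the countably many tubes
  contained in U, so the start and the evaluations suffice to test measurability.\<close>

lemma measurable_pathI:
  assumes X: "\<And>x. x \<in> space M \<Longrightarrow> X x \<in> paths" and "(\<lambda>x. fst (X x)) \<in> borel_measurable M"
    "\<And>t. (\<lambda>x. snd (X x) t) \<in> borel_measurable M"
  shows "X \<in> M \<rightarrow>\<^sub>M path_measure \<delta>"
proof (rule measurable_sigma_sets[OF sets_path_measure])
  show "{U. openin (path_topology \<delta>) U} \<subseteq> Pow paths"
    using openin_subset[of "path_topology \<delta>"] by auto
  show "X \<in> space M \<rightarrow> paths" using X by auto
  fix U assume "U \<in> {U. openin (path_topology \<delta>) U}"
  then have U: "openin (path_topology \<delta>) U" by simp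
  have "X -` U \<inter> space M \<subseteq> (\<Union>N\<in>{N\<in>tubes. N \<subseteq> U}. {x\<in>space M. X x \<in> N})"
  proof
    fix x assume "x \<in> X -` U \<inter> space M"
    then have x: "X x \<in> U" "x \<in> space M" by auto
    then obtain e where e: "e > 0" "\<And>g. g \<in> paths \<Longrightarrow> path_dist \<delta> (X x) g < e \<Longrightarrow> g \<in> U"
      using U unfolding open_path_iff by blast
    obtain N where N: "N \<in> tubes" "X x \<in> N" "\<And>g. g \<in> N \<Longrightarrow> path_dist \<delta> (X x) g < e"
      using ex_small_tube[OF X[OF x(2)] e(1)] by auto
    moreover have "N \<subseteq> paths" using N(1) by (auto simp: tubes_def tube_def)
    ultimately have "N \<subseteq> U" using e by blast
    with N x show "x \<in> (\<Union>N\<in>{N\<in>tubes. N \<subseteq> U}. {x\<in>space M. X x \<in> N})" by auto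
  qed
  then have "X -` U \<inter> space M = (\<Union>N\<in>{N\<in>tubes. N \<subseteq> U}. {x\<in>space M. X x \<in> N})" by auto
  also have "\<dots> \<in> sets M"
    by (rule sets.countable_UN'') (auto intro: countable_subset[OF _ countable_tubes] tube_vimage_measurable assms)
  finally show "X -` U \<inter> space M \<in> sets M" .
qed

lemma continuous_path_functional_measurable:
  fixes h :: "'m path \<Rightarrow> 'b::metric_space"
  assumes "\<And>G f. (\<And>n. G n \<in> paths) \<Longrightarrow> f \<in> paths \<Longrightarrow> (\<lambda>n. path_dist \<delta> (G n) f) \<longlonglongrightarrow> 0 \<Longrightarrow>
    (\<lambda>n. h (G n)) \<longlonglongrightarrow> h f"
  shows "h \<in> borel_measurable (path_measure \<delta>)"
proof (rule borel_measurableI)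
  fix S :: "'b set" assume S: "open S"
  have "openin (path_topology \<delta>) (h -` S \<inter> paths)"
    unfolding open_path_iff
  proof safe
    fix a b assume f: "h (a, b) \<in> S" "(a, b) \<in> paths"
    let ?f = "(a, b)"
    show "\<exists>e>0. \<forall>g\<in>paths. path_dist \<delta> (a, b) g < e \<longrightarrow> g \<in> h -` S \<inter> paths"
    proof (rule ccontr)
      assume "\<not> ?thesis"
      then have "\<exists>g\<in>paths. path_dist \<delta> ?f g < 1 / Suc n \<and> h g \<notin> S" for n
        by (auto dest!: spec[of _ "1 / real (Suc n)"])
      then obtain G where G: "\<And>n. G n \<in> paths" "\<And>n. path_dist \<delta> ?f (G n) < 1 / Suc n" "\<And>n. h (G n) \<notin> S"
        by metis
      have "(\<lambda>n. path_dist \<delta> (G n) ?f) \<longlonglongrightarrow> 0"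
        by (rule tendsto_sandwich[OF _ _ tendsto_const LIMSEQ_Suc[OF lim_const_over_n[of 1]]])
          (use G(2) in \<open>auto simp: paths.commute intro!: always_eventually less_imp_le\<close>)
      from assms[OF G(1) f(2) this] have "(\<lambda>n. h (G n)) \<longlonglongrightarrow> h ?f" .
      from topological_tendstoD[OF this S f(1)] show False
        using G(3) by (auto simp: eventually_sequentially)
    qed
  qed
  then show "h -` S \<inter> space (path_measure \<delta>) \<in> sets (path_measure \<delta>)"
    by (auto simp: sets_path_measure)
qed

lemma path_dist_tendsto_eval:
  assumes "\<And>n. G n \<in> paths" "f \<in> paths" "(\<lambda>n. path_dist \<delta> (G n) f) \<longlonglongrightarrow> 0"
  shows "(\<lambda>n. snd (G n) t) \<longlonglongrightarrow> snd f t"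
proof -
  have "\<forall>K. compact K \<longrightarrow> uniform_limit K (\<lambda>n. snd (G n)) (snd f) sequentially"
    using iffD1[OF path_dist_tendsto_iff[OF assms(1,2)] assms(3)] by (rule conjunct2)
  from spec[OF this, of "{t}"] show ?thesis by simp
qed

lemma eval_measurable [measurable]: "(\<lambda>f. snd f t) \<in> borel_measurable (path_measure \<delta>)"
  by (rule continuous_path_functional_measurable) (rule path_dist_tendsto_eval)

lemma start_measurable [measurable]: "fst \<in> borel_measurable (path_measure \<delta>)"
  by (rule continuous_path_functional_measurable) (auto simp: path_dist_tendsto_iff)

end

text \<open>Rounding T down to multiples of 1 / Suc n leaves countably many values, and continuity
  in time recovers T in the limit. M may be any measure, in particular a member of a
  filtration.\<close>

lemma measurable_continuous_argument:
  fixes W :: "'a \<Rightarrow> real \<Rightarrow> 'b::metric_space"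
  assumes W: "\<And>t. (\<lambda>x. W x t) \<in> borel_measurable M"
    and cont: "\<And>x. x \<in> space M \<Longrightarrow> continuous_on UNIV (W x)"
    and T [measurable]: "T \<in> borel_measurable M"
  shows "(\<lambda>x. W x (T x)) \<in> borel_measurable M"
proof (rule borel_measurable_LIMSEQ_metric)
  fix n :: nat
  have "(\<lambda>x. W x (of_int i / Suc n)) \<in> borel_measurable M" for i :: int by (rule W)
  then show "(\<lambda>x. W x (of_int \<lfloor>T x * Suc n\<rfloor> / Suc n)) \<in> borel_measurable M"
    by (rule measurable_compose_countable) measurable
next
  fix x assume x: "x \<in> space M"
  have "(\<lambda>n. of_int \<lfloor>T x * Suc n\<rfloor> / real (Suc n)) \<longlonglongrightarrow> T x"
  proof (rule metric_tendsto_imp_tendsto[OF LIMSEQ_Suc[OF lim_const_over_n[of "1::real"]]])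
    have "dist (of_int \<lfloor>T x * Suc n\<rfloor> / real (Suc n)) (T x) \<le> dist (1 / real (Suc n)) 0" for n
    proof -
      have "\<bar>of_int \<lfloor>T x * Suc n\<rfloor> - T x * Suc n\<bar> \<le> 1" by linarith
      moreover have "of_int \<lfloor>T x * Suc n\<rfloor> / real (Suc n) - T x = (of_int \<lfloor>T x * Suc n\<rfloor> - T x * Suc n) / Suc n"
        by (simp add: field_simps)
      ultimately show ?thesis by (simp add: dist_real_def divide_right_mono)
    qed
    then show "\<forall>\<^sub>F n in sequentially. dist (of_int \<lfloor>T x * Suc n\<rfloor> / real (Suc n)) (T x) \<le> dist (1 / real (Suc n)) 0"
      by (intro always_eventually allI)
  qed
  moreover have "isCont (W x) (T x)"
    using cont[OF x] by (simp add: continuous_on_eq_continuous_at)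
  ultimately show "(\<lambda>n. W x (of_int \<lfloor>T x * Suc n\<rfloor> / Suc n)) \<longlonglongrightarrow> W x (T x)"
    using isCont_tendsto_compose by fast
qed

context path_space
begin

lemma measurable_eval_at:
  assumes X: "X \<in> M \<rightarrow>\<^sub>M path_measure \<delta>" and T: "T \<in> borel_measurable M"
  shows "(\<lambda>x. snd (X x) (T x)) \<in> borel_measurable M"
proof (rule measurable_continuous_argument[OF _ _ T])
  show "(\<lambda>x. snd (X x) t) \<in> borel_measurable M" for t
    by (rule measurable_compose[OF X eval_measurable])
  show "continuous_on UNIV (snd (X x))" if "x \<in> space M" for x
    using measurable_space[OF X that] by (simp add: paths_continuous)
qed

lemma measurable_path_tail:
  assumes X: "X \<in> M \<rightarrow>\<^sub>M path_measure \<delta>" and [measurable]: "T \<in> borel_measurable M"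
  shows "(\<lambda>x. path_tail (T x) (X x)) \<in> M \<rightarrow>\<^sub>M path_measure \<delta>"
proof (rule measurable_pathI)
  show "path_tail (T x) (X x) \<in> paths" if "x \<in> space M" for x
    using path_tail_paths[of "X x" "T x"] measurable_space[OF X that] by (simp add: paths_from_def)
qed (auto intro!: measurable_eval_at[OF X])

text \<open>Continuity of the distance only yields open sets of pairs, and these are not known to
  lie in the product sigma-algebra. Countably many rectangles of tubes exhaust the pairs at distance
  less than c.\<close>

lemma path_dist_measurable:
  assumes X: "X \<in> M \<rightarrow>\<^sub>M path_measure \<delta>" and Y: "Y \<in> M \<rightarrow>\<^sub>M path_measure \<delta>"
  shows "(\<lambda>x. path_dist \<delta> (X x) (Y x)) \<in> borel_measurable M"
proof (rule borel_measurableI_less)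
  fix c :: real
  have P: "X x \<in> paths" "Y x \<in> paths" if "x \<in> space M" for x
    using measurable_space[OF X that] measurable_space[OF Y that] by auto
  have sets: "{x\<in>space M. Z x \<in> N} \<in> sets M" if "Z \<in> M \<rightarrow>\<^sub>M path_measure \<delta>" "N \<in> tubes" for Z N
  proof (rule tube_vimage_measurable[OF _ _ _ that(2)])
    show "Z x \<in> paths" if "x \<in> space M" for x
      using measurable_space[OF \<open>Z \<in> _\<close> that] by simp
  qed (auto intro: measurable_compose[OF that(1)] start_measurable eval_measurable)
  have "{x\<in>space M. path_dist \<delta> (X x) (Y x) < c} =
    (\<Union>(N, N')\<in>{(N, N')\<in>tubes \<times> tubes. \<forall>f\<in>N. \<forall>g\<in>N'. path_dist \<delta> f g < c}.
       {x\<in>space M. X x \<in> N} \<inter> {x\<in>space M. Y x \<in> N'})" (is "?L = ?R")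
  proof safe
    fix x assume x: "x \<in> space M" and less: "path_dist \<delta> (X x) (Y x) < c"
    \<comment> \<open>Moving each of the two paths by less than e keeps the distance below
      c.\<close>
    define e where "e = (c - path_dist \<delta> (X x) (Y x)) / 2"
    have "e > 0" using less by (simp add: e_def)
    obtain N where N: "N \<in> tubes" "X x \<in> N" "\<And>g. g \<in> N \<Longrightarrow> path_dist \<delta> (X x) g < e"
      using ex_small_tube[OF P(1)[OF x] \<open>e > 0\<close>] by auto
    obtain N' where N': "N' \<in> tubes" "Y x \<in> N'" "\<And>g. g \<in> N' \<Longrightarrow> path_dist \<delta> (Y x) g < e"
      using ex_small_tube[OF P(2)[OF x] \<open>e > 0\<close>] by auto
    have "path_dist \<delta> f g < c" if fg: "f \<in> N" "g \<in> N'" for f g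
    proof -
      have "f \<in> paths" "g \<in> paths" using fg N(1) N'(1) by (auto simp: tubes_def tube_def)
      then have "path_dist \<delta> f g \<le> path_dist \<delta> (X x) f + path_dist \<delta> (X x) (Y x) + path_dist \<delta> (Y x) g"
        using paths.triangle[of f "X x" g] paths.triangle[of "X x" "Y x" g] P[OF x]
          paths.commute[of f "X x"] by auto
      also have "\<dots> < e + path_dist \<delta> (X x) (Y x) + e" using N(3)[OF fg(1)] N'(3)[OF fg(2)] by auto
      finally show ?thesis by (simp add: e_def)
    qed
    then have "\<forall>f\<in>N. \<forall>g\<in>N'. path_dist \<delta> f g < c" by blast
    then show "x \<in> ?R" using N(1,2) N'(1,2) x by (intro UN_I[of "(N, N')"]) simp_all
  qed auto
  also have "\<dots> \<in> sets M"
    by (rule sets.countable_UN'') (auto intro!: countable_subset[OF _ countable_SIGMA[OF countable_tubes countable_tubes]]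
        sets.Int sets X Y)
  finally show "{x\<in>space M. path_dist \<delta> (X x) (Y x) < c} \<in> sets M" .
qed

section \<open>Convergence inside compact sets of paths\<close>

lemma compact_pathsD:
  fixes G :: "nat \<Rightarrow> 'm path"
  assumes "compactin (path_topology \<delta>) K" and "\<And>n. G n \<in> K"
  obtains f r where "f \<in> K" "strict_mono r" "(\<lambda>n. path_dist \<delta> (G (r n)) f) \<longlonglongrightarrow> 0"
proof -
  have "range G \<subseteq> K" using assms(2) by auto
  then obtain f r where "f \<in> K" "strict_mono (r :: nat \<Rightarrow> nat)" "limitin (path_topology \<delta>) (G \<circ> r) f sequentially"
    using assms(1) unfolding path_topology_def paths.compactin_sequentially by meson
  then show thesis using that by (auto simp: limitin_path_iff)
qed

lemma compactin_paths: "compactin (path_topology \<delta>) K \<Longrightarrow> K \<subseteq> paths"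
  using compactin_subset_topspace by fastforce

lemma path_eq_rational:
  fixes f g :: "'m path"
  assumes "f \<in> paths_from s" "g \<in> paths_from s" "\<And>q. q \<in> \<rat> \<Longrightarrow> q > s \<Longrightarrow> snd f q = snd g q"
  shows "f = g"
proof (rule path_eqI[OF assms(1,2)])
  fix t assume t: "t \<ge> s"
  have cont: "continuous_on UNIV (\<lambda>t. dist (snd f t) (snd g t))"
    using assms(1,2) by (auto intro!: continuous_intros paths_continuous simp: paths_from_def)
  have "dist (snd f t) (snd g t) \<in> {0}"
    by (rule closed_rational_extension[OF cont, where a=s and b="t + 1"]) (use t assms(3) in auto)
  then show "snd f t = snd g t" by simp
qed

text \<open>Every subsequence has a further subsequence with a limit in K. That limit starts at s
  and agrees with f at the rational times after s, so it is f.\<close>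

lemma compact_pointwise_imp_limit:
  assumes K: "compactin (path_topology \<delta>) K" and G: "\<And>n. G n \<in> K" "\<And>n. G n \<in> paths_from s"
    and f: "f \<in> paths_from s" and lim: "\<And>q. q \<in> \<rat> \<Longrightarrow> q > s \<Longrightarrow> (\<lambda>n. snd (G n) q) \<longlonglongrightarrow> snd f q"
  shows "(\<lambda>n. path_dist \<delta> (G n) f) \<longlonglongrightarrow> 0"
proof (rule ccontr)
  assume "\<not> ?thesis"
  then obtain e where e: "e > 0" "\<And>N. \<exists>n\<ge>N. path_dist \<delta> (G n) f \<ge> e"
    by (auto simp: LIMSEQ_iff not_less)
  then have "infinite {n. path_dist \<delta> (G n) f \<ge> e}"
    by (auto simp: infinite_nat_iff_unbounded_le)
  from infinite_enumerate[OF this]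
  obtain r where r: "strict_mono (r :: nat \<Rightarrow> nat)" "\<And>n. path_dist \<delta> (G (r n)) f \<ge> e"
    by auto
  obtain g r' where g: "g \<in> K" "strict_mono (r' :: nat \<Rightarrow> nat)" "(\<lambda>n. path_dist \<delta> (G (r (r' n))) g) \<longlonglongrightarrow> 0"
    using compact_pathsD[OF K, of "\<lambda>n. G (r n)"] G(1) by auto
  have gp: "g \<in> paths" using g(1) compactin_paths[OF K] by auto
  have Gp: "G n \<in> paths" for n using G(2) paths_fromD by blast
  have "(\<lambda>n. fst (G (r (r' n)))) \<longlonglongrightarrow> fst g"
    using g(3) Gp gp by (subst (asm) path_dist_tendsto_iff) auto
  then have "fst g = s" using G(2) by (auto simp: paths_from_def LIMSEQ_const_iff)
  then have gs: "g \<in> paths_from s" using gp by (auto simp: paths_from_def)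
  have sm: "strict_mono (r \<circ> r')" using r(1) g(2) by (rule strict_mono_o)
  have "g = f"
  proof (rule path_eq_rational[OF gs f])
    fix q :: real assume q: "q \<in> \<rat>" "q > s"
    have "(\<lambda>n. snd (G (r (r' n))) q) \<longlonglongrightarrow> snd g q"
      by (rule path_dist_tendsto_eval[OF _ gp g(3)]) (rule Gp)
    moreover have "(\<lambda>n. snd (G (r (r' n))) q) \<longlonglongrightarrow> snd f q"
      using LIMSEQ_subseq_LIMSEQ[OF lim[OF q] sm] by (simp add: o_def)
    ultimately show "snd g q = snd f q" by (rule LIMSEQ_unique)
  qed
  then have "(\<lambda>n. path_dist \<delta> (G (r (r' n))) f) \<longlonglongrightarrow> 0" using g(3) by simp
  from order_tendstoD(2)[OF this e(1)] show False
    using r(2) by (auto simp: eventually_sequentially not_less[symmetric])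
qed

text \<open>Compactness provides a candidate limit, and convergence at each rational time forces the
  whole sequence to it.\<close>

lemma compact_pointwise_imp_convergent:
  assumes K: "compactin (path_topology \<delta>) K" and G: "\<And>n. G n \<in> K" "\<And>n. G n \<in> paths_from s"
    and lim: "\<And>q. q \<in> \<rat> \<Longrightarrow> q > s \<Longrightarrow> convergent (\<lambda>n. snd (G n) q)"
  obtains f where "f \<in> paths_from s" "(\<lambda>n. path_dist \<delta> (G n) f) \<longlonglongrightarrow> 0"
proof -
  obtain g r where g: "g \<in> K" "strict_mono (r :: nat \<Rightarrow> nat)" "(\<lambda>n. path_dist \<delta> (G (r n)) g) \<longlonglongrightarrow> 0"
    using compact_pathsD[OF K G(1)] .
  have gp: "g \<in> paths" using g(1) compactin_paths[OF K] by auto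
  have Gp: "G n \<in> paths" for n using G(2) paths_fromD by blast
  have "(\<lambda>n. fst (G (r n))) \<longlonglongrightarrow> fst g"
    using g(3) Gp gp by (subst (asm) path_dist_tendsto_iff) auto
  then have "fst g = s" using G(2) by (auto simp: paths_from_def LIMSEQ_const_iff)
  then have gs: "g \<in> paths_from s" using gp by (auto simp: paths_from_def)
  have "(\<lambda>n. snd (G n) q) \<longlonglongrightarrow> snd g q" if q: "q \<in> \<rat>" "q > s" for q
  proof -
    obtain c where c: "(\<lambda>n. snd (G n) q) \<longlonglongrightarrow> c" using lim[OF q] by (auto simp: convergent_def)
    have "(\<lambda>n. snd (G (r n)) q) \<longlonglongrightarrow> snd g q"
      by (rule path_dist_tendsto_eval[OF _ gp g(3)]) (rule Gp)
    moreover have "(\<lambda>n. snd (G (r n)) q) \<longlonglongrightarrow> c"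
      using LIMSEQ_subseq_LIMSEQ[OF c g(2)] by (simp add: o_def)
    ultimately have "c = snd g q" using LIMSEQ_unique by blast
    with c show ?thesis by simp
  qed
  from compact_pointwise_imp_limit[OF K G gs this] gs that show thesis by blast
qed

end

section \<open>Gluing\<close>

text \<open>The infimum in the recursion of \<open>stage\<close>, for a real s. Because only times t
  > s count, the value s means that hits accumulate at s from the right.\<close>

definition first_hit :: "(real \<times> 'm) set \<Rightarrow> (real \<Rightarrow> 'm) \<Rightarrow> real \<Rightarrow> ereal" where
  "first_hit F f s = Inf {ereal t | t. ereal t > ereal s \<and> (t, f t) \<in> F}"

lemma first_hit_ge: "ereal s \<le> first_hit F f s"
  unfolding first_hit_def by (rule Inf_greatest) auto

lemma first_hit_less_iff: "first_hit F f s < c \<longleftrightarrow> (\<exists>t>s. ereal t < c \<and> (t, f t) \<in> F)"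
  unfolding first_hit_def Inf_less_iff by auto

lemma first_hit_not_in: "s < t \<Longrightarrow> ereal t < first_hit F f s \<Longrightarrow> (t, f t) \<notin> F"
  unfolding first_hit_def by (metis (mono_tags, lifting) Inf_lower ereal_less(2) leD less_ereal.simps(1) mem_Collect_eq)

lemma first_hit_le: "s < t \<Longrightarrow> (t, f t) \<in> F \<Longrightarrow> first_hit F f s \<le> ereal t"
  unfolding first_hit_def by (rule Inf_lower) auto

text \<open>Hits within 1 / Suc n to the right of the infimum converge to it, and F is
  closed.\<close>

lemma first_hit_in:
  fixes f :: "real \<Rightarrow> 'm::metric_space"
  assumes F: "closed F" and f: "continuous_on UNIV f" and T: "first_hit F f s = ereal T" "s < T"
  shows "(T, f T) \<in> F"
proof -
  have "\<exists>t. T \<le> t \<and> t < T + 1 / Suc n \<and> (t, f t) \<in> F" for n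
  proof -
    have "first_hit F f s < ereal (T + 1 / Suc n)" by (simp add: T)
    then obtain t where t: "t > s" "t < T + 1 / Suc n" "(t, f t) \<in> F"
      by (auto simp: first_hit_less_iff)
    with first_hit_le[of s t f F] T have "T \<le> t" by auto
    with t show ?thesis by auto
  qed
  then obtain t where t: "\<And>n. T \<le> t n" "\<And>n. t n < T + 1 / Suc n" "\<And>n. (t n, f (t n)) \<in> F"
    by metis
  have "t \<longlonglongrightarrow> T"
  proof (rule tendsto_sandwich[OF _ _ tendsto_const])
    show "(\<lambda>n. T + 1 / real (Suc n)) \<longlonglongrightarrow> T"
      using tendsto_add[OF tendsto_const[of T] LIMSEQ_Suc[OF lim_const_over_n[of 1]]] by simp
    show "\<forall>\<^sub>F n in sequentially. T \<le> t n" using t(1) by (intro always_eventually allI)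
    show "\<forall>\<^sub>F n in sequentially. t n \<le> T + 1 / real (Suc n)"
      using t(2) by (intro always_eventually allI less_imp_le)
  qed
  moreover have "isCont f T" using f by (simp add: continuous_on_eq_continuous_at)
  ultimately have "(\<lambda>n. (t n, f (t n))) \<longlonglongrightarrow> (T, f T)"
    by (auto intro!: tendsto_Pair isCont_tendsto_compose[of T f])
  with F t(3) show ?thesis by (meson closed_sequentially)
qed

lemma first_hit_cong:
  assumes "\<And>t. t > s \<Longrightarrow> f t = g t"
  shows "first_hit F f s = first_hit F g s"
proof -
  have "{ereal t | t. ereal t > ereal s \<and> (t, f t) \<in> F} = {ereal t | t. ereal t > ereal s \<and> (t, g t) \<in> F}"
    using assms by force
  then show ?thesis by (simp add: first_hit_def)
qed

section \<open>The recursion of switching times and switching points\<close>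

lemma stage_Suc_finite:
  assumes "stage th F s x k = (ereal a, z)"
  shows "stage th F s x (Suc k) = (first_hit F (snd (th a z)) a,
     if first_hit F (snd (th a z)) a < \<infinity> then snd (th a z) (real_of_ereal (first_hit F (snd (th a z)) a)) else x)"
  using assms by (simp add: first_hit_def Let_def)

lemma stage_Suc_infinite:
  assumes "stage th F s x k = (\<infinity>, z)"
  shows "stage th F s x (Suc k) = (\<infinity>, x)"
  using assms by (simp add: Let_def)

lemma stage_eq: "stage th F s x k = (sigma_time th F s x k, z_point th F s x k)"
  by (simp add: sigma_time_def z_point_def)

lemma sigma_0 [simp]: "sigma_time th F s x 0 = ereal s" and z_0 [simp]: "z_point th F s x 0 = x"
  by (auto simp: sigma_time_def z_point_def)

lemma sigma_Suc_finite:
  "sigma_time th F s x k = ereal a \<Longrightarrow> sigma_time th F s x (Suc k) = first_hit F (snd (th a (z_point th F s x k))) a"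
  using stage_Suc_finite[of th F s x k a "z_point th F s x k"] by (simp add: stage_eq)

lemma z_Suc_finite:
  "sigma_time th F s x k = ereal a \<Longrightarrow> sigma_time th F s x (Suc k) = ereal b \<Longrightarrow>
     z_point th F s x (Suc k) = snd (th a (z_point th F s x k)) b"
  using stage_Suc_finite[of th F s x k a "z_point th F s x k"] sigma_Suc_finite[of th F s x k a]
  by (auto simp: stage_eq)

lemma sigma_Suc_infinite: "sigma_time th F s x k = \<infinity> \<Longrightarrow> sigma_time th F s x (Suc k) = \<infinity>"
  using stage_Suc_infinite[of th F s x k "z_point th F s x k"] by (simp add: stage_eq)

lemma sigma_not_minf: "sigma_time th F s x k \<noteq> -\<infinity>"
proof (induction k)
  case (Suc k)
  show ?case
  proof (cases "sigma_time th F s x k")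
    case (real a)
    then show ?thesis
      using sigma_Suc_finite[OF real] first_hit_ge[of a F "snd (th a (z_point th F s x k))"] by auto
  next
    case PInf
    then show ?thesis using sigma_Suc_infinite[OF PInf] by simp
  next
    case MInf
    with Suc show ?thesis by blast
  qed
qed simp

lemma sigma_mono_Suc: "sigma_time th F s x k \<le> sigma_time th F s x (Suc k)"
  using sigma_Suc_finite[of th F s x k] sigma_Suc_infinite[of th F s x k] sigma_not_minf[of th F s x k]
    first_hit_ge
  by (cases "sigma_time th F s x k") auto

lemma sigma_mono: "j \<le> k \<Longrightarrow> sigma_time th F s x j \<le> sigma_time th F s x k"
  by (rule lift_Suc_mono_le[of "sigma_time th F s x"]) (rule sigma_mono_Suc)

lemma sigma_ge: "ereal s \<le> sigma_time th F s x k"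
  using sigma_mono[of 0 k th F s x] by simp

lemma sigma_1: "sigma_time th F s x (Suc 0) = first_hit F (snd (th s x)) s"
  using sigma_Suc_finite[of th F s x 0 s] by simp

section \<open>The glued flow of an arbitrary family of paths\<close>

locale gluing =
  fixes th :: "real \<Rightarrow> 'm::metric_space \<Rightarrow> 'm path" and F :: "(real \<times> 'm) set"
  assumes closed: "closed F" and th_paths: "\<And>s x. th s x \<in> paths_from s"
    and th_start: "\<And>s x. snd (th s x) s = x"
    and k_stop: "\<And>s x. k_stop th F s x < \<infinity>"
begin

abbreviation "\<sigma> \<equiv> sigma_time th F"
abbreviation "z \<equiv> z_point th F"

lemma th_cont: "continuous_on UNIV (snd (th s x))"
  using th_paths[of s x] by (simp add: paths_continuous paths_from_def)

text \<open>If the recursion does not advance from a finite time, the point does not change either,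
  by \<open>th_start\<close>, and the whole state repeats.\<close>

lemma sigma_stationary: "\<sigma> s x k = \<sigma> s x (Suc k) \<Longrightarrow> k \<le> j \<Longrightarrow> \<sigma> s x j = \<sigma> s x k"
proof -
  assume k: "\<sigma> s x k = \<sigma> s x (Suc k)" and "k \<le> j"
  \<comment> \<open>The point is carried along in the induction, except after time infinity, where
    it is reset to the default x.\<close>
  from \<open>k \<le> j\<close> have "\<sigma> s x j = \<sigma> s x k \<and> (\<sigma> s x k = \<infinity> \<or> z s x j = z s x k)"
  proof (induction rule: dec_induct)
    case (step j)
    show ?case
    proof (cases "\<sigma> s x k")
      case (real a)
      then have "z s x j = z s x k" "\<sigma> s x j = ereal a" using step by auto
      then have "\<sigma> s x (Suc j) = ereal a" using real k sigma_Suc_finite[of th F s x k a]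
          sigma_Suc_finite[of th F s x j a] by simp
      moreover have "z s x (Suc j) = z s x k"
        using z_Suc_finite[of th F s x j a a] \<open>z s x j = _\<close> \<open>\<sigma> s x j = _\<close> calculation th_start by simp
      ultimately show ?thesis using real by simp
    next
      case PInf
      then show ?thesis using step sigma_Suc_infinite[of th F s x j] by simp
    next
      case MInf
      then show ?thesis using sigma_not_minf[of th F s x k] by simp
    qed
  qed simp
  then show ?thesis by simp
qed

definition "kfin s x = (LEAST k. \<sigma> s x k = \<sigma> s x (Suc k))"

lemma ex_stop: "\<exists>k. \<sigma> s x k = \<sigma> s x (Suc k)"
proof (rule ccontr)
  assume "\<not> ?thesis"
  then have "k_stop th F s x = \<infinity>" by (simp add: k_stop_def top_enat_def)
  with k_stop[of s x] show False by simp
qed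

lemma kfin: "\<sigma> s x (kfin s x) = \<sigma> s x (Suc (kfin s x))"
  unfolding kfin_def using ex_stop by (rule LeastI_ex)

lemma less_kfin: "k < kfin s x \<Longrightarrow> \<sigma> s x k < \<sigma> s x (Suc k)"
  unfolding kfin_def using not_less_Least[of k "\<lambda>k. \<sigma> s x k = \<sigma> s x (Suc k)"] sigma_mono_Suc[of th F s x k]
  by (simp add: less_le)

lemma k_stop_eq: "k_stop th F s x = enat (kfin s x)"
proof (rule antisym)
  show "k_stop th F s x \<le> enat (kfin s x)"
    unfolding k_stop_def by (rule Inf_lower) (use kfin in auto)
  show "enat (kfin s x) \<le> k_stop th F s x"
    unfolding k_stop_def kfin_def by (rule Inf_greatest) (auto intro: Least_le)
qed

lemma sigma_infinity_eq: "sigma_infinity th F s x = \<sigma> s x (kfin s x)"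
proof -
  have "\<forall>\<^sub>F k in sequentially. \<sigma> s x k = \<sigma> s x (kfin s x)"
    using eventually_ge_at_top[of "kfin s x"]
    by eventually_elim (rule sigma_stationary[OF kfin])
  then show ?thesis
    unfolding sigma_infinity_def by (intro limI tendsto_eventually)
qed

definition "piece s x k = snd (th (real_of_ereal (\<sigma> s x k)) (z s x k))"

text \<open>The least such k is the active stage at time t. The second alternative stands for the
  branch of \<open>glued_flow\<close> in which the construction has stopped.\<close>

definition "stage_at s x t k \<longleftrightarrow> ereal t < \<sigma> s x (Suc k) \<or> \<sigma> s x k = \<sigma> s x (Suc k)"

lemma ex_stage_at: "\<exists>k. stage_at s x t k"
  using kfin unfolding stage_at_def by blast

lemma Least_stage_at:
  assumes "s \<le> t" "L = (LEAST k. stage_at s x t k)"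
  shows "stage_at s x t L" "\<sigma> s x L \<le> ereal t" "L \<le> kfin s x"
proof -
  show "stage_at s x t L" unfolding assms(2) using ex_stage_at by (rule LeastI_ex)
  show "L \<le> kfin s x" unfolding assms(2) by (rule Least_le) (simp add: stage_at_def kfin)
  show "\<sigma> s x L \<le> ereal t"
  proof (cases L)
    case (Suc j)
    then have "\<not> stage_at s x t j" using not_less_Least[of j "stage_at s x t"] assms(2) by simp
    then show ?thesis using Suc by (simp add: stage_at_def not_less)
  qed (use assms in simp)
qed

text \<open>Collapses the branches of \<open>glued_flow\<close> into one least number; this form
  serves both the recursion in time and measurability.\<close>

lemma glued_eq:
  assumes "s \<le> t"
  shows "glued_flow th F s t x = piece s x (LEAST k. stage_at s x t k) t"
proof -
  define L where "L = (LEAST k. stage_at s x t k)"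
  define K where "K = kfin s x"
  note L = Least_stage_at[OF assms L_def]
  \<comment> \<open>Before index K the times strictly increase, so an active stage L < K would end
    after t and no later than stage K begins.\<close>
  have "L = K" if "\<not> ereal t < \<sigma> s x K"
  proof (rule ccontr)
    assume "L \<noteq> K"
    then have "L < K" using L(3) by (simp add: K_def)
    then have "\<sigma> s x (Suc L) \<le> \<sigma> s x K" "\<sigma> s x L \<noteq> \<sigma> s x (Suc L)"
      using sigma_mono[of "Suc L" K th F s x] less_kfin[of L s x] by (auto simp: K_def)
    with L(1) that show False unfolding stage_at_def using less_le_trans by blast
  qed
  moreover have "(THE k. enat k < k_stop th F s x \<and> \<sigma> s x k \<le> ereal t \<and> ereal t < \<sigma> s x (Suc k)) = L"
    if t: "ereal t < \<sigma> s x K"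
  proof (rule the_equality)
    have "L \<noteq> K" using L(2) t by auto
    then have "L < K" using L(3) by (simp add: K_def)
    then show "enat L < k_stop th F s x \<and> \<sigma> s x L \<le> ereal t \<and> ereal t < \<sigma> s x (Suc L)"
      using L(1,2) less_kfin[of L s x] by (auto simp: k_stop_eq K_def stage_at_def)
    fix k assume k: "enat k < k_stop th F s x \<and> \<sigma> s x k \<le> ereal t \<and> ereal t < \<sigma> s x (Suc k)"
    then have "L \<le> k" unfolding L_def by (intro Least_le) (simp add: stage_at_def)
    moreover have "\<not> Suc L \<le> k"
    proof
      assume "Suc L \<le> k"
      then have "\<sigma> s x (Suc L) \<le> ereal t" using sigma_mono[of "Suc L" k th F s x] k by auto
      with L(1) \<open>L < K\<close> less_kfin[of L s x] show False by (auto simp: stage_at_def K_def)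
    qed
    ultimately show "k = L" by simp
  qed
  ultimately show ?thesis
    unfolding glued_flow_def Let_def sigma_infinity_eq K_def[symmetric] L_def[symmetric]
    using k_stop[of s x] by (auto simp: k_stop_eq K_def piece_def)
qed

text \<open>Starting afresh at the first switching time drops one stage of the recursion. The points
  are compared only at finite times: after infinity the default is the starting point, which may
  differ for the two recursions.\<close>

lemma stage_shift:
  assumes T: "\<sigma> s x (Suc 0) = ereal T"
  shows "\<sigma> s x (Suc k) = \<sigma> T (snd (th s x) T) k \<and>
    (\<sigma> s x (Suc k) < \<infinity> \<longrightarrow> z s x (Suc k) = z T (snd (th s x) T) k)"
proof (induction k)
  case 0
  then show ?case using T z_Suc_finite[of th F s x 0 s T] by simp
next
  case (Suc k)
  let ?y = "snd (th s x) T"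
  show ?case
  proof (cases "\<sigma> s x (Suc k)")
    case (real a)
    then have *: "z s x (Suc k) = z T ?y k" "\<sigma> T ?y k = ereal a" using Suc by auto
    have e: "\<sigma> s x (Suc (Suc k)) = \<sigma> T ?y (Suc k)"
      using sigma_Suc_finite[OF real] sigma_Suc_finite[OF *(2)] *(1) by simp
    show ?thesis
    proof (cases "\<sigma> s x (Suc (Suc k))")
      case (real b)
      then show ?thesis using z_Suc_finite[OF \<open>\<sigma> s x (Suc k) = ereal a\<close> real]
          z_Suc_finite[OF *(2), of b] e *(1) by simp
    next
      case PInf
      then show ?thesis using e by simp
    next
      case MInf
      then show ?thesis using sigma_not_minf[of th F s x "Suc (Suc k)"] by simp
    qed
  next
    case PInf
    then show ?thesis using Suc sigma_Suc_infinite[of th F s x "Suc k"]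
        sigma_Suc_infinite[of th F T ?y k] by simp
  next
    case MInf
    then show ?thesis using sigma_not_minf[of th F s x "Suc k"] by simp
  qed
qed

lemma kfin_0_iff: "kfin s x = 0 \<longleftrightarrow> first_hit F (snd (th s x)) s = ereal s"
proof
  assume "kfin s x = 0"
  with kfin[of s x] show "first_hit F (snd (th s x)) s = ereal s" by (simp add: sigma_1)
next
  assume "first_hit F (snd (th s x)) s = ereal s"
  then have "\<sigma> s x 0 = \<sigma> s x (Suc 0)" by (simp add: sigma_1)
  then show "kfin s x = 0" unfolding kfin_def by (intro Least_eq_0)
qed

text \<open>The number of remaining pieces drops by one at a switching time, which makes it the
  induction variable for continuity and for the flow property.\<close>

lemma kfin_shift:
  assumes "first_hit F (snd (th s x)) s = ereal T" "s < T"
  shows "kfin s x = Suc (kfin T (snd (th s x) T))"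
proof -
  have T: "\<sigma> s x (Suc 0) = ereal T" using assms by (simp add: sigma_1)
  obtain k where k: "\<sigma> s x k = \<sigma> s x (Suc k)" using ex_stop by blast
  have "kfin s x = Suc (LEAST k. \<sigma> s x (Suc k) = \<sigma> s x (Suc (Suc k)))"
    unfolding kfin_def using k by (rule Least_Suc) (use T assms in simp)
  then show ?thesis using stage_shift[OF T] by (simp add: kfin_def)
qed

lemma glued_before:
  assumes "s \<le> t" "first_hit F (snd (th s x)) s = ereal s \<or> ereal t < first_hit F (snd (th s x)) s"
  shows "glued_flow th F s t x = snd (th s x) t"
proof -
  have "stage_at s x t 0" using assms(2) by (auto simp: stage_at_def sigma_1)
  then have "(LEAST k. stage_at s x t k) = 0" by (rule Least_eq_0)
  then show ?thesis by (simp add: glued_eq[OF assms(1)] piece_def)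
qed

text \<open>Stage 0 is over at time T, so the least active stage is a successor, and
  \<open>stage_shift\<close> identifies its predecessor with the active stage of the restarted
  construction.\<close>

lemma glued_after:
  assumes T: "first_hit F (snd (th s x)) s = ereal T" "s < T" "T \<le> t"
  shows "glued_flow th F s t x = glued_flow th F T t (snd (th s x) T)"
proof -
  let ?y = "snd (th s x) T"
  have T': "\<sigma> s x (Suc 0) = ereal T" using T by (simp add: sigma_1)
  note shift = stage_shift[OF T']
  obtain k where k: "stage_at s x t k" using ex_stage_at by blast
  have "(LEAST k. stage_at s x t k) = Suc (LEAST k. stage_at s x t (Suc k))"
    by (rule Least_Suc[of _ k]) (use k T T' in \<open>auto simp: stage_at_def\<close>)
  also have "(\<lambda>k. stage_at s x t (Suc k)) = stage_at T ?y t"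
    using shift by (auto simp: stage_at_def fun_eq_iff)
  finally have L: "(LEAST k. stage_at s x t k) = Suc (LEAST k. stage_at T ?y t k)" .
  have "\<sigma> T ?y (LEAST k. stage_at T ?y t k) \<le> ereal t"
    by (rule Least_stage_at(2)[OF T(3) refl])
  then have "\<sigma> s x (Suc (LEAST k. stage_at T ?y t k)) < \<infinity>"
    using shift by (auto simp: less_top[symmetric])
  then have "piece s x (Suc (LEAST k. stage_at T ?y t k)) = piece T ?y (LEAST k. stage_at T ?y t k)"
    using shift by (simp add: piece_def)
  moreover have "s \<le> t" using T by simp
  ultimately show ?thesis using T(3) by (simp add: glued_eq L)
qed

lemma hit_cases:
  obtains "first_hit F (snd (th s x)) s = ereal s"
  | "first_hit F (snd (th s x)) s = \<infinity>"
  | T where "s < T" "first_hit F (snd (th s x)) s = ereal T"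
  using first_hit_ge[of s F "snd (th s x)"]
  by (cases "first_hit F (snd (th s x)) s") (auto simp: le_less)

lemma glued_start: "glued_flow th F s s x = x"
  by (rule hit_cases[of s x]) (simp_all add: glued_before th_start)

lemma glued_continuous: "continuous_on {s..} (\<lambda>t. glued_flow th F s t x)"
proof (induction "kfin s x" arbitrary: s x)
  case 0
  then have "\<And>t. s \<le> t \<Longrightarrow> glued_flow th F s t x = snd (th s x) t"
    by (intro glued_before) (simp_all add: kfin_0_iff[symmetric])
  then show ?case
    by (subst continuous_on_cong[OF refl, of _ _ "snd (th s x)"])
      (auto intro: continuous_on_subset[OF th_cont])
next
  case (Suc n)
  show ?case
  proof (rule hit_cases[of s x])
    assume "first_hit F (snd (th s x)) s = ereal s"
    with Suc show ?thesis by (simp add: kfin_0_iff[symmetric])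
  next
    assume "first_hit F (snd (th s x)) s = \<infinity>"
    then have "\<And>t. s \<le> t \<Longrightarrow> glued_flow th F s t x = snd (th s x) t"
      by (intro glued_before) simp_all
    then show ?thesis
      by (subst continuous_on_cong[OF refl, of _ _ "snd (th s x)"])
        (auto intro: continuous_on_subset[OF th_cont])
  next
    fix T assume T: "s < T" "first_hit F (snd (th s x)) s = ereal T"
    let ?y = "snd (th s x) T"
    have "n = kfin T ?y" using kfin_shift[OF T(2,1)] Suc by simp
    then have IH: "continuous_on {T..} (\<lambda>t. glued_flow th F T t ?y)" by (rule Suc)
    \<comment> \<open>The two parts fit together at T because the restarted flow begins at the end
      of the first piece.\<close>
    have "continuous_on ({s..T} \<union> {T..}) (\<lambda>t. if t \<le> T then snd (th s x) t else glued_flow th F T t ?y)"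
      by (rule continuous_on_If)
        (use IH glued_start in \<open>auto intro: continuous_on_subset[OF th_cont]\<close>)
    moreover have "{s..T} \<union> {T..} = {s..}" using T by auto
    ultimately have "continuous_on {s..} (\<lambda>t. if t \<le> T then snd (th s x) t else glued_flow th F T t ?y)"
      by simp
    moreover have "(if t \<le> T then snd (th s x) t else glued_flow th F T t ?y) = glued_flow th F s t x"
      if "t \<in> {s..}" for t
    proof (cases "t < T")
      case True
      then show ?thesis using T that by (simp add: glued_before)
    next
      case False
      then show ?thesis using T glued_after[OF T(2,1), of t] glued_start by auto
    qed
    ultimately show ?thesis by (subst (asm) continuous_on_cong[OF refl]) auto
  qed
qed

end

section \<open>The flow property of the glued flow\<close>

text \<open>\<open>stuck\<close> is hypothesis (b); \<open>follow\<close> and \<open>restart\<close>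
  are what \<open>theta_follow\<close> and \<open>theta_restart\<close> will supply. In
  \<open>restart\<close> the time u may be the next hit of F, but t must precede it, because at
  points of F limits of skeleton paths may bifurcate.\<close>

locale flow_gluing = gluing +
  fixes \<phi> :: "nat \<Rightarrow> 'a path"
  assumes stuck: "\<And>s x t. first_hit F (snd (th s x)) s = ereal s \<Longrightarrow> s < t \<Longrightarrow>
      \<exists>n\<in>started \<phi> t. \<forall>u\<ge>t. snd (th s x) u = snd (\<phi> n) u"
    and follow: "\<And>t n u. n \<in> started \<phi> t \<Longrightarrow> t \<le> u \<Longrightarrow> snd (th t (snd (\<phi> n) t)) u = snd (\<phi> n) u"
    and restart: "\<And>s x t u. s < t \<Longrightarrow> t \<le> u \<Longrightarrow> ereal u \<le> first_hit F (snd (th s x)) s \<Longrightarrow> ereal t < first_hit F (snd (th s x)) s \<Longrightarrow>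
      snd (th t (snd (th s x) t)) u = snd (th s x) u"
begin

text \<open>Every switching point lies again on the skeleton path, so \<open>follow\<close> applies
  to each piece in turn.\<close>

lemma glued_skeleton: "n \<in> started \<phi> t \<Longrightarrow> t \<le> u \<Longrightarrow> glued_flow th F t u (snd (\<phi> n) t) = snd (\<phi> n) u"
proof (induction "kfin t (snd (\<phi> n) t)" arbitrary: t)
  case 0
  then show ?case
    using glued_before[of t u "snd (\<phi> n) t"] follow by (simp add: kfin_0_iff[symmetric])
next
  case (Suc k)
  let ?x = "snd (\<phi> n) t"
  show ?case
  proof (rule hit_cases[of t ?x])
    assume "first_hit F (snd (th t ?x)) t = ereal t"
    with Suc show ?thesis by (simp add: kfin_0_iff[symmetric])
  next
    assume "first_hit F (snd (th t ?x)) t = \<infinity>"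
    then show ?thesis using glued_before[of t u ?x] follow Suc by simp
  next
    fix T assume T: "t < T" "first_hit F (snd (th t ?x)) t = ereal T"
    show ?thesis
    proof (cases "u < T")
      case True
      then show ?thesis using glued_before[of t u ?x] follow Suc T by simp
    next
      case False
      have y: "snd (th t ?x) T = snd (\<phi> n) T" using follow Suc.prems(1) T by simp
      have "n \<in> started \<phi> T" using Suc.prems(1) T by (simp add: started_def)
      moreover have "k = kfin T (snd (\<phi> n) T)" using kfin_shift[OF T(2,1)] Suc.hyps y by simp
      ultimately have "glued_flow th F T u (snd (\<phi> n) T) = snd (\<phi> n) u"
        using False by (intro Suc.hyps(1)) auto
      then show ?thesis using glued_after[OF T(2,1), of u] False y by simp
    qed
  qed
qed

text \<open>Both paths coincide up to and including the old hitting time. Agreement at that time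
  itself shows that the new hit is not later.\<close>

lemma first_hit_restart:
  assumes "s < t" "ereal t < first_hit F (snd (th s x)) s"
  shows "first_hit F (snd (th t (snd (th s x) t))) t = first_hit F (snd (th s x)) s"
    (is "?A = ?B")
proof (rule antisym)
  show "?A \<le> ?B"
  proof (cases ?B)
    case (real T)
    then have "t < T" "s < T" using assms by auto
    moreover have "(T, snd (th s x) T) \<in> F"
      by (rule first_hit_in[OF closed th_cont real]) (use \<open>s < T\<close> in simp)
    ultimately show ?thesis
      using restart[of s t T x] real assms by (auto intro!: first_hit_le)
  qed (use assms in auto)
  show "?B \<le> ?A"
  proof (rule ccontr)
    assume "\<not> ?B \<le> ?A"
    then obtain u where u: "u > t" "ereal u < ?B" "(u, snd (th t (snd (th s x) t)) u) \<in> F"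
      by (auto simp: not_le first_hit_less_iff)
    then have "(u, snd (th s x) u) \<in> F" using restart[of s t u x] assms by simp
    moreover have "(u, snd (th s x) u) \<notin> F" using first_hit_not_in[of s u] u assms by simp
    ultimately show False by simp
  qed
qed

text \<open>If hits of F accumulate at s, the construction follows a single path of
  \<open>th\<close>; by \<open>stuck\<close> it is on a skeleton path at time t, and the flow
  restarted there stays on it by \<open>glued_skeleton\<close>. Otherwise either t precedes the
  first switching time, or both sides can be restarted at that time with one piece less.\<close>

lemma glued_flow_property:
  "s \<le> t \<Longrightarrow> t \<le> u \<Longrightarrow> glued_flow th F s u x = glued_flow th F t u (glued_flow th F s t x)"
proof (induction "kfin s x" arbitrary: s x)
  case 0
  then have h: "first_hit F (snd (th s x)) s = ereal s" by (simp add: kfin_0_iff)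
  show ?case
  proof (cases "s = t")
    case False
    then obtain n where n: "n \<in> started \<phi> t" "\<And>u. u \<ge> t \<Longrightarrow> snd (th s x) u = snd (\<phi> n) u"
      using stuck[OF h, of t] 0 by auto
    then show ?thesis using 0 h glued_before[of s t x] glued_before[of s u x] glued_skeleton[of n t u] by simp
  qed (simp add: glued_start)
next
  case (Suc k)
  have h: "first_hit F (snd (th s x)) s \<noteq> ereal s" using Suc.hyps(2) by (simp add: kfin_0_iff[symmetric])
  \<comment> \<open>The path is cut before it reaches F: the restarted path repeats it and has the
    same next hit, from which point on both constructions coincide.\<close>
  have small: ?case if t: "ereal t < first_hit F (snd (th s x)) s"
  proof (cases "s = t")
    case False
    then have st: "s < t" using Suc by simp
    let ?y = "snd (th s x) t"
    have gt: "glued_flow th F s t x = ?y" using glued_before t Suc by simp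
    note H = first_hit_restart[OF st t]
    show ?thesis
    proof (cases "ereal u < first_hit F (snd (th s x)) s")
      case True
      then show ?thesis
        using glued_before[of s u x] glued_before[of t u ?y] restart[OF st Suc.prems(2), of x] Suc.prems t
        by (simp add: gt H)
    next
      case False
      then obtain T where T: "first_hit F (snd (th s x)) s = ereal T" "T \<le> u"
        using t by (cases "first_hit F (snd (th s x)) s") auto
      then have "t < T" using t by simp
      then show ?thesis
        using glued_after[of s x T u] glued_after[of t ?y T u] T H st restart[OF st, of T x] t by (simp add: gt)
    qed
  qed (simp add: glued_start)
  show ?case
  proof (rule hit_cases[of s x])
    fix T assume T: "s < T" "first_hit F (snd (th s x)) s = ereal T"
    show ?thesis
    proof (cases "t < T")
      case False
      let ?y = "snd (th s x) T"
      have "k = kfin T ?y" using kfin_shift[OF T(2,1)] Suc by simp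
      then show ?thesis
        using Suc.hyps(1)[of T ?y] glued_after[OF T(2,1)] False Suc.prems by simp
    qed (use small T in simp)
  qed (use h small in auto)
qed

end

section \<open>The paths of a skeleton\<close>

text \<open>Continuous functions on a compact interval are bounded, as \<open>cfunspace\<close>
  requires, and closeness at every time bounds the supremum metric.\<close>

lemma cfunspace_closure_ofI:
  fixes h :: "real \<Rightarrow> 'b::metric_space"
  assumes h: "continuous_on {a..b} h"
    and S: "\<And>e. e > 0 \<Longrightarrow> \<exists>g. continuous_on {a..b} g \<and> restrict g {a..b} \<in> S \<and> (\<forall>t\<in>{a..b}. dist (h t) (g t) \<le> e)"
  shows "restrict h {a..b} \<in> mtopology_of (cfunspace (top_of_set {a..b}) euclidean_metric) closure_of S"
proof -
  let ?C = "cfunspace (top_of_set {a..b}) (euclidean_metric :: 'b metric)"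
  interpret C: Metric_space "mspace ?C" "mdist ?C" by (rule Metric_space_mspace_mdist)
  have mem: "restrict g {a..b} \<in> mspace ?C" if g: "continuous_on {a..b} g" for g :: "real \<Rightarrow> 'b"
  proof -
    have "compact (g ` {a..b})" using g by (rule compact_continuous_image) simp
    then have "bounded (g ` {a..b})" by (rule compact_imp_bounded)
    moreover have "continuous_on {a..b} (restrict g {a..b})"
      using g by (subst continuous_on_cong[OF refl]) auto
    ultimately show ?thesis by simp
  qed
  show ?thesis
    unfolding mtopology_of_def C.metric_closure_of_alt
  proof (intro CollectI conjI allI impI)
    show "restrict h {a..b} \<in> mspace ?C" by (rule mem[OF h])
    fix e :: real assume e: "e > 0"
    obtain g where g: "continuous_on {a..b} g" "restrict g {a..b} \<in> S" "\<And>t. t \<in> {a..b} \<Longrightarrow> dist (h t) (g t) \<le> e"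
      using S[OF e] by blast
    have "mdist ?C (restrict h {a..b}) (restrict g {a..b}) \<le> e"
      by (rule mdist_cfunspace_le) (use e g in auto)
    then have "restrict g {a..b} \<in> C.mcball (restrict h {a..b}) e"
      using mem[OF h] mem[OF g(1)] by (simp only: C.in_mcball)
    with g(2) show "\<exists>y\<in>S. y \<in> C.mcball (restrict h {a..b}) e" by blast
  qed
qed

text \<open>The common form of a path of \<open>theta\<close> and of its restart at a later time;
  uniform convergence on each [v, r] is what leads to membership in
  \<open>local_limits\<close>.\<close>

definition skeleton_limit :: "(nat \<Rightarrow> 'm::metric_space path) \<Rightarrow> real \<Rightarrow> (real \<Rightarrow> 'm) \<Rightarrow> bool" where
  "skeleton_limit \<phi> v f \<longleftrightarrow> continuous_on UNIV f \<and> (\<exists>m. (\<forall>j. m j \<in> started \<phi> v) \<and>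
     (\<forall>r>v. uniform_limit {v..r} (\<lambda>j. snd (\<phi> (m j))) f sequentially))"

lemma skeleton_limit_in_local_limits:
  assumes f: "skeleton_limit \<phi> v f" and "v < r" and \<phi>: "\<And>n. \<phi> n \<in> paths"
  shows "restrict f {v..r} \<in> local_limits \<phi> v r (f v)"
  unfolding local_limits_def
proof (intro INT_I cfunspace_closure_ofI)
  show "continuous_on {v..r} f"
    using f by (auto simp: skeleton_limit_def intro: continuous_on_subset)
  fix d e :: real assume d: "d \<in> {0<..}" and e: "e > 0"
  obtain m where m: "\<And>j. m j \<in> started \<phi> v" "uniform_limit {v..r} (\<lambda>j. snd (\<phi> (m j))) f sequentially"
    using f \<open>v < r\<close> by (auto simp: skeleton_limit_def)
  have "min d e > 0" using d e by simp
  from uniform_limitD[OF m(2) this]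
  obtain j where "\<forall>x\<in>{v..r}. dist (snd (\<phi> (m j)) x) (f x) < min d e"
    using eventually_happens trivial_limit_sequentially by blast
  then have j: "\<And>x. x \<in> {v..r} \<Longrightarrow> dist (f x) (snd (\<phi> (m j)) x) < min d e"
    by (simp add: dist_commute)
  show "\<exists>g. continuous_on {v..r} g \<and>
      restrict g {v..r} \<in> {restrict (snd (\<phi> n)) {v..r} |n. n \<in> started \<phi> v \<and> snd (\<phi> n) v \<in> ball (f v) d} \<and>
      (\<forall>t\<in>{v..r}. dist (f t) (g t) \<le> e)"
  proof (intro exI conjI ballI)
    show "continuous_on {v..r} (snd (\<phi> (m j)))"
      using paths_continuous[OF \<phi>] continuous_on_subset by blast
    show "restrict (snd (\<phi> (m j))) {v..r} \<in> {restrict (snd (\<phi> n)) {v..r} |n. n \<in> started \<phi> v \<and> snd (\<phi> n) v \<in> ball (f v) d}"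
      using m(1) j[of v] \<open>v < r\<close> by auto
    show "dist (f t) (snd (\<phi> (m j)) t) \<le> e" if "t \<in> {v..r}" for t
      using j[OF that] by simp
  qed
qed

text \<open>For r strictly between v and the bifurcation time, the set of local limits on [v, r] has
  at most one element, and it contains both restrictions.\<close>

lemma agree_after_non_bifurcation:
  assumes f: "skeleton_limit \<phi> v f" and g: "skeleton_limit \<phi> v g" and fg: "f v = g v"
    and \<phi>: "\<And>n. \<phi> n \<in> paths" and nb: "(v, f v) \<notin> bifurcation_points \<phi>"
  obtains r where "r > v" "\<And>u. u \<in> {v..r} \<Longrightarrow> f u = g u"
proof -
  let ?S = "{ereal t | t. t > v \<and> (\<exists>f'\<in>local_limits \<phi> v t (f v). \<exists>g\<in>local_limits \<phi> v t (f v). f' \<noteq> g)}"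
  have "ereal v \<le> Inf ?S" by (rule Inf_greatest) auto
  moreover have "Inf ?S \<noteq> ereal v"
    using nb by (simp add: bifurcation_points_def bifurcation_time_def)
  ultimately have "ereal v < Inf ?S" by simp
  then obtain r where r: "ereal v < ereal r" "ereal r < Inf ?S"
    using ereal_dense2 by blast
  then have "ereal r \<notin> ?S" by (meson Inf_lower leD)
  with r have "\<And>f' g. f' \<in> local_limits \<phi> v r (f v) \<Longrightarrow> g \<in> local_limits \<phi> v r (f v) \<Longrightarrow> f' = g"
    by auto
  from this[OF skeleton_limit_in_local_limits[OF f _ \<phi>] skeleton_limit_in_local_limits[OF g _ \<phi>, folded fg]]
  have "restrict f {v..r} = restrict g {v..r}" using r by simp
  then have "\<And>u. u \<in> {v..r} \<Longrightarrow> f u = g u" by (metis restrict_apply')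
  with r that show thesis by simp
qed

lemma skeleton_paths: "skeleton \<delta> \<phi> \<Longrightarrow> \<phi> n \<in> paths"
  by (simp add: skeleton_def)

lemma skeleton_coalesce:
  assumes "skeleton \<delta> \<phi>" "m \<in> started \<phi> s" "n \<in> started \<phi> s" "snd (\<phi> m) s = snd (\<phi> n) s" "s \<le> t"
  shows "snd (\<phi> m) t = snd (\<phi> n) t"
proof -
  have "\<forall>s. \<forall>m\<in>started \<phi> s. \<forall>n\<in>started \<phi> s.
      snd (\<phi> m) s = snd (\<phi> n) s \<longrightarrow> (\<forall>t\<ge>s. snd (\<phi> m) t = snd (\<phi> n) t)"
    using assms(1) unfolding skeleton_def by (elim conjE)
  from bspec[OF bspec[OF spec[OF this, of s] assms(2)] assms(3)] show ?thesis
    using assms(4,5) by simp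
qed

lemma started_mono: "n \<in> started \<phi> s \<Longrightarrow> s \<le> t \<Longrightarrow> n \<in> started \<phi> t"
  by (simp add: started_def)

lemma theta_radius_le: "theta_radius \<delta> P k x \<le> ereal ((1 / 2) ^ k)"
  by (simp add: theta_radius_def)

definition skeleton_tails :: "(nat \<Rightarrow> 'm path) \<Rightarrow> (real \<times> 'm) set \<Rightarrow> 'm path set" where
  "skeleton_tails \<phi> L = {path_tail s (\<phi> n) | s n. n \<in> started \<phi> s \<and> (s, snd (\<phi> n) s) \<in> L}"

lemma (in path_space) compact_skeleton_tails:
  assumes "skeleton \<delta> \<phi>" "compact L"
  shows "compactin (path_topology \<delta>) (path_topology \<delta> closure_of skeleton_tails \<phi> L)"
    and "skeleton_tails \<phi> L \<subseteq> path_topology \<delta> closure_of skeleton_tails \<phi> L"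
proof -
  have *: "relatively_compact_in (path_topology \<delta>) (skeleton_tails \<phi> L)"
    using assms by (simp add: skeleton_def skeleton_tails_def)
  then show "compactin (path_topology \<delta>) (path_topology \<delta> closure_of skeleton_tails \<phi> L)"
    by (simp add: relatively_compact_in_def)
  show "skeleton_tails \<phi> L \<subseteq> path_topology \<delta> closure_of skeleton_tails \<phi> L"
    using * by (intro closure_of_subset) (simp add: relatively_compact_in_def)
qed

section \<open>The paths of \<open>theta\<close> for one realization of the skeleton\<close>

locale skeleton_theta = path_space \<delta>
  for \<delta> :: "(real \<Rightarrow> 'm::{heine_borel, polish_space}) \<Rightarrow> (real \<Rightarrow> 'm) \<Rightarrow> real" +
  fixes \<phi> :: "nat \<Rightarrow> 'm path" and P :: "nat \<Rightarrow> real \<Rightarrow> (nat \<Rightarrow> 'm) \<Rightarrow> (nat \<Rightarrow> 'm) measure"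
    and l :: "(nat \<Rightarrow> 'm path) \<Rightarrow> 'm path"
  assumes skel: "skeleton \<delta> \<phi>" and radius_pos: "\<And>k x. 0 < theta_radius \<delta> P k x"
    and selector: "limit_point_selector \<delta> l"
begin

abbreviation "tails \<equiv> skeleton_tails \<phi>"

lemmas compact_tails = compact_skeleton_tails[OF skel]

lemma phi_paths: "\<phi> n \<in> paths"
  by (rule skeleton_paths[OF skel])

text \<open>Density provides paths that start near x shortly before s. That some are still near x at
  time s follows from condition (3) of a skeleton: a subsequence converges uniformly near s, so the
  positions at the start times and at time s have the same limit.\<close>

lemma dense_positions:
  assumes "e > 0"
  shows "\<exists>n\<in>started \<phi> s. dist (snd (\<phi> n) s) x < e"
proof -
  have "\<exists>n. s - 1 / Suc j < fst (\<phi> n) \<and> fst (\<phi> n) < s \<and> dist x (snd (\<phi> n) (fst (\<phi> n))) < 1 / Suc j" for j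
  proof -
    let ?U = "{s - 1 / Suc j<..<s} \<times> ball x (1 / Suc j)"
    have "open ?U" by (intro open_Times) auto
    then have "?U \<inter> closure (range (\<lambda>n. (fst (\<phi> n), snd (\<phi> n) (fst (\<phi> n))))) = {} \<longleftrightarrow>
        ?U \<inter> range (\<lambda>n. (fst (\<phi> n), snd (\<phi> n) (fst (\<phi> n)))) = {}"
      by (rule open_Int_closure_eq_empty)
    moreover have "(s - 1 / (2 * Suc j), x) \<in> ?U" by (auto simp: field_simps)
    moreover have "closure (range (\<lambda>n. (fst (\<phi> n), snd (\<phi> n) (fst (\<phi> n))))) = UNIV"
      using skel unfolding skeleton_def by (elim conjE)
    ultimately have "?U \<inter> range (\<lambda>n. (fst (\<phi> n), snd (\<phi> n) (fst (\<phi> n)))) \<noteq> {}"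
      by (simp only: Int_UNIV_right) blast
    then obtain n where "(fst (\<phi> n), snd (\<phi> n) (fst (\<phi> n))) \<in> ?U" by blast
    then show ?thesis by (intro exI[of _ n]) simp
  qed
  then obtain n where n: "\<And>j. s - 1 / Suc j < fst (\<phi> (n j))" "\<And>j. fst (\<phi> (n j)) < s"
    "\<And>j. dist x (snd (\<phi> (n j)) (fst (\<phi> (n j)))) < 1 / Suc j" by metis
  \<comment> \<open>Contains all the starting points, so each path counts as a tail of
    itself.\<close>
  define L where "L = {s - 1..s} \<times> cball x 1"
  have "compact L" unfolding L_def by (intro compact_Times) auto
  note K = compact_tails[OF this]
  have le1: "1 / real (Suc j) \<le> 1" for j by simp
  have "\<phi> (n j) \<in> tails L" for j
  proof -
    have "\<phi> (n j) = path_tail (fst (\<phi> (n j))) (\<phi> (n j))"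
      by (rule path_tail_self[symmetric]) (simp add: paths_from_def phi_paths)
    moreover have "(fst (\<phi> (n j)), snd (\<phi> (n j)) (fst (\<phi> (n j)))) \<in> L"
      using n(1)[of j] n(2)[of j] n(3)[of j] le1[of j] unfolding L_def mem_Times_iff mem_cball fst_conv snd_conv atLeastAtMost_iff
      by linarith
    moreover have "n j \<in> started \<phi> (fst (\<phi> (n j)))" by (simp add: started_def)
    ultimately show ?thesis
      unfolding skeleton_tails_def by (intro CollectI exI[of _ "fst (\<phi> (n j))"] exI[of _ "n j"] conjI)
  qed
  then have "\<phi> (n j) \<in> path_topology \<delta> closure_of tails L" for j using K(2) by blast
  then obtain f r where f: "f \<in> path_topology \<delta> closure_of tails L" "strict_mono (r :: nat \<Rightarrow> nat)"
    "(\<lambda>j. path_dist \<delta> (\<phi> (n (r j))) f) \<longlonglongrightarrow> 0"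
    by (rule compact_pathsD[OF K(1)])
  have fp: "f \<in> paths" using f(1) compactin_paths[OF K(1)] by auto
  have lim: "(\<lambda>j. fst (\<phi> (n (r j)))) \<longlonglongrightarrow> fst f"
    "uniform_limit {s - 1..s} (\<lambda>j. snd (\<phi> (n (r j)))) (snd f) sequentially"
    using iffD1[OF path_dist_tendsto_iff f(3)] phi_paths fp by simp_all
  have inv: "(\<lambda>j. 1 / real (Suc (r j))) \<longlonglongrightarrow> 0"
    using LIMSEQ_subseq_LIMSEQ[OF LIMSEQ_Suc[OF lim_const_over_n[of 1]] f(2)] by (simp add: o_def)
  have times: "(\<lambda>j. fst (\<phi> (n (r j)))) \<longlonglongrightarrow> s"
  proof (rule metric_tendsto_imp_tendsto[OF inv], intro always_eventually allI)
    fix j show "dist (fst (\<phi> (n (r j)))) s \<le> dist (1 / real (Suc (r j))) 0"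
      using n(1)[of "r j"] n(2)[of "r j"] by (simp add: dist_real_def)
  qed
  have "isCont (snd f) s" using paths_continuous[OF fp] by (simp add: continuous_on_eq_continuous_at)
  then have a: "(\<lambda>j. snd f (fst (\<phi> (n (r j))))) \<longlonglongrightarrow> snd f s"
    using times by (rule isCont_tendsto_compose)
  have b: "(\<lambda>j. dist (snd (\<phi> (n (r j))) (fst (\<phi> (n (r j))))) (snd f (fst (\<phi> (n (r j)))))) \<longlonglongrightarrow> 0"
  proof (rule tendstoI)
    fix e :: real assume "e > 0"
    from uniform_limitD[OF lim(2) this]
    show "\<forall>\<^sub>F j in sequentially. dist (dist (snd (\<phi> (n (r j))) (fst (\<phi> (n (r j))))) (snd f (fst (\<phi> (n (r j)))))) 0 < e"
    proof eventually_elim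
      case (elim j)
      have "fst (\<phi> (n (r j))) \<in> {s - 1..s}"
        using n(1)[of "r j"] n(2)[of "r j"] le1[of "r j"] unfolding atLeastAtMost_iff by linarith
      with elim show ?case by simp
    qed
  qed
  have c: "(\<lambda>j. dist x (snd (\<phi> (n (r j))) (fst (\<phi> (n (r j)))))) \<longlonglongrightarrow> 0"
    by (rule tendsto_sandwich[OF _ _ tendsto_const inv]) (use n(3) in \<open>auto intro!: always_eventually less_imp_le\<close>)
  have "(\<lambda>j. dist x (snd (\<phi> (n (r j))) (fst (\<phi> (n (r j))))) + dist (snd (\<phi> (n (r j))) (fst (\<phi> (n (r j))))) (snd f (fst (\<phi> (n (r j)))))) \<longlonglongrightarrow> 0"
    using tendsto_add[OF c b] by simp
  then have "(\<lambda>j. dist x (snd f (fst (\<phi> (n (r j)))))) \<longlonglongrightarrow> 0"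
    by (rule tendsto_sandwich[OF _ _ tendsto_const, rotated 2]) (auto intro!: always_eventually dist_triangle)
  moreover have "(\<lambda>j. dist x (snd f (fst (\<phi> (n (r j)))))) \<longlonglongrightarrow> dist x (snd f s)"
    by (intro tendsto_intros a)
  ultimately have "dist x (snd f s) = 0" using LIMSEQ_unique by blast
  then have "x = snd f s" by simp
  have "(\<lambda>j. snd (\<phi> (n (r j))) s) \<longlonglongrightarrow> snd f s"
    using f(3) by (rule path_dist_tendsto_eval[rotated 2]) (use phi_paths fp in simp_all)
  from metric_LIMSEQ_D[OF this assms] obtain j where "dist (snd (\<phi> (n (r j))) s) x < e"
    using \<open>x = snd f s\<close> by blast
  moreover have "n (r j) \<in> started \<phi> s" using n(2)[of "r j"] by (simp add: started_def)
  ultimately show ?thesis by blast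
qed

abbreviation "idx \<equiv> theta_index \<delta> P \<phi>"
abbreviation "\<theta> \<equiv> theta \<delta> P l \<phi>"
abbreviation "approx s x k \<equiv> path_tail s (\<phi> (idx s x k))"

text \<open>Positive radii and dense positions guarantee an admissible index, without which the
  least number in \<open>theta_index\<close> would be unspecified.\<close>

lemma idx: "idx s x k \<in> started \<phi> s" "ereal (dist (snd (\<phi> (idx s x k)) s) x) < theta_radius \<delta> P k x"
proof -
  have "\<exists>n. n \<in> started \<phi> s \<and> ereal (dist (snd (\<phi> n) s) x) < theta_radius \<delta> P k x"
  proof -
    obtain e where e: "0 < ereal e" "ereal e < theta_radius \<delta> P k x"
      using ereal_dense2[OF radius_pos] by blast
    from dense_positions[of e s x] e show ?thesis
      by (auto intro: less_trans) (meson ereal_less(2) less_ereal.simps(1) less_trans)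
  qed
  from LeastI_ex[OF this]
  show "idx s x k \<in> started \<phi> s" "ereal (dist (snd (\<phi> (idx s x k)) s) x) < theta_radius \<delta> P k x"
    by (simp_all add: theta_index_def)
qed

lemma dist_idx: "dist (snd (\<phi> (idx s x k)) s) x < (1 / 2) ^ k"
  using less_le_trans[OF idx(2) theta_radius_le] by simp

lemma approx_paths: "approx s x k \<in> paths_from s"
  by (rule path_tail_paths) (rule phi_paths)

lemma approx_start: "(\<lambda>k. snd (approx s x k) s) \<longlonglongrightarrow> x"
proof (rule metric_tendsto_imp_tendsto)
  show "(\<lambda>k. (1 / 2 :: real) ^ k) \<longlonglongrightarrow> 0" by (rule LIMSEQ_power_zero) simp
  show "\<forall>\<^sub>F k in sequentially. dist (snd (approx s x k) s) x \<le> dist ((1 / 2 :: real) ^ k) 0"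
    using dist_idx[of s x] by (intro always_eventually allI) (simp add: less_imp_le)
qed

lemma approx_in_tails: "approx s x k \<in> tails ({s} \<times> cball x 1)"
proof -
  have "(1 / 2 :: real) ^ k \<le> 1" by (simp add: power_le_one)
  then have "dist (snd (\<phi> (idx s x k)) s) x \<le> 1" using dist_idx[of s x k] by linarith
  then show ?thesis unfolding skeleton_tails_def using idx(1)[of s x k] by (auto simp: dist_commute)
qed

text \<open>The approximating tails lie in one compact set, so the selector applies. It promises
  convergence only along some subsequence r, and later limits are taken along r.\<close>

lemma theta_limit:
  obtains r where "strict_mono r" "\<theta> s x \<in> paths" "(\<lambda>k. path_dist \<delta> (approx s x (r k)) (\<theta> s x)) \<longlonglongrightarrow> 0"
proof -
  let ?K = "path_topology \<delta> closure_of tails ({s} \<times> cball x 1)"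
  have "compact ({s} \<times> cball x 1)" by (intro compact_Times) auto
  note K = compact_tails[OF this]
  have sub: "range (approx s x) \<subseteq> tails ({s} \<times> cball x 1)" using approx_in_tails by blast
  have "path_topology \<delta> closure_of range (approx s x) \<subseteq> ?K" using sub by (rule closure_of_mono)
  then have "compactin (path_topology \<delta>) (path_topology \<delta> closure_of range (approx s x))"
    by (intro closed_compactin[OF K(1)]) auto
  moreover have "range (approx s x) \<subseteq> paths"
    using approx_paths paths_fromD by blast
  ultimately have "relatively_compact_in (path_topology \<delta>) (range (approx s x))"
    by (simp add: relatively_compact_in_def)
  then obtain r where "strict_mono r" "limitin (path_topology \<delta>) (approx s x \<circ> r) (\<theta> s x) sequentially"
    using selector unfolding limit_point_selector_def theta_def by blast
  then show thesis using that by (simp add: limitin_path_iff)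
qed

lemma theta_paths: "\<theta> s x \<in> paths_from s"
proof -
  obtain r where r: "strict_mono r" "\<theta> s x \<in> paths" "(\<lambda>k. path_dist \<delta> (approx s x (r k)) (\<theta> s x)) \<longlonglongrightarrow> 0"
    by (rule theta_limit)
  have "(\<lambda>k. fst (approx s x (r k))) \<longlonglongrightarrow> fst (\<theta> s x)"
    using iffD1[OF path_dist_tendsto_iff r(3)] r(2) approx_paths paths_fromD(1) by blast
  then show ?thesis using r(2) by (simp add: LIMSEQ_const_iff paths_from_def)
qed

lemma theta_eval_limit:
  assumes "strict_mono r" "(\<lambda>k. path_dist \<delta> (approx s x (r k)) (\<theta> s x)) \<longlonglongrightarrow> 0"
  shows "(\<lambda>k. snd (approx s x (r k)) t) \<longlonglongrightarrow> snd (\<theta> s x) t"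
  using assms(2)
  by (rule path_dist_tendsto_eval[rotated 2]) (use approx_paths theta_paths paths_fromD(1) in blast)+

lemma theta_start: "snd (\<theta> s x) s = x"
proof -
  obtain r where r: "strict_mono r" "\<theta> s x \<in> paths" "(\<lambda>k. path_dist \<delta> (approx s x (r k)) (\<theta> s x)) \<longlonglongrightarrow> 0"
    by (rule theta_limit)
  have "(\<lambda>k. snd (approx s x (r k)) s) \<longlonglongrightarrow> x"
    using LIMSEQ_subseq_LIMSEQ[OF approx_start r(1)] by (simp add: o_def)
  with theta_eval_limit[OF r(1,3)] show ?thesis by (rule LIMSEQ_unique)
qed

lemma theta_skeleton_limit:
  assumes "s \<le> v"
  shows "skeleton_limit \<phi> v (snd (\<theta> s x))"
proof -
  obtain r where r: "strict_mono r" "\<theta> s x \<in> paths" "(\<lambda>k. path_dist \<delta> (approx s x (r k)) (\<theta> s x)) \<longlonglongrightarrow> 0"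
    by (rule theta_limit)
  have ap: "approx s x k \<in> paths" for k using approx_paths paths_fromD(1) by blast
  have "uniform_limit {v..b} (\<lambda>k. snd (approx s x (r k))) (snd (\<theta> s x)) sequentially" for b
    using iffD1[OF path_dist_tendsto_iff[OF ap r(2)] r(3)] by simp
  then have "uniform_limit {v..b} (\<lambda>k. snd (\<phi> (idx s x (r k)))) (snd (\<theta> s x)) sequentially" for b
    using assms by (auto simp: uniform_limit_iff max_def)
  then show ?thesis
    unfolding skeleton_limit_def
    by (intro conjI exI[of _ "\<lambda>j. idx s x (r j)"] allI impI paths_continuous[OF r(2)] started_mono[OF idx(1) assms])
qed

text \<open>The minimal indices are bounded by \<open>n\<close>, so the convergence of their positions to that of \<open>\<phi> n\<close>
  is eventually an equality.\<close>

lemma theta_follow: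
  assumes n: "n \<in> started \<phi> t" and "t \<le> u"
  shows "snd (\<theta> t (snd (\<phi> n) t)) u = snd (\<phi> n) u"
proof -
  let ?x = "snd (\<phi> n) t"
  \<comment> \<open>n itself qualifies at every level k, since its distance to the point is
    0.\<close>
  have idx_le: "idx t ?x k \<le> n" for k
    unfolding theta_index_def using n radius_pos[of k ?x] by (intro Least_le) (simp flip: zero_ereal_def)
  \<comment> \<open>The positive distances realised by indices up to n. Once 2^(-k) is below their
    minimum, the chosen position must equal the given one.\<close>
  define S where "S = {d. \<exists>m\<le>n. d = dist (snd (\<phi> m) t) ?x \<and> d > 0}"
  have "finite S" unfolding S_def by (rule finite_subset[of _ "(\<lambda>m. dist (snd (\<phi> m) t) ?x) ` {..n}"]) auto
  then obtain d where d: "d > 0" "\<And>e. e \<in> S \<Longrightarrow> d \<le> e"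
  proof (cases "S = {}")
    case False
    then have "Min S \<in> S" using \<open>finite S\<close> by simp
    moreover have "\<And>d. d \<in> S \<Longrightarrow> d > 0" by (auto simp: S_def)
    ultimately have "Min S > 0" by blast
    then show ?thesis using that[of "Min S"] \<open>finite S\<close> by simp
  qed (use that[of 1] in auto)
  have "(\<lambda>k. (1 / 2 :: real) ^ k) \<longlonglongrightarrow> 0" by (rule LIMSEQ_power_zero) simp
  from order_tendstoD(2)[OF this d(1)]
  have ev: "\<forall>\<^sub>F k in sequentially. snd (approx t ?x k) u = snd (\<phi> n) u"
  proof eventually_elim
    case (elim k)
    have "dist (snd (\<phi> (idx t ?x k)) t) ?x \<notin> S"
      using d(2) dist_idx[of t ?x k] elim by force
    then have "snd (\<phi> (idx t ?x k)) t = ?x" using idx_le[of k] by (auto simp: S_def)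
    then have "snd (\<phi> (idx t ?x k)) u = snd (\<phi> n) u"
      by (rule skeleton_coalesce[OF skel idx(1) n]) fact
    then show ?case using \<open>t \<le> u\<close> by (simp add: max_def)
  qed
  obtain r where r: "strict_mono r" "\<theta> t ?x \<in> paths" "(\<lambda>k. path_dist \<delta> (approx t ?x (r k)) (\<theta> t ?x)) \<longlonglongrightarrow> 0"
    by (rule theta_limit)
  have "(\<lambda>k. snd (approx t ?x (r k)) u) \<longlonglongrightarrow> snd (\<phi> n) u"
    using LIMSEQ_subseq_LIMSEQ[OF tendsto_eventually[OF ev] r(1)] by (simp add: o_def)
  with theta_eval_limit[OF r(1,3)] show ?thesis by (rule LIMSEQ_unique)
qed

text \<open>At the infimum a of the times at which the two paths differ, they still agree. As a lies
  strictly before the next hit of F, the point reached there is no bifurcation point, so they agree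
  a little longer, a contradiction.\<close>

lemma theta_restart:
  assumes B: "bifurcation_points \<phi> \<subseteq> F" and st: "s < t" "t \<le> u"
    and u: "ereal u \<le> first_hit F (snd (\<theta> s x)) s"
  shows "snd (\<theta> t (snd (\<theta> s x) t)) u = snd (\<theta> s x) u"
proof (rule ccontr)
  assume ne: "snd (\<theta> t (snd (\<theta> s x) t)) u \<noteq> snd (\<theta> s x) u"
  define f where "f = snd (\<theta> s x)"
  define g where "g = snd (\<theta> t (f t))"
  have cont: "continuous_on UNIV f" "continuous_on UNIV g"
    unfolding f_def g_def using theta_paths paths_fromD(1) paths_continuous by blast+
  define A where "A = {v. t \<le> v \<and> f v \<noteq> g v}"
  define a where "a = Inf A"
  have "u \<in> A" using ne st by (auto simp: A_def f_def g_def)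
  have bdd: "bdd_below A" by (rule bdd_belowI[of _ t]) (simp add: A_def)
  have "t \<le> a" unfolding a_def using \<open>u \<in> A\<close> by (intro cInf_greatest) (auto simp: A_def)
  have before: "f v = g v" if "t \<le> v" "v < a" for v
  proof (rule ccontr)
    assume "f v \<noteq> g v"
    then have "a \<le> v" unfolding a_def using that bdd by (intro cInf_lower) (auto simp: A_def)
    with that show False by simp
  qed
  have eq: "f a = g a"
  proof (cases "t = a")
    case True
    then show ?thesis using theta_start by (simp add: g_def)
  next
    case False
    have "continuous_on UNIV (\<lambda>v. dist (f v) (g v))" using cont by (intro continuous_intros)
    then have "dist (f a) (g a) \<in> {0}"
      by (rule closed_rational_extension[where a=t and b=a]) (use False \<open>t \<le> a\<close> before in auto)
    then show ?thesis by simp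
  qed
  have "a \<le> u" unfolding a_def using \<open>u \<in> A\<close> bdd by (rule cInf_lower)
  moreover have "a \<noteq> u" using eq \<open>u \<in> A\<close> by (auto simp: A_def)
  ultimately have "ereal a < ereal u" by simp
  \<comment> \<open>Here s < a matters, because \<open>first_hit\<close> ignores the time s
    itself.\<close>
  then have "(a, f a) \<notin> F"
    using st \<open>t \<le> a\<close> less_le_trans[OF _ u] unfolding f_def by (intro first_hit_not_in[of s]) auto
  then have nb: "(a, f a) \<notin> bifurcation_points \<phi>" using B by blast
  have "skeleton_limit \<phi> a f" "skeleton_limit \<phi> a g"
    unfolding f_def g_def using st \<open>t \<le> a\<close> by (simp_all add: theta_skeleton_limit)
  from agree_after_non_bifurcation[OF this eq phi_paths nb]
  obtain r where r: "r > a" "\<And>u. u \<in> {a..r} \<Longrightarrow> f u = g u" by blast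
  have "r \<le> a" unfolding a_def
  proof (rule cInf_greatest)
    show "A \<noteq> {}" using \<open>u \<in> A\<close> by auto
    fix v assume v: "v \<in> A"
    then have "a \<le> v" unfolding a_def using bdd by (rule cInf_lower)
    with r(2)[of v] v show "r \<le> v" by (cases "v \<le> r") (auto simp: A_def)
  qed
  with r show False by simp
qed

lemma flow_gluing_theta:
  assumes "closed F" "bifurcation_points \<phi> \<subseteq> F" "\<And>s x. k_stop \<theta> F s x < \<infinity>"
    and b: "\<And>s x t. k_stop \<theta> F s x = 0 \<Longrightarrow> s < t \<Longrightarrow>
       \<exists>n\<in>started \<phi> t. path_tail t (\<theta> s x) = path_tail t (\<phi> n)"
  shows "flow_gluing \<theta> F \<phi>"
proof -
  interpret gluing \<theta> F
    by unfold_locales (use assms theta_paths theta_start in auto)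
  show ?thesis
  proof unfold_locales
    fix s x t assume h: "first_hit F (snd (\<theta> s x)) s = ereal s" "s < (t :: real)"
    then have "kfin s x = 0" by (simp add: kfin_0_iff)
    then have "k_stop \<theta> F s x = 0" by (simp add: k_stop_eq zero_enat_def)
    from b[OF this h(2)] show "\<exists>n\<in>started \<phi> t. \<forall>u\<ge>t. snd (\<theta> s x) u = snd (\<phi> n) u"
      unfolding path_tail_eq_iff by blast
  qed (use theta_follow theta_restart assms(2) in auto)
qed

end

section \<open>Laws of the two-point motion\<close>

locale pair_kernel = path_space \<delta>
  for \<delta> :: "(real \<Rightarrow> 'm::{heine_borel, polish_space}) \<Rightarrow> (real \<Rightarrow> 'm) \<Rightarrow> real" +
  fixes Q :: "real \<Rightarrow> (nat \<Rightarrow> 'm) \<Rightarrow> (nat \<Rightarrow> 'm) measure"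
  assumes Q: "\<And>t. 0 \<le> t \<Longrightarrow> Q t \<in> power_measure 2 \<rightarrow>\<^sub>M prob_algebra (power_measure 2)"
begin

abbreviation "M2 \<equiv> (power_measure 2 :: (nat \<Rightarrow> 'm) measure)"
abbreviation "W2 \<equiv> path_power_measure \<delta> 2"
abbreviation "pos \<equiv> path_position 2"

lemma space_M2: "space M2 = extensional {..<2}"
  by (simp add: power_measure_def space_PiM PiE_def)

lemma space_M2_nonempty: "space M2 \<noteq> {}"
  by (auto simp: space_M2 intro: exI[of _ "\<lambda>_. undefined"])

lemma space_W2: "space W2 = PiE {..<2} (\<lambda>_. paths_from 0)"
  by (auto simp: path_power_measure_def space_PiM space_restrict_space paths_from_def intro!: PiE_cong)

lemma coordinate_measurable:
  assumes "i < 2"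
  shows "(\<lambda>w. w i) \<in> W2 \<rightarrow>\<^sub>M path_measure \<delta>"
proof -
  have "(\<lambda>w. w i) \<in> W2 \<rightarrow>\<^sub>M restrict_space (path_measure \<delta>) (paths_from 0)"
    unfolding path_power_measure_def by (rule measurable_component_singleton) (use assms in simp)
  then show ?thesis by (rule measurable_restrict_space2_iff[THEN iffD1, THEN conjunct1])
qed

lemma pos_measurable [measurable]: "pos t \<in> W2 \<rightarrow>\<^sub>M M2"
proof -
  have "(\<lambda>w. snd (w i) t) \<in> W2 \<rightarrow>\<^sub>M borel" if "i \<in> {..<2}" for i
    using measurable_compose[OF coordinate_measurable eval_measurable] that by simp
  then show ?thesis
    unfolding path_position_def[abs_def] power_measure_def by (intro measurable_restrict) auto
qed

lemma W2_measurableI: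
  assumes X: "\<And>i. i < 2 \<Longrightarrow> X i \<in> N \<rightarrow>\<^sub>M path_measure \<delta>"
    and from0: "\<And>x i. x \<in> space N \<Longrightarrow> i < 2 \<Longrightarrow> X i x \<in> paths_from 0"
  shows "(\<lambda>x. \<lambda>i\<in>{..<2}. X i x) \<in> N \<rightarrow>\<^sub>M W2"
  unfolding path_power_measure_def
proof (rule measurable_restrict)
  fix i :: nat assume "i \<in> {..<2}"
  then show "X i \<in> N \<rightarrow>\<^sub>M restrict_space (path_measure \<delta>) (paths_from 0)"
    using X from0 by (intro measurable_restrict_space2) auto
qed

section \<open>Finite-dimensional events of the two-point motion\<close>

definition cyl :: "real set \<Rightarrow> (real \<Rightarrow> (nat \<Rightarrow> 'm) set) \<Rightarrow> (nat \<Rightarrow> 'm path) set" where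
  "cyl J B = {w\<in>space W2. \<forall>t\<in>J. pos t w \<in> B t}"

definition "cyls = {cyl J B | J B. finite J \<and> J \<subseteq> {0..} \<and> (\<forall>t. B t \<in> sets M2)}"

lemma cyl_insert: "cyl (insert b J) B = cyl J B \<inter> {w\<in>space W2. pos b w \<in> B b}"
  by (auto simp: cyl_def)

lemma past_events_sigma: "sigma_algebra (space W2) (past_events \<delta> 2 s)"
  unfolding past_events_def by (rule sigma_algebra_sigma_sets) auto

lemma past_event_basic: "0 \<le> u \<Longrightarrow> u \<le> s \<Longrightarrow> B \<in> sets M2 \<Longrightarrow> {w\<in>space W2. pos u w \<in> B} \<in> past_events \<delta> 2 s"
  unfolding past_events_def by (rule sigma_sets.Basic) auto

lemma past_events_sets: "past_events \<delta> 2 s \<subseteq> sets W2"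
proof -
  have "{{w\<in>space W2. pos u w \<in> B} | u B. 0 \<le> u \<and> u \<le> s \<and> B \<in> sets M2} \<subseteq> sets W2"
    by (auto intro: measurable_sets_Collect[OF pos_measurable])
  then show ?thesis unfolding past_events_def by (rule sets.sigma_sets_subset)
qed

lemma cyl_past_event:
  assumes "finite J" "J \<subseteq> {0..s}" "\<And>t. B t \<in> sets M2"
  shows "cyl J B \<in> past_events \<delta> 2 s"
  using assms(1,2)
proof (induction J)
  case empty
  interpret sigma_algebra "space W2" "past_events \<delta> 2 s" by (rule past_events_sigma)
  show ?case using top by (simp add: cyl_def)
next
  case (insert b J)
  interpret sigma_algebra "space W2" "past_events \<delta> 2 s" by (rule past_events_sigma)
  show ?case unfolding cyl_insert
    by (rule Int) (use insert assms(3) in \<open>auto intro: past_event_basic\<close>)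
qed

lemma cyls_Int_stable: "Int_stable cyls"
proof (rule Int_stableI)
  fix a b assume "a \<in> cyls" "b \<in> cyls"
  then obtain J B J' B' where a: "a = cyl J B" "finite J" "J \<subseteq> {0..}" "\<forall>t. B t \<in> sets M2"
    and b: "b = cyl J' B'" "finite J'" "J' \<subseteq> {0..}" "\<forall>t. B' t \<in> sets M2"
    by (auto simp: cyls_def)
  \<comment> \<open>Times that belong to only one of the two index sets get the whole space on the
    other side.\<close>
  have "a \<inter> b = cyl (J \<union> J') (\<lambda>t. (if t \<in> J then B t else space M2) \<inter> (if t \<in> J' then B' t else space M2))"
    unfolding a(1) b(1) cyl_def using measurable_space[OF pos_measurable] by (auto split: if_splits)
  moreover have "(if t \<in> J then B t else space M2) \<inter> (if t \<in> J' then B' t else space M2) \<in> sets M2" for t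
    using a b by auto
  ultimately show "a \<inter> b \<in> cyls"
    unfolding cyls_def using a b by blast
qed

text \<open>The identity from the sigma-algebra of the cylinders into \<open>W2\<close> is
  measurable by \<open>measurable_pathI\<close>, which asks only for the start and the evaluations;
  at negative times a path takes its value at 0.\<close>

lemma sets_W2: "sets W2 = sigma_sets (space W2) cyls"
proof
  have sub: "cyls \<subseteq> Pow (space W2)" by (auto simp: cyls_def cyl_def)
  define N where "N = sigma (space W2) cyls"
  have N: "space N = space W2" "sets N = sigma_sets (space W2) cyls"
    using sub by (auto simp: N_def)
  have "cyls \<subseteq> sets W2"
  proof
    fix a assume "a \<in> cyls"
    then obtain J B where a: "a = cyl J B" "finite J" "J \<subseteq> {0..}" "\<And>t. B t \<in> sets M2"
      by (auto simp: cyls_def)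
    obtain s where "\<And>t. t \<in> J \<Longrightarrow> t \<le> s" using bdd_above_finite[OF a(2)] by (auto simp: bdd_above_def)
    then have "J \<subseteq> {0..s}" using a(3) by auto
    from cyl_past_event[OF a(2) this a(4)] show "a \<in> sets W2"
      unfolding a(1) by (rule subsetD[OF past_events_sets])
  qed
  then show "sigma_sets (space W2) cyls \<subseteq> sets W2" by (rule sets.sigma_sets_subset)
  have pos_N: "pos t \<in> N \<rightarrow>\<^sub>M M2" if "0 \<le> t" for t
  proof (rule measurableI)
    fix B assume B: "B \<in> sets M2"
    have "pos t -` B \<inter> space N = cyl {t} (\<lambda>_. B)" by (auto simp: N cyl_def)
    also have "\<dots> \<in> cyls" using that B by (auto simp: cyls_def)
    finally show "pos t -` B \<inter> space N \<in> sets N" unfolding N(2) by (rule sigma_sets.Basic)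
  qed (use measurable_space[OF pos_measurable] N in auto)
  have "(\<lambda>w. \<lambda>i\<in>{..<2}. w i) \<in> N \<rightarrow>\<^sub>M W2"
  proof (rule W2_measurableI)
    fix i :: nat assume i: "i < 2"
    show mem: "w i \<in> paths_from 0" if "w \<in> space N" for w
      using that i by (auto simp: N space_W2)
    have ev: "(\<lambda>w. snd (w i) t) \<in> borel_measurable N" if "0 \<le> t" for t
    proof -
      have "(\<lambda>w. pos t w i) \<in> borel_measurable N"
        using pos_N[OF that] i unfolding power_measure_def
        by (auto intro: measurable_compose[OF _ measurable_component_singleton])
      then show ?thesis using i by (simp add: path_position_def)
    qed
    show "(\<lambda>w. w i) \<in> N \<rightarrow>\<^sub>M path_measure \<delta>"
    proof (rule measurable_pathI)
      show "w i \<in> paths" if "w \<in> space N" for w using mem[OF that] by (rule paths_fromD)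
      show "(\<lambda>w. fst (w i)) \<in> borel_measurable N"
        by (subst measurable_cong[where g="\<lambda>_. 0"]) (use paths_fromD(2)[OF mem] in simp_all)
      show "(\<lambda>w. snd (w i) t) \<in> borel_measurable N" for t
      proof (cases "0 \<le> t")
        case False
        have "snd (w i) t = snd (w i) 0" if "w \<in> space N" for w
          using paths_before[of "w i" t] mem[OF that] False by (auto simp: paths_from_def)
        then show ?thesis using ev[of 0] by (subst measurable_cong) auto
      qed (rule ev)
    qed
  qed
  then have id: "(\<lambda>w. w) \<in> N \<rightarrow>\<^sub>M W2"
    by (subst measurable_cong[where g="\<lambda>w. \<lambda>i\<in>{..<2}. w i"]) (auto simp: N space_W2 fun_eq_iff PiE_def extensional_def restrict_def)
  show "sets W2 \<subseteq> sigma_sets (space W2) cyls"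
  proof
    fix a assume a: "a \<in> sets W2"
    have "(\<lambda>w. w) -` a \<inter> space N \<in> sets N" using measurable_sets[OF id a] .
    moreover have "(\<lambda>w. w) -` a \<inter> space N = a" using sets.sets_into_space[OF a] by (auto simp: N)
    ultimately show "a \<in> sigma_sets (space W2) cyls" by (simp add: N)
  qed
qed

section \<open>Uniqueness and measurability of Markov laws\<close>

definition Markov :: "(nat \<Rightarrow> 'm path) measure \<Rightarrow> bool" where
  "Markov \<mu> \<longleftrightarrow> (\<forall>s\<ge>0. \<forall>t\<ge>0. \<forall>A\<in>past_events \<delta> 2 s. \<forall>B\<in>sets M2.
     emeasure \<mu> (A \<inter> {w\<in>space \<mu>. pos (s + t) w \<in> B}) = (\<integral>\<^sup>+w\<in>A. emeasure (Q t (pos s w)) B \<partial>\<mu>))"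

text \<open>The law of the position on the event A, left unnormalized so that null events need no
  separate treatment.\<close>

definition law_at :: "(nat \<Rightarrow> 'm path) measure \<Rightarrow> (nat \<Rightarrow> 'm path) set \<Rightarrow> real \<Rightarrow> (nat \<Rightarrow> 'm) measure" where
  "law_at \<mu> A u = distr (density \<mu> (indicator A)) M2 (pos u)"

lemma sets_law_at [simp]: "sets (law_at \<mu> A u) = sets M2" "space (law_at \<mu> A u) = space M2"
  by (auto simp: law_at_def)

lemma emeasure_law_at:
  assumes "sets \<mu> = sets W2" "A \<in> sets W2" "C \<in> sets M2"
  shows "emeasure (law_at \<mu> A u) C = emeasure \<mu> (A \<inter> {w\<in>space W2. pos u w \<in> C})"
proof -
  have [measurable_cong]: "sets \<mu> = sets W2" by fact
  have sp: "space \<mu> = space W2" using assms(1) by (rule sets_eq_imp_space_eq)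
  have [measurable]: "pos u \<in> \<mu> \<rightarrow>\<^sub>M M2" by measurable
  have "emeasure (law_at \<mu> A u) C = emeasure (density \<mu> (indicator A)) (pos u -` C \<inter> space \<mu>)"
    unfolding law_at_def using assms by (subst emeasure_distr) simp_all
  also have "\<dots> = emeasure \<mu> (A \<inter> (pos u -` C \<inter> space \<mu>))"
  proof (rule emeasure_restricted)
    show "A \<in> sets \<mu>" using assms by simp
    show "pos u -` C \<inter> space \<mu> \<in> sets \<mu>" by (rule measurable_sets[OF _ assms(3)]) measurable
  qed
  also have "pos u -` C \<inter> space \<mu> = {w\<in>space W2. pos u w \<in> C}" by (auto simp: sp)
  finally show ?thesis .
qed

lemma nn_integral_law_at:
  assumes "sets \<mu> = sets W2" "A \<in> sets W2" and h [measurable]: "h \<in> borel_measurable M2"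
  shows "(\<integral>\<^sup>+w\<in>A. h (pos u w) \<partial>\<mu>) = (\<integral>\<^sup>+y. h y \<partial>law_at \<mu> A u)"
proof -
  have [measurable_cong]: "sets \<mu> = sets W2" by fact
  have [measurable]: "A \<in> sets \<mu>" using assms by simp
  have "(\<integral>\<^sup>+y. h y \<partial>law_at \<mu> A u) = (\<integral>\<^sup>+w. h (pos u w) \<partial>density \<mu> (indicator A))"
    unfolding law_at_def by (subst nn_integral_distr) auto
  also have "\<dots> = (\<integral>\<^sup>+w. indicator A w * h (pos u w) \<partial>\<mu>)"
    by (subst nn_integral_density) auto
  finally show ?thesis by (simp add: mult.commute)
qed

lemma Q_measurable: "0 \<le> t \<Longrightarrow> C \<in> sets M2 \<Longrightarrow> (\<lambda>y. emeasure (Q t y) C) \<in> borel_measurable M2"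
  using measurable_emeasure_kernel[OF measurable_prob_algebraD[OF Q]] .

lemma past_event_measurable: "A \<in> past_events \<delta> 2 s \<Longrightarrow> A \<in> sets W2"
  using past_events_sets by blast

lemma Markov_law_at:
  assumes "sets \<mu> = sets W2" "Markov \<mu>" "0 \<le> s" "s \<le> u" "A \<in> past_events \<delta> 2 s" "C \<in> sets M2"
  shows "emeasure \<mu> (A \<inter> {w\<in>space W2. pos u w \<in> C}) = (\<integral>\<^sup>+y. emeasure (Q (u - s) y) C \<partial>law_at \<mu> A s)"
proof -
  have "emeasure \<mu> (A \<inter> {w\<in>space \<mu>. pos (s + (u - s)) w \<in> C}) = (\<integral>\<^sup>+w\<in>A. emeasure (Q (u - s) (pos s w)) C \<partial>\<mu>)"
    using assms(2)[unfolded Markov_def, rule_format, OF assms(3) _ assms(5,6), of "u - s"] assms(4) by simp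
  also have "\<dots> = (\<integral>\<^sup>+y. emeasure (Q (u - s) y) C \<partial>law_at \<mu> A s)"
    using assms past_events_sets by (intro nn_integral_law_at Q_measurable) auto
  finally show ?thesis using sets_eq_imp_space_eq[OF assms(1)] by simp
qed

lemma cyl_insert_past:
  assumes "finite J" "J \<subseteq> {0..}" "\<forall>t\<in>J. t < b" "0 \<le> b" "\<And>t. B t \<in> sets M2"
  shows "cyl (insert b J) B \<in> past_events \<delta> 2 b"
proof (rule cyl_past_event)
  show "insert b J \<subseteq> {0..b}"
    using assms(2-4) by (auto simp: subset_iff Ball_def less_imp_le)
qed (use assms in auto)

text \<open>Induction over the times in increasing order. With the additional event at a later time
  u, the hypothesis says that the unnormalized laws at the last time b agree, and the Markov
  property carries this from b to u.\<close>

lemma Markov_cyl_eq: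
  assumes sets: "sets \<mu> = sets W2" "sets \<nu> = sets W2" and M: "Markov \<mu>" "Markov \<nu>"
    and init: "\<And>C. C \<in> sets M2 \<Longrightarrow>
      emeasure \<mu> {w\<in>space W2. pos 0 w \<in> C} = emeasure \<nu> {w\<in>space W2. pos 0 w \<in> C}"
    and B: "\<And>t. B t \<in> sets M2"
    and J: "finite J"
  shows "J \<subseteq> {0..} \<Longrightarrow> \<forall>t\<in>J. t \<le> u \<Longrightarrow> 0 \<le> u \<Longrightarrow> C \<in> sets M2 \<Longrightarrow>
    emeasure \<mu> (cyl J B \<inter> {w\<in>space W2. pos u w \<in> C}) = emeasure \<nu> (cyl J B \<inter> {w\<in>space W2. pos u w \<in> C})"
  using J
proof (induction J arbitrary: u C rule: finite_linorder_max_induct)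
  case empty
  interpret sigma_algebra "space W2" "past_events \<delta> 2 0" by (rule past_events_sigma)
  have "law_at \<mu> (space W2) 0 = law_at \<nu> (space W2) 0"
  proof (rule measure_eqI)
    fix C assume "C \<in> sets (law_at \<mu> (space W2) 0)"
    then show "emeasure (law_at \<mu> (space W2) 0) C = emeasure (law_at \<nu> (space W2) 0) C"
      using init sets by (simp add: emeasure_law_at Int_absorb1)
  qed simp
  then show ?case
    using Markov_law_at[OF sets(1) M(1), of 0 u "space W2" C] Markov_law_at[OF sets(2) M(2), of 0 u "space W2" C]
      empty top by (simp add: cyl_def)
next
  case (insert b J)
  let ?A = "cyl (insert b J) B"
  have b: "0 \<le> b" "b \<le> u" using insert.prems by auto
  have A: "?A \<in> past_events \<delta> 2 b"
    using insert b B by (intro cyl_insert_past) auto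
  have "law_at \<mu> ?A b = law_at \<nu> ?A b"
  proof (rule measure_eqI)
    fix C' assume "C' \<in> sets (law_at \<mu> ?A b)"
    then have C': "C' \<in> sets M2" by simp
    have "?A \<inter> {w\<in>space W2. pos b w \<in> C'} = cyl J B \<inter> {w\<in>space W2. pos b w \<in> B b \<inter> C'}"
      by (auto simp: cyl_def)
    moreover have "emeasure \<mu> (cyl J B \<inter> {w\<in>space W2. pos b w \<in> B b \<inter> C'}) =
        emeasure \<nu> (cyl J B \<inter> {w\<in>space W2. pos b w \<in> B b \<inter> C'})"
      using insert b C' B by (intro insert.IH) (auto intro: less_imp_le)
    ultimately show "emeasure (law_at \<mu> ?A b) C' = emeasure (law_at \<nu> ?A b) C'"
      using sets past_event_measurable[OF A] C' by (simp add: emeasure_law_at)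
  qed simp
  then show ?case
    using Markov_law_at[OF sets(1) M(1) b A, of C] Markov_law_at[OF sets(2) M(2) b A, of C] insert.prems by simp
qed

text \<open>A vacuous event at a time after all of J brings a cylinder into the form handled by
  these inductions.\<close>

lemma cyl_top:
  assumes "J \<subseteq> {0..}" "finite J"
  obtains u where "0 \<le> u" "\<forall>t\<in>J. t \<le> u" "\<And>B. cyl J B = cyl J B \<inter> {w\<in>space W2. pos u w \<in> space M2}"
proof (rule that[of "Max (insert 0 J)"])
  show "cyl J B = cyl J B \<inter> {w\<in>space W2. pos (Max (insert 0 J)) w \<in> space M2}" for B
    using measurable_space[OF pos_measurable] by (auto simp: cyl_def)
qed (use assms in auto)

text \<open>Stated for finite measures because it is applied to laws restricted to events of the
  past.\<close>

lemma Markov_unique: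
  assumes sets: "sets \<mu> = sets W2" "sets \<nu> = sets W2" and M: "Markov \<mu>" "Markov \<nu>"
    and init: "\<And>C. C \<in> sets M2 \<Longrightarrow>
      emeasure \<mu> {w\<in>space W2. pos 0 w \<in> C} = emeasure \<nu> {w\<in>space W2. pos 0 w \<in> C}"
    and fin: "finite_measure \<mu>"
  shows "\<mu> = \<nu>"
proof (rule measure_eqI_generator_eq[of cyls "space W2" _ _ "\<lambda>_. space W2"])
  show "Int_stable cyls" by (rule cyls_Int_stable)
  show "cyls \<subseteq> Pow (space W2)" by (auto simp: cyls_def cyl_def)
  show "sets \<mu> = sigma_sets (space W2) cyls" "sets \<nu> = sigma_sets (space W2) cyls"
    using sets sets_W2 by auto
  show "range (\<lambda>_. space W2) \<subseteq> cyls"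
    by (auto simp: cyls_def cyl_def intro!: exI[of _ "{}"] exI[of _ "\<lambda>_. {}"])
  show "emeasure \<mu> (space W2) \<noteq> \<infinity>"
    using finite_measure.emeasure_finite[OF fin] by simp
  fix X assume "X \<in> cyls"
  then obtain J B where X: "X = cyl J B" "finite J" "J \<subseteq> {0..}" "\<And>t. B t \<in> sets M2"
    by (auto simp: cyls_def)
  obtain u where u: "0 \<le> u" "\<forall>t\<in>J. t \<le> u" "\<And>B. cyl J B = cyl J B \<inter> {w\<in>space W2. pos u w \<in> space M2}"
    using cyl_top[OF X(3,2)] by blast
  show "emeasure \<mu> X = emeasure \<nu> X"
    unfolding X(1) by (subst (1 2) u(3), rule Markov_cyl_eq[OF sets M init X(4,2,3) u(2,1)]) auto
qed auto

lemma is_Markov_law_iff: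
  "is_Markov_law \<delta> 2 Q x \<mu> \<longleftrightarrow>
     prob_space \<mu> \<and> sets \<mu> = sets W2 \<and> (AE w in \<mu>. pos 0 w = x) \<and> Markov \<mu>"
  by (auto simp: is_Markov_law_def Markov_def)

lemma is_Markov_law_init:
  assumes \<mu>: "is_Markov_law \<delta> 2 Q x \<mu>" and C: "C \<in> sets M2"
  shows "emeasure \<mu> {w\<in>space W2. pos 0 w \<in> C} = indicator C x"
proof -
  interpret prob_space \<mu> using \<mu> by (simp add: is_Markov_law_iff)
  have sets [measurable_cong]: "sets \<mu> = sets W2" using \<mu> by (simp add: is_Markov_law_iff)
  have "emeasure \<mu> {w\<in>space W2. pos 0 w \<in> C} = (\<integral>\<^sup>+w. indicator C (pos 0 w) \<partial>\<mu>)"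
    unfolding sets_eq_imp_space_eq[OF sets, symmetric]
  proof (subst nn_integral_indicator[symmetric])
    show "{w\<in>space \<mu>. pos 0 w \<in> C} \<in> sets \<mu>" using C by measurable
  qed (auto intro!: nn_integral_cong split: split_indicator)
  also have "\<dots> = (\<integral>\<^sup>+w. indicator C x \<partial>\<mu>)"
    using \<mu> by (intro nn_integral_cong_AE) (auto simp: is_Markov_law_iff)
  finally show ?thesis by (simp add: emeasure_space_1)
qed

lemma is_Markov_law_unique:
  assumes "is_Markov_law \<delta> 2 Q x \<mu>" "is_Markov_law \<delta> 2 Q x \<nu>"
  shows "\<mu> = \<nu>"
  using assms is_Markov_law_init[OF assms(1)] is_Markov_law_init[OF assms(2)]
  by (intro Markov_unique) (auto simp: is_Markov_law_iff prob_space_def)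

text \<open>The induction of \<open>Markov_cyl_eq\<close> once more, now for measurable dependence
  on x: the unnormalized law at the last time is a subprobability kernel, against which the
  transition kernel is integrated.\<close>

lemma Markov_kernel:
  assumes K: "\<And>x. x \<in> space M2 \<Longrightarrow> is_Markov_law \<delta> 2 Q x (K x)"
  shows "K \<in> M2 \<rightarrow>\<^sub>M prob_algebra W2"
proof (rule measurable_prob_algebra_generated[OF sets_W2 cyls_Int_stable])
  show "cyls \<subseteq> Pow (space W2)" by (auto simp: cyls_def cyl_def)
  show prob: "prob_space (K x)" and sets: "sets (K x) = sets W2" if "x \<in> space M2" for x
    using K[OF that] by (auto simp: is_Markov_law_iff)
  have M: "Markov (K x)" if "x \<in> space M2" for x
    using K[OF that] by (auto simp: is_Markov_law_iff)
  have *: "(\<lambda>x. emeasure (K x) (cyl J B \<inter> {w\<in>space W2. pos u w \<in> C})) \<in> borel_measurable M2"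
    if "finite J" "J \<subseteq> {0..}" "\<forall>t\<in>J. t \<le> u" "0 \<le> u" "C \<in> sets M2" and B: "\<And>t. B t \<in> sets M2" for J B u C
    using that(1-5)
  proof (induction J arbitrary: u C rule: finite_linorder_max_induct)
    case empty
    interpret sigma_algebra "space W2" "past_events \<delta> 2 0" by (rule past_events_sigma)
    have "emeasure (K x) (cyl {} B \<inter> {w\<in>space W2. pos u w \<in> C}) = emeasure (Q u x) C"
      if x: "x \<in> space M2" for x
    proof -
      interpret prob_space "K x" by (rule prob[OF x])
      have "emeasure (K x) (cyl {} B \<inter> {w\<in>space W2. pos u w \<in> C}) =
          (\<integral>\<^sup>+w\<in>space W2. emeasure (Q u (pos 0 w)) C \<partial>K x)"
        using M[OF x, unfolded Markov_def, rule_format, of 0 u "space W2" C] empty top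
          sets_eq_imp_space_eq[OF sets[OF x]] by (simp add: cyl_def)
      also have "\<dots> = (\<integral>\<^sup>+w. emeasure (Q u x) C \<partial>K x)"
        using K[OF x] by (intro nn_integral_cong_AE)
          (auto simp: is_Markov_law_iff sets_eq_imp_space_eq[OF sets[OF x], symmetric])
      finally show ?thesis by (simp add: emeasure_space_1)
    qed
    then show ?case using Q_measurable[of u C] empty by (subst measurable_cong) auto
  next
    case (insert b J)
    let ?A = "cyl (insert b J) B"
    have b: "0 \<le> b" "b \<le> u" using insert.prems by auto
    have A: "?A \<in> past_events \<delta> 2 b"
      using insert b B by (intro cyl_insert_past) auto
    have "(\<lambda>x. law_at (K x) ?A b) \<in> M2 \<rightarrow>\<^sub>M subprob_algebra M2"
    proof (rule measurable_subprob_algebra)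
      fix x assume x: "x \<in> space M2"
      interpret prob_space "K x" by (rule prob[OF x])
      show "sets (law_at (K x) ?A b) = sets M2" by simp
      show "subprob_space (law_at (K x) ?A b)"
      proof
        show "emeasure (law_at (K x) ?A b) (space (law_at (K x) ?A b)) \<le> 1"
          using past_event_measurable[OF A] sets[OF x] by (simp add: emeasure_law_at measure_le_1)
      qed (simp add: space_M2_nonempty)
    next
      fix C' assume C': "C' \<in> sets M2"
      have "?A \<inter> {w\<in>space W2. pos b w \<in> C'} = cyl J B \<inter> {w\<in>space W2. pos b w \<in> B b \<inter> C'}"
        by (auto simp: cyl_def)
      then have "emeasure (law_at (K x) ?A b) C' = emeasure (K x) (cyl J B \<inter> {w\<in>space W2. pos b w \<in> B b \<inter> C'})"
        if "x \<in> space M2" for x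
        using past_event_measurable[OF A] sets[OF that] C' by (simp add: emeasure_law_at)
      moreover have "(\<lambda>x. emeasure (K x) (cyl J B \<inter> {w\<in>space W2. pos b w \<in> B b \<inter> C'})) \<in> borel_measurable M2"
        using insert b C' B by (intro insert.IH) (auto intro: less_imp_le)
      ultimately show "(\<lambda>x. emeasure (law_at (K x) ?A b) C') \<in> borel_measurable M2"
        by (subst measurable_cong) auto
    qed
    then have "(\<lambda>x. \<integral>\<^sup>+y. emeasure (Q (u - b) y) C \<partial>law_at (K x) ?A b) \<in> borel_measurable M2"
      using Q_measurable[of "u - b" C] b insert.prems
      by (intro measurable_compose[OF _ nn_integral_measurable_subprob_algebra]) auto
    moreover have "emeasure (K x) (?A \<inter> {w\<in>space W2. pos u w \<in> C}) =
        (\<integral>\<^sup>+y. emeasure (Q (u - b) y) C \<partial>law_at (K x) ?A b)" if "x \<in> space M2" for x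
      using Markov_law_at[OF sets[OF that] M[OF that] b A, of C] insert.prems by simp
    ultimately show ?case by (subst measurable_cong) auto
  qed
  fix X assume "X \<in> cyls"
  then obtain J B where X: "X = cyl J B" "finite J" "J \<subseteq> {0..}" "\<And>t. B t \<in> sets M2"
    by (auto simp: cyls_def)
  obtain u where u: "0 \<le> u" "\<forall>t\<in>J. t \<le> u" "\<And>B. cyl J B = cyl J B \<inter> {w\<in>space W2. pos u w \<in> space M2}"
    using cyl_top[OF X(3,2)] by blast
  have "(\<lambda>x. emeasure (K x) (cyl J B \<inter> {w\<in>space W2. pos u w \<in> space M2})) \<in> borel_measurable M2"
    by (rule *[OF X(2,3) u(2,1)]) (use X(4) in auto)
  then show "(\<lambda>x. emeasure (K x) X) \<in> borel_measurable M2"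
    unfolding X(1) u(3)[symmetric] .
qed

text \<open>A measure with the Markov property is a mixture of the Markov laws over its initial
  distribution, since the mixture has the Markov property as well.\<close>

lemma Markov_disintegration:
  assumes K: "\<And>x. x \<in> space M2 \<Longrightarrow> is_Markov_law \<delta> 2 Q x (K x)"
    and \<mu>: "finite_measure \<mu>" "sets \<mu> = sets W2" "Markov \<mu>"
    and h [measurable]: "h \<in> borel_measurable W2"
  shows "(\<integral>\<^sup>+w. h w \<partial>\<mu>) = (\<integral>\<^sup>+w. (\<integral>\<^sup>+v. h v \<partial>K (pos 0 w)) \<partial>\<mu>)"
proof -
  have [measurable_cong]: "sets \<mu> = sets W2" by fact
  have sp: "space \<mu> = space W2" by (rule sets_eq_imp_space_eq) fact
  have [measurable]: "pos 0 \<in> \<mu> \<rightarrow>\<^sub>M M2" by measurable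
  have KM [measurable]: "K \<in> M2 \<rightarrow>\<^sub>M subprob_algebra W2"
    by (rule measurable_prob_algebraD[OF Markov_kernel[OF K]])
  define N where "N = distr \<mu> M2 (pos 0)"
  have N [measurable_cong]: "sets N = sets M2" and spN: "space N = space M2" by (auto simp: N_def)
  have KN: "K \<in> N \<rightarrow>\<^sub>M subprob_algebra W2" by measurable
  define \<nu> where "\<nu> = N \<bind> K"
  have ne: "space N \<noteq> {}" by (simp add: N_def space_M2_nonempty)
  have \<nu>: "sets \<nu> = sets W2" unfolding \<nu>_def by (rule sets_bind[OF sets_kernel[OF KN] ne])
  have sp\<nu>: "space \<nu> = space W2" by (rule sets_eq_imp_space_eq[OF \<nu>])
  have em: "emeasure \<nu> X = (\<integral>\<^sup>+x. emeasure (K x) X \<partial>N)" if "X \<in> sets W2" for X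
    unfolding \<nu>_def by (rule emeasure_bind[OF ne KN that])
  have "\<mu> = \<nu>"
  proof (rule Markov_unique[OF \<mu>(2) \<nu> \<mu>(3) _ _ \<mu>(1)])
    show "Markov \<nu>"
      unfolding Markov_def
    proof (intro allI impI ballI)
      fix s t :: real and A B assume st: "0 \<le> s" "0 \<le> t" and A: "A \<in> past_events \<delta> 2 s" and B: "B \<in> sets M2"
      have A' [measurable]: "A \<in> sets W2" using A past_events_sets by auto
      have X: "A \<inter> {w\<in>space W2. pos (s + t) w \<in> B} \<in> sets W2"
        using B by measurable
      have Qm [measurable]: "(\<lambda>w. emeasure (Q t (pos s w)) B) \<in> borel_measurable W2"
        by (rule measurable_compose[OF pos_measurable Q_measurable[OF st(2) B]])
      have "emeasure \<nu> (A \<inter> {w\<in>space \<nu>. pos (s + t) w \<in> B}) =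
          (\<integral>\<^sup>+x. emeasure (K x) (A \<inter> {w\<in>space W2. pos (s + t) w \<in> B}) \<partial>N)"
        unfolding sp\<nu> by (rule em[OF X])
      also have "\<dots> = (\<integral>\<^sup>+x. (\<integral>\<^sup>+w\<in>A. emeasure (Q t (pos s w)) B \<partial>K x) \<partial>N)"
      proof (rule nn_integral_cong)
        fix x assume "x \<in> space N"
        then have x: "x \<in> space M2" by (simp add: spN)
        have "space (K x) = space W2" using K[OF x] by (intro sets_eq_imp_space_eq) (simp add: is_Markov_law_iff)
        then show "emeasure (K x) (A \<inter> {w\<in>space W2. pos (s + t) w \<in> B}) = (\<integral>\<^sup>+w\<in>A. emeasure (Q t (pos s w)) B \<partial>K x)"
          using K[OF x] st A B by (simp add: is_Markov_law_iff Markov_def)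
      qed
      also have "\<dots> = (\<integral>\<^sup>+w\<in>A. emeasure (Q t (pos s w)) B \<partial>\<nu>)"
        unfolding \<nu>_def by (rule nn_integral_bind[OF _ KN, symmetric]) measurable
      finally show "emeasure \<nu> (A \<inter> {w\<in>space \<nu>. pos (s + t) w \<in> B}) = (\<integral>\<^sup>+w\<in>A. emeasure (Q t (pos s w)) B \<partial>\<nu>)" .
    qed
    fix C assume C [measurable]: "C \<in> sets M2"
    have "emeasure \<nu> {w\<in>space W2. pos 0 w \<in> C} = (\<integral>\<^sup>+x. emeasure (K x) {w\<in>space W2. pos 0 w \<in> C} \<partial>N)"
      by (rule em) measurable
    also have "\<dots> = (\<integral>\<^sup>+x. indicator C x \<partial>N)"
      by (rule nn_integral_cong) (use is_Markov_law_init[OF K C] in \<open>simp add: spN\<close>)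
    also have "\<dots> = emeasure N C" by (simp add: N)
    also have "\<dots> = emeasure \<mu> {w\<in>space W2. pos 0 w \<in> C}"
      unfolding N_def by (subst emeasure_distr) (auto simp: sp intro!: arg_cong[where f="emeasure \<mu>"])
    finally show "emeasure \<mu> {w\<in>space W2. pos 0 w \<in> C} = emeasure \<nu> {w\<in>space W2. pos 0 w \<in> C}" ..
  qed
  then have "(\<integral>\<^sup>+w. h w \<partial>\<mu>) = (\<integral>\<^sup>+w. h w \<partial>(N \<bind> K))" by (simp add: \<nu>_def)
  also have "\<dots> = (\<integral>\<^sup>+x. (\<integral>\<^sup>+v. h v \<partial>K x) \<partial>N)"
    by (rule nn_integral_bind[OF h KN])
  also have "\<dots> = (\<integral>\<^sup>+w. (\<integral>\<^sup>+v. h v \<partial>K (pos 0 w)) \<partial>\<mu>)"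
    unfolding N_def by (subst nn_integral_distr) (auto intro!: measurable_compose[OF KM nn_integral_measurable_subprob_algebra])
  finally show ?thesis .
qed

end

section \<open>Continuous versions of the one-point motions\<close>

lemma C0_bounded:
  assumes "f \<in> C0 (euclidean :: 'a::metric_space topology)"
  obtains B where "\<And>x. \<bar>f x\<bar> \<le> B"
proof -
  have f: "continuous_on UNIV f" and v: "vanishes_at_infinity euclidean f"
    using assms by (auto simp: C0_def)
  obtain K where K: "compact K" "\<And>x. x \<notin> K \<Longrightarrow> \<bar>f x\<bar> < 1"
    using v[unfolded vanishes_at_infinity_def, rule_format, of 1] by auto
  have "compact (f ` K)" using continuous_on_subset[OF f] K(1) by (intro compact_continuous_image) auto
  then obtain B where B: "\<And>x. x \<in> K \<Longrightarrow> \<bar>f x\<bar> \<le> B"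
    using compact_imp_bounded[of "f ` K"] by (auto simp: bounded_iff)
  have "\<bar>f x\<bar> \<le> max B 1" for x
    using K(2)[of x] B[of x] by (cases "x \<in> K") auto
  then show thesis by (rule that)
qed

text \<open>Small bumps around a countable dense set form a countable family in \<open>C0\<close>
  that detects convergence; their supports are bounded, hence relatively compact.\<close>

definition bump :: "'m::metric_space \<Rightarrow> real \<Rightarrow> 'm \<Rightarrow> real" where
  "bump c r x = max 0 (r - dist x c)"

lemma bump_C0: "bump (c :: 'm::heine_borel) r \<in> C0 euclidean"
proof -
  have "continuous_on UNIV (bump c r)"
    unfolding bump_def[abs_def] by (intro continuous_intros)
  moreover have "vanishes_at_infinity euclidean (bump c r)"
    unfolding vanishes_at_infinity_def
  proof (intro allI impI)
    fix e :: real assume "e > 0"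
    then show "\<exists>K. compactin euclidean K \<and> (\<forall>x\<in>topspace euclidean - K. \<bar>bump c r x\<bar> < e)"
      by (intro exI[of _ "cball c r"]) (auto simp: bump_def dist_commute)
  qed
  ultimately show ?thesis by (simp add: C0_def)
qed

text \<open>The filter \<open>at a within S\<close> leaves out a, while the sequence may take this
  value; that the limit is g a covers this case.\<close>

lemma continuous_within_tendsto_0:
  fixes g :: "'a::t2_space \<Rightarrow> 'b::topological_space"
  assumes "(g \<longlongrightarrow> g a) (at a within S)" "\<And>n. X n \<in> S" "X \<longlonglongrightarrow> a"
  shows "(\<lambda>n. g (X n)) \<longlonglongrightarrow> g a"
  using assms by (intro continuous_within_tendsto_compose'[of a S g X]) (auto simp: continuous_within)

text \<open>Convergence in mean gives almost sure convergence along a subsequence for each k; the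
  diagonal sequence is, up to finitely many terms, a subsequence of each of these.\<close>

lemma (in prob_space) diagonal_AE_subseq:
  fixes u :: "nat \<Rightarrow> nat \<Rightarrow> 'a \<Rightarrow> real"
  assumes int: "\<And>k n. integrable M (u k n)"
    and lim: "\<And>k. (\<lambda>n. \<integral>x. norm (u k n x) \<partial>M) \<longlonglongrightarrow> 0"
  obtains r where "strict_mono r" "AE x in M. \<forall>k. (\<lambda>n. u k (r n) x) \<longlonglongrightarrow> 0"
proof -
  interpret subseqs "\<lambda>k s. AE x in M. (\<lambda>n. u k (s n) x) \<longlonglongrightarrow> 0"
  proof
    fix k and s :: "nat \<Rightarrow> nat" assume s: "strict_mono s"
    have "(\<lambda>n. \<integral>x. norm (u k (s n) x) \<partial>M) \<longlonglongrightarrow> 0"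
      using LIMSEQ_subseq_LIMSEQ[OF lim s] by (simp add: o_def)
    from tendsto_L1_AE_subseq[OF int this]
    show "\<exists>r'. strict_mono r' \<and> (AE x in M. (\<lambda>n. u k ((s \<circ> r') n) x) \<longlonglongrightarrow> 0)" by simp
  qed
  have "AE x in M. (\<lambda>n. u k (diagseq n) x) \<longlonglongrightarrow> 0" for k
  proof -
    have "AE x in M. (\<lambda>n. u k ((diagseq \<circ> (+) (Suc k)) n) x) \<longlonglongrightarrow> 0"
    proof (rule diagseq_holds)
      fix r s :: "nat \<Rightarrow> nat" and n assume r: "strict_mono r" and *: "AE x in M. (\<lambda>m. u n (s m) x) \<longlonglongrightarrow> 0"
      from * show "AE x in M. (\<lambda>m. u n ((s \<circ> r) m) x) \<longlonglongrightarrow> 0"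
      proof eventually_elim
        case (elim x)
        from LIMSEQ_subseq_LIMSEQ[OF this r] show ?case by (simp add: o_def)
      qed
    qed
    then show ?thesis
    proof eventually_elim
      case (elim x)
      then have "(\<lambda>n. u k (diagseq (n + Suc k)) x) \<longlonglongrightarrow> 0" by (simp add: add.commute)
      then show ?case by (rule LIMSEQ_offset)
    qed
  qed
  then have "AE x in M. \<forall>k. (\<lambda>n. u k (diagseq n) x) \<longlonglongrightarrow> 0" by (simp add: AE_all_countable)
  with subseq_diagseq show thesis by (rule that)
qed

context path_space
begin

text \<open>Some dense point c is within 1 / Suc j of x, so its bump is positive at x and eventually
  at X n, which puts X n within 2 / Suc j of x.\<close>

lemma tendsto_bump:
  assumes "\<And>c j. c \<in> dense_pts \<Longrightarrow> (\<lambda>n. bump c (1 / Suc j) (X n)) \<longlonglongrightarrow> bump c (1 / Suc j) x"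
  shows "X \<longlonglongrightarrow> x"
proof (rule metric_LIMSEQ_I)
  fix e :: real assume e: "e > 0"
  then obtain j where j: "1 / real (Suc j) < e / 2" using nat_approx_posE[of "e / 2"] by auto
  obtain c where c: "c \<in> dense_pts" "c \<in> ball x (1 / Suc j)"
    using dense_pts(2)[of "ball x (1 / Suc j)"] by auto
  have "bump c (1 / Suc j) x > 0" using c(2) by (simp add: bump_def)
  from order_tendstoD(1)[OF assms[OF c(1)] this]
  obtain N where "\<And>n. n \<ge> N \<Longrightarrow> bump c (1 / Suc j) (X n) > 0" by (auto simp: eventually_sequentially)
  then have "dist (X n) c < 1 / Suc j" if "n \<ge> N" for n
    using that by (fastforce simp: bump_def)
  moreover have "dist c x < 1 / Suc j" using c(2) by (simp add: dist_commute)
  ultimately have "dist (X n) x < e" if "n \<ge> N" for n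
    using that dist_triangle[of "X n" x c] j by fastforce
  then show "\<exists>N. \<forall>n\<ge>N. dist (X n) x < e" by blast
qed

end

section \<open>Mean square continuity of the flow and almost sure subsequences\<close>

locale flow_setting = path_space \<delta> + prob_space Pr
  for \<delta> :: "(real \<Rightarrow> 'm::{heine_borel, polish_space}) \<Rightarrow> (real \<Rightarrow> 'm) \<Rightarrow> real"
    and Pr :: "'w measure" +
  fixes P :: "nat \<Rightarrow> real \<Rightarrow> (nat \<Rightarrow> 'm) \<Rightarrow> (nat \<Rightarrow> 'm) measure"
    and \<psi> :: "real \<Rightarrow> real \<Rightarrow> 'w \<Rightarrow> 'm \<Rightarrow> 'm"
    and D :: "nat \<Rightarrow> real \<times> 'm"
    and \<Phi> :: "'w \<Rightarrow> nat \<Rightarrow> 'm path"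
  assumes transition: "consistent_coalescing_Feller P"
    and flow: "stochastic_flow Pr P \<psi>"
    and dense: "closure (range D) = UNIV"
    and \<Phi>: "continuous_modifications Pr \<psi> D \<Phi>"
    and skel: "AE \<omega> in Pr. skeleton \<delta> (\<Phi> \<omega>)"
begin

lemma psi_maps: "s \<le> t \<Longrightarrow> \<psi> s t \<in> Pr \<rightarrow>\<^sub>M maps_measure"
  using flow by (simp add: stochastic_flow_def)

lemma eval_maps_measurable: "(\<lambda>f. f x) \<in> (maps_measure :: ('m \<Rightarrow> 'm) measure) \<rightarrow>\<^sub>M borel"
  unfolding maps_measure_def by (intro measurable_restrict_space1 measurable_component_singleton) simp

lemma psi_measurable: "s \<le> t \<Longrightarrow> (\<lambda>\<omega>. \<psi> s t \<omega> x) \<in> borel_measurable Pr"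
  by (rule measurable_compose[OF psi_maps eval_maps_measurable])

lemma psi_start: "\<omega> \<in> space Pr \<Longrightarrow> \<psi> s s \<omega> x = x"
  using flow unfolding stochastic_flow_def SF2_def by blast

lemma C0_borel: "f \<in> C0 euclidean \<Longrightarrow> f \<in> borel_measurable borel"
  by (rule borel_measurable_continuous_onI) (simp add: C0_def)

lemma square_integrable:
  fixes f :: "'m \<Rightarrow> real"
  assumes f: "f \<in> C0 euclidean" and [measurable]: "X \<in> borel_measurable Pr" "Y \<in> borel_measurable Pr"
  shows "integrable Pr (\<lambda>\<omega>. (f (X \<omega>) - f (Y \<omega>))\<^sup>2)"
proof -
  obtain B where B: "\<And>x. \<bar>f x\<bar> \<le> B" using C0_bounded[OF f] by blast
  note [measurable] = C0_borel[OF f]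
  have "(f x - f y)\<^sup>2 \<le> (2 * B)\<^sup>2" for x y
    by (rule abs_le_square_iff[THEN iffD1]) (use B[of x] B[of y] in linarith)
  then show ?thesis by (intro integrable_const_bound[of _ "(2 * B)\<^sup>2"]) auto
qed

lemma square_integral_le:
  fixes f :: "'m \<Rightarrow> real"
  assumes f: "f \<in> C0 euclidean" and B: "\<And>x. \<bar>f x\<bar> \<le> B"
    and X: "X \<in> borel_measurable Pr" and Y: "Y \<in> borel_measurable Pr"
  shows "(\<integral>\<omega>. (f (X \<omega>) - f (Y \<omega>))\<^sup>2 \<partial>Pr) \<le> (2 * B)\<^sup>2"
proof -
  have "(f x - f y)\<^sup>2 \<le> (2 * B)\<^sup>2" for x y
    by (rule abs_le_square_iff[THEN iffD1]) (use B[of x] B[of y] in linarith)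
  then have "(\<integral>\<omega>. (f (X \<omega>) - f (Y \<omega>))\<^sup>2 \<partial>Pr) \<le> (\<integral>\<omega>. (2 * B)\<^sup>2 \<partial>Pr)"
    by (intro integral_mono square_integrable[OF f X Y]) auto
  then show ?thesis by (simp add: prob_space)
qed

text \<open>(SF4) is uniform in the starting point and can therefore be used at the moving points b
  n; (SF5) then moves b n to y at fixed times.\<close>

lemma flow_L2_limit:
  assumes f: "f \<in> C0 euclidean" and st: "s \<le> t" and a: "\<And>n. a n \<le> s" "a \<longlonglongrightarrow> s" and b: "b \<longlonglongrightarrow> y"
  shows "(\<lambda>n. \<integral>\<omega>. (f (\<psi> (a n) t \<omega> (b n)) - f (\<psi> s t \<omega> y))\<^sup>2 \<partial>Pr) \<longlonglongrightarrow> 0"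
proof -
  obtain B where B: "\<And>x. \<bar>f x\<bar> \<le> B" using C0_bounded[OF f] by blast
  have at: "a n \<le> t" for n using a(1)[of n] st by simp
  define g where "g = (\<lambda>(u, v). SUP x. \<integral>\<omega>. (f (\<psi> u v \<omega> x) - f (\<psi> s t \<omega> x))\<^sup>2 \<partial>Pr)"
  have "(g \<longlongrightarrow> g (s, t)) (at (s, t) within {(u, v). u \<le> v})"
    using flow f st unfolding stochastic_flow_def SF4_def by (simp add: g_def)
  then have "(\<lambda>n. g (a n, t)) \<longlonglongrightarrow> g (s, t)"
    by (rule continuous_within_tendsto_0) (use at in simp, rule tendsto_Pair[OF a(2) tendsto_const])
  then have g: "(\<lambda>n. g (a n, t)) \<longlonglongrightarrow> 0" by (simp add: g_def)
  have le_g: "(\<integral>\<omega>. (f (\<psi> (a n) t \<omega> x) - f (\<psi> s t \<omega> x))\<^sup>2 \<partial>Pr) \<le> g (a n, t)" for n x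
    unfolding g_def prod.case
    by (rule cSUP_upper) (auto intro!: bdd_aboveI2[of _ _ "(2 * B)\<^sup>2"] square_integral_le f B psi_measurable at st)
  define h where "h = (\<lambda>x. \<integral>\<omega>. (f (\<psi> s t \<omega> x) - f (\<psi> s t \<omega> y))\<^sup>2 \<partial>Pr)"
  have "(h \<longlongrightarrow> h y) (at y within UNIV)"
    using flow f st unfolding stochastic_flow_def SF5_def by (simp add: h_def)
  from continuous_within_tendsto_0[OF this _ b]
  have h: "(\<lambda>n. h (b n)) \<longlonglongrightarrow> 0" by (simp add: h_def)
  have "(\<integral>\<omega>. (f (\<psi> (a n) t \<omega> (b n)) - f (\<psi> s t \<omega> y))\<^sup>2 \<partial>Pr) \<le> 2 * g (a n, t) + 2 * h (b n)" for n
  proof -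
    have "(\<integral>\<omega>. (f (\<psi> (a n) t \<omega> (b n)) - f (\<psi> s t \<omega> y))\<^sup>2 \<partial>Pr) \<le>
      (\<integral>\<omega>. 2 * (f (\<psi> (a n) t \<omega> (b n)) - f (\<psi> s t \<omega> (b n)))\<^sup>2 + 2 * (f (\<psi> s t \<omega> (b n)) - f (\<psi> s t \<omega> y))\<^sup>2 \<partial>Pr)"
    proof (rule integral_mono)
      fix \<omega>
      have "(A - C)\<^sup>2 \<le> 2 * (A - B)\<^sup>2 + 2 * (B - C)\<^sup>2" for A B C :: real
        using zero_le_power2[of "(A - B) - (B - C)"] by (simp add: power2_eq_square algebra_simps)
      then show "(f (\<psi> (a n) t \<omega> (b n)) - f (\<psi> s t \<omega> y))\<^sup>2 \<le>
        2 * (f (\<psi> (a n) t \<omega> (b n)) - f (\<psi> s t \<omega> (b n)))\<^sup>2 + 2 * (f (\<psi> s t \<omega> (b n)) - f (\<psi> s t \<omega> y))\<^sup>2" .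
    qed (auto intro!: square_integrable f psi_measurable at st Bochner_Integration.integrable_add integrable_mult_right)
    also have "\<dots> = 2 * (\<integral>\<omega>. (f (\<psi> (a n) t \<omega> (b n)) - f (\<psi> s t \<omega> (b n)))\<^sup>2 \<partial>Pr) + 2 * h (b n)"
      unfolding h_def
      by (subst Bochner_Integration.integral_add)
        (auto intro!: square_integrable f psi_measurable at st integrable_mult_right)
    finally show ?thesis using le_g[of n "b n"] by simp
  qed
  then have upper: "\<forall>\<^sub>F n in sequentially. (\<integral>\<omega>. (f (\<psi> (a n) t \<omega> (b n)) - f (\<psi> s t \<omega> y))\<^sup>2 \<partial>Pr) \<le> 2 * g (a n, t) + 2 * h (b n)"
    by (intro always_eventually allI)
  have lower: "\<forall>\<^sub>F n in sequentially. 0 \<le> (\<integral>\<omega>. (f (\<psi> (a n) t \<omega> (b n)) - f (\<psi> s t \<omega> y))\<^sup>2 \<partial>Pr)"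
    by (intro always_eventually allI Bochner_Integration.integral_nonneg zero_le_power2)
  have "(\<lambda>n. 2 * g (a n, t) + 2 * h (b n)) \<longlonglongrightarrow> 0"
    using tendsto_add[OF tendsto_mult_right_zero[OF g, of 2] tendsto_mult_right_zero[OF h, of 2]] by simp
  from tendsto_sandwich[OF lower upper tendsto_const this] show ?thesis .
qed

text \<open>Mean square convergence is applied to countably many bumps and times, and a diagonal
  sequence serves all of them at once.\<close>

lemma flow_AE_subseq:
  fixes T :: "nat \<Rightarrow> real"
  assumes T: "\<And>i. s \<le> T i" and a: "\<And>n. a n \<le> s" "a \<longlonglongrightarrow> s" and b: "b \<longlonglongrightarrow> y"
  obtains r where "strict_mono r"
    "AE \<omega> in Pr. \<forall>i. (\<lambda>n. \<psi> (a (r n)) (T i) \<omega> (b (r n))) \<longlonglongrightarrow> \<psi> s (T i) \<omega> y"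
proof -
  have ne: "dense_pts \<noteq> ({} :: 'm set)" using dense_pts(2)[of "UNIV :: 'm set"] by auto
  define c where "c = from_nat_into (dense_pts :: 'm set)"
  have c: "range c = dense_pts" unfolding c_def by (rule range_from_nat_into[OF ne dense_pts(1)])
  \<comment> \<open>\<open>f\<close> enumerates the bumps by coding centre and radius; in
    \<open>u\<close> a further code adds the time.\<close>
  define f where "f = (\<lambda>k. bump (c (fst (prod_decode k))) (1 / Suc (snd (prod_decode k))))"
  define u where "u = (\<lambda>k n \<omega>. (f (fst (prod_decode k)) (\<psi> (a n) (T (snd (prod_decode k))) \<omega> (b n)) -
      f (fst (prod_decode k)) (\<psi> s (T (snd (prod_decode k))) \<omega> y))\<^sup>2)"
  have f: "f k \<in> C0 euclidean" for k unfolding f_def by (rule bump_C0)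
  have aT: "a n \<le> T i" for n i using a(1)[of n] T[of i] by simp
  have int: "integrable Pr (u k n)" for k n
    unfolding u_def by (intro square_integrable f psi_measurable aT T)
  have lim: "(\<lambda>n. \<integral>\<omega>. norm (u k n \<omega>) \<partial>Pr) \<longlonglongrightarrow> 0" for k
    using flow_L2_limit[OF f T a b] by (simp add: u_def)
  obtain r where r: "strict_mono r" "AE \<omega> in Pr. \<forall>k. (\<lambda>n. u k (r n) \<omega>) \<longlonglongrightarrow> 0"
    by (rule diagonal_AE_subseq[OF int lim])
  from r(2) have "AE \<omega> in Pr. \<forall>i. (\<lambda>n. \<psi> (a (r n)) (T i) \<omega> (b (r n))) \<longlonglongrightarrow> \<psi> s (T i) \<omega> y"
  proof eventually_elim
    case (elim \<omega>)
    show ?case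
    proof (intro allI tendsto_bump)
      fix i j and d :: 'm assume "d \<in> dense_pts"
      then obtain l where l: "d = c l" using c by auto
      have "(\<lambda>n. (bump d (1 / Suc j) (\<psi> (a (r n)) (T i) \<omega> (b (r n))) - bump d (1 / Suc j) (\<psi> s (T i) \<omega> y))\<^sup>2) \<longlonglongrightarrow> 0"
        using elim[rule_format, of "prod_encode (prod_encode (l, j), i)"] by (simp add: u_def f_def l)
      then have "(\<lambda>n. bump d (1 / Suc j) (\<psi> (a (r n)) (T i) \<omega> (b (r n))) - bump d (1 / Suc j) (\<psi> s (T i) \<omega> y)) \<longlonglongrightarrow> 0"
        using tendsto_real_sqrt[of _ 0] by (fastforce simp: tendsto_rabs_zero_iff)
      then show "(\<lambda>n. bump d (1 / Suc j) (\<psi> (a (r n)) (T i) \<omega> (b (r n)))) \<longlonglongrightarrow> bump d (1 / Suc j) (\<psi> s (T i) \<omega> y)"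
        by (simp add: LIM_zero_iff)
    qed
  qed
  with r(1) show thesis by (rule that)
qed

lemma Phi_paths: "\<omega> \<in> space Pr \<Longrightarrow> \<Phi> \<omega> n \<in> paths_from (fst (D n))"
  and Phi_start: "\<omega> \<in> space Pr \<Longrightarrow> snd (\<Phi> \<omega> n) (fst (D n)) = snd (D n)"
  using \<Phi> unfolding continuous_modifications_def by blast+

lemma Phi_AE: "fst (D n) \<le> t \<Longrightarrow> AE \<omega> in Pr. snd (\<Phi> \<omega> n) t = \<psi> (fst (D n)) t \<omega> (snd (D n))"
  using \<Phi> unfolding continuous_modifications_def by blast

lemma Phi_measurable: "(\<lambda>\<omega>. snd (\<Phi> \<omega> n) t) \<in> borel_measurable Pr"
proof (cases "fst (D n) \<le> t")
  case True
  then show ?thesis using \<Phi> unfolding continuous_modifications_def by blast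
next
  case False
  have "snd (\<Phi> \<omega> n) t = snd (D n)" if "\<omega> \<in> space Pr" for \<omega>
    using paths_before[of "\<Phi> \<omega> n" t] Phi_paths[OF that, of n] Phi_start[OF that, of n] False
    by (simp add: paths_from_def)
  then show ?thesis by (subst measurable_cong[where g="\<lambda>_. snd (D n)"]) auto
qed

section \<open>Continuous versions started at arbitrary points\<close>

definition version :: "real \<Rightarrow> 'm \<Rightarrow> ('w \<Rightarrow> 'm path) \<Rightarrow> bool" where
  "version s y Z \<longleftrightarrow> (\<forall>\<omega>\<in>space Pr. Z \<omega> \<in> paths_from s \<and> snd (Z \<omega>) s = y) \<and>
     (\<forall>t. (\<lambda>\<omega>. snd (Z \<omega>) t) \<in> borel_measurable Pr) \<and> (\<forall>t\<ge>s. AE \<omega> in Pr. snd (Z \<omega>) t = \<psi> s t \<omega> y)"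

lemma version_Phi: "version (fst (D n)) (snd (D n)) (\<lambda>\<omega>. \<Phi> \<omega> n)"
  unfolding version_def using Phi_paths Phi_start Phi_measurable Phi_AE by blast

lemma versionD:
  assumes "version s y Z"
  shows "\<omega> \<in> space Pr \<Longrightarrow> Z \<omega> \<in> paths_from s" "\<omega> \<in> space Pr \<Longrightarrow> snd (Z \<omega>) s = y"
    "(\<lambda>\<omega>. snd (Z \<omega>) t) \<in> borel_measurable Pr" "s \<le> t \<Longrightarrow> AE \<omega> in Pr. snd (Z \<omega>) t = \<psi> s t \<omega> y"
  using assms unfolding version_def by blast+

lemma version_path_measurable:
  assumes "version s y Z"
  shows "Z \<in> Pr \<rightarrow>\<^sub>M path_measure \<delta>"
proof (rule measurable_pathI)
  show "Z \<omega> \<in> paths" if "\<omega> \<in> space Pr" for \<omega> using versionD(1)[OF assms that] by (rule paths_fromD)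
  show "(\<lambda>\<omega>. fst (Z \<omega>)) \<in> borel_measurable Pr"
    by (subst measurable_cong[where g="\<lambda>_. s"]) (use versionD(1)[OF assms] paths_fromD(2) in blast, simp)
qed (rule versionD(3)[OF assms])

text \<open>The start times approach s from the left, so that the approximating skeleton paths are
  already running at s.\<close>

lemma dense_sequence:
  "\<exists>n. (\<forall>j. fst (D (n j)) \<le> s) \<and> (\<lambda>j. fst (D (n j))) \<longlonglongrightarrow> s \<and> (\<lambda>j. snd (D (n j))) \<longlonglongrightarrow> y"
proof -
  have "\<exists>n. s - 1 / Suc j < fst (D n) \<and> fst (D n) < s \<and> dist y (snd (D n)) < 1 / Suc j" for j
  proof -
    let ?U = "{s - 1 / Suc j<..<s} \<times> ball y (1 / Suc j)"
    have "open ?U" by (intro open_Times) auto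
    then have "?U \<inter> closure (range D) = {} \<longleftrightarrow> ?U \<inter> range D = {}" by (rule open_Int_closure_eq_empty)
    moreover have "(s - 1 / (2 * Suc j), y) \<in> ?U" by (auto simp: field_simps)
    ultimately have "?U \<inter> range D \<noteq> {}" using dense by auto
    then obtain p where "p \<in> ?U \<inter> range D" by (meson ex_in_conv)
    then obtain n where "D n \<in> ?U" by (elim IntE rangeE) simp
    then show ?thesis by (intro exI[of _ n]) (auto simp: mem_Times_iff)
  qed
  then obtain n where n: "\<And>j. s - 1 / Suc j < fst (D (n j))" "\<And>j. fst (D (n j)) < s"
    "\<And>j. dist y (snd (D (n j))) < 1 / Suc j" by metis
  have inv: "(\<lambda>j. 1 / real (Suc j)) \<longlonglongrightarrow> 0" using LIMSEQ_Suc[OF lim_const_over_n[of 1]] by simp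
  have "(\<lambda>j. fst (D (n j))) \<longlonglongrightarrow> s"
  proof (rule metric_tendsto_imp_tendsto[OF inv], intro always_eventually allI)
    fix j show "dist (fst (D (n j))) s \<le> dist (1 / real (Suc j)) 0"
      using n(1)[of j] n(2)[of j] by (simp add: dist_real_def)
  qed
  moreover have "(\<lambda>j. snd (D (n j))) \<longlonglongrightarrow> y"
  proof (rule metric_tendsto_imp_tendsto[OF inv], intro always_eventually allI)
    fix j show "dist (snd (D (n j))) y \<le> dist (1 / real (Suc j)) 0"
      using n(3)[of j] by (simp add: dist_commute)
  qed
  ultimately show ?thesis using n(2) by (intro exI[of _ n]) (auto intro: less_imp_le)
qed

text \<open>A version started at (s, y) is the limit of tails of skeleton paths that start near (s,
  y). Mean square continuity gives convergence at rational times along a subsequence, and the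
  relative compactness in the definition of a skeleton upgrades it to convergence of paths. The
  second conjunct keeps the version in a set that is compact for almost every \<omega>; limits of
  versions rely on it.\<close>

lemma ex_version:
  "\<exists>Z. version s y Z \<and>
     (AE \<omega> in Pr. Z \<omega> \<in> path_topology \<delta> closure_of skeleton_tails (\<Phi> \<omega>) ({s} \<times> cball y 1))"
proof -
  obtain n where n': "\<forall>j. fst (D (n j)) \<le> s" and n: "(\<lambda>j. fst (D (n j))) \<longlonglongrightarrow> s" "(\<lambda>j. snd (D (n j))) \<longlonglongrightarrow> y"
    using dense_sequence[of s y] by (elim exE conjE)
  note n = n'[rule_format] n
  \<comment> \<open>The time s is added to identify the starting value of the limit.\<close>
  define S where "S = insert s {q\<in>\<rat>. s < q}"
  have "countable {q\<in>\<rat>. s < q}" by (rule countable_subset[OF _ countable_rat]) auto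
  then have S: "countable S" "S \<noteq> {}" by (auto simp: S_def)
  define T where "T = from_nat_into S"
  have T: "range T = S" unfolding T_def by (rule range_from_nat_into[OF S(2,1)])
  then have Ts: "s \<le> T i" for i using rangeI[of T i] by (auto simp: S_def)
  obtain r where r: "strict_mono r"
    "AE \<omega> in Pr. \<forall>i. (\<lambda>j. \<psi> (fst (D (n (r j)))) (T i) \<omega> (snd (D (n (r j))))) \<longlonglongrightarrow> \<psi> s (T i) \<omega> y"
    using flow_AE_subseq[of s T "\<lambda>j. fst (D (n j))" "\<lambda>j. snd (D (n j))" y, OF Ts n] .
  define G where "G = (\<lambda>j \<omega>. path_tail s (\<Phi> \<omega> (n (r j))))"
  have Gfrom: "G j \<omega> \<in> paths_from s" if "\<omega> \<in> space Pr" for j \<omega>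
    unfolding G_def using Phi_paths[OF that] by (intro path_tail_paths paths_fromD(1))
  have Gt: "snd (G j \<omega>) t = snd (\<Phi> \<omega> (n (r j))) t" if "s \<le> t" for j \<omega> t
    using that by (simp add: G_def)
  have "AE \<omega> in Pr. \<forall>j i. snd (\<Phi> \<omega> (n (r j))) (T i) = \<psi> (fst (D (n (r j)))) (T i) \<omega> (snd (D (n (r j))))"
    unfolding AE_all_countable by (intro allI Phi_AE order_trans[OF n(1) Ts])
  with r(2) have conv: "AE \<omega> in Pr. \<forall>i. (\<lambda>j. snd (G j \<omega>) (T i)) \<longlonglongrightarrow> \<psi> s (T i) \<omega> y"
    by eventually_elim (simp add: Gt[OF Ts])
  define C where "C = (\<lambda>\<omega>. path_topology \<delta> closure_of skeleton_tails (\<Phi> \<omega>) ({s} \<times> cball y 1))"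
  define good where "good = (\<lambda>\<omega> f. f \<in> paths_from s \<and> (\<lambda>j. path_dist \<delta> (G j \<omega>) f) \<longlonglongrightarrow> 0 \<and> snd f s = y \<and> f \<in> C \<omega>)"
  from conv skel AE_space have "AE \<omega> in Pr. \<exists>f. good \<omega> f"
  proof eventually_elim
    case (elim \<omega>)
    have cpt: "compact ({s} \<times> cball y 1)" by (intro compact_Times) auto
    note K = compact_skeleton_tails[OF elim(2) cpt]
    have limq: "(\<lambda>j. snd (G j \<omega>) q) \<longlonglongrightarrow> \<psi> s q \<omega> y" if "q \<in> S" for q
    proof -
      have "q \<in> range T" using that T by simp
      then obtain i where "q = T i" by auto
      with elim(1) show ?thesis by simp
    qed
    have lims: "(\<lambda>j. snd (G j \<omega>) s) \<longlonglongrightarrow> y"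
      using limq[of s] psi_start[OF elim(3)] by (simp add: S_def)
    \<comment> \<open>Only from index J on do the tails start in \<open>cball y 1\<close>.\<close>
    obtain J where J: "\<And>j. j \<ge> J \<Longrightarrow> dist (snd (G j \<omega>) s) y < 1"
      using metric_LIMSEQ_D[OF lims, of 1] by auto
    have inC: "G j \<omega> \<in> C \<omega>" if "j \<ge> J" for j
    proof -
      have "n (r j) \<in> started (\<Phi> \<omega>) s"
        using n(1)[of "r j"] Phi_paths[OF elim(3)] by (simp add: started_def paths_from_def)
      moreover have "(s, snd (\<Phi> \<omega> (n (r j))) s) \<in> {s} \<times> cball y 1"
        using J[OF that] by (simp add: Gt dist_commute)
      ultimately have "G j \<omega> \<in> skeleton_tails (\<Phi> \<omega>) ({s} \<times> cball y 1)"
        unfolding skeleton_tails_def G_def by (intro CollectI exI[of _ s] exI[of _ "n (r j)"] conjI refl)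
      with K(2) show ?thesis by (auto simp: C_def)
    qed
    obtain f where f: "f \<in> paths_from s" "(\<lambda>j. path_dist \<delta> (G (j + J) \<omega>) f) \<longlonglongrightarrow> 0"
    proof (rule compact_pointwise_imp_convergent[OF K(1), of "\<lambda>j. G (j + J) \<omega>" s])
      show "convergent (\<lambda>j. snd (G (j + J) \<omega>) q)" if "q \<in> \<rat>" "s < q" for q
        using LIMSEQ_ignore_initial_segment[OF limq[of q], of J] that
        by (intro convergentI) (simp add: S_def)
      show "G (j + J) \<omega> \<in> path_topology \<delta> closure_of skeleton_tails (\<Phi> \<omega>) ({s} \<times> cball y 1)" for j
        using inC[of "j + J"] by (simp add: C_def)
    qed (use Gfrom[OF elim(3)] in simp_all)
    have lim: "(\<lambda>j. path_dist \<delta> (G j \<omega>) f) \<longlonglongrightarrow> 0" using f(2) by (rule LIMSEQ_offset)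
    have "(\<lambda>j. snd (G j \<omega>) s) \<longlonglongrightarrow> snd f s"
      by (rule path_dist_tendsto_eval[OF _ _ lim]) (use Gfrom[OF elim(3)] f(1) paths_fromD(1) in blast)+
    with lims have "snd f s = y" using LIMSEQ_unique by blast
    moreover have "f \<in> C \<omega>"
    proof (rule limitin_closedin)
      show "limitin (path_topology \<delta>) (\<lambda>j. G j \<omega>) f sequentially"
        unfolding limitin_path_iff using lim f(1) Gfrom[OF elim(3)] paths_fromD(1)
        by (intro conjI always_eventually allI) blast+
      show "closedin (path_topology \<delta>) (C \<omega>)" by (simp add: C_def)
      show "\<forall>\<^sub>F j in sequentially. G j \<omega> \<in> C \<omega>"
        using inC by (auto simp: eventually_sequentially)
    qed simp
    ultimately show ?case using f(1) lim by (intro exI[of _ f]) (simp add: good_def)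
  qed
  then obtain N where N: "{\<omega>\<in>space Pr. \<not> (\<exists>f. good \<omega> f)} \<subseteq> N" "emeasure Pr N = 0" "N \<in> sets Pr"
    by (rule AE_E)
  define E where "E = space Pr - N"
  have E [measurable]: "E \<in> sets Pr" unfolding E_def using N(3) by auto
  have AE_E: "AE \<omega> in Pr. \<omega> \<in> E"
    using AE_not_in[of N Pr] N(2,3) by (auto simp: E_def null_sets_def)
  \<comment> \<open>The choice need not be measurable by itself: on E the path is the limit of the
    measurable \<open>G j\<close>, and off E it is constant.\<close>
  define Z where "Z = (\<lambda>\<omega>. if \<omega> \<in> E then (SOME f. good \<omega> f) else (s, \<lambda>_. y))"
  have ZE: "good \<omega> (Z \<omega>)" if "\<omega> \<in> E" for \<omega>
  proof -
    have "\<exists>f. good \<omega> f" using that N(1) by (auto simp: E_def)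
    from someI_ex[OF this] show ?thesis using that by (simp add: Z_def)
  qed
  have Zfrom: "Z \<omega> \<in> paths_from s" "snd (Z \<omega>) s = y" for \<omega>
    using ZE[of \<omega>] by (auto simp: good_def Z_def paths_from_def paths_def split: if_splits)
  have Zlim: "(\<lambda>j. snd (G j \<omega>) t) \<longlonglongrightarrow> snd (Z \<omega>) t" if "\<omega> \<in> E" for \<omega> t
  proof -
    have "\<omega> \<in> space Pr" using that by (simp add: E_def)
    moreover have "(\<lambda>j. path_dist \<delta> (G j \<omega>) (Z \<omega>)) \<longlonglongrightarrow> 0" using ZE[OF that] by (simp add: good_def)
    ultimately show ?thesis
      using Gfrom Zfrom(1) paths_fromD(1) by (intro path_dist_tendsto_eval) blast+
  qed
  have "version s y Z"
    unfolding version_def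
  proof (intro conjI ballI allI impI)
    show "(\<lambda>\<omega>. snd (Z \<omega>) t) \<in> borel_measurable Pr" for t
    proof (rule borel_measurable_LIMSEQ_metric)
      show "(\<lambda>\<omega>. if \<omega> \<in> E then snd (G j \<omega>) t else y) \<in> borel_measurable Pr" for j
        by (intro measurable_If_set) (auto simp: G_def intro: Phi_measurable)
      show "(\<lambda>j. if \<omega> \<in> E then snd (G j \<omega>) t else y) \<longlonglongrightarrow> snd (Z \<omega>) t" for \<omega>
        using Zlim[of \<omega> t] by (cases "\<omega> \<in> E") (auto simp: Z_def)
    qed
  next
    fix t assume t: "s \<le> t"
    \<comment> \<open>T enumerates only s and the rationals after it; for an arbitrary time t a
      further subsequence is extracted and both limits are compared along it.\<close>
    obtain r' where r': "strict_mono r'"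
      "AE \<omega> in Pr. \<forall>i::nat. (\<lambda>j. \<psi> (fst (D (n (r (r' j))))) t \<omega> (snd (D (n (r (r' j)))))) \<longlonglongrightarrow> \<psi> s t \<omega> y"
    proof (rule flow_AE_subseq[of s "\<lambda>_. t" "\<lambda>j. fst (D (n (r j)))" "\<lambda>j. snd (D (n (r j)))" y])
      show "(\<lambda>j. fst (D (n (r j)))) \<longlonglongrightarrow> s" "(\<lambda>j. snd (D (n (r j)))) \<longlonglongrightarrow> y"
        using LIMSEQ_subseq_LIMSEQ[OF n(2) r(1)] LIMSEQ_subseq_LIMSEQ[OF n(3) r(1)] by (simp_all add: o_def)
    qed (use t n(1) in auto)
    have "AE \<omega> in Pr. \<forall>j. snd (\<Phi> \<omega> (n (r (r' j)))) t = \<psi> (fst (D (n (r (r' j))))) t \<omega> (snd (D (n (r (r' j)))))"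
      unfolding AE_all_countable by (intro allI Phi_AE order_trans[OF n(1) t])
    with r'(2) AE_E show "AE \<omega> in Pr. snd (Z \<omega>) t = \<psi> s t \<omega> y"
    proof eventually_elim
      case (elim \<omega>)
      have "(\<lambda>j. snd (G (r' j) \<omega>) t) \<longlonglongrightarrow> \<psi> s t \<omega> y"
        using elim(1,3) by (simp add: Gt[OF t])
      moreover have "(\<lambda>j. snd (G (r' j) \<omega>) t) \<longlonglongrightarrow> snd (Z \<omega>) t"
        using LIMSEQ_subseq_LIMSEQ[OF Zlim[OF elim(2)] r'(1)] by (simp add: o_def)
      ultimately show ?case using LIMSEQ_unique by blast
    qed
  qed (use Zfrom in auto)
  moreover have "AE \<omega> in Pr. Z \<omega> \<in> C \<omega>"
    using AE_E by eventually_elim (use ZE in \<open>simp add: good_def\<close>)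
  ultimately show ?thesis by (auto simp: C_def)
qed

end

section \<open>The Markov property of pairs of paths of the flow\<close>

lemma measurable_Collect_in:
  assumes "f \<in> M \<rightarrow>\<^sub>M N" "B \<in> sets N"
  shows "{x\<in>space M. f x \<in> B} \<in> sets M"
  using measurable_sets[OF assms] by (simp add: vimage_def Int_def conj_commute)

text \<open>A closed set is the union of its intersections with countably many compact
  balls.\<close>

lemma borel_eq_compact:
  "sets (borel :: 'b::heine_borel measure) = sigma_sets UNIV {C. compact C}"
proof
  have "closed C \<Longrightarrow> C \<in> sigma_sets UNIV {C. compact C}" for C :: "'b set"
  proof -
    assume C: "closed C"
    have "C = (\<Union>n::nat. C \<inter> cball undefined n)"
    proof (intro set_eqI iffI)
      fix x assume "x \<in> C"
      moreover obtain n :: nat where "dist undefined x \<le> n" using real_arch_simple by blast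
      ultimately show "x \<in> (\<Union>n::nat. C \<inter> cball undefined n)" by auto
    qed auto
    also have "\<dots> \<in> sigma_sets UNIV {C. compact C}"
      by (intro sigma_sets.Union sigma_sets.Basic) (use C in \<open>auto intro: closed_Int_compact\<close>)
    finally show ?thesis .
  qed
  then have "Collect closed \<subseteq> sigma_sets UNIV {C. compact (C :: 'b set)}" by auto
  then have "sigma_sets UNIV (Collect closed) \<subseteq> sigma_sets UNIV {C. compact (C :: 'b set)}"
    by (rule sigma_sets_mono)
  then show "sets (borel :: 'b measure) \<subseteq> sigma_sets UNIV {C. compact C}"
    by (simp add: borel_eq_closed)
  show "sigma_sets UNIV {C. compact (C :: 'b set)} \<subseteq> sets borel"
    using sets.sigma_sets_subset[of "{C. compact (C :: 'b set)}" borel]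
    by (auto intro: borel_compact)
qed

text \<open>Indicators of compact sets C are limits of cutoffs that vanish at distance 1 / Suc k
  from C; their support is compact because it is closed and bounded. Compact sets are stable under
  intersection and generate the Borel sets, and closed balls exhaust the space.\<close>

lemma finite_borel_measure_eqI:
  fixes \<mu> \<nu> :: "'b::heine_borel measure"
  assumes fin: "finite_measure \<mu>" "finite_measure \<nu>" and sets: "sets \<mu> = sets borel" "sets \<nu> = sets borel"
    and eq: "\<And>F. continuous_on UNIV F \<Longrightarrow> compact (closure {x. F x \<noteq> 0}) \<Longrightarrow> (\<integral>x. F x \<partial>\<mu>) = (\<integral>x. F x \<partial>\<nu> :: real)"
    and total: "emeasure \<mu> UNIV = emeasure \<nu> UNIV"
  shows "\<mu> = \<nu>"
proof -
  have compact_eq: "emeasure \<mu> C = emeasure \<nu> C" if C: "compact C" for C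
  proof (cases "C = {}")
    case False
    define F where "F = (\<lambda>k x. max 0 (1 - real (Suc k) * infdist x C))"
    have F01: "0 \<le> F k x" "F k x \<le> 1" for k x
      by (auto simp: F_def infdist_nonneg)
    have cont: "continuous_on UNIV (F k)" for k
      unfolding F_def by (intro continuous_intros)
    have supp: "compact (closure {x. F k x \<noteq> 0})" for k
    proof -
      obtain c R where R: "\<And>x. x \<in> C \<Longrightarrow> dist c x \<le> R"
        using compact_imp_bounded[OF C] by (auto simp: bounded_def)
      have "{x. F k x \<noteq> 0} \<subseteq> cball c (R + 1)"
      proof
        fix x assume "x \<in> {x. F k x \<noteq> 0}"
        then have "real (Suc k) * infdist x C < 1" by (auto simp: F_def max_def split: if_splits)
        moreover have "1 * infdist x C \<le> real (Suc k) * infdist x C"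
          by (intro mult_right_mono) (auto simp: infdist_nonneg)
        moreover obtain a where "a \<in> C" "infdist x C = dist x a"
          using infdist_attains_inf[OF compact_imp_closed[OF C] False] by blast
        ultimately show "x \<in> cball c (R + 1)"
          using R[of a] dist_triangle[of c x a] by (simp add: dist_commute)
      qed
      then have "bounded {x. F k x \<noteq> 0}" using bounded_cball bounded_subset by blast
      then show ?thesis by simp
    qed
    have lim: "(\<lambda>k. F k x) \<longlonglongrightarrow> indicator C x" for x
    proof (cases "x \<in> C")
      case False
      then have pos: "infdist x C > 0"
        using infdist_pos_not_in_closed[OF compact_imp_closed[OF C] \<open>C \<noteq> {}\<close>] by blast
      obtain N :: nat where N: "1 / infdist x C \<le> N" using real_arch_simple by blast
      have "F k x = 0" if "k \<ge> N" for k
      proof -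
        have "1 / infdist x C \<le> real (Suc k)" using N that by linarith
        then have "1 \<le> real (Suc k) * infdist x C" using pos by (simp add: field_simps)
        then show ?thesis by (simp add: F_def)
      qed
      then have "\<forall>\<^sub>F k in sequentially. F k x = indicator C x"
        using False by (auto simp: eventually_sequentially)
      then show ?thesis by (rule tendsto_eventually)
    qed (simp add: F_def)
    have "(\<lambda>k. \<integral>x. F k x \<partial>\<kappa>) \<longlonglongrightarrow> measure \<kappa> C"
      if "finite_measure \<kappa>" and s: "sets \<kappa> = sets borel" for \<kappa>
    proof -
      interpret finite_measure \<kappa> by fact
      have [measurable_cong]: "sets \<kappa> = sets borel" by fact
      have "C \<in> sets \<kappa>" using C s by (simp add: borel_compact)
      have "(\<lambda>k. \<integral>x. F k x \<partial>\<kappa>) \<longlonglongrightarrow> (\<integral>x. indicator C x \<partial>\<kappa>)"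
      proof (rule integral_dominated_convergence[where w="\<lambda>_. 1"])
        show "F k \<in> borel_measurable \<kappa>" for k
          using borel_measurable_continuous_onI[OF cont] s by (simp cong: measurable_cong_sets)
      qed (use \<open>C \<in> sets \<kappa>\<close> lim F01 in auto)
      then show ?thesis using \<open>C \<in> sets \<kappa>\<close> s by (simp add: sets_eq_imp_space_eq[OF s])
    qed
    from this[OF fin(1) sets(1)] this[OF fin(2) sets(2)] have "measure \<mu> C = measure \<nu> C"
      using eq[OF cont supp] LIMSEQ_unique by force
    then show ?thesis
      using finite_measure.emeasure_eq_measure[OF fin(1)] finite_measure.emeasure_eq_measure[OF fin(2)] by simp
  qed simp
  show ?thesis
  proof (rule measure_eqI_generator_eq[of "{C. compact C}" UNIV _ _ "\<lambda>n. cball undefined (real n)"])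
    show "Int_stable {C::'b set. compact C}" by (auto intro!: Int_stableI compact_Int)
    show "(\<Union>n::nat. cball undefined (real n)) = (UNIV :: 'b set)"
      using real_arch_simple by fastforce
    show "emeasure \<mu> (cball undefined (real i)) \<noteq> \<infinity>" for i
      using finite_measure.emeasure_finite[OF fin(1)] by simp
  qed (use compact_eq sets borel_eq_compact in auto)
qed

lemma pair_point_simps [simp]: "pair_point x y 0 = x" "pair_point x y (Suc 0) = y"
  by (auto simp: pair_point_def)

lemma restrict_pair: "(\<lambda>i\<in>{..<2}. g (pair_point x y i)) = pair_point (g x) (g y)"
  by (auto simp: pair_point_def fun_eq_iff)

lemma pair_point_eta: "w \<in> extensional {..<2} \<Longrightarrow> pair_point (w 0) (w 1) = w"
  by (auto simp: pair_point_def fun_eq_iff extensional_def less_2_cases_iff)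

lemma pair_point_measurable [measurable (raw)]:
  assumes "X \<in> N \<rightarrow>\<^sub>M borel" "Y \<in> N \<rightarrow>\<^sub>M borel"
  shows "(\<lambda>\<omega>. pair_point (X \<omega>) (Y \<omega>)) \<in> N \<rightarrow>\<^sub>M power_measure 2"
proof -
  have "(\<lambda>\<omega>. if i = 0 then X \<omega> else Y \<omega>) \<in> N \<rightarrow>\<^sub>M borel" for i :: nat
    using assms by simp
  then show ?thesis
    unfolding pair_point_def power_measure_def by (intro measurable_restrict) auto
qed

lemma openin_prod_euclidean: "openin (prod_topology euclidean euclidean) S \<longleftrightarrow> open S"
  unfolding openin_prod_topology_alt open_prod_def by (auto simp: mem_Times_iff) fastforce+

text \<open>Makes functions of a pair available to (SF1), whose test functions live on the
  extensional power. The support lies in the product of its two compact projections.\<close>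

lemma pair_functional_C0:
  fixes F :: "'m::heine_borel \<times> 'm \<Rightarrow> real"
  assumes F: "continuous_on UNIV F" "compact (closure {x. F x \<noteq> 0})"
  shows "(\<lambda>w. F (w 0, w 1)) \<in> C0 (power_topology 2)"
proof -
  have "prod_topology euclidean euclidean = (euclidean :: ('m \<times> 'm) topology)"
    by (simp add: topology_eq openin_prod_euclidean)
  moreover have "continuous_map (power_topology 2) (prod_topology euclidean euclidean) (\<lambda>w. (w 0, w 1 :: 'm))"
    unfolding power_topology_def by (intro continuous_map_pairedI continuous_map_product_projection) auto
  ultimately have "continuous_map (power_topology 2) euclideanreal (F \<circ> (\<lambda>w. (w 0, w 1)))"
    using F(1) by (intro continuous_map_compose[where X'="prod_topology euclidean euclidean"]) auto
  moreover have "vanishes_at_infinity (power_topology 2) (\<lambda>w. F (w 0, w 1))"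
    unfolding vanishes_at_infinity_def
  proof (intro allI impI)
    fix e :: real assume "e > 0"
    let ?S = "closure {x. F x \<noteq> 0}"
    define K where "K = PiE {..<2} (\<lambda>i::nat. if i = 0 then fst ` ?S else snd ` ?S)"
    have "compactin (power_topology 2) K"
      unfolding power_topology_def K_def compactin_PiE
      by (intro disjI2 ballI) (auto intro!: compact_continuous_image continuous_intros F(2))
    moreover have "\<bar>F (w 0, w 1)\<bar> < e" if "w \<in> topspace (power_topology 2) - K" for w
    proof -
      have w: "w \<in> topspace (power_topology 2)" "w \<notin> K" using that by simp_all
      from w(1) have "w \<in> extensional {..<2}" by (simp add: power_topology_def PiE_def)
      have "(w 0, w 1) \<notin> ?S"
      proof
        assume *: "(w 0, w 1) \<in> ?S"
        have "w 0 \<in> fst ` ?S" "w 1 \<in> snd ` ?S"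
          using imageI[OF *, of fst] imageI[OF *, of snd] by simp_all
        then have "w i \<in> (if i = 0 then fst ` ?S else snd ` ?S)" if "i \<in> {..<2}" for i
        proof -
          have "i = 0 \<or> i = 1" using that by auto
          with \<open>w 0 \<in> _\<close> \<open>w 1 \<in> _\<close> show ?thesis by (elim disjE) simp_all
        qed
        then have "w \<in> K"
          unfolding K_def PiE_iff using \<open>w \<in> extensional {..<2}\<close> by blast
        with w(2) show False by simp
      qed
      then have "F (w 0, w 1) = 0" using closure_subset[of "{x. F x \<noteq> 0}"] by auto
      then show ?thesis using \<open>e > 0\<close> by simp
    qed
    ultimately show "\<exists>K. compactin (power_topology 2) K \<and> (\<forall>x\<in>topspace (power_topology 2) - K. \<bar>F (x 0, x 1)\<bar> < e)"
      by blast
  qed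
  ultimately show ?thesis by (simp add: C0_def o_def)
qed

text \<open>Two-point laws live on the times from 0 on, so the clock is reset to 0 at time r,
  whereas \<open>path_tail\<close> keeps the clock.\<close>

definition path_shift :: "real \<Rightarrow> 'm path \<Rightarrow> 'm path" where
  "path_shift r f = (0, \<lambda>t. snd f (r + max 0 t))"

lemma path_shift_simps [simp]: "fst (path_shift r f) = 0" "snd (path_shift r f) t = snd f (r + max 0 t)"
  by (auto simp: path_shift_def)

lemma path_shift_paths:
  assumes "f \<in> paths"
  shows "path_shift r f \<in> paths_from 0"
proof -
  have "continuous_on UNIV (\<lambda>t. snd f (r + max 0 t))"
    by (rule continuous_on_compose2[OF paths_continuous[OF assms]]) (auto intro!: continuous_intros)
  then show ?thesis by (simp add: path_shift_def paths_from_def paths_def)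
qed

sublocale flow_setting \<subseteq> pair_kernel \<delta> "P 2"
proof
  fix t :: real assume "0 \<le> t"
  then show "P 2 t \<in> power_measure 2 \<rightarrow>\<^sub>M prob_algebra (power_measure 2)"
    using transition unfolding consistent_coalescing_Feller_def Feller_transition_function_def
      transition_function_def by force
qed

context flow_setting
begin

lemma flow_composition:
  obtains J where "\<And>t. 0 \<le> t \<Longrightarrow> (\<lambda>(f, x). J t f x) \<in> maps_measure \<Otimes>\<^sub>M borel \<rightarrow>\<^sub>M borel"
    "\<And>s t x. s \<le> t \<Longrightarrow> AE \<omega> in Pr. J (t - s) (\<psi> s t \<omega>) x = \<psi> s t \<omega> x"
    "\<And>s t u x. s \<le> t \<Longrightarrow> t \<le> u \<Longrightarrow> AE \<omega> in Pr. \<psi> s u \<omega> x = J (u - t) (\<psi> t u \<omega>) (\<psi> s t \<omega> x)"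
proof -
  have "SF2 Pr \<psi>" using flow by (simp add: stochastic_flow_def)
  then obtain J where J: "\<forall>t\<ge>0. (\<lambda>(f, x). J t f x) \<in> maps_measure \<Otimes>\<^sub>M borel \<rightarrow>\<^sub>M borel"
    "\<forall>s t u x. s \<le> t \<and> t \<le> u \<longrightarrow> (AE \<omega> in Pr. J (t - s) (\<psi> s t \<omega>) x = \<psi> s t \<omega> x) \<and>
       (AE \<omega> in Pr. \<psi> s u \<omega> x = J (u - t) (\<psi> t u \<omega>) (\<psi> s t \<omega> x)) \<and> (\<forall>\<omega>\<in>space Pr. \<psi> s s \<omega> x = x)"
    unfolding SF2_def by (elim exE conjE)
  show thesis
  proof (rule that)
    show "(\<lambda>(f, x). J t f x) \<in> maps_measure \<Otimes>\<^sub>M borel \<rightarrow>\<^sub>M borel" if "0 \<le> t" for t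
      using J(1) that by simp
    show "AE \<omega> in Pr. J (t - s) (\<psi> s t \<omega>) x = \<psi> s t \<omega> x" if "s \<le> t" for s t x
      using J(2)[rule_format, of s t t x] that by simp
    show "AE \<omega> in Pr. \<psi> s u \<omega> x = J (u - t) (\<psi> t u \<omega>) (\<psi> s t \<omega> x)" if "s \<le> t" "t \<le> u" for s t u x
      using J(2)[rule_format, of s t u x] that by simp
  qed
qed

text \<open>(SF1) fixes the integrals of compactly supported continuous functions of the pair. The
  measures are compared on the product of two copies of the space, where such functions determine
  them, and carried back by \<open>pair_point\<close>.\<close>

lemma two_point_law:
  assumes st: "s \<le> t"
  shows "distr Pr M2 (\<lambda>\<omega>. pair_point (\<psi> s t \<omega> y) (\<psi> s t \<omega> z)) = P 2 (t - s) (pair_point y z)"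
    (is "?L = ?R")
proof -
  note [measurable] = psi_measurable[OF st]
  have pp: "pair_point y z \<in> space M2" by (simp add: space_M2 pair_point_def)
  have R: "prob_space ?R" "sets ?R = sets M2"
    using measurable_space[OF Q[of "t - s"] pp] st by (auto simp: space_prob_algebra)
  have L: "prob_space ?L" by (rule prob_space_distr) measurable
  let ?h = "\<lambda>w :: nat \<Rightarrow> 'm. (w 0, w 1)"
  have h [measurable]: "?h \<in> M2 \<rightarrow>\<^sub>M borel"
  proof -
    have "(\<lambda>w. w i) \<in> M2 \<rightarrow>\<^sub>M borel" if "i < 2" for i
      unfolding power_measure_def using that by (intro measurable_component_singleton) simp
    then show ?thesis by (intro borel_measurable_Pair) auto
  qed
  have [measurable_cong]: "sets ?R = sets M2" by (rule R)
  have "distr ?L borel ?h = distr ?R borel ?h"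
  proof (rule finite_borel_measure_eqI)
    have p: "prob_space (distr ?L borel ?h)" "prob_space (distr ?R borel ?h)"
      by (rule prob_space.prob_space_distr[OF L], measurable) (rule prob_space.prob_space_distr[OF R(1)], measurable)
    then show "finite_measure (distr ?L borel ?h)" "finite_measure (distr ?R borel ?h)"
      by (simp_all add: prob_space_def)
    show "emeasure (distr ?L borel ?h) UNIV = emeasure (distr ?R borel ?h) UNIV"
      using prob_space.emeasure_space_1[OF p(1)] prob_space.emeasure_space_1[OF p(2)] by simp
    fix F :: "'m \<times> 'm \<Rightarrow> real" assume F: "continuous_on UNIV F" "compact (closure {x. F x \<noteq> 0})"
    have [measurable]: "F \<in> borel_measurable borel" using F(1) by (rule borel_measurable_continuous_onI)
    have "(\<integral>x. F x \<partial>distr ?L borel ?h) = (\<integral>\<omega>. F (\<psi> s t \<omega> y, \<psi> s t \<omega> z) \<partial>Pr)"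
    proof -
      have "distr ?L borel ?h = distr Pr borel (\<lambda>\<omega>. (\<psi> s t \<omega> y, \<psi> s t \<omega> z))"
        by (subst distr_distr) (use h in \<open>auto simp: o_def\<close>)
      then show ?thesis by (simp add: integral_distr)
    qed
    also have "\<dots> = (\<integral>\<omega>. (\<lambda>w. F (w 0, w 1)) (\<lambda>i\<in>{..<2}. \<psi> s t \<omega> (pair_point y z i)) \<partial>Pr)"
      unfolding restrict_pair by simp
    also have "\<dots> = (\<integral>w. F (w 0, w 1) \<partial>?R)"
    proof -
      have "SF1 Pr P \<psi>" using flow by (simp add: stochastic_flow_def)
      from this[unfolded SF1_def, rule_format, of "pair_point y z" 2 "\<lambda>w. F (w 0, w 1)" s t]
      show ?thesis using pair_functional_C0[OF F] st pp by simp
    qed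
    also have "\<dots> = (\<integral>x. F x \<partial>distr ?R borel ?h)"
      by (subst integral_distr) measurable
    finally show "(\<integral>x. F x \<partial>distr ?L borel ?h) = (\<integral>x. F x \<partial>distr ?R borel ?h)" .
  qed auto
  then have eq: "distr (distr ?L borel ?h) M2 (\<lambda>p. pair_point (fst p) (snd p)) =
      distr (distr ?R borel ?h) M2 (\<lambda>p. pair_point (fst p) (snd p))" by (rule arg_cong)
  have recover: "distr (distr \<mu> borel ?h) M2 (\<lambda>p. pair_point (fst p) (snd p)) = \<mu>"
    if s: "sets \<mu> = sets M2" for \<mu>
  proof -
    have [measurable_cong]: "sets \<mu> = sets M2" by fact
    have [measurable]: "fst \<in> (borel :: ('m \<times> 'm) measure) \<rightarrow>\<^sub>M borel" "snd \<in> (borel :: ('m \<times> 'm) measure) \<rightarrow>\<^sub>M borel"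
      by (auto intro!: borel_measurable_continuous_onI continuous_intros)
    have "distr (distr \<mu> borel ?h) M2 (\<lambda>p. pair_point (fst p) (snd p)) = distr \<mu> M2 (\<lambda>w. pair_point (w 0) (w 1))"
      using h s by (subst distr_distr) (auto simp: o_def cong: measurable_cong_sets)
    also have "\<dots> = distr \<mu> \<mu> (\<lambda>w. w)"
      by (rule distr_cong) (use s sets_eq_imp_space_eq[OF s] in \<open>auto simp: space_M2 pair_point_eta[unfolded One_nat_def]\<close>)
    finally show ?thesis by simp
  qed
  show ?thesis using eq unfolding recover[OF sets_distr] recover[OF R(2)] .
qed

end

section \<open>Independence of past and future\<close>

text \<open>The family is an arbitrary sequence: two versions when laws are constructed, and later
  the tracked path together with all paths of the skeleton, so that one filtration sees them
  all.\<close>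

locale flow_family = flow_setting \<delta> Pr P \<psi> D \<Phi>
  for \<delta> :: "(real \<Rightarrow> 'm::{heine_borel, polish_space}) \<Rightarrow> (real \<Rightarrow> 'm) \<Rightarrow> real"
    and Pr :: "'w measure" and P \<psi> D \<Phi> +
  fixes V :: "nat \<Rightarrow> 'w \<Rightarrow> 'm path" and \<alpha> :: "nat \<Rightarrow> real" and \<beta> :: "nat \<Rightarrow> 'm"
  assumes version: "\<And>i. version (\<alpha> i) (\<beta> i) (V i)"
begin

lemma V_measurable: "(\<lambda>\<omega>. snd (V i \<omega>) t) \<in> borel_measurable Pr"
  using versionD(3)[OF version] .

lemma V_paths: "\<omega> \<in> space Pr \<Longrightarrow> V i \<omega> \<in> paths"
  using versionD(1)[OF version] paths_fromD(1) by blast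

definition gens :: "real \<Rightarrow> 'w set set" where
  "gens r = {{\<omega>\<in>space Pr. snd (V i \<omega>) u \<in> B} | i u B. \<alpha> i \<le> u \<and> u \<le> r \<and> B \<in> sets borel}"

definition filt :: "real \<Rightarrow> 'w measure" where
  "filt r = sigma (space Pr) (gens r)"

lemma gens_events: "gens r \<subseteq> sets Pr"
  unfolding gens_def by (auto intro: measurable_Collect_in[OF V_measurable])

lemma space_filt [simp]: "space (filt r) = space Pr"
  and sets_filt: "sets (filt r) = sigma_sets (space Pr) (gens r)"
  unfolding filt_def using gens_events[of r] sets.space_closed by (auto intro!: space_measure_of sets_measure_of)

lemma filt_events: "sets (filt r) \<subseteq> sets Pr"
  unfolding sets_filt using gens_events by (rule sets.sigma_sets_subset)

lemma filt_mono: "r \<le> r' \<Longrightarrow> sets (filt r) \<subseteq> sets (filt r')"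
  unfolding sets_filt by (rule sigma_sets_mono') (force simp: gens_def)

lemma V_filt: "\<alpha> i \<le> u \<Longrightarrow> u \<le> r \<Longrightarrow> (\<lambda>\<omega>. snd (V i \<omega>) u) \<in> borel_measurable (filt r)"
  by (rule measurableI) (auto simp: sets_filt gens_def vimage_def Int_def conj_commute intro!: sigma_sets.Basic exI[of _ i] exI[of _ u])

definition cylV :: "(nat \<times> real) set \<Rightarrow> (nat \<times> real \<Rightarrow> 'm set) \<Rightarrow> 'w set" where
  "cylV J B = {\<omega>\<in>space Pr. \<forall>p\<in>J. snd (V (fst p) \<omega>) (snd p) \<in> B p}"

definition "cylVs r = {cylV J B | J B. finite J \<and> (\<forall>p\<in>J. \<alpha> (fst p) \<le> snd p \<and> snd p \<le> r) \<and> (\<forall>p. B p \<in> sets borel)}"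

lemma cylVs_Int_stable: "Int_stable (cylVs r)"
proof (rule Int_stableI)
  fix a b assume "a \<in> cylVs r" "b \<in> cylVs r"
  then obtain J B J' B' where a: "a = cylV J B" "finite J" "\<forall>p\<in>J. \<alpha> (fst p) \<le> snd p \<and> snd p \<le> r" "\<forall>p. B p \<in> sets borel"
    and b: "b = cylV J' B'" "finite J'" "\<forall>p\<in>J'. \<alpha> (fst p) \<le> snd p \<and> snd p \<le> r" "\<forall>p. B' p \<in> sets borel"
    unfolding cylVs_def by blast
  have "a \<inter> b = cylV (J \<union> J') (\<lambda>p. (if p \<in> J then B p else UNIV) \<inter> (if p \<in> J' then B' p else UNIV))"
    unfolding a(1) b(1) cylV_def by (auto split: if_splits)
  then show "a \<inter> b \<in> cylVs r"
    unfolding cylVs_def using a b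
    by (intro CollectI exI[of _ "J \<union> J'"] exI[of _ "\<lambda>p. (if p \<in> J then B p else UNIV) \<inter> (if p \<in> J' then B' p else UNIV)"]) auto
qed

lemma cylVs_events: "cylVs r \<subseteq> sets Pr"
proof
  fix a assume "a \<in> cylVs r"
  then obtain J B where a: "a = cylV J B" "finite J" "\<forall>p. B p \<in> sets borel"
    unfolding cylVs_def by blast
  show "a \<in> sets Pr"
    unfolding a(1) cylV_def using a(2,3)
    by (intro sets.sets_Collect_finite_All sets.sets_Collect measurable_Collect_in[OF V_measurable]) auto
qed

lemma gens_cylVs: "gens r \<subseteq> cylVs r"
proof
  fix a assume "a \<in> gens r"
  then obtain i u B where "a = {\<omega>\<in>space Pr. snd (V i \<omega>) u \<in> B}" "\<alpha> i \<le> u" "u \<le> r" "B \<in> sets borel"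
    by (auto simp: gens_def)
  then show "a \<in> cylVs r"
    unfolding cylVs_def by (intro CollectI exI[of _ "{(i, u)}"] exI[of _ "\<lambda>_. B"]) (auto simp: cylV_def)
qed

text \<open>Along a grid of times the value of the flow is almost surely a function of the consecutive
  increments, by iterating (SF2).\<close>

lemma flow_function_of_increments:
  assumes \<tau>: "mono_on {..Suc N} \<tau>" and mk: "m \<le> k" "k \<le> N"
  shows "\<exists>g\<in>PiM {..<N} (\<lambda>_. maps_measure) \<rightarrow>\<^sub>M borel.
    AE \<omega> in Pr. \<psi> (\<tau> m) (\<tau> k) \<omega> x = g (\<lambda>j\<in>{..<N}. \<psi> (\<tau> j) (\<tau> (Suc j)) \<omega>)"
  using mk
proof (induction rule: dec_induct)
  case base
  show ?case by (intro bexI[of _ "\<lambda>_. x"] AE_I2) (auto simp: psi_start)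
next
  case (step k)
  obtain J where J: "\<And>t. 0 \<le> t \<Longrightarrow> (\<lambda>(f, x). J t f x) \<in> maps_measure \<Otimes>\<^sub>M borel \<rightarrow>\<^sub>M borel"
    "\<And>s t u x. s \<le> t \<Longrightarrow> t \<le> u \<Longrightarrow> AE \<omega> in Pr. \<psi> s u \<omega> x = J (u - t) (\<psi> t u \<omega>) (\<psi> s t \<omega> x)"
    by (rule flow_composition) blast
  obtain g where g: "g \<in> PiM {..<N} (\<lambda>_. maps_measure) \<rightarrow>\<^sub>M borel"
    "AE \<omega> in Pr. \<psi> (\<tau> m) (\<tau> k) \<omega> x = g (\<lambda>j\<in>{..<N}. \<psi> (\<tau> j) (\<tau> (Suc j)) \<omega>)"
    using step.IH[OF Suc_leD[OF step.prems]] by (rule bexE)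
  have le: "\<tau> m \<le> \<tau> k" "\<tau> k \<le> \<tau> (Suc k)"
    using step by (auto intro!: mono_onD[OF \<tau>])
  define g' where "g' = (\<lambda>\<xi>. J (\<tau> (Suc k) - \<tau> k) (\<xi> k) (g \<xi>))"
  have "(\<lambda>\<xi>. \<xi> k) \<in> PiM {..<N} (\<lambda>_. maps_measure) \<rightarrow>\<^sub>M maps_measure"
    by (rule measurable_component_singleton) (use step in simp)
  from measurable_compose[OF measurable_Pair[OF this g(1)] J(1)[of "\<tau> (Suc k) - \<tau> k"]] le
  have "g' \<in> PiM {..<N} (\<lambda>_. maps_measure) \<rightarrow>\<^sub>M borel" by (simp add: g'_def)
  moreover have "AE \<omega> in Pr. \<psi> (\<tau> m) (\<tau> (Suc k)) \<omega> x = g' (\<lambda>j\<in>{..<N}. \<psi> (\<tau> j) (\<tau> (Suc j)) \<omega>)"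
    using J(2)[OF le, of x] g(2) by eventually_elim (use step in \<open>simp add: g'_def\<close>)
  ultimately show ?case by blast
qed

text \<open>(SF3) is used along the times occurring in a, with u added at the end: a is almost
  surely determined by the increments up to r, and the last increment is
  \<open>\<psi> r u\<close>.\<close>

lemma cylV_indep:
  assumes ru: "r \<le> u" and a: "a \<in> cylVs r" and E: "E \<in> sets maps_measure"
  shows "prob (a \<inter> (\<psi> r u -` E \<inter> space Pr)) = prob a * prob (\<psi> r u -` E \<inter> space Pr)"
proof -
  obtain J B where a: "a = cylV J B" "finite J" "\<And>p. p \<in> J \<Longrightarrow> \<alpha> (fst p) \<le> snd p \<and> snd p \<le> r"
    "\<And>p. B p \<in> sets borel"
    using a unfolding cylVs_def by blast
  define S where "S = insert r ((\<lambda>p. \<alpha> (fst p)) ` J \<union> snd ` J)"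
  have S: "finite S" "r \<in> S" "\<And>x. x \<in> S \<Longrightarrow> x \<le> r"
    using a(2,3) by (auto simp: S_def intro: order_trans)
  define ts where "ts = sorted_list_of_set S"
  have ts: "set ts = S" "sorted ts" using S(1) by (auto simp: ts_def)
  then have "ts \<noteq> []" using S(2) by auto
  define N where "N = length ts - 1"
  have len: "length ts = Suc N" using \<open>ts \<noteq> []\<close> by (simp add: N_def)
  \<comment> \<open>Place N of the grid is r, the largest element of S, and every later place is
    u.\<close>
  define \<tau> where "\<tau> = (\<lambda>k. if k \<le> N then ts ! k else u)"
  have inS: "\<exists>k\<le>N. x = \<tau> k" if "x \<in> S" for x
    using that unfolding ts(1)[symmetric] in_set_conv_nth by (auto simp: \<tau>_def len less_Suc_eq_le)
  have \<tau>S: "\<tau> k \<in> S" if "k \<le> N" for k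
    using that nth_mem[of k ts] by (simp add: \<tau>_def len ts)
  have sorted: "\<tau> j \<le> \<tau> k" if "j \<le> k" "k \<le> N" for j k
    using that sorted_nth_mono[OF ts(2)] by (simp add: \<tau>_def len)
  have mono: "mono_on {..Suc N} \<tau>"
  proof (rule mono_onI)
    fix j k assume jk: "j \<in> {..Suc N}" "k \<in> {..Suc N}" "j \<le> k"
    show "\<tau> j \<le> \<tau> k"
    proof (cases "k \<le> N")
      case False
      then have "\<tau> k = u" by (simp add: \<tau>_def)
      moreover have "\<tau> j \<le> u" using S(3)[OF \<tau>S, of j] ru by (cases "j \<le> N") (auto simp: \<tau>_def)
      ultimately show ?thesis by simp
    qed (use sorted jk in simp)
  qed
  obtain k where "k \<le> N" "r = \<tau> k" using inS[OF S(2)] by blast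
  then have \<tau>N: "\<tau> N = r" using sorted[of k N] S(3)[OF \<tau>S[of N]] by simp
  have \<tau>SN: "\<tau> (Suc N) = u" by (simp add: \<tau>_def)
  let ?X = "\<lambda>\<omega>. \<lambda>j\<in>{..<N}. \<psi> (\<tau> j) (\<tau> (Suc j)) \<omega>"
  let ?Y = "\<lambda>\<omega>. \<lambda>j\<in>{N}. \<psi> (\<tau> j) (\<tau> (Suc j)) \<omega>"
  have indep: "indep_var (PiM {..<N} (\<lambda>_. maps_measure)) ?X (PiM {N} (\<lambda>_. maps_measure)) ?Y"
  proof (rule indep_var_restrict)
    show "indep_vars (\<lambda>_. maps_measure) (\<lambda>i. \<psi> (\<tau> i) (\<tau> (Suc i))) {..<Suc N}"
      using flow mono unfolding stochastic_flow_def SF3_def by blast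
  qed auto
  note X = indep_var_rv1[OF indep]
  have "\<forall>p\<in>J. \<exists>g\<in>PiM {..<N} (\<lambda>_. maps_measure) \<rightarrow>\<^sub>M borel.
      AE \<omega> in Pr. snd (V (fst p) \<omega>) (snd p) = g (?X \<omega>)"
  proof
    fix p assume p: "p \<in> J"
    then have "\<alpha> (fst p) \<in> S" "snd p \<in> S" by (auto simp: S_def)
    then obtain m k where mk: "m \<le> N" "\<alpha> (fst p) = \<tau> m" "k \<le> N" "snd p = \<tau> k" using inS by metis
    have le: "\<alpha> (fst p) \<le> snd p" using a(3)[OF p] by simp
    obtain g where g: "g \<in> PiM {..<N} (\<lambda>_. maps_measure) \<rightarrow>\<^sub>M borel"
      "AE \<omega> in Pr. \<psi> (\<alpha> (fst p)) (snd p) \<omega> (\<beta> (fst p)) = g (?X \<omega>)"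
    proof (cases "m \<le> k")
      case True
      show ?thesis using flow_function_of_increments[OF mono True mk(3), of "\<beta> (fst p)"] that
        by (auto simp: mk)
    next
      \<comment> \<open>Then start and evaluation time coincide, and the value is the starting
        point.\<close>
      case False
      then have "\<tau> m = \<tau> k" using sorted[of k m] le mk by simp
      then show ?thesis
        by (intro that[of "\<lambda>_. \<beta> (fst p)"] AE_I2) (auto simp: mk psi_start)
    qed
    have "AE \<omega> in Pr. snd (V (fst p) \<omega>) (snd p) = g (?X \<omega>)"
      using versionD(4)[OF version le] g(2) by eventually_elim simp
    with g(1) show "\<exists>g\<in>PiM {..<N} (\<lambda>_. maps_measure) \<rightarrow>\<^sub>M borel.
      AE \<omega> in Pr. snd (V (fst p) \<omega>) (snd p) = g (?X \<omega>)" by blast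
  qed
  then obtain g where "\<forall>p\<in>J. g p \<in> PiM {..<N} (\<lambda>_. maps_measure) \<rightarrow>\<^sub>M borel \<and>
      (AE \<omega> in Pr. snd (V (fst p) \<omega>) (snd p) = g p (?X \<omega>))"
    unfolding Bex_def by (rule bchoice[THEN exE])
  then have g: "g p \<in> PiM {..<N} (\<lambda>_. maps_measure) \<rightarrow>\<^sub>M borel"
    "AE \<omega> in Pr. snd (V (fst p) \<omega>) (snd p) = g p (?X \<omega>)" if "p \<in> J" for p
    using that by simp_all
  define A where "A = {\<xi>\<in>space (PiM {..<N} (\<lambda>_. maps_measure :: ('m \<Rightarrow> 'm) measure)). \<forall>p\<in>J. g p \<xi> \<in> B p}"
  have A: "A \<in> sets (PiM {..<N} (\<lambda>_. maps_measure))"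
    unfolding A_def using a(2,4)
    by (intro sets.sets_Collect_finite_All measurable_Collect_in[OF g(1)]) auto
  define E' where "E' = {\<xi>\<in>space (PiM {N} (\<lambda>_. maps_measure :: ('m \<Rightarrow> 'm) measure)). \<xi> N \<in> E}"
  have E': "E' \<in> sets (PiM {N} (\<lambda>_. maps_measure))"
    unfolding E'_def by (intro measurable_Collect_in[OF measurable_component_singleton[of N "{N}" "\<lambda>_. maps_measure"] E]) auto
  have AA: "AE \<omega> in Pr. \<omega> \<in> a \<longleftrightarrow> ?X \<omega> \<in> A"
  proof -
    have "AE \<omega> in Pr. \<forall>p\<in>J. snd (V (fst p) \<omega>) (snd p) = g p (?X \<omega>)"
      unfolding AE_finite_all[OF a(2)] using g(2) by (rule ballI)
    with AE_space show ?thesis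
    proof eventually_elim
      case (elim \<omega>)
      then show ?case using measurable_space[OF X elim(1)] by (simp add: a(1) cylV_def A_def)
    qed
  qed
  have aev: "a \<in> sets Pr" using assms(2) cylVs_events by blast
  have Xev: "?X -` A \<inter> space Pr \<in> sets Pr" by (rule measurable_sets[OF X A])
  have Eev: "\<psi> r u -` E \<inter> space Pr \<in> sets Pr" by (rule measurable_sets[OF psi_maps[OF ru] E])
  have YE: "?Y -` E' \<inter> space Pr = \<psi> r u -` E \<inter> space Pr"
    using measurable_space[OF indep_var_rv2[OF indep]] by (auto simp: E'_def \<tau>N \<tau>SN)
  have "prob (a \<inter> (\<psi> r u -` E \<inter> space Pr)) = prob ((?X -` A \<inter> space Pr) \<inter> (\<psi> r u -` E \<inter> space Pr))"
    using AA aev Xev Eev by (intro finite_measure_eq_AE) auto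
  also have "\<dots> = prob ((\<lambda>\<omega>. (?X \<omega>, ?Y \<omega>)) -` (A \<times> E') \<inter> space Pr)"
    unfolding YE[symmetric] by (intro arg_cong[where f=prob]) auto
  also have "\<dots> = prob (?X -` A \<inter> space Pr) * prob (?Y -` E' \<inter> space Pr)"
    by (rule indep_varD[OF indep A E'])
  also have "prob (?X -` A \<inter> space Pr) = prob a"
    using AA aev Xev by (intro finite_measure_eq_AE) auto
  finally show ?thesis unfolding YE .
qed

text \<open>The cylinders of the past and the events of the increment are both stable under
  intersection, so independence passes to the generated sigma-algebras.\<close>

lemma filt_indep:
  assumes ru: "r \<le> u" and A: "A \<in> sets (filt r)" and E: "E \<in> sets maps_measure"
  shows "prob (A \<inter> (\<psi> r u -` E \<inter> space Pr)) = prob A * prob (\<psi> r u -` E \<inter> space Pr)"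
proof -
  let ?\<E> = "{\<psi> r u -` E \<inter> space Pr | E. E \<in> sets maps_measure}"
  have stable: "Int_stable ?\<E>"
  proof (rule Int_stableI)
    fix a b assume "a \<in> ?\<E>" "b \<in> ?\<E>"
    then obtain E E' where "a = \<psi> r u -` E \<inter> space Pr" "b = \<psi> r u -` E' \<inter> space Pr"
      "E \<in> sets maps_measure" "E' \<in> sets maps_measure" by blast
    then show "a \<inter> b \<in> ?\<E>" by (intro CollectI exI[of _ "E \<inter> E'"]) auto
  qed
  have "indep_set (cylVs r) ?\<E>"
  proof (rule indep_setI)
    show "?\<E> \<subseteq> events" using measurable_sets[OF psi_maps[OF ru]] by blast
  qed (use cylVs_events cylV_indep[OF ru] in auto)
  from indep_set_sigma_sets[OF this cylVs_Int_stable stable]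
  have "indep_set (sigma_sets (space Pr) (cylVs r)) (sigma_sets (space Pr) ?\<E>)" .
  moreover have "A \<in> sigma_sets (space Pr) (cylVs r)"
    using A sigma_sets_mono'[OF gens_cylVs] unfolding sets_filt by blast
  moreover have "\<psi> r u -` E \<inter> space Pr \<in> sigma_sets (space Pr) ?\<E>"
    using E by (intro sigma_sets.Basic) blast
  ultimately show ?thesis by (rule indep_setD)
qed

section \<open>The Markov property of pairs at a fixed time\<close>

text \<open>The values at u are almost surely \<open>J\<close> applied to the increment over [r, u]
  and the values at r. By independence the past and the increment have a product law, so the values
  at r can be frozen by Fubini's theorem, after which \<open>two_point_law\<close> applies.\<close>

lemma one_step_Markov:
  assumes ru: "r \<le> u" and ij: "\<alpha> i \<le> r" "\<alpha> j \<le> r" and A: "A \<in> sets (filt r)" and B: "B \<in> sets M2"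
  shows "emeasure Pr (A \<inter> {\<omega>\<in>space Pr. pair_point (snd (V i \<omega>) u) (snd (V j \<omega>) u) \<in> B}) =
    (\<integral>\<^sup>+\<omega>\<in>A. emeasure (P 2 (u - r) (pair_point (snd (V i \<omega>) r) (snd (V j \<omega>) r))) B \<partial>Pr)"
proof -
  obtain J where J: "\<And>t. 0 \<le> t \<Longrightarrow> (\<lambda>(f, x). J t f x) \<in> maps_measure \<Otimes>\<^sub>M borel \<rightarrow>\<^sub>M borel"
    "\<And>s t x. s \<le> t \<Longrightarrow> AE \<omega> in Pr. J (t - s) (\<psi> s t \<omega>) x = \<psi> s t \<omega> x"
    "\<And>s t u x. s \<le> t \<Longrightarrow> t \<le> u \<Longrightarrow> AE \<omega> in Pr. \<psi> s u \<omega> x = J (u - t) (\<psi> t u \<omega>) (\<psi> s t \<omega> x)"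
    by (rule flow_composition) blast
  define K where "K = J (u - r)"
  have K: "(\<lambda>(f, x). K f x) \<in> maps_measure \<Otimes>\<^sub>M borel \<rightarrow>\<^sub>M borel" unfolding K_def using J(1) ru by simp
  note Y = psi_maps[OF ru]
  have Aev: "A \<in> sets Pr" using A filt_events by blast
  have VK: "AE \<omega> in Pr. snd (V i \<omega>) u = K (\<psi> r u \<omega>) (snd (V i \<omega>) r)" if "\<alpha> i \<le> r" for i
    using versionD(4)[OF version that] versionD(4)[OF version order_trans[OF that ru]] J(3)[OF that ru]
    by eventually_elim (simp add: K_def)
  let ?F = "filt r"
  let ?N1 = "distr Pr ?F (\<lambda>\<omega>. \<omega>)"
  let ?N2 = "distr Pr maps_measure (\<psi> r u)"
  let ?N = "distr Pr (?F \<Otimes>\<^sub>M maps_measure) (\<lambda>\<omega>. (\<omega>, \<psi> r u \<omega>))"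
  \<comment> \<open>The past enters as a random element: the identity, viewed with the smaller
    sigma-algebra.\<close>
  have id: "(\<lambda>\<omega>. \<omega>) \<in> Pr \<rightarrow>\<^sub>M ?F"
  proof (rule measurableI)
    fix A' assume A': "A' \<in> sets ?F"
    then have "(\<lambda>\<omega>. \<omega>) -` A' \<inter> space Pr = A'" using sets.sets_into_space[OF A'] by auto
    then show "(\<lambda>\<omega>. \<omega>) -` A' \<inter> space Pr \<in> sets Pr" using A' filt_events[of r] by auto
  qed simp
  have pair: "(\<lambda>\<omega>. (\<omega>, \<psi> r u \<omega>)) \<in> Pr \<rightarrow>\<^sub>M ?F \<Otimes>\<^sub>M maps_measure"
    by (rule measurable_Pair[OF id Y])
  interpret N1: prob_space ?N1 by (rule prob_space_distr[OF id])
  interpret N2: prob_space ?N2 by (rule prob_space_distr[OF Y])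
  have prod: "?N1 \<Otimes>\<^sub>M ?N2 = ?N"
  proof (rule pair_measure_eqI)
    show "sigma_finite_measure ?N1" "sigma_finite_measure ?N2" by unfold_locales
    show "sets (?N1 \<Otimes>\<^sub>M ?N2) = sets ?N" by (simp cong: sets_pair_measure_cong)
    fix A' E assume "A' \<in> sets ?N1" "E \<in> sets ?N2"
    then have A': "A' \<in> sets ?F" and E: "E \<in> sets maps_measure" by auto
    have sub: "A' \<subseteq> space Pr" using sets.sets_into_space[OF A'] by simp
    have "emeasure ?N (A' \<times> E) = emeasure Pr ((\<lambda>\<omega>. (\<omega>, \<psi> r u \<omega>)) -` (A' \<times> E) \<inter> space Pr)"
      using A' E by (intro emeasure_distr[OF pair]) auto
    also have "(\<lambda>\<omega>. (\<omega>, \<psi> r u \<omega>)) -` (A' \<times> E) \<inter> space Pr = A' \<inter> (\<psi> r u -` E \<inter> space Pr)"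
      using sub by auto
    also have "emeasure Pr \<dots> = emeasure Pr A' * emeasure Pr (\<psi> r u -` E \<inter> space Pr)"
      using filt_indep[OF ru A' E] by (simp add: emeasure_eq_measure ennreal_mult measure_nonneg)
    also have "emeasure Pr A' = emeasure ?N1 A'"
      using A' sub by (simp add: emeasure_distr[OF id] Int_absorb2)
    also have "emeasure Pr (\<psi> r u -` E \<inter> space Pr) = emeasure ?N2 E"
      using E by (simp add: emeasure_distr[OF Y])
    finally show "emeasure ?N1 A' * emeasure ?N2 E = emeasure ?N (A' \<times> E)" ..
  qed
  \<comment> \<open>The event at time u as a function of two separate arguments, the past and the
    increment.\<close>
  define G where "G = (\<lambda>(\<omega>, f). indicator A \<omega> * indicator B (pair_point (K f (snd (V i \<omega>) r)) (K f (snd (V j \<omega>) r))) :: ennreal)"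
  have Kf: "(\<lambda>p. K (snd p) (snd (V i (fst p)) r)) \<in> ?F \<Otimes>\<^sub>M maps_measure \<rightarrow>\<^sub>M borel" if "\<alpha> i \<le> r" for i
    using measurable_compose[OF measurable_Pair[OF measurable_snd measurable_compose[OF measurable_fst V_filt[OF that order_refl]]] K]
    by simp
  have G: "G \<in> borel_measurable (?F \<Otimes>\<^sub>M maps_measure)"
    unfolding G_def split_beta
    by (intro borel_measurable_times_ennreal measurable_compose[OF measurable_fst borel_measurable_indicator[OF A]]
        measurable_compose[OF pair_point_measurable[OF Kf[OF ij(1)] Kf[OF ij(2)]] borel_measurable_indicator[OF B]])
  have "emeasure Pr (A \<inter> {\<omega>\<in>space Pr. pair_point (snd (V i \<omega>) u) (snd (V j \<omega>) u) \<in> B}) =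
      (\<integral>\<^sup>+\<omega>. indicator (A \<inter> {\<omega>\<in>space Pr. pair_point (snd (V i \<omega>) u) (snd (V j \<omega>) u) \<in> B}) \<omega> \<partial>Pr)"
    by (intro nn_integral_indicator[symmetric] sets.Int Aev
        measurable_Collect_in[OF pair_point_measurable[OF V_measurable V_measurable] B])
  also have "\<dots> = (\<integral>\<^sup>+\<omega>. G (\<omega>, \<psi> r u \<omega>) \<partial>Pr)"
  proof (rule nn_integral_cong_AE)
    show "AE \<omega> in Pr. indicator (A \<inter> {\<omega>\<in>space Pr. pair_point (snd (V i \<omega>) u) (snd (V j \<omega>) u) \<in> B}) \<omega> = G (\<omega>, \<psi> r u \<omega>)"
      using VK[OF ij(1)] VK[OF ij(2)] AE_space
      by eventually_elim (simp add: G_def split: split_indicator)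
  qed
  also have "\<dots> = (\<integral>\<^sup>+p. G p \<partial>?N)"
    by (rule nn_integral_distr[OF pair, symmetric]) (use G in simp)
  also have "\<dots> = (\<integral>\<^sup>+\<omega>. \<integral>\<^sup>+f. G (\<omega>, f) \<partial>?N2 \<partial>?N1)"
    unfolding prod[symmetric] using G by (intro N2.nn_integral_fst[symmetric]) (simp cong: measurable_cong_sets sets_pair_measure_cong)
  also have "\<dots> = (\<integral>\<^sup>+\<omega>. \<integral>\<^sup>+f. G (\<omega>, f) \<partial>?N2 \<partial>Pr)"
    using G by (intro nn_integral_distr[OF id] N2.borel_measurable_nn_integral_fst) (simp cong: measurable_cong_sets sets_pair_measure_cong)
  also have "\<dots> = (\<integral>\<^sup>+\<omega>\<in>A. emeasure (P 2 (u - r) (pair_point (snd (V i \<omega>) r) (snd (V j \<omega>) r))) B \<partial>Pr)"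
  proof (rule nn_integral_cong)
    fix \<omega> assume \<omega>: "\<omega> \<in> space Pr"
    let ?y = "snd (V i \<omega>) r" and ?z = "snd (V j \<omega>) r"
    have Gs: "(\<lambda>f. G (\<omega>, f)) \<in> borel_measurable maps_measure"
      using measurable_compose[OF measurable_Pair1'[of \<omega> ?F maps_measure] G] \<omega> by simp
    have "(\<integral>\<^sup>+f. G (\<omega>, f) \<partial>?N2) = (\<integral>\<^sup>+\<omega>'. G (\<omega>, \<psi> r u \<omega>') \<partial>Pr)"
      by (rule nn_integral_distr[OF Y]) (use Gs in simp)
    \<comment> \<open>The points are now fixed, so (SF2) replaces \<open>K\<close> by the flow
      almost surely.\<close>
    also have "\<dots> = (\<integral>\<^sup>+\<omega>'. indicator A \<omega> * indicator B (pair_point (\<psi> r u \<omega>' ?y) (\<psi> r u \<omega>' ?z)) \<partial>Pr)"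
    proof (rule nn_integral_cong_AE)
      show "AE \<omega>' in Pr. G (\<omega>, \<psi> r u \<omega>') = indicator A \<omega> * indicator B (pair_point (\<psi> r u \<omega>' ?y) (\<psi> r u \<omega>' ?z))"
        using J(2)[OF ru, of ?y] J(2)[OF ru, of ?z] by eventually_elim (simp add: G_def K_def)
    qed
    also have "\<dots> = indicator A \<omega> * (\<integral>\<^sup>+\<omega>'. indicator B (pair_point (\<psi> r u \<omega>' ?y) (\<psi> r u \<omega>' ?z)) \<partial>Pr)"
      by (intro nn_integral_cmult measurable_compose[OF pair_point_measurable borel_measurable_indicator[OF B]] psi_measurable ru)
    also have "(\<integral>\<^sup>+\<omega>'. indicator B (pair_point (\<psi> r u \<omega>' ?y) (\<psi> r u \<omega>' ?z)) \<partial>Pr) =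
        (\<integral>\<^sup>+w. indicator B w \<partial>distr Pr M2 (\<lambda>\<omega>'. pair_point (\<psi> r u \<omega>' ?y) (\<psi> r u \<omega>' ?z)))"
      by (intro nn_integral_distr[symmetric] pair_point_measurable psi_measurable ru)
        (simp add: B borel_measurable_indicator)
    also have "\<dots> = emeasure (P 2 (u - r) (pair_point ?y ?z)) B"
    proof -
      have "sets (P 2 (u - r) (pair_point ?y ?z)) = sets M2"
        unfolding two_point_law[OF ru, symmetric] by simp
      then show ?thesis unfolding two_point_law[OF ru] using B by simp
    qed
    finally show "(\<integral>\<^sup>+f. G (\<omega>, f) \<partial>?N2) = emeasure (P 2 (u - r) (pair_point ?y ?z)) B * indicator A \<omega>"
      by (simp add: mult.commute)
  qed
  finally show ?thesis .
qed

definition shifted :: "nat \<Rightarrow> nat \<Rightarrow> real \<Rightarrow> 'w \<Rightarrow> nat \<Rightarrow> 'm path" where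
  "shifted i j r \<omega> = (\<lambda>k\<in>{..<2}. path_shift r (V (if k = 0 then i else j) \<omega>))"

lemma shifted_measurable: "shifted i j r \<in> Pr \<rightarrow>\<^sub>M W2"
  unfolding shifted_def[abs_def]
proof (rule W2_measurableI)
  show "path_shift r (V (if k = 0 then i else j) \<omega>) \<in> paths_from 0" if "\<omega> \<in> space Pr" for \<omega> and k :: nat
    by (rule path_shift_paths[OF V_paths[OF that]])
  then show "(\<lambda>\<omega>. path_shift r (V (if k = 0 then i else j) \<omega>)) \<in> Pr \<rightarrow>\<^sub>M path_measure \<delta>" for k :: nat
    by (intro measurable_pathI paths_fromD(1)[where s=0]) (auto intro: V_measurable)
qed

lemma pos_shifted: "0 \<le> t \<Longrightarrow> pos t (shifted i j r \<omega>) = pair_point (snd (V i \<omega>) (r + t)) (snd (V j \<omega>) (r + t))"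
  by (auto simp: path_position_def shifted_def pair_point_def fun_eq_iff)

lemma shifted_past_event:
  assumes ij: "\<alpha> i \<le> r" "\<alpha> j \<le> r" and s: "0 \<le> s" and A: "A \<in> past_events \<delta> 2 s"
  shows "shifted i j r -` A \<inter> space Pr \<in> sets (filt (r + s))"
  using A unfolding past_events_def
proof induction
  case (Basic a)
  then obtain u B where a: "a = {w\<in>space W2. pos u w \<in> B}" "0 \<le> u" "u \<le> s" "B \<in> sets M2" by auto
  have "shifted i j r -` a \<inter> space Pr =
      {\<omega>\<in>space (filt (r + s)). pair_point (snd (V i \<omega>) (r + u)) (snd (V j \<omega>) (r + u)) \<in> B}"
    using measurable_space[OF shifted_measurable] a(2) by (auto simp: a(1) pos_shifted)
  also have "\<dots> \<in> sets (filt (r + s))"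
    by (intro measurable_Collect_in[OF pair_point_measurable a(4)] V_filt) (use ij a in auto)
  finally show ?case .
next
  case (Compl a)
  have "shifted i j r -` (space W2 - a) \<inter> space Pr = space (filt (r + s)) - (shifted i j r -` a \<inter> space Pr)"
    using measurable_space[OF shifted_measurable] by auto
  with Compl show ?case by (simp only: sets.compl_sets)
next
  case (Union a)
  have "shifted i j r -` (\<Union>k. a k) \<inter> space Pr = (\<Union>k. shifted i j r -` a k \<inter> space Pr)" by auto
  with Union show ?case by (simp only: sets.countable_nat_UN image_subset_iff) blast
qed simp

definition "shifted_law i j r A = distr (density Pr (indicator A)) W2 (shifted i j r)"

lemma nn_integral_shifted_law:
  assumes A: "A \<in> sets Pr" and h: "h \<in> borel_measurable W2"
  shows "(\<integral>\<^sup>+w. h w \<partial>shifted_law i j r A) = (\<integral>\<^sup>+\<omega>\<in>A. h (shifted i j r \<omega>) \<partial>Pr)"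
proof -
  have "(\<integral>\<^sup>+w. h w \<partial>shifted_law i j r A) = (\<integral>\<^sup>+\<omega>. h (shifted i j r \<omega>) \<partial>density Pr (indicator A))"
    unfolding shifted_law_def using shifted_measurable h by (intro nn_integral_distr) auto
  also have "\<dots> = (\<integral>\<^sup>+\<omega>. indicator A \<omega> * h (shifted i j r \<omega>) \<partial>Pr)"
    using A measurable_compose[OF shifted_measurable h] by (intro nn_integral_density) auto
  finally show ?thesis by (simp add: mult.commute)
qed

text \<open>An event of the shifted past up to s is an event of \<open>filt (r + s)\<close>;
  intersected with A it enters \<open>one_step_Markov\<close> at time r + s.\<close>

lemma shifted_law_Markov:
  assumes ij: "\<alpha> i \<le> r" "\<alpha> j \<le> r" and A: "A \<in> sets (filt r)"
  shows "Markov (shifted_law i j r A)" "finite_measure (shifted_law i j r A)" "sets (shifted_law i j r A) = sets W2"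
proof -
  have Aev: "A \<in> sets Pr" using A filt_events by blast
  show sets: "sets (shifted_law i j r A) = sets W2" by (simp add: shifted_law_def)
  have sp: "space (shifted_law i j r A) = space W2" by (simp add: shifted_law_def)
  have em: "emeasure (shifted_law i j r A) X = emeasure Pr (A \<inter> (shifted i j r -` X \<inter> space Pr))"
    if X: "X \<in> sets W2" for X
  proof -
    have "emeasure (shifted_law i j r A) X = (\<integral>\<^sup>+w. indicator X w \<partial>shifted_law i j r A)"
      using X sets by simp
    also have "\<dots> = (\<integral>\<^sup>+\<omega>\<in>A. indicator X (shifted i j r \<omega>) \<partial>Pr)"
      using Aev X by (intro nn_integral_shifted_law) auto
    also have "\<dots> = (\<integral>\<^sup>+\<omega>. indicator (A \<inter> (shifted i j r -` X \<inter> space Pr)) \<omega> \<partial>Pr)"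
      by (intro nn_integral_cong) (auto split: split_indicator)
    also have "\<dots> = emeasure Pr (A \<inter> (shifted i j r -` X \<inter> space Pr))"
      by (intro nn_integral_indicator sets.Int Aev measurable_sets[OF shifted_measurable X])
    finally show ?thesis .
  qed
  show "finite_measure (shifted_law i j r A)"
    by (rule finite_measureI) (use em[of "space W2"] sp emeasure_finite in auto)
  show "Markov (shifted_law i j r A)"
    unfolding Markov_def
  proof (intro allI impI ballI)
    fix s t :: real and A' B assume st: "0 \<le> s" "0 \<le> t" and A': "A' \<in> past_events \<delta> 2 s" and B: "B \<in> sets M2"
    have A'2: "A' \<in> sets W2" by (rule past_event_measurable[OF A'])
    let ?A = "A \<inter> (shifted i j r -` A' \<inter> space Pr)"
    have Af: "?A \<in> sets (filt (r + s))"
      using A filt_mono[of r "r + s"] st shifted_past_event[OF ij st(1) A'] by auto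
    have "emeasure (shifted_law i j r A) (A' \<inter> {w\<in>space W2. pos (s + t) w \<in> B}) =
      emeasure Pr (A \<inter> (shifted i j r -` (A' \<inter> {w\<in>space W2. pos (s + t) w \<in> B}) \<inter> space Pr))"
      by (intro em sets.Int A'2 measurable_Collect_in[OF pos_measurable B])
    also have "A \<inter> (shifted i j r -` (A' \<inter> {w\<in>space W2. pos (s + t) w \<in> B}) \<inter> space Pr) =
      ?A \<inter> {\<omega>\<in>space Pr. pair_point (snd (V i \<omega>) (r + s + t)) (snd (V j \<omega>) (r + s + t)) \<in> B}"
      using measurable_space[OF shifted_measurable] st by (auto simp: pos_shifted add.assoc)
    also have "emeasure Pr \<dots> = (\<integral>\<^sup>+\<omega>\<in>?A. emeasure (P 2 t (pair_point (snd (V i \<omega>) (r + s)) (snd (V j \<omega>) (r + s)))) B \<partial>Pr)"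
      using one_step_Markov[OF _ _ _ Af B, of "r + s + t" i j] ij st by simp
    also have "\<dots> = (\<integral>\<^sup>+\<omega>\<in>A. emeasure (P 2 t (pos s (shifted i j r \<omega>))) B * indicator A' (shifted i j r \<omega>) \<partial>Pr)"
      by (intro nn_integral_cong) (auto simp: pos_shifted[OF st(1)] split: split_indicator)
    also have "\<dots> = (\<integral>\<^sup>+w\<in>A'. emeasure (P 2 t (pos s w)) B \<partial>shifted_law i j r A)"
      by (intro nn_integral_shifted_law[symmetric] Aev borel_measurable_times_ennreal
          measurable_compose[OF pos_measurable Q_measurable] st B borel_measurable_indicator A'2)
    finally show "emeasure (shifted_law i j r A) (A' \<inter> {w\<in>space (shifted_law i j r A). pos (s + t) w \<in> B}) =
      (\<integral>\<^sup>+w\<in>A'. emeasure (P 2 t (pos s w)) B \<partial>shifted_law i j r A)" by (simp add: sp)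
  qed
qed

end

section \<open>Existence of the two-point laws\<close>

context flow_setting
begin

text \<open>A pair of versions realises the Markov law: this is \<open>shifted_law_Markov\<close>
  for a family with two members, observed from time 0 on the sure event.\<close>

lemma Markov_law_distr:
  assumes Y: "version 0 y Y" and Z: "version 0 z Z"
  shows "is_Markov_law \<delta> 2 (P 2) (pair_point y z) (distr Pr W2 (\<lambda>\<omega>. \<lambda>k\<in>{..<2}. if k = 0 then Y \<omega> else Z \<omega>))"
    and "(\<lambda>\<omega>. \<lambda>k\<in>{..<2}. if k = 0 then Y \<omega> else Z \<omega>) \<in> Pr \<rightarrow>\<^sub>M W2"
proof -
  define V where "V = (\<lambda>i::nat. if i = 0 then Y else Z)"
  interpret flow_family \<delta> Pr P \<psi> D \<Phi> V "\<lambda>_. 0" "\<lambda>i. if i = 0 then y else z"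
    by unfold_locales (use Y Z in \<open>auto simp: V_def\<close>)
  have shift0: "path_shift 0 f = f" if "f \<in> paths_from 0" for f :: "'m path"
    by (rule path_eqI[OF path_shift_paths that]) (use that in \<open>auto simp: paths_from_def\<close>)
  have eq: "shifted 0 1 0 \<omega> = (\<lambda>k\<in>{..<2}. if k = 0 then Y \<omega> else Z \<omega>)" if "\<omega> \<in> space Pr" for \<omega>
    unfolding shifted_def
    by (rule restrict_ext) (use shift0 versionD(1)[OF Y that] versionD(1)[OF Z that] in \<open>auto simp: V_def\<close>)
  show meas: "(\<lambda>\<omega>. \<lambda>k\<in>{..<2}. if k = 0 then Y \<omega> else Z \<omega>) \<in> Pr \<rightarrow>\<^sub>M W2"
    using shifted_measurable[of 0 1 0] by (subst (asm) measurable_cong[OF eq])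
  let ?\<mu> = "distr Pr W2 (\<lambda>\<omega>. \<lambda>k\<in>{..<2}. if k = 0 then Y \<omega> else Z \<omega>)"
  have "shifted_law 0 1 0 (space Pr) = distr (density Pr (indicator (space Pr))) W2 (\<lambda>\<omega>. \<lambda>k\<in>{..<2}. if k = 0 then Y \<omega> else Z \<omega>)"
    unfolding shifted_law_def by (rule distr_cong) (use eq in auto)
  also have "density Pr (indicator (space Pr)) = density Pr (\<lambda>_. 1)"
    by (rule density_cong) auto
  finally have law: "shifted_law 0 1 0 (space Pr) = ?\<mu>" by (simp only: density_1)
  have top: "space Pr \<in> sets (filt 0)" using sets.top[of "filt 0"] by simp
  have "AE w in ?\<mu>. pos 0 w = pair_point y z"
  proof (subst AE_distr_iff[OF meas])
    show "{w\<in>space W2. pos 0 w = pair_point y z} \<in> sets W2"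
    proof -
      have "{w\<in>space W2. pos 0 w = pair_point y z} = {w\<in>space W2. snd (w 0) 0 = y \<and> snd (w 1) 0 = z}"
        by (auto simp: path_position_def pair_point_def fun_eq_iff less_2_cases_iff)
      also have "\<dots> = {w\<in>space W2. snd (w 0) 0 \<in> {y}} \<inter> {w\<in>space W2. snd (w 1) 0 \<in> {z}}"
        by auto
      also have "\<dots> \<in> sets W2"
        by (intro sets.Int measurable_Collect_in[OF measurable_compose[OF coordinate_measurable eval_measurable]]) auto
      finally show ?thesis .
    qed
    show "AE \<omega> in Pr. pos 0 (\<lambda>k\<in>{..<2}. if k = 0 then Y \<omega> else Z \<omega>) = pair_point y z"
      using versionD(2)[OF Y] versionD(2)[OF Z]
      by (intro AE_I2) (auto simp: path_position_def pair_point_def fun_eq_iff)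
  qed
  then show "is_Markov_law \<delta> 2 (P 2) (pair_point y z) ?\<mu>"
    unfolding is_Markov_law_iff using shifted_law_Markov[where i=0 and j=1 and r=0, OF _ _ top] prob_space_distr[OF meas]
    by (simp add: law[unfolded One_nat_def])
qed

lemma Markov_law_eq:
  assumes Y: "version 0 y Y" and Z: "version 0 z Z"
  shows "Markov_law \<delta> P 2 (pair_point y z) = distr Pr W2 (\<lambda>\<omega>. \<lambda>k\<in>{..<2}. if k = 0 then Y \<omega> else Z \<omega>)"
  unfolding Markov_law_def
  by (rule the_equality) (use Markov_law_distr(1)[OF Y Z] is_Markov_law_unique in blast)+

lemma Markov_law:
  assumes "x \<in> space M2"
  shows "is_Markov_law \<delta> 2 (P 2) x (Markov_law \<delta> P 2 x)"
proof -
  obtain Y where Y: "version 0 (x 0) Y" using ex_version by blast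
  obtain Z where Z: "version 0 (x 1) Z" using ex_version by blast
  have "pair_point (x 0) (x 1) = x" using assms by (intro pair_point_eta) (simp add: space_M2)
  then show ?thesis using Markov_law_distr(1)[OF Y Z] Markov_law_eq[OF Y Z] by simp
qed

end

context flow_family
begin

text \<open>The pair after r, restricted to A, has the Markov property and is therefore a mixture of
  Markov laws over its positions at r.\<close>

lemma Markov_at_time:
  assumes ij: "\<alpha> i \<le> r" "\<alpha> j \<le> r" and A: "A \<in> sets (filt r)" and h: "h \<in> borel_measurable W2"
  shows "(\<integral>\<^sup>+\<omega>\<in>A. h (shifted i j r \<omega>) \<partial>Pr) =
    (\<integral>\<^sup>+\<omega>\<in>A. (\<integral>\<^sup>+w. h w \<partial>Markov_law \<delta> P 2 (pair_point (snd (V i \<omega>) r) (snd (V j \<omega>) r))) \<partial>Pr)"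
proof -
  have Aev: "A \<in> sets Pr" using A filt_events by blast
  note M = shifted_law_Markov[OF ij A]
  note KM = measurable_prob_algebraD[OF Markov_kernel[OF Markov_law]]
  have "(\<integral>\<^sup>+\<omega>\<in>A. h (shifted i j r \<omega>) \<partial>Pr) = (\<integral>\<^sup>+w. h w \<partial>shifted_law i j r A)"
    by (rule nn_integral_shifted_law[OF Aev h, symmetric])
  also have "\<dots> = (\<integral>\<^sup>+w. (\<integral>\<^sup>+v. h v \<partial>Markov_law \<delta> P 2 (pos 0 w)) \<partial>shifted_law i j r A)"
    by (rule Markov_disintegration[OF Markov_law M(2,3,1) h])
  also have "\<dots> = (\<integral>\<^sup>+\<omega>\<in>A. (\<integral>\<^sup>+v. h v \<partial>Markov_law \<delta> P 2 (pos 0 (shifted i j r \<omega>))) \<partial>Pr)"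
    by (intro nn_integral_shifted_law Aev measurable_compose[OF pos_measurable]
        measurable_compose[OF KM nn_integral_measurable_subprob_algebra] h)
  finally show ?thesis by (simp add: pos_shifted)
qed

end

section \<open>The radii in the definition of \<open>\<theta>\<close>\<close>

text \<open>Continuous upper bounds of the indicator of {c..}, converging to it; for m > 0 they
  vanish up to c - 1 / m. Continuity of expectations in the starting points is available for such
  functions, not for the indicator.\<close>

definition ramp :: "real \<Rightarrow> nat \<Rightarrow> real \<Rightarrow> real" where
  "ramp c m t = max 0 (min 1 (1 - real m * (c - t)))"

lemma ramp_bounds: "0 \<le> ramp c m t" "ramp c m t \<le> 1"
  by (auto simp: ramp_def)

lemma ramp_ge: "c \<le> t \<Longrightarrow> ramp c m t = 1"
  by (simp add: ramp_def mult_nonneg_nonpos)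

lemma continuous_ramp: "continuous_on UNIV (ramp c m)"
  unfolding ramp_def[abs_def] by (intro continuous_intros)

lemma ramp_limit: "(\<lambda>m. ramp c m t) \<longlonglongrightarrow> indicator {c..} t"
proof (cases "c \<le> t")
  case False
  obtain N :: nat where N: "1 / (c - t) \<le> N" using real_arch_simple by blast
  have "ramp c m t = 0" if "m \<ge> N" for m
  proof -
    have "1 / (c - t) \<le> real m" using N that by linarith
    then have "1 \<le> real m * (c - t)" using False by (simp add: field_simps)
    then show ?thesis by (simp add: ramp_def)
  qed
  then have "\<forall>\<^sub>F m in sequentially. ramp c m t = indicator {c..} t"
    using False by (auto simp: eventually_sequentially)
  then show ?thesis by (rule tendsto_eventually)
qed (simp add: ramp_ge)

context path_space
begin

lemma path_dist_tendsto:
  assumes G: "\<And>n. G n \<in> paths" "f \<in> paths" "(\<lambda>n. path_dist \<delta> (G n) f) \<longlonglongrightarrow> 0"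
    and G': "\<And>n. G' n \<in> paths" "f' \<in> paths" "(\<lambda>n. path_dist \<delta> (G' n) f') \<longlonglongrightarrow> 0"
  shows "(\<lambda>n. path_dist \<delta> (G n) (G' n)) \<longlonglongrightarrow> path_dist \<delta> f f'"
proof -
  have "dist (path_dist \<delta> (G n) (G' n)) (path_dist \<delta> f f') \<le> path_dist \<delta> (G n) f + path_dist \<delta> (G' n) f'" for n
  proof -
    have "path_dist \<delta> (G n) (G' n) \<le> path_dist \<delta> (G n) f + (path_dist \<delta> f f' + path_dist \<delta> f' (G' n))"
      using paths.triangle[of "G n" f "G' n"] paths.triangle[of f f' "G' n"] G G' by simp
    moreover have "path_dist \<delta> f f' \<le> path_dist \<delta> f (G n) + (path_dist \<delta> (G n) (G' n) + path_dist \<delta> (G' n) f')"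
      using paths.triangle[of f "G n" f'] paths.triangle[of "G n" "G' n" f'] G G' by simp
    ultimately show ?thesis
      using paths.commute[of f "G n"] paths.commute[of f' "G' n"] by (simp add: dist_real_def)
  qed
  then have bound: "\<forall>\<^sub>F n in sequentially. dist (path_dist \<delta> (G n) (G' n)) (path_dist \<delta> f f') \<le> path_dist \<delta> (G n) f + path_dist \<delta> (G' n) f'"
    by (intro always_eventually allI)
  have lim: "(\<lambda>n. path_dist \<delta> (G n) f + path_dist \<delta> (G' n) f') \<longlonglongrightarrow> 0"
    using tendsto_add[OF G(3) G'(3)] by simp
  have "(\<lambda>n. dist (path_dist \<delta> (G n) (G' n)) (path_dist \<delta> f f')) \<longlonglongrightarrow> 0"
    by (rule tendsto_sandwich[OF _ bound tendsto_const lim]) simp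
  then show ?thesis by (simp add: tendsto_dist_iff[symmetric])
qed

lemma path_shift_tendsto:
  fixes f :: "'m path"
  assumes f: "f \<in> paths" and t: "t \<longlonglongrightarrow> u"
  shows "(\<lambda>n. path_dist \<delta> (path_shift (t n) f) (path_shift u f)) \<longlonglongrightarrow> 0"
proof (subst path_dist_tendsto_iff)
  show "path_shift (t n) f \<in> paths" "path_shift u f \<in> paths" for n
    using path_shift_paths[OF f] paths_fromD(1) by blast+
  have "uniform_limit K (\<lambda>n. snd (path_shift (t n) f)) (snd (path_shift u f)) sequentially" if K: "compact K" for K
  proof (rule uniform_limitI)
    fix e :: real assume e: "e > 0"
    obtain R where R: "\<And>x. x \<in> K \<Longrightarrow> \<bar>x\<bar> \<le> R"
      using compact_imp_bounded[OF K] by (auto simp: bounded_iff)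
    \<comment> \<open>Large enough to contain t n + max 0 x for all x in K once t n is within 1 of
      u.\<close>
    define I where "I = {u - 1 .. u + 1 + \<bar>R\<bar>}"
    have "uniformly_continuous_on I (snd f)"
      unfolding I_def by (rule compact_uniformly_continuous) (auto intro: continuous_on_subset paths_continuous[OF f])
    from this[unfolded uniformly_continuous_on_def, rule_format, OF e]
    obtain d where d: "d > 0" "\<And>x y. x \<in> I \<Longrightarrow> y \<in> I \<Longrightarrow> dist y x < d \<Longrightarrow> dist (snd f y) (snd f x) < e"
      by auto
    have "min d 1 > 0" using d by simp
    from tendstoD[OF t this]
    show "\<forall>\<^sub>F n in sequentially. \<forall>x\<in>K. dist (snd (path_shift (t n) f) x) (snd (path_shift u f) x) < e"
    proof eventually_elim
      case (elim n)
      show ?case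
      proof
        fix x assume "x \<in> K"
        then have x: "max 0 x \<le> \<bar>R\<bar>" using R[of x] by auto
        have a: "t n + max 0 x \<in> I" "u + max 0 x \<in> I"
          using elim x by (auto simp: I_def dist_real_def abs_less_iff max_def)
        show "dist (snd (path_shift (t n) f) x) (snd (path_shift u f) x) < e"
          using d(2)[OF a(2) a(1)] elim by (simp add: dist_real_def)
      qed
    qed
  qed
  then show "(\<lambda>n. fst (path_shift (t n) f)) \<longlonglongrightarrow> fst (path_shift u f) \<and>
      (\<forall>K. compact K \<longrightarrow> uniform_limit K (\<lambda>n. snd (path_shift (t n) f)) (snd (path_shift u f)) sequentially)"
    by simp
qed

end

section \<open>Continuity of the two-point motion in its starting points\<close>

context flow_setting
begin

text \<open>The second clause is a compactness condition: for almost every realization, versions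
  with bounded starting points stay in one compact set of paths.\<close>

definition regular_version :: "real \<Rightarrow> 'm \<Rightarrow> ('w \<Rightarrow> 'm path) \<Rightarrow> bool" where
  "regular_version s y Z \<longleftrightarrow> version s y Z \<and>
     (AE \<omega> in Pr. Z \<omega> \<in> path_topology \<delta> closure_of skeleton_tails (\<Phi> \<omega>) ({s} \<times> cball y 1))"

text \<open>\<open>flow_AE_subseq\<close> gives convergence at rational times along a subsequence.
  The starting points are bounded, so all paths lie in one compact set, where this implies
  convergence of paths.\<close>

lemma regular_versions_converge:
  assumes Y: "\<And>n. regular_version s (y n) (Y n)" and Z: "version s z Z" and lim: "y \<longlonglongrightarrow> z"
  obtains r where "strict_mono r" "AE \<omega> in Pr. (\<lambda>n. path_dist \<delta> (Y (r n) \<omega>) (Z \<omega>)) \<longlonglongrightarrow> 0"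
proof -
  have Yv: "version s (y n) (Y n)" for n using Y by (simp add: regular_version_def)
  define S where "S = insert s {q\<in>\<rat>. s < q}"
  have "countable {q\<in>\<rat>. s < q}" by (rule countable_subset[OF _ countable_rat]) auto
  then have S: "countable S" "S \<noteq> {}" by (auto simp: S_def)
  define T where "T = from_nat_into S"
  have T: "range T = S" unfolding T_def by (rule range_from_nat_into[OF S(2,1)])
  then have Ts: "s \<le> T i" for i using rangeI[of T i] by (auto simp: S_def)
  obtain r where r: "strict_mono r"
    "AE \<omega> in Pr. \<forall>i. (\<lambda>n. \<psi> s (T i) \<omega> (y (r n))) \<longlonglongrightarrow> \<psi> s (T i) \<omega> z"
    using flow_AE_subseq[of s T "\<lambda>_. s" y z, OF Ts order_refl tendsto_const lim] by blast
  obtain R where R: "\<And>n. dist z (y n) \<le> R"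
    using convergent_imp_bounded[OF lim] by (auto simp: bounded_any_center[of _ z])
  have "AE \<omega> in Pr. \<forall>n. Y n \<omega> \<in> path_topology \<delta> closure_of skeleton_tails (\<Phi> \<omega>) ({s} \<times> cball (y n) 1)"
    using Y unfolding AE_all_countable regular_version_def by blast
  moreover have "AE \<omega> in Pr. \<forall>n i. snd (Y n \<omega>) (T i) = \<psi> s (T i) \<omega> (y n)"
    unfolding AE_all_countable using versionD(4)[OF Yv Ts] by blast
  moreover have "AE \<omega> in Pr. \<forall>i. snd (Z \<omega>) (T i) = \<psi> s (T i) \<omega> z"
    unfolding AE_all_countable using versionD(4)[OF Z Ts] by blast
  ultimately have "AE \<omega> in Pr. (\<lambda>n. path_dist \<delta> (Y (r n) \<omega>) (Z \<omega>)) \<longlonglongrightarrow> 0"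
    using r(2) skel AE_space
  proof eventually_elim
    case (elim \<omega>)
    have cpt: "compact ({s} \<times> cball z (R + 1))" by (intro compact_Times) auto
    note K = compact_skeleton_tails(1)[OF elim(5) cpt]
    show ?case
    proof (rule compact_pointwise_imp_limit[OF K])
      show "Y (r n) \<omega> \<in> path_topology \<delta> closure_of skeleton_tails (\<Phi> \<omega>) ({s} \<times> cball z (R + 1))" for n
      proof -
        have "cball (y (r n)) 1 \<subseteq> cball z (R + 1)"
        proof
          fix v assume "v \<in> cball (y (r n)) 1"
          then show "v \<in> cball z (R + 1)"
            using R[of "r n"] dist_triangle[of z v "y (r n)"] by simp
        qed
        then have "skeleton_tails (\<Phi> \<omega>) ({s} \<times> cball (y (r n)) 1) \<subseteq> skeleton_tails (\<Phi> \<omega>) ({s} \<times> cball z (R + 1))"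
          unfolding skeleton_tails_def by blast
        from closure_of_mono[OF this] show ?thesis using elim(1) by blast
      qed
      show "Y (r n) \<omega> \<in> paths_from s" for n by (rule versionD(1)[OF Yv elim(6)])
      show "Z \<omega> \<in> paths_from s" by (rule versionD(1)[OF Z elim(6)])
      fix q :: real assume "q \<in> \<rat>" "s < q"
      then have "q \<in> range T" by (simp add: T S_def)
      then obtain i where "q = T i" by auto
      then show "(\<lambda>n. snd (Y (r n) \<omega>) q) \<longlonglongrightarrow> snd (Z \<omega>) q"
        using elim(2,3,4) by simp
    qed
  qed
  with r(1) show thesis by (rule that)
qed

text \<open>One fixed choice for each starting point at time 0. Measurability in y is not claimed
  for it; it is available for the laws of pairs.\<close>

definition vers :: "'m \<Rightarrow> 'w \<Rightarrow> 'm path" where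
  "vers y = (SOME Z. regular_version 0 y Z)"

lemma vers: "regular_version 0 y (vers y)"
proof -
  have "\<exists>Z. regular_version 0 y Z" unfolding regular_version_def by (rule ex_version)
  then show ?thesis unfolding vers_def by (rule someI_ex)
qed

lemma vers_version: "version 0 y (vers y)"
  using vers by (simp add: regular_version_def)

lemma vers_paths: "\<omega> \<in> space Pr \<Longrightarrow> vers y \<omega> \<in> paths"
  using versionD(1)[OF vers_version] paths_fromD(1) by blast

definition pair_gap :: "'m \<times> 'm \<Rightarrow> 'w \<Rightarrow> real" where
  "pair_gap p \<omega> = path_dist \<delta> (vers (fst p) \<omega>) (vers (snd p) \<omega>)"

lemma pair_gap_measurable: "pair_gap p \<in> borel_measurable Pr"
  unfolding pair_gap_def[abs_def]
  by (intro path_dist_measurable version_path_measurable[OF vers_version])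

text \<open>Almost sure convergence holds only along subsequences, so the proof is indirect: a
  subsequence staying at distance e from the limit would contain one that converges to it.\<close>

lemma pair_gap_expectation_continuous:
  assumes \<phi>: "continuous_on UNIV \<phi>" and bd: "\<And>t. \<bar>\<phi> t\<bar> \<le> (1::real)" and p: "p \<longlonglongrightarrow> q"
  shows "(\<lambda>n. \<integral>\<omega>. \<phi> (pair_gap (p n) \<omega>) \<partial>Pr) \<longlonglongrightarrow> (\<integral>\<omega>. \<phi> (pair_gap q \<omega>) \<partial>Pr)"
proof (rule ccontr)
  let ?H = "\<lambda>p. \<integral>\<omega>. \<phi> (pair_gap p \<omega>) \<partial>Pr"
  assume "\<not> (\<lambda>n. ?H (p n)) \<longlonglongrightarrow> ?H q"
  then obtain e where e: "e > 0" "\<And>N. \<exists>n\<ge>N. dist (?H (p n)) (?H q) \<ge> e"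
    by (auto simp: LIMSEQ_def not_less)
  then have "infinite {n. dist (?H (p n)) (?H q) \<ge> e}"
    by (auto simp: infinite_nat_iff_unbounded_le)
  from infinite_enumerate[OF this]
  obtain r0 where r0: "strict_mono (r0 :: nat \<Rightarrow> nat)" "\<And>n. dist (?H (p (r0 n))) (?H q) \<ge> e"
    by auto
  have p0: "(\<lambda>n. p (r0 n)) \<longlonglongrightarrow> q" using LIMSEQ_subseq_LIMSEQ[OF p r0(1)] by (simp add: o_def)
  \<comment> \<open>r1 makes the first components converge, r2 then the second ones along
    r1.\<close>
  obtain r1 where r1: "strict_mono r1"
    "AE \<omega> in Pr. (\<lambda>n. path_dist \<delta> (vers (fst (p (r0 (r1 n)))) \<omega>) (vers (fst q) \<omega>)) \<longlonglongrightarrow> 0"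
    using regular_versions_converge[OF vers vers_version tendsto_fst[OF p0]] .
  have p1: "(\<lambda>n. p (r0 (r1 n))) \<longlonglongrightarrow> q" using LIMSEQ_subseq_LIMSEQ[OF p0 r1(1)] by (simp add: o_def)
  obtain r2 where r2: "strict_mono r2"
    "AE \<omega> in Pr. (\<lambda>n. path_dist \<delta> (vers (snd (p (r0 (r1 (r2 n))))) \<omega>) (vers (snd q) \<omega>)) \<longlonglongrightarrow> 0"
    using regular_versions_converge[OF vers vers_version tendsto_snd[OF p1]] .
  have meas: "(\<lambda>\<omega>. \<phi> (pair_gap p \<omega>)) \<in> borel_measurable Pr" for p
    by (rule measurable_compose[OF pair_gap_measurable borel_measurable_continuous_onI[OF \<phi>]])
  have "(\<lambda>n. ?H (p (r0 (r1 (r2 n))))) \<longlonglongrightarrow> ?H q"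
  proof (rule integral_dominated_convergence[where w="\<lambda>_. 1"])
    show "AE \<omega> in Pr. (\<lambda>n. \<phi> (pair_gap (p (r0 (r1 (r2 n)))) \<omega>)) \<longlonglongrightarrow> \<phi> (pair_gap q \<omega>)"
      using r1(2) r2(2) AE_space
    proof eventually_elim
      case (elim \<omega>)
      have "(\<lambda>n. path_dist \<delta> (vers (fst (p (r0 (r1 (r2 n))))) \<omega>) (vers (fst q) \<omega>)) \<longlonglongrightarrow> 0"
        using LIMSEQ_subseq_LIMSEQ[OF elim(1) r2(1)] by (simp add: o_def)
      then have "(\<lambda>n. pair_gap (p (r0 (r1 (r2 n)))) \<omega>) \<longlonglongrightarrow> pair_gap q \<omega>"
        unfolding pair_gap_def by (intro path_dist_tendsto vers_paths elim)
      moreover have "isCont \<phi> (pair_gap q \<omega>)" using \<phi> by (simp add: continuous_on_eq_continuous_at)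
      ultimately show ?case using isCont_tendsto_compose by blast
    qed
  qed (use bd in \<open>auto intro: meas\<close>)
  from tendstoD[OF this e(1)] show False
    using r0(2) by (auto simp: eventually_sequentially not_less[symmetric])
qed

section \<open>Gap probabilities and the radii\<close>

definition gap_prob :: "real \<Rightarrow> 'm \<times> 'm \<Rightarrow> real" where
  "gap_prob c p = prob {\<omega>\<in>space Pr. c \<le> pair_gap p \<omega>}"

lemma gap_functional_measurable: "(\<lambda>w. path_dist \<delta> (w 0) (w 1)) \<in> borel_measurable W2"
  by (intro path_dist_measurable coordinate_measurable) auto

lemma nn_integral_Markov_law_gap:
  assumes "f \<in> borel_measurable borel"
  shows "(\<integral>\<^sup>+w. f (path_dist \<delta> (w 0) (w 1)) \<partial>Markov_law \<delta> P 2 (pair_point y z)) = (\<integral>\<^sup>+\<omega>. f (pair_gap (y, z) \<omega>) \<partial>Pr)"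
  unfolding Markov_law_eq[OF vers_version vers_version]
  by (subst nn_integral_distr[OF Markov_law_distr(2)[OF vers_version vers_version]])
    (use measurable_compose[OF gap_functional_measurable assms] in \<open>auto simp: pair_gap_def\<close>)

text \<open>Identifies the probability in \<open>theta_radius\<close>, so that the radii can be
  studied through \<open>pair_gap\<close> on the given probability space.\<close>

lemma measure_Markov_law_gap:
  "measure (Markov_law \<delta> P 2 (pair_point y z)) {w\<in>space W2. path_dist \<delta> (w 0) (w 1) \<ge> c} = gap_prob c (y, z)"
proof -
  have S: "{w\<in>space W2. path_dist \<delta> (w 0) (w 1) \<in> {c..}} \<in> sets W2"
    by (rule measurable_Collect_in[OF gap_functional_measurable]) auto
  show ?thesis
    unfolding Markov_law_eq[OF vers_version vers_version] gap_prob_def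
    by (subst measure_distr[OF Markov_law_distr(2)[OF vers_version vers_version]])
      (use S measurable_space[OF Markov_law_distr(2)[OF vers_version vers_version]] in
        \<open>auto simp: pair_gap_def intro!: arg_cong[where f=prob]\<close>)
qed

lemma gap_event: "{\<omega>\<in>space Pr. c \<le> pair_gap p \<omega>} \<in> sets Pr"
  using measurable_Collect_in[OF pair_gap_measurable, of "{c..}"] by simp

lemma gap_prob_limit: "(\<lambda>m. \<integral>\<omega>. ramp c m (pair_gap p \<omega>) \<partial>Pr) \<longlonglongrightarrow> gap_prob c p"
proof -
  have "(\<lambda>m. \<integral>\<omega>. ramp c m (pair_gap p \<omega>) \<partial>Pr) \<longlonglongrightarrow> (\<integral>\<omega>. indicator {c..} (pair_gap p \<omega>) \<partial>Pr)"
    by (rule integral_dominated_convergence[where w="\<lambda>_. 1"])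
      (auto simp: ramp_bounds ramp_limit intro: measurable_compose[OF pair_gap_measurable]
        borel_measurable_continuous_onI[OF continuous_ramp])
  also have "(\<integral>\<omega>. indicator {c..} (pair_gap p \<omega>) \<partial>Pr) = (\<integral>\<omega>. indicator {\<omega>\<in>space Pr. c \<le> pair_gap p \<omega>} \<omega> \<partial>Pr)"
    by (intro Bochner_Integration.integral_cong) (auto split: split_indicator)
  also have "\<dots> = gap_prob c p" using gap_event[of c p] by (simp add: gap_prob_def)
  finally show ?thesis .
qed

lemma gap_prob_le_ramp: "gap_prob c p \<le> (\<integral>\<omega>. ramp c m (pair_gap p \<omega>) \<partial>Pr)"
proof -
  have "gap_prob c p = (\<integral>\<omega>. indicator {\<omega>\<in>space Pr. c \<le> pair_gap p \<omega>} \<omega> \<partial>Pr)"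
    using gap_event[of c p] by (simp add: gap_prob_def)
  also have "\<dots> \<le> (\<integral>\<omega>. ramp c m (pair_gap p \<omega>) \<partial>Pr)"
  proof (rule integral_mono)
    show "integrable Pr (\<lambda>\<omega>. ramp c m (pair_gap p \<omega>))"
      by (rule integrable_const_bound[of _ 1])
        (auto simp: ramp_bounds intro: measurable_compose[OF pair_gap_measurable]
          borel_measurable_continuous_onI[OF continuous_ramp])
    show "integrable Pr (indicator {\<omega>\<in>space Pr. c \<le> pair_gap p \<omega>} :: 'w \<Rightarrow> real)"
      using gap_event[of c p] by (intro integrable_real_indicator) (auto simp: emeasure_eq_measure)
  qed (auto simp: ramp_bounds ramp_ge split: split_indicator)
  finally show ?thesis .
qed

text \<open>\<open>gap_prob\<close> is approached from above by expectations that are continuous in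
  the pair, hence it is upper semicontinuous.\<close>

lemma gap_prob_closed: "closed {p. a \<le> gap_prob c p}"
  unfolding closed_sequential_limits
proof (intro allI impI)
  fix p q assume "(\<forall>n. p n \<in> {p. a \<le> gap_prob c p}) \<and> p \<longlonglongrightarrow> q"
  then have p: "\<And>n. a \<le> gap_prob c (p n)" "p \<longlonglongrightarrow> q" by auto
  have "a \<le> (\<integral>\<omega>. ramp c m (pair_gap q \<omega>) \<partial>Pr)" for m
  proof (rule LIMSEQ_le_const)
    show "(\<lambda>n. \<integral>\<omega>. ramp c m (pair_gap (p n) \<omega>) \<partial>Pr) \<longlonglongrightarrow> (\<integral>\<omega>. ramp c m (pair_gap q \<omega>) \<partial>Pr)"
      by (rule pair_gap_expectation_continuous[OF continuous_ramp _ p(2)]) (simp add: ramp_bounds)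
    show "\<exists>N. \<forall>n\<ge>N. a \<le> (\<integral>\<omega>. ramp c m (pair_gap (p n) \<omega>) \<partial>Pr)"
      using p(1) gap_prob_le_ramp order_trans by blast
  qed
  then have "a \<le> gap_prob c q" by (intro LIMSEQ_le_const[OF gap_prob_limit]) auto
  then show "q \<in> {p. a \<le> gap_prob c p}" by simp
qed

abbreviation "radius \<equiv> theta_radius \<delta> P"

text \<open>The infimum and the supremum disappear together: the supremum over a ball exceeds the
  level exactly if some point of the ball does, and dist x y < c leaves room for a radius strictly
  between.\<close>

lemma radius_less_iff:
  "radius k x < c \<longleftrightarrow> ereal ((1 / 2) ^ k) < c \<or> (\<exists>y. ereal (dist x y) < c \<and> (1 / 2) ^ k < gap_prob ((1 / 2) ^ k) (x, y))"
proof -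
  let ?q = "(1 / 2) ^ k :: real"
  have sup: "?q < (SUP y\<in>cball x r. gap_prob ?q (x, y)) \<longleftrightarrow> (\<exists>y\<in>cball x r. ?q < gap_prob ?q (x, y))" if "0 < r" for r
    by (rule less_cSUP_iff) (use that in \<open>auto intro!: bdd_aboveI2[of _ _ 1] simp: gap_prob_def\<close>)
  have "Inf {ereal r | r. 0 < r \<and> ?q < (SUP y\<in>cball x r. gap_prob ?q (x, y))} < c \<longleftrightarrow>
      (\<exists>y. ereal (dist x y) < c \<and> ?q < gap_prob ?q (x, y))"
    unfolding Inf_less_iff
  proof
    assume "\<exists>v\<in>{ereal r | r. 0 < r \<and> ?q < (SUP y\<in>cball x r. gap_prob ?q (x, y))}. v < c"
    then obtain r where r: "0 < r" "ereal r < c" "?q < (SUP y\<in>cball x r. gap_prob ?q (x, y))" by auto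
    then obtain y where "dist x y \<le> r" "?q < gap_prob ?q (x, y)" using sup by auto
    then show "\<exists>y. ereal (dist x y) < c \<and> ?q < gap_prob ?q (x, y)"
      using r(2) le_less_trans[of "ereal (dist x y)" "ereal r" c] by auto
  next
    assume "\<exists>y. ereal (dist x y) < c \<and> ?q < gap_prob ?q (x, y)"
    then obtain y where y: "ereal (dist x y) < c" "?q < gap_prob ?q (x, y)" by auto
    obtain r where r: "ereal (dist x y) < ereal r" "ereal r < c" using ereal_dense2[OF y(1)] by blast
    then have "dist x y < r" by simp
    then have "0 < r" using zero_le_dist[of x y] by linarith
    moreover have "?q < (SUP y\<in>cball x r. gap_prob ?q (x, y))"
      using sup[OF \<open>0 < r\<close>] y(2) \<open>dist x y < r\<close> by auto
    ultimately show "\<exists>v\<in>{ereal r | r. 0 < r \<and> ?q < (SUP y\<in>cball x r. gap_prob ?q (x, y))}. v < c"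
      using r(2) by auto
  qed
  then show ?thesis
    unfolding theta_radius_def measure_Markov_law_gap min_less_iff_disj by blast
qed

text \<open>A point y violating the bound would by itself force the radius to be at most dist x
  y.\<close>

lemma gap_prob_within_radius:
  assumes "ereal (dist x y) < radius k x"
  shows "gap_prob ((1 / 2) ^ k) (x, y) \<le> (1 / 2) ^ k"
proof (rule ccontr)
  assume "\<not> ?thesis"
  with assms have "radius k x < radius k x"
    by (subst radius_less_iff) (auto simp: not_le)
  then show False by simp
qed

text \<open>A path has distance 0 from itself, so the diagonal lies in the open set where the gap
  probability is below 2^(-k).\<close>

lemma radius_pos: "0 < radius k x"
proof -
  let ?q = "(1 / 2) ^ k :: real"
  let ?S = "- {p. ?q \<le> gap_prob ?q p}"
  have S: "open ?S" using gap_prob_closed by auto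
  have "pair_gap (x, x) \<omega> = 0" if "\<omega> \<in> space Pr" for \<omega>
    using vers_paths[OF that, of x] by (simp add: pair_gap_def)
  then have "{\<omega>\<in>space Pr. ?q \<le> pair_gap (x, x) \<omega>} = {}" by (auto simp: not_le)
  then have "gap_prob ?q (x, x) = 0" by (simp only: gap_prob_def measure_empty)
  moreover have "0 < ?q" by simp
  ultimately have "(x, x) \<in> ?S" by (simp del: zero_less_power zero_less_divide_iff)
  with S obtain e where e: "e > 0" "ball (x, x) e \<subseteq> ?S" by (meson open_contains_ball)
  have small: "gap_prob ?q (x, y) < ?q" if "dist x y < e" for y
  proof -
    have "(x, y) \<in> ball (x, x) e" using that by (simp add: dist_Pair_Pair)
    with e(2) have "(x, y) \<in> ?S" by blast
    then show ?thesis by simp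
  qed
  have "\<not> radius k x < ereal (min e ?q)"
    unfolding radius_less_iff using small by (auto simp: not_less less_imp_le)
  then have "ereal (min e ?q) \<le> radius k x" by (simp only: not_less)
  moreover have "0 < ereal (min e ?q)" using e(1) by simp
  ultimately show ?thesis by (rule less_le_trans[rotated])
qed

text \<open>Apart from the cutoff 2^(-k), the set {radius < c} is a countable union of closed sets:
  rational R < c and a margin 1 / Suc m replace the two strict inequalities. Closedness uses that
  bounded sequences of the points y have convergent subsequences, and the upper semicontinuity of
  \<open>gap_prob\<close>.\<close>

lemma radius_measurable: "radius k \<in> borel_measurable borel"
proof (rule borel_measurableI_less)
  fix c :: ereal
  let ?q = "(1 / 2) ^ k :: real"
  define A where "A = (\<lambda>R m. {x. \<exists>y. dist x y \<le> R \<and> ?q + 1 / Suc m \<le> gap_prob ?q (x, y)})"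
  have A: "closed (A R m)" for R m
    unfolding closed_sequential_limits
  proof (intro allI impI)
    fix X x assume "(\<forall>n. X n \<in> A R m) \<and> X \<longlonglongrightarrow> x"
    then have X: "\<And>n. X n \<in> A R m" "X \<longlonglongrightarrow> x" by auto
    then obtain Y where Y: "\<And>n. dist (X n) (Y n) \<le> R" "\<And>n. ?q + 1 / Suc m \<le> gap_prob ?q (X n, Y n)"
      unfolding A_def mem_Collect_eq by metis
    obtain B where B: "\<And>n. dist x (X n) \<le> B"
      using convergent_imp_bounded[OF X(2)] by (auto simp: bounded_any_center[of _ x])
    have "dist x (Y n) \<le> B + R" for n
      using dist_triangle[of x "Y n" "X n"] B[of n] Y(1)[of n] by linarith
    then have "bounded (range Y)" by (auto simp: bounded_def)
    then obtain y r where r: "strict_mono (r :: nat \<Rightarrow> nat)" "(Y \<circ> r) \<longlonglongrightarrow> y"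
      using bounded_imp_convergent_subsequence by blast
    have Xr: "(X \<circ> r) \<longlonglongrightarrow> x" by (rule LIMSEQ_subseq_LIMSEQ[OF X(2) r(1)])
    have "(\<lambda>n. ((X \<circ> r) n, (Y \<circ> r) n)) \<longlonglongrightarrow> (x, y)" by (rule tendsto_Pair[OF Xr r(2)])
    from closed_sequentially[OF gap_prob_closed[of "?q + 1 / Suc m" ?q] _ this]
    have "(x, y) \<in> {p. ?q + 1 / Suc m \<le> gap_prob ?q p}" using Y(2) by simp
    moreover have "dist x y \<le> R"
      by (rule LIMSEQ_le_const2[OF tendsto_dist[OF Xr r(2)]]) (use Y(1) in auto)
    ultimately show "x \<in> A R m" by (auto simp: A_def)
  qed
  have "{x. radius k x < c} = (if ereal ?q < c then UNIV else (\<Union>R\<in>{R\<in>\<rat>. ereal R < c}. \<Union>m. A R m))"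
  proof (cases "ereal ?q < c")
    case False
    have "(\<exists>y. ereal (dist x y) < c \<and> ?q < gap_prob ?q (x, y)) \<longleftrightarrow> x \<in> (\<Union>R\<in>{R\<in>\<rat>. ereal R < c}. \<Union>m. A R m)" for x
    proof
      assume "\<exists>y. ereal (dist x y) < c \<and> ?q < gap_prob ?q (x, y)"
      then obtain y where y: "ereal (dist x y) < c" "?q < gap_prob ?q (x, y)" by auto
      obtain r where r: "ereal (dist x y) < ereal r" "ereal r < c" using ereal_dense2[OF y(1)] by blast
      obtain R where R: "R \<in> \<rat>" "dist x y < R" "R < r" using Rats_dense_in_real[of "dist x y" r] r by auto
      have "ereal R < c" using R(3) r(2) less_trans[of "ereal R" "ereal r" c] by simp
      moreover obtain m where "1 / Suc m < gap_prob ?q (x, y) - ?q"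
        using nat_approx_posE[of "gap_prob ?q (x, y) - ?q"] y(2) by auto
      then have "x \<in> A R m" using R(2) by (auto simp: A_def intro!: exI[of _ y])
      ultimately show "x \<in> (\<Union>R\<in>{R\<in>\<rat>. ereal R < c}. \<Union>m. A R m)" using R(1) by blast
    next
      assume "x \<in> (\<Union>R\<in>{R\<in>\<rat>. ereal R < c}. \<Union>m. A R m)"
      then obtain R m y where y: "ereal R < c" "dist x y \<le> R" "?q + 1 / Suc m \<le> gap_prob ?q (x, y)"
        by (auto simp: A_def)
      have "0 < 1 / real (Suc m)" by simp
      then have "?q < gap_prob ?q (x, y)" using y(3) by linarith
      moreover have "ereal (dist x y) < c" using y(1,2) le_less_trans[of "ereal (dist x y)" "ereal R" c] by simp
      ultimately show "\<exists>y. ereal (dist x y) < c \<and> ?q < gap_prob ?q (x, y)" by blast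
    qed
    then show ?thesis unfolding radius_less_iff using False by auto
  qed (auto simp: radius_less_iff)
  moreover have "countable {R\<in>\<rat>. ereal R < c}" by (rule countable_subset[OF _ countable_rat]) auto
  then have "(\<Union>R\<in>{R\<in>\<rat>. ereal R < c}. \<Union>m. A R m) \<in> sets borel"
    using A by (intro sets.countable_UN'' sets.countable_nat_UN) (auto intro: borel_closed)
  ultimately show "{x\<in>space borel. radius k x < c} \<in> sets borel" by simp
qed

end

section \<open>The strong Markov property and \<open>\<theta>\<close> at optional times\<close>

lemma nn_integral_eq_on_partition:
  fixes K :: "'a \<Rightarrow> int"
  assumes u: "u \<in> borel_measurable M" and v: "v \<in> borel_measurable M" and A: "A \<in> sets M"
    and K: "K \<in> M \<rightarrow>\<^sub>M count_space UNIV"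
    and eq: "\<And>k. (\<integral>\<^sup>+x\<in>A \<inter> {x\<in>space M. K x = k}. u x \<partial>M) = (\<integral>\<^sup>+x\<in>A \<inter> {x\<in>space M. K x = k}. v x \<partial>M)"
  shows "(\<integral>\<^sup>+x\<in>A. u x \<partial>M) = (\<integral>\<^sup>+x\<in>A. v x \<partial>M)"
proof -
  let ?A = "\<lambda>k. A \<inter> {x\<in>space M. K x = k}"
  have Ak: "?A k \<in> sets M" for k
    using measurable_Collect_in[OF K, of "{k}"] A by auto
  have UN: "(\<Union>k. ?A k) = A" using sets.sets_into_space[OF A] by auto
  have *: "(\<integral>\<^sup>+x\<in>A. u x \<partial>M) = (\<integral>\<^sup>+k. (\<integral>\<^sup>+x\<in>?A k. u x \<partial>M) \<partial>count_space UNIV)"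
    if u: "u \<in> borel_measurable M" for u
  proof -
    have "(\<integral>\<^sup>+x\<in>A. u x \<partial>M) = emeasure (density M u) (\<Union>k. ?A k)"
      unfolding UN using u A by (simp add: emeasure_density)
    also have "\<dots> = (\<integral>\<^sup>+k. emeasure (density M u) (?A k) \<partial>count_space UNIV)"
      using Ak by (intro emeasure_UN_countable) (auto simp: disjoint_family_on_def)
    also have "\<dots> = (\<integral>\<^sup>+k. (\<integral>\<^sup>+x\<in>?A k. u x \<partial>M) \<partial>count_space UNIV)"
      using u Ak by (intro nn_integral_cong) (simp add: emeasure_density)
    finally show ?thesis .
  qed
  show ?thesis unfolding *[OF u] *[OF v] eq ..
qed

text \<open>The distance to F is continuous along the path and attains its minimum on [a, b]. A
  rational left end covers the case a = b, and F must be nonempty because \<open>infdist\<close> to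
  the empty set is 0.\<close>

lemma hit_iff:
  fixes f :: "real \<Rightarrow> 'm::metric_space"
  assumes F: "closed F" and f: "continuous_on UNIV f" and ab: "a \<in> \<rat>" "a \<le> b"
  shows "(\<exists>t\<in>{a..b}. (t, f t) \<in> F) \<longleftrightarrow> F \<noteq> {} \<and> (\<forall>n. \<exists>q\<in>\<rat> \<inter> {a..b}. infdist (q, f q) F < 1 / Suc n)"
proof -
  define g where "g = (\<lambda>q. infdist (q, f q) F)"
  have g: "continuous_on UNIV g" unfolding g_def using f by (intro continuous_intros)
  show ?thesis
  proof
    assume "\<exists>t\<in>{a..b}. (t, f t) \<in> F"
    then obtain t where t: "a \<le> t" "t \<le> b" "(t, f t) \<in> F" by auto
    have "\<exists>q\<in>\<rat> \<inter> {a..b}. g q < 1 / Suc n" for n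
    proof (rule ccontr)
      assume "\<not> ?thesis"
      then have q: "\<And>q. q \<in> \<rat> \<Longrightarrow> a \<le> q \<Longrightarrow> q \<le> b \<Longrightarrow> 1 / Suc n \<le> g q" by (auto simp: not_less)
      have "g t \<in> {1 / Suc n..}"
      proof (cases "a < b")
        case True
        then show ?thesis by (intro closed_rational_extension[OF g closed_atLeast True _ t(1,2)]) (use q in auto)
      qed (use q[of a] ab t in auto)
      moreover have "g t = 0" using t(3) by (simp add: g_def)
      ultimately show False by simp
    qed
    with t(3) show "F \<noteq> {} \<and> (\<forall>n. \<exists>q\<in>\<rat> \<inter> {a..b}. infdist (q, f q) F < 1 / Suc n)"
      unfolding g_def by blast
  next
    assume *: "F \<noteq> {} \<and> (\<forall>n. \<exists>q\<in>\<rat> \<inter> {a..b}. infdist (q, f q) F < 1 / Suc n)"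
    obtain t where t: "t \<in> {a..b}" "\<And>q. q \<in> {a..b} \<Longrightarrow> g t \<le> g q"
      using continuous_attains_inf[of "{a..b}" g] ab continuous_on_subset[OF g] by auto
    have "g t < 1 / Suc n" for n using * t(2) unfolding g_def by (meson IntE le_less_trans)
    then have "g t = 0"
      using nat_approx_posE[of "g t"] infdist_nonneg[of "(t, f t)" F] unfolding g_def by (metis less_asym' less_eq_real_def)
    then have "(t, f t) \<in> F" using in_closed_iff_infdist_zero[OF F] * by (simp add: g_def)
    with t(1) show "\<exists>t\<in>{a..b}. (t, f t) \<in> F" by blast
  qed
qed

lemma hit_measurable:
  fixes W :: "'a \<Rightarrow> real \<Rightarrow> 'm::{metric_space, second_countable_topology}"
  assumes F: "closed F" and cont: "\<And>x. x \<in> space N \<Longrightarrow> continuous_on UNIV (W x)"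
    and W: "\<And>t. a \<le> t \<Longrightarrow> t \<le> b \<Longrightarrow> (\<lambda>x. W x t) \<in> borel_measurable N" and ab: "a \<in> \<rat>" "a \<le> b"
  shows "{x\<in>space N. \<exists>t\<in>{a..b}. (t, W x t) \<in> F} \<in> sets N"
proof -
  have "{x\<in>space N. \<exists>t\<in>{a..b}. (t, W x t) \<in> F} =
      {x\<in>space N. F \<noteq> {} \<and> (\<forall>n. \<exists>q\<in>\<rat> \<inter> {a..b}. infdist (q, W x q) F \<in> {..<1 / Suc n})}"
    using hit_iff[OF F cont ab] by auto
  also have "\<dots> \<in> sets N"
  proof (intro sets.sets_Collect sets.sets_Collect_countable_Ex')
    show "countable (\<rat> \<inter> {a..b})" by (rule countable_subset[OF _ countable_rat]) auto
    fix n q assume q: "q \<in> \<rat> \<inter> {a..b}"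
    have "(\<lambda>p. infdist p F) \<in> borel_measurable borel"
      by (intro borel_measurable_continuous_onI continuous_intros)
    moreover have "(\<lambda>x. (q, W x q)) \<in> borel_measurable N"
      using W[of q] q by (intro borel_measurable_Pair) auto
    ultimately have "(\<lambda>x. infdist (q, W x q) F) \<in> borel_measurable N" by (rule measurable_compose[rotated])
    then show "{x\<in>space N. infdist (q, W x q) F \<in> {..<1 / real (Suc n)}} \<in> sets N"
      by (rule measurable_Collect_in) auto
  qed
  finally show ?thesis .
qed

text \<open>Reduces hits in an open range of times to countably many compact intervals, to which
  \<open>hit_measurable\<close> applies.\<close>

lemma hit_rational_interval:
  fixes \<sigma> c :: ereal
  shows "(\<exists>t. \<sigma> < ereal t \<and> ereal t < c \<and> Q t) \<longleftrightarrow>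
    (\<exists>a\<in>\<rat>. \<exists>b\<in>\<rat>. \<sigma> < ereal a \<and> ereal b < c \<and> a \<le> b \<and> (\<exists>t\<in>{a..b}. Q t))"
proof
  assume "\<exists>t. \<sigma> < ereal t \<and> ereal t < c \<and> Q t"
  then obtain t where t: "\<sigma> < ereal t" "ereal t < c" "Q t" by blast
  obtain a' where a': "\<sigma> < ereal a'" "ereal a' < ereal t" using ereal_dense2[OF t(1)] by blast
  obtain b' where b': "ereal t < ereal b'" "ereal b' < c" using ereal_dense2[OF t(2)] by blast
  obtain a where a: "a \<in> \<rat>" "a' < a" "a < t" using Rats_dense_in_real[of a' t] a' by auto
  obtain b where b: "b \<in> \<rat>" "t < b" "b < b'" using Rats_dense_in_real[of t b'] b' by auto
  have "\<sigma> < ereal a" using a'(1) a(2) less_trans[of \<sigma> "ereal a'" "ereal a"] by simp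
  moreover have "ereal b < c" using b'(2) b(3) less_trans[of "ereal b" "ereal b'" c] by simp
  ultimately show "\<exists>a\<in>\<rat>. \<exists>b\<in>\<rat>. \<sigma> < ereal a \<and> ereal b < c \<and> a \<le> b \<and> (\<exists>t\<in>{a..b}. Q t)"
    using a b t(3) by (intro bexI[OF _ a(1)] bexI[OF _ b(1)] conjI bexI[of _ t]) auto
next
  assume "\<exists>a\<in>\<rat>. \<exists>b\<in>\<rat>. \<sigma> < ereal a \<and> ereal b < c \<and> a \<le> b \<and> (\<exists>t\<in>{a..b}. Q t)"
  then obtain a b t where t: "\<sigma> < ereal a" "ereal b < c" "a \<le> t" "t \<le> b" "Q t" by auto
  then have "\<sigma> < ereal t" "ereal t < c"
    using less_le_trans[of \<sigma> "ereal a" "ereal t"] le_less_trans[of "ereal t" "ereal b" c] by auto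
  with t(5) show "\<exists>t. \<sigma> < ereal t \<and> ereal t < c \<and> Q t" by blast
qed

lemma sigma_Suc_less_iff:
  "sigma_time th F s x (Suc k) < c \<longleftrightarrow>
     (\<exists>t. sigma_time th F s x k < ereal t \<and> ereal t < c \<and>
       (t, snd (th (real_of_ereal (sigma_time th F s x k)) (z_point th F s x k)) t) \<in> F)"
proof (cases "sigma_time th F s x k")
  case (real a)
  then show ?thesis unfolding sigma_Suc_finite[OF real] first_hit_less_iff by auto
next
  case PInf
  then show ?thesis using sigma_Suc_infinite[OF PInf] by simp
next
  case MInf
  then show ?thesis using sigma_not_minf[of th F s x k] by simp
qed

context flow_setting
begin

definition gap_expect :: "(real \<Rightarrow> ennreal) \<Rightarrow> 'm \<times> 'm \<Rightarrow> ennreal" where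
  "gap_expect f p = (\<integral>\<^sup>+\<omega>. f (pair_gap p \<omega>) \<partial>Pr)"

text \<open>Measurability in the starting points comes from the kernel of Markov laws, since none is
  known for \<open>vers\<close>.\<close>

lemma gap_expect_measurable:
  assumes f: "f \<in> borel_measurable borel" and X: "X \<in> borel_measurable N" and Y: "Y \<in> borel_measurable N"
  shows "(\<lambda>\<omega>. gap_expect f (X \<omega>, Y \<omega>)) \<in> borel_measurable N"
proof -
  have KM: "Markov_law \<delta> P 2 \<in> M2 \<rightarrow>\<^sub>M subprob_algebra W2"
    by (rule measurable_prob_algebraD[OF Markov_kernel[OF Markov_law]])
  have "(\<lambda>x. \<integral>\<^sup>+w. f (path_dist \<delta> (w 0) (w 1)) \<partial>Markov_law \<delta> P 2 x) \<in> borel_measurable M2"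
    by (rule measurable_compose[OF KM nn_integral_measurable_subprob_algebra])
      (rule measurable_compose[OF gap_functional_measurable f])
  from measurable_compose[OF pair_point_measurable[OF X Y] this] show ?thesis
    unfolding nn_integral_Markov_law_gap[OF f] gap_expect_def .
qed

lemma ramp_borel: "(\<lambda>t. ennreal (ramp c n t)) \<in> borel_measurable borel"
  using borel_measurable_continuous_onI[OF continuous_ramp] by measurable

lemma gap_expect_ramp:
  "gap_expect (\<lambda>t. ennreal (ramp c n t)) p = ennreal (\<integral>\<omega>. ramp c n (pair_gap p \<omega>) \<partial>Pr)"
  unfolding gap_expect_def
  by (rule nn_integral_eq_integral)
    (auto simp: ramp_bounds intro!: integrable_const_bound[of _ 1] measurable_compose[OF pair_gap_measurable]
      borel_measurable_continuous_onI[OF continuous_ramp])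

lemma gap_prob_borel: "gap_prob c \<in> borel_measurable borel"
proof (subst borel_measurable_iff_ge, intro allI)
  fix a
  have "closed {p. a \<le> gap_prob c p}" by (rule gap_prob_closed)
  then show "{p\<in>space borel. a \<le> gap_prob c p} \<in> sets borel" by (simp add: borel_closed)
qed

end

section \<open>From fixed times to optional times\<close>

context flow_family
begin

definition gap :: "nat \<Rightarrow> nat \<Rightarrow> real \<Rightarrow> 'w \<Rightarrow> real" where
  "gap i j r \<omega> = path_dist \<delta> (path_shift r (V i \<omega>)) (path_shift r (V j \<omega>))"

lemma gap_shifted: "gap i j r \<omega> = path_dist \<delta> (shifted i j r \<omega> 0) (shifted i j r \<omega> 1)"
  by (simp add: gap_def shifted_def)

lemma path_shift_measurable:
  assumes \<tau>: "\<tau> \<in> borel_measurable Pr"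
  shows "(\<lambda>\<omega>. path_shift (\<tau> \<omega>) (V i \<omega>)) \<in> Pr \<rightarrow>\<^sub>M path_measure \<delta>"
proof (rule measurable_pathI)
  show "path_shift (\<tau> \<omega>) (V i \<omega>) \<in> paths" if "\<omega> \<in> space Pr" for \<omega>
    by (rule paths_fromD(1)[OF path_shift_paths[OF V_paths[OF that]]])
  show "(\<lambda>\<omega>. snd (path_shift (\<tau> \<omega>) (V i \<omega>)) t) \<in> borel_measurable Pr" for t
    using \<tau> by (auto intro!: measurable_eval_at[OF version_path_measurable[OF version]])
qed simp

lemma gap_measurable: "\<tau> \<in> borel_measurable Pr \<Longrightarrow> (\<lambda>\<omega>. gap i j (\<tau> \<omega>) \<omega>) \<in> borel_measurable Pr"
  unfolding gap_def by (intro path_dist_measurable path_shift_measurable)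

lemma V_at_measurable: "\<tau> \<in> borel_measurable Pr \<Longrightarrow> (\<lambda>\<omega>. snd (V i \<omega>) (\<tau> \<omega>)) \<in> borel_measurable Pr"
  by (rule measurable_eval_at[OF version_path_measurable[OF version]])

lemma V_cont: "\<omega> \<in> space Pr \<Longrightarrow> continuous_on UNIV (snd (V i \<omega>))"
  by (rule paths_continuous[OF V_paths])

lemma gap_at_time:
  assumes ij: "\<alpha> i \<le> r" "\<alpha> j \<le> r" and A: "A \<in> sets (filt r)" and f: "f \<in> borel_measurable borel"
  shows "(\<integral>\<^sup>+\<omega>\<in>A. f (gap i j r \<omega>) \<partial>Pr) = (\<integral>\<^sup>+\<omega>\<in>A. gap_expect f (snd (V i \<omega>) r, snd (V j \<omega>) r) \<partial>Pr)"
  using Markov_at_time[OF ij A measurable_compose[OF gap_functional_measurable f]]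
  unfolding gap_shifted gap_expect_def nn_integral_Markov_law_gap[OF f] .

text \<open>The least multiple of 1 / Suc m strictly above t. Strictness matches optional times,
  which are described by the events {T < r}.\<close>

definition grid_time :: "nat \<Rightarrow> real \<Rightarrow> real" where
  "grid_time m t = (of_int \<lfloor>t * real (Suc m)\<rfloor> + 1) / Suc m"

lemma grid_time_measurable:
  assumes [measurable]: "\<tau> \<in> borel_measurable Pr"
  shows "(\<lambda>\<omega>. grid_time m (\<tau> \<omega>)) \<in> borel_measurable Pr"
  unfolding grid_time_def by measurable

lemma grid_time_bounds: "t < grid_time m t" "grid_time m t \<le> t + 1 / Suc m"
proof -
  define k where "k = \<lfloor>t * real (Suc m)\<rfloor>"
  have k: "t * real (Suc m) < of_int k + 1" "of_int k \<le> t * real (Suc m)"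
    unfolding k_def by linarith+
  have "t = t * real (Suc m) / real (Suc m)" by simp
  also have "\<dots> < (of_int k + 1) / real (Suc m)" using k(1) by (intro divide_strict_right_mono) auto
  finally show "t < grid_time m t" by (simp add: grid_time_def k_def)
  have "(of_int k + 1) / real (Suc m) \<le> (t * real (Suc m) + 1) / real (Suc m)"
    using k(2) by (intro divide_right_mono) auto
  also have "\<dots> = t + 1 / Suc m" by (simp add: add_divide_distrib)
  finally show "grid_time m t \<le> t + 1 / Suc m" by (simp add: grid_time_def k_def)
qed

lemma grid_time_tendsto: "(\<lambda>m. grid_time m t) \<longlonglongrightarrow> t"
proof (rule tendsto_sandwich[OF _ _ tendsto_const])
  show "(\<lambda>m. t + 1 / real (Suc m)) \<longlonglongrightarrow> t"
    using tendsto_add[OF tendsto_const[of t] LIMSEQ_Suc[OF lim_const_over_n[of 1]]] by simp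
qed (use grid_time_bounds in \<open>auto intro!: always_eventually less_imp_le\<close>)

text \<open>At the grid times approximating an optional time from above the Markov property applies on each
  of countably many events.\<close>

lemma gap_at_grid_time:
  assumes \<tau>: "\<tau> \<in> borel_measurable Pr" and A: "A \<in> sets Pr"
    and opt: "\<And>r. A \<inter> {\<omega>\<in>space Pr. \<tau> \<omega> < r} \<in> sets (filt r)"
    and ij: "\<And>\<omega>. \<omega> \<in> A \<Longrightarrow> \<alpha> i \<le> \<tau> \<omega> \<and> \<alpha> j \<le> \<tau> \<omega>" and f: "f \<in> borel_measurable borel"
  shows "(\<integral>\<^sup>+\<omega>\<in>A. f (gap i j (grid_time m (\<tau> \<omega>)) \<omega>) \<partial>Pr) =
    (\<integral>\<^sup>+\<omega>\<in>A. gap_expect f (snd (V i \<omega>) (grid_time m (\<tau> \<omega>)), snd (V j \<omega>) (grid_time m (\<tau> \<omega>))) \<partial>Pr)"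
proof (rule nn_integral_eq_on_partition[where K="\<lambda>\<omega>. \<lfloor>\<tau> \<omega> * real (Suc m)\<rfloor>"])
  note g = grid_time_measurable[OF \<tau>]
  show "(\<lambda>\<omega>. f (gap i j (grid_time m (\<tau> \<omega>)) \<omega>)) \<in> borel_measurable Pr"
    by (rule measurable_compose[OF gap_measurable[OF g] f])
  show "(\<lambda>\<omega>. gap_expect f (snd (V i \<omega>) (grid_time m (\<tau> \<omega>)), snd (V j \<omega>) (grid_time m (\<tau> \<omega>)))) \<in> borel_measurable Pr"
    by (intro gap_expect_measurable f V_at_measurable g)
  show "A \<in> sets Pr" by fact
  show "(\<lambda>\<omega>. \<lfloor>\<tau> \<omega> * real (Suc m)\<rfloor>) \<in> Pr \<rightarrow>\<^sub>M count_space UNIV" using \<tau> by measurable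
  fix k :: int
  define r where "r = (of_int k + 1) / real (Suc m)"
  define a where "a = of_int k / real (Suc m)"
  let ?A = "A \<inter> {\<omega>\<in>space Pr. \<lfloor>\<tau> \<omega> * real (Suc m)\<rfloor> = k}"
  have floor: "\<lfloor>t * real (Suc m)\<rfloor> = k \<longleftrightarrow> a \<le> t \<and> t < r" for t
    unfolding floor_eq_iff a_def r_def by (auto simp: field_simps)
  have grid: "grid_time m (\<tau> \<omega>) = r" if "\<omega> \<in> ?A" for \<omega>
    using that by (simp add: grid_time_def r_def)
  \<comment> \<open>The grid time equals r exactly when \<tau> lies in [a, r); as a difference of
    two events this is known at time r.\<close>
  have "?A = A \<inter> {\<omega>\<in>space Pr. \<tau> \<omega> < r} - A \<inter> {\<omega>\<in>space Pr. \<tau> \<omega> < a}"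
    unfolding floor by auto
  moreover have "a \<le> r" by (simp add: a_def r_def divide_right_mono)
  ultimately have Af: "?A \<in> sets (filt r)"
    using opt[of r] subsetD[OF filt_mono opt[of a]] by simp
  have "(\<integral>\<^sup>+\<omega>\<in>?A. f (gap i j (grid_time m (\<tau> \<omega>)) \<omega>) \<partial>Pr) = (\<integral>\<^sup>+\<omega>\<in>?A. f (gap i j r \<omega>) \<partial>Pr)"
    using grid by (intro nn_integral_cong) (auto split: split_indicator)
  also have "\<dots> = (\<integral>\<^sup>+\<omega>\<in>?A. gap_expect f (snd (V i \<omega>) r, snd (V j \<omega>) r) \<partial>Pr)"
  proof (cases "?A = {}")
    case False
    then obtain \<omega> where "\<omega> \<in> A" "\<tau> \<omega> < r" using floor by auto
    then have "\<alpha> i \<le> r" "\<alpha> j \<le> r" using ij[of \<omega>] by auto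
    then show ?thesis by (rule gap_at_time[OF _ _ Af f])
  qed simp
  also have "\<dots> = (\<integral>\<^sup>+\<omega>\<in>?A. gap_expect f (snd (V i \<omega>) (grid_time m (\<tau> \<omega>)), snd (V j \<omega>) (grid_time m (\<tau> \<omega>))) \<partial>Pr)"
    using grid by (intro nn_integral_cong) (auto split: split_indicator)
  finally show "(\<integral>\<^sup>+\<omega>\<in>?A. f (gap i j (grid_time m (\<tau> \<omega>)) \<omega>) \<partial>Pr) =
    (\<integral>\<^sup>+\<omega>\<in>?A. gap_expect f (snd (V i \<omega>) (grid_time m (\<tau> \<omega>)), snd (V j \<omega>) (grid_time m (\<tau> \<omega>))) \<partial>Pr)" .
qed

text \<open>As the grid is refined, the left side converges by continuity of the paths in time and
  the right side by continuity of the expectation in the starting points; both integrands are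
  bounded by 1.\<close>

lemma ramp_gap_at_optional_time:
  assumes \<tau>: "\<tau> \<in> borel_measurable Pr" and A: "A \<in> sets Pr"
    and opt: "\<And>r. A \<inter> {\<omega>\<in>space Pr. \<tau> \<omega> < r} \<in> sets (filt r)"
    and ij: "\<And>\<omega>. \<omega> \<in> A \<Longrightarrow> \<alpha> i \<le> \<tau> \<omega> \<and> \<alpha> j \<le> \<tau> \<omega>"
  shows "(\<integral>\<^sup>+\<omega>\<in>A. ennreal (ramp c n (gap i j (\<tau> \<omega>) \<omega>)) \<partial>Pr) =
    (\<integral>\<^sup>+\<omega>\<in>A. gap_expect (\<lambda>t. ennreal (ramp c n t)) (snd (V i \<omega>) (\<tau> \<omega>), snd (V j \<omega>) (\<tau> \<omega>)) \<partial>Pr)"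
proof -
  let ?f = "\<lambda>t. ennreal (ramp c n t)"
  let ?g = "\<lambda>m \<omega>. grid_time m (\<tau> \<omega>)"
  let ?p = "\<lambda>r \<omega>. (snd (V i \<omega>) r, snd (V j \<omega>) r)"
  have f1: "?f t \<le> 1" for t using ramp_bounds by (simp add: ennreal_le_1)
  have ge1: "gap_expect ?f p \<le> 1" for p
  proof -
    have "gap_expect ?f p \<le> (\<integral>\<^sup>+\<omega>. 1 \<partial>Pr)" unfolding gap_expect_def by (intro nn_integral_mono f1)
    then show ?thesis by (simp add: emeasure_space_1)
  qed
  have indA: "(\<lambda>\<omega>. indicator A \<omega> :: ennreal) \<in> borel_measurable Pr" using A by simp
  note g = grid_time_measurable[OF \<tau>]
  have gap_lim: "(\<lambda>m. gap i j (?g m \<omega>) \<omega>) \<longlonglongrightarrow> gap i j (\<tau> \<omega>) \<omega>" if "\<omega> \<in> space Pr" for \<omega>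
    unfolding gap_def
    using path_shift_paths[OF V_paths[OF that]] paths_fromD(1) V_paths[OF that] grid_time_tendsto
    by (intro path_dist_tendsto path_shift_tendsto) blast+
  have "(\<lambda>m. \<integral>\<^sup>+\<omega>\<in>A. ?f (gap i j (?g m \<omega>) \<omega>) \<partial>Pr) \<longlonglongrightarrow> (\<integral>\<^sup>+\<omega>\<in>A. ?f (gap i j (\<tau> \<omega>) \<omega>) \<partial>Pr)"
  proof (rule nn_integral_dominated_convergence[where w="\<lambda>_. 1"])
    show "AE \<omega> in Pr. (\<lambda>m. ?f (gap i j (?g m \<omega>) \<omega>) * indicator A \<omega>) \<longlonglongrightarrow> ?f (gap i j (\<tau> \<omega>) \<omega>) * indicator A \<omega>"
    proof (rule AE_I2)
      fix \<omega> assume "\<omega> \<in> space Pr"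
      have "isCont (ramp c n) (gap i j (\<tau> \<omega>) \<omega>)"
        using continuous_ramp by (simp add: continuous_on_eq_continuous_at)
      from isCont_tendsto_compose[OF this gap_lim[OF \<open>\<omega> \<in> space Pr\<close>]]
      have "(\<lambda>m. ?f (gap i j (?g m \<omega>) \<omega>)) \<longlonglongrightarrow> ?f (gap i j (\<tau> \<omega>) \<omega>)" by (rule tendsto_ennrealI)
      then show "(\<lambda>m. ?f (gap i j (?g m \<omega>) \<omega>) * indicator A \<omega>) \<longlonglongrightarrow> ?f (gap i j (\<tau> \<omega>) \<omega>) * indicator A \<omega>"
        by (cases "\<omega> \<in> A") simp_all
    qed
    show "AE \<omega> in Pr. ?f (gap i j (?g m \<omega>) \<omega>) * indicator A \<omega> \<le> 1" for m
      using f1 by (intro AE_I2) (simp split: split_indicator)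
  qed (auto simp: emeasure_space_1 intro!: borel_measurable_times_ennreal indA
      measurable_compose[OF gap_measurable ramp_borel] \<tau> g)
  moreover have "(\<lambda>m. \<integral>\<^sup>+\<omega>\<in>A. gap_expect ?f (?p (?g m \<omega>) \<omega>) \<partial>Pr) \<longlonglongrightarrow> (\<integral>\<^sup>+\<omega>\<in>A. gap_expect ?f (?p (\<tau> \<omega>) \<omega>) \<partial>Pr)"
  proof (rule nn_integral_dominated_convergence[where w="\<lambda>_. 1"])
    show "AE \<omega> in Pr. (\<lambda>m. gap_expect ?f (?p (?g m \<omega>) \<omega>) * indicator A \<omega>) \<longlonglongrightarrow> gap_expect ?f (?p (\<tau> \<omega>) \<omega>) * indicator A \<omega>"
    proof (rule AE_I2)
      fix \<omega> assume \<omega>: "\<omega> \<in> space Pr"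
      have "(\<lambda>m. snd (V i \<omega>) (?g m \<omega>)) \<longlonglongrightarrow> snd (V i \<omega>) (\<tau> \<omega>)" for i
        using V_cont[OF \<omega>, of i] by (intro isCont_tendsto_compose[OF _ grid_time_tendsto]) (simp add: continuous_on_eq_continuous_at)
      then have "(\<lambda>m. ?p (?g m \<omega>) \<omega>) \<longlonglongrightarrow> ?p (\<tau> \<omega>) \<omega>" by (intro tendsto_Pair)
      then have "(\<lambda>m. gap_expect ?f (?p (?g m \<omega>) \<omega>)) \<longlonglongrightarrow> gap_expect ?f (?p (\<tau> \<omega>) \<omega>)"
        unfolding gap_expect_ramp
        by (intro tendsto_ennrealI pair_gap_expectation_continuous[OF continuous_ramp]) (simp add: ramp_bounds)
      then show "(\<lambda>m. gap_expect ?f (?p (?g m \<omega>) \<omega>) * indicator A \<omega>) \<longlonglongrightarrow> gap_expect ?f (?p (\<tau> \<omega>) \<omega>) * indicator A \<omega>"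
        by (cases "\<omega> \<in> A") simp_all
    qed
    show "AE \<omega> in Pr. gap_expect ?f (?p (?g m \<omega>) \<omega>) * indicator A \<omega> \<le> 1" for m
      using ge1 by (intro AE_I2) (simp split: split_indicator)
  qed (auto simp: emeasure_space_1 intro!: borel_measurable_times_ennreal indA
      gap_expect_measurable ramp_borel V_at_measurable \<tau> g)
  moreover have "(\<integral>\<^sup>+\<omega>\<in>A. ?f (gap i j (?g m \<omega>) \<omega>) \<partial>Pr) = (\<integral>\<^sup>+\<omega>\<in>A. gap_expect ?f (?p (?g m \<omega>) \<omega>) \<partial>Pr)" for m
    by (rule gap_at_grid_time[where f="?f", OF \<tau> A opt ij ramp_borel])
  ultimately show ?thesis by (auto intro: LIMSEQ_unique)
qed

text \<open>The indicator of {c..} is bounded by a ramp before the strong Markov property is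
  applied, and the ramps return to the indicator afterwards, where \<open>gap_prob\<close> is
  bounded by q.\<close>

lemma gap_bound_at_optional_time:
  assumes \<tau>: "\<tau> \<in> borel_measurable Pr" and A: "A \<in> sets Pr"
    and opt: "\<And>r. A \<inter> {\<omega>\<in>space Pr. \<tau> \<omega> < r} \<in> sets (filt r)"
    and ij: "\<And>\<omega>. \<omega> \<in> A \<Longrightarrow> \<alpha> i \<le> \<tau> \<omega> \<and> \<alpha> j \<le> \<tau> \<omega>"
    and q: "\<And>\<omega>. \<omega> \<in> A \<Longrightarrow> gap_prob c (snd (V i \<omega>) (\<tau> \<omega>), snd (V j \<omega>) (\<tau> \<omega>)) \<le> q"
  shows "emeasure Pr (A \<inter> {\<omega>\<in>space Pr. c \<le> gap i j (\<tau> \<omega>) \<omega>}) \<le> ennreal q * emeasure Pr A"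
proof -
  let ?p = "\<lambda>\<omega>. (snd (V i \<omega>) (\<tau> \<omega>), snd (V j \<omega>) (\<tau> \<omega>))"
  have ev: "{\<omega>\<in>space Pr. c \<le> gap i j (\<tau> \<omega>) \<omega>} \<in> sets Pr"
    using measurable_Collect_in[OF gap_measurable[OF \<tau>], of "{c..}" i j] by simp
  have indA: "(\<lambda>\<omega>. indicator A \<omega> :: ennreal) \<in> borel_measurable Pr" using A by simp
  have le: "emeasure Pr (A \<inter> {\<omega>\<in>space Pr. c \<le> gap i j (\<tau> \<omega>) \<omega>}) \<le>
      (\<integral>\<^sup>+\<omega>\<in>A. gap_expect (\<lambda>t. ennreal (ramp c n t)) (?p \<omega>) \<partial>Pr)" for n
  proof -
    have "emeasure Pr (A \<inter> {\<omega>\<in>space Pr. c \<le> gap i j (\<tau> \<omega>) \<omega>}) =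
        (\<integral>\<^sup>+\<omega>. indicator (A \<inter> {\<omega>\<in>space Pr. c \<le> gap i j (\<tau> \<omega>) \<omega>}) \<omega> \<partial>Pr)"
      using A ev by (intro nn_integral_indicator[symmetric]) auto
    also have "\<dots> \<le> (\<integral>\<^sup>+\<omega>\<in>A. ennreal (ramp c n (gap i j (\<tau> \<omega>) \<omega>)) \<partial>Pr)"
      by (intro nn_integral_mono) (auto simp: ramp_ge split: split_indicator)
    also note ramp_gap_at_optional_time[OF \<tau> A opt ij]
    finally show ?thesis .
  qed
  have "(\<lambda>n. \<integral>\<^sup>+\<omega>\<in>A. gap_expect (\<lambda>t. ennreal (ramp c n t)) (?p \<omega>) \<partial>Pr) \<longlonglongrightarrow> (\<integral>\<^sup>+\<omega>\<in>A. ennreal (gap_prob c (?p \<omega>)) \<partial>Pr)"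
  proof (rule nn_integral_dominated_convergence[where w="\<lambda>_. 1"])
    show "AE \<omega> in Pr. (\<lambda>n. gap_expect (\<lambda>t. ennreal (ramp c n t)) (?p \<omega>) * indicator A \<omega>) \<longlonglongrightarrow> ennreal (gap_prob c (?p \<omega>)) * indicator A \<omega>"
    proof (rule AE_I2)
      fix \<omega>
      have "(\<lambda>n. gap_expect (\<lambda>t. ennreal (ramp c n t)) (?p \<omega>)) \<longlonglongrightarrow> ennreal (gap_prob c (?p \<omega>))"
        unfolding gap_expect_ramp by (intro tendsto_ennrealI gap_prob_limit)
      then show "(\<lambda>n. gap_expect (\<lambda>t. ennreal (ramp c n t)) (?p \<omega>) * indicator A \<omega>) \<longlonglongrightarrow> ennreal (gap_prob c (?p \<omega>)) * indicator A \<omega>"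
        by (cases "\<omega> \<in> A") simp_all
    qed
    show "AE \<omega> in Pr. gap_expect (\<lambda>t. ennreal (ramp c n t)) (?p \<omega>) * indicator A \<omega> \<le> 1" for n
    proof (rule AE_I2)
      fix \<omega>
      have "gap_expect (\<lambda>t. ennreal (ramp c n t)) (?p \<omega>) \<le> (\<integral>\<^sup>+\<omega>. 1 \<partial>Pr)"
        unfolding gap_expect_def using ramp_bounds by (intro nn_integral_mono) (simp add: ennreal_le_1)
      then show "gap_expect (\<lambda>t. ennreal (ramp c n t)) (?p \<omega>) * indicator A \<omega> \<le> 1"
        by (simp add: emeasure_space_1 split: split_indicator)
    qed
    show "(\<lambda>\<omega>. ennreal (gap_prob c (?p \<omega>)) * indicator A \<omega>) \<in> borel_measurable Pr"
      by (intro borel_measurable_times_ennreal indA measurable_compose[OF _ measurable_ennreal]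
          measurable_compose[OF borel_measurable_Pair gap_prob_borel] V_at_measurable \<tau>)
  qed (auto simp: emeasure_space_1 intro!: borel_measurable_times_ennreal indA
      gap_expect_measurable ramp_borel V_at_measurable \<tau>)
  then have "emeasure Pr (A \<inter> {\<omega>\<in>space Pr. c \<le> gap i j (\<tau> \<omega>) \<omega>}) \<le> (\<integral>\<^sup>+\<omega>\<in>A. ennreal (gap_prob c (?p \<omega>)) \<partial>Pr)"
    using le by (intro LIMSEQ_le_const) auto
  also have "\<dots> \<le> (\<integral>\<^sup>+\<omega>. ennreal q * indicator A \<omega> \<partial>Pr)"
    using q by (intro nn_integral_mono) (auto simp: ennreal_leI split: split_indicator)
  also have "\<dots> = ennreal q * emeasure Pr A" using A by (simp add: nn_integral_cmult)
  finally show ?thesis .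
qed

lemma V_filt_le: "u \<le> r \<Longrightarrow> (\<lambda>\<omega>. snd (V i \<omega>) u) \<in> borel_measurable (filt r)"
proof (cases "\<alpha> i \<le> u")
  case False
  have "snd (V i \<omega>) u = \<beta> i" if "\<omega> \<in> space Pr" for \<omega>
    using paths_before[OF V_paths[OF that], of u i] versionD(1,2)[OF version that, of i] False
    by (simp add: paths_from_def)
  then show ?thesis by (subst measurable_cong[where g="\<lambda>_. \<beta> i"]) auto
qed (rule V_filt)

text \<open>Strict inequality suits hitting times over an open range of times t > \<sigma>: such a
  time is below r exactly if a hit occurs before r.\<close>

definition optional_time :: "('w \<Rightarrow> ereal) \<Rightarrow> bool" where
  "optional_time T \<longleftrightarrow> (\<forall>r. {\<omega>\<in>space Pr. T \<omega> < ereal r} \<in> sets (filt r))"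

text \<open>Truncation hides everything from r on, and for c at most r the event {T < c} is already
  known at time c.\<close>

lemma optional_time_min:
  assumes T: "optional_time T"
  shows "(\<lambda>\<omega>. min (T \<omega>) (ereal r)) \<in> borel_measurable (filt r)"
proof (rule borel_measurableI_less)
  fix c :: ereal
  show "{\<omega>\<in>space (filt r). min (T \<omega>) (ereal r) < c} \<in> sets (filt r)"
  proof (cases "ereal r < c")
    case True
    then have "{\<omega>\<in>space (filt r). min (T \<omega>) (ereal r) < c} = space (filt r)"
      by (auto simp: min_less_iff_disj)
    then show ?thesis by (simp only: sets.top)
  next
    case False
    show ?thesis
    proof (cases c)
      case (real c')
      then have "{\<omega>\<in>space (filt r). min (T \<omega>) (ereal r) < c} = {\<omega>\<in>space Pr. T \<omega> < ereal c'}"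
        using False by (auto simp: min_less_iff_disj)
      moreover have "c' \<le> r" using False real by simp
      ultimately show ?thesis using T filt_mono[of c' r] unfolding optional_time_def by auto
    qed (use False in auto)
  qed
qed

lemma optional_time_measurable:
  assumes T: "optional_time T" and "\<And>\<omega>. \<omega> \<in> space Pr \<Longrightarrow> T \<omega> \<noteq> -\<infinity>"
  shows "T \<in> borel_measurable Pr"
proof (rule borel_measurableI_less)
  fix c :: ereal
  have ev: "{\<omega>\<in>space Pr. T \<omega> < ereal r} \<in> sets Pr" for r
    using T filt_events[of r] unfolding optional_time_def by blast
  show "{\<omega>\<in>space Pr. T \<omega> < c} \<in> sets Pr"
  proof (cases c)
    case PInf
    have "{\<omega>\<in>space Pr. T \<omega> < \<infinity>} = (\<Union>n::nat. {\<omega>\<in>space Pr. T \<omega> < ereal (real n)})"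
    proof (intro set_eqI iffI)
      fix \<omega> assume "\<omega> \<in> {\<omega>\<in>space Pr. T \<omega> < \<infinity>}"
      then obtain t where t: "\<omega> \<in> space Pr" "T \<omega> = ereal t" using assms(2)[of \<omega>] by (cases "T \<omega>") auto
      obtain n :: nat where "t < n" using reals_Archimedean2 by blast
      with t show "\<omega> \<in> (\<Union>n::nat. {\<omega>\<in>space Pr. T \<omega> < ereal (real n)})" by auto
    qed auto
    then show ?thesis using ev PInf by auto
  qed (use ev in auto)
qed

end

section \<open>The construction along one tracked path\<close>

locale tracked_path = flow_setting \<delta> Pr P \<psi> D \<Phi>
  for \<delta> :: "(real \<Rightarrow> 'm::{heine_borel, polish_space}) \<Rightarrow> (real \<Rightarrow> 'm) \<Rightarrow> real"
    and Pr :: "'w measure" and P \<psi> D \<Phi> +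
  fixes l :: "(nat \<Rightarrow> 'm path) \<Rightarrow> 'm path" and F :: "(real \<times> 'm) set"
    and s :: real and x :: 'm and Z :: "'w \<Rightarrow> 'm path"
  assumes selector: "limit_point_selector \<delta> l" and F: "closed F" and Z: "version s x Z"
begin

text \<open>Place 0 holds the tracked path and place Suc n the skeleton path with index n.\<close>

definition "fam = case_nat Z (\<lambda>n \<omega>. \<Phi> \<omega> n)"
definition "fam_time = case_nat s (\<lambda>n. fst (D n))"
definition "fam_start = case_nat x (\<lambda>n. snd (D n))"

lemma fam_simps [simp]: "fam 0 = Z" "fam (Suc n) = (\<lambda>\<omega>. \<Phi> \<omega> n)"
  "fam_time 0 = s" "fam_time (Suc n) = fst (D n)"
  by (auto simp: fam_def fam_time_def)

sublocale flow_family \<delta> Pr P \<psi> D \<Phi> fam fam_time fam_start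
proof
  show "version (fam_time i) (fam_start i) (fam i)" for i
    by (cases i) (auto simp: fam_start_def Z version_Phi)
qed

lemma skeleton_theta: "skeleton \<delta> (\<Phi> \<omega>) \<Longrightarrow> skeleton_theta \<delta> (\<Phi> \<omega>) P l"
  by unfold_locales (use selector radius_pos in auto)

text \<open>The radii are chosen such that the strong Markov property and the Borel--Cantelli lemma make
  the approximating paths converge to the given path.\<close>

lemma theta_at_optional_time:
  assumes T: "optional_time T" and Ts: "\<And>\<omega>. \<omega> \<in> space Pr \<Longrightarrow> ereal s \<le> T \<omega>"
  shows "AE \<omega> in Pr. T \<omega> < \<infinity> \<longrightarrow> (\<forall>t\<ge>real_of_ereal (T \<omega>).
    snd (theta \<delta> P l (\<Phi> \<omega>) (real_of_ereal (T \<omega>)) (snd (Z \<omega>) (real_of_ereal (T \<omega>)))) t = snd (Z \<omega>) t)"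
proof -
  have Tminf: "T \<omega> \<noteq> -\<infinity>" if "\<omega> \<in> space Pr" for \<omega> using Ts[OF that] by auto
  note Tm = optional_time_measurable[OF T Tminf]
  define \<tau> where "\<tau> = (\<lambda>\<omega>. real_of_ereal (T \<omega>))"
  have \<tau>: "\<tau> \<in> borel_measurable Pr" unfolding \<tau>_def using Tm by measurable
  have T\<tau>: "T \<omega> = ereal (\<tau> \<omega>)" if "\<omega> \<in> space Pr" "T \<omega> < \<infinity>" for \<omega>
    using Tminf[OF that(1)] that(2) by (cases "T \<omega>") (auto simp: \<tau>_def)
  \<comment> \<open>The condition by which \<open>theta_index\<close> admits index j at level k for
    the point of Z at time t.\<close>
  define C where "C = (\<lambda>k j t \<omega>. fst (D j) \<le> t \<and> ereal (dist (snd (\<Phi> \<omega> j) t) (snd (Z \<omega>) t)) < radius k (snd (Z \<omega>) t))"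
  \<comment> \<open>On A k i the index chosen at level k is i; for fixed k these events are
    disjoint.\<close>
  define A where "A = (\<lambda>k i. {\<omega>\<in>space Pr. T \<omega> < \<infinity> \<and> C k i (\<tau> \<omega>) \<omega> \<and> (\<forall>j\<in>{..<i}. \<not> C k j (\<tau> \<omega>) \<omega>)})"
  have opt: "A k i \<inter> {\<omega>\<in>space Pr. \<tau> \<omega> < r} \<in> sets (filt r)" for k i r
  proof -
    \<comment> \<open>Before r the time agrees with this truncation, which is measurable for
      \<open>filt r\<close>.\<close>
    define \<tau>' where "\<tau>' = (\<lambda>\<omega>. real_of_ereal (min (T \<omega>) (ereal r)))"
    have \<tau>' [measurable]: "\<tau>' \<in> borel_measurable (filt r)"
      unfolding \<tau>'_def using optional_time_min[OF T, of r] by measurable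
    have W [measurable]: "(\<lambda>\<omega>. snd (fam j \<omega>) (min (\<tau>' \<omega>) r)) \<in> borel_measurable (filt r)" for j
    proof (rule measurable_continuous_argument[where W="\<lambda>\<omega> t. snd (fam j \<omega>) (min t r)", OF _ _ \<tau>'])
      show "(\<lambda>\<omega>. snd (fam j \<omega>) (min t r)) \<in> borel_measurable (filt r)" for t
        by (rule V_filt_le) simp
      show "continuous_on UNIV (\<lambda>t. snd (fam j \<omega>) (min t r))" if "\<omega> \<in> space (filt r)" for \<omega>
        by (rule continuous_on_compose2[OF V_cont]) (use that in \<open>auto intro!: continuous_intros\<close>)
    qed
    have [measurable]: "radius k \<in> borel_measurable borel" by (rule radius_measurable)
    have W0 [measurable]: "(\<lambda>\<omega>. snd (Z \<omega>) (min (\<tau>' \<omega>) r)) \<in> borel_measurable (filt r)"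
      using W[of 0] by simp
    have W1 [measurable]: "(\<lambda>\<omega>. snd (\<Phi> \<omega> j) (min (\<tau>' \<omega>) r)) \<in> borel_measurable (filt r)" for j
      using W[of "Suc j"] by simp
    have R [measurable]: "(\<lambda>\<omega>. radius k (snd (Z \<omega>) (min (\<tau>' \<omega>) r))) \<in> borel_measurable (filt r)"
      by (rule measurable_compose[OF W0 radius_measurable])
    have Cm [measurable]: "Measurable.pred (filt r) (\<lambda>\<omega>. C k j (min (\<tau>' \<omega>) r) \<omega>)" for j
      unfolding C_def by measurable
    have Tr [measurable]: "Measurable.pred (filt r) (\<lambda>\<omega>. T \<omega> < ereal r)"
      using T unfolding optional_time_def unfolding pred_def by simp
    have "A k i \<inter> {\<omega>\<in>space Pr. \<tau> \<omega> < r} =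
      {\<omega>\<in>space (filt r). T \<omega> < ereal r \<and> C k i (min (\<tau>' \<omega>) r) \<omega> \<and> (\<forall>j\<in>{..<i}. \<not> C k j (min (\<tau>' \<omega>) r) \<omega>)}"
    proof (intro set_eqI)
      fix \<omega>
      have "min (\<tau>' \<omega>) r = \<tau> \<omega>" if "\<omega> \<in> space Pr" "T \<omega> < ereal r"
        using Tminf[OF that(1)] that(2) by (cases "T \<omega>") (auto simp: \<tau>'_def \<tau>_def min_def)
      moreover have "T \<omega> < \<infinity> \<and> \<tau> \<omega> < r \<longleftrightarrow> T \<omega> < ereal r" if "\<omega> \<in> space Pr"
        using Tminf[OF that] by (cases "T \<omega>") (auto simp: \<tau>_def)
      ultimately show "\<omega> \<in> A k i \<inter> {\<omega>\<in>space Pr. \<tau> \<omega> < r} \<longleftrightarrow> \<omega> \<in>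
          {\<omega>\<in>space (filt r). T \<omega> < ereal r \<and> C k i (min (\<tau>' \<omega>) r) \<omega> \<and> (\<forall>j\<in>{..<i}. \<not> C k j (min (\<tau>' \<omega>) r) \<omega>)}"
        by (auto simp: A_def)
    qed
    also have "\<dots> \<in> sets (filt r)" by measurable
    finally show ?thesis .
  qed
  have Aev: "A k i \<in> sets Pr" for k i
  proof -
    have "A k i = (\<Union>n::nat. A k i \<inter> {\<omega>\<in>space Pr. \<tau> \<omega> < real n})"
      using reals_Archimedean2 by (auto simp: A_def)
    also have "\<dots> \<in> sets Pr" using opt filt_events by (intro sets.countable_nat_UN) blast
    finally show ?thesis .
  qed
  \<comment> \<open>The bad event: the chosen path keeps a distance of at least 2^(-k) from Z after
    T.\<close>
  define B where "B = (\<lambda>k i. A k i \<inter> {\<omega>\<in>space Pr. (1 / 2) ^ k \<le> gap 0 (Suc i) (\<tau> \<omega>) \<omega>})"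
  have Bev: "B k i \<in> sets Pr" for k i
    unfolding B_def using Aev measurable_Collect_in[OF gap_measurable[OF \<tau>], of "{(1 / 2) ^ k..}" 0 "Suc i"] by auto
  have Bi: "emeasure Pr (B k i) \<le> ennreal ((1 / 2) ^ k) * emeasure Pr (A k i)" for k i
    unfolding B_def
  proof (rule gap_bound_at_optional_time[OF \<tau> Aev opt])
    fix \<omega> assume \<omega>: "\<omega> \<in> A k i"
    then show "fam_time 0 \<le> \<tau> \<omega> \<and> fam_time (Suc i) \<le> \<tau> \<omega>"
      using Ts[of \<omega>] T\<tau>[of \<omega>] by (auto simp: A_def C_def)
    show "gap_prob ((1 / 2) ^ k) (snd (fam 0 \<omega>) (\<tau> \<omega>), snd (fam (Suc i) \<omega>) (\<tau> \<omega>)) \<le> (1 / 2) ^ k"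
      by (rule gap_prob_within_radius) (use \<omega> in \<open>simp add: A_def C_def dist_commute\<close>)
  qed
  have disj: "disjoint_family (A k)" for k
    unfolding disjoint_family_on_def
  proof (intro ballI impI)
    fix i j :: nat assume "i \<noteq> j"
    then have "i < j \<or> j < i" by arith
    then show "A k i \<inter> A k j = {}" by (auto simp: A_def)
  qed
  \<comment> \<open>Disjointness turns the sum of the bounds into 2^(-k) times a probability,
    however many indices compete.\<close>
  have PB: "emeasure Pr (\<Union>i. B k i) \<le> ennreal ((1 / 2) ^ k)" for k
  proof -
    have "emeasure Pr (\<Union>i. B k i) \<le> (\<Sum>i. emeasure Pr (B k i))"
      using Bev by (intro emeasure_subadditive_countably) auto
    also have "\<dots> \<le> (\<Sum>i. ennreal ((1 / 2) ^ k) * emeasure Pr (A k i))"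
      by (intro suminf_le Bi) auto
    also have "\<dots> = ennreal ((1 / 2) ^ k) * (\<Sum>i. emeasure Pr (A k i))" by simp
    also have "(\<Sum>i. emeasure Pr (A k i)) = emeasure Pr (\<Union>i. A k i)"
      using Aev disj by (intro suminf_emeasure) auto
    also have "ennreal ((1 / 2) ^ k) * emeasure Pr (\<Union>i. A k i) \<le> ennreal ((1 / 2) ^ k) * 1"
      by (intro mult_left_mono measure_le_1) auto
    finally show ?thesis by simp
  qed
  have "AE \<omega> in Pr. \<forall>\<^sub>F k in sequentially. \<omega> \<in> space Pr - (\<Union>i. B k i)"
  proof (rule borel_cantelli_AE1)
    show "(\<Union>i. B k i) \<in> sets Pr" for k using Bev by auto
    show "emeasure Pr (\<Union>i. B k i) < \<infinity>" for k by (simp add: emeasure_eq_measure)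
    have "norm (prob (\<Union>i. B k i)) \<le> (1 / 2) ^ k" for k
      using PB[of k] by (simp add: emeasure_eq_measure)
    then show "summable (\<lambda>k. prob (\<Union>i. B k i))"
      by (rule summable_comparison_test'[OF summable_geometric[of "1 / 2 :: real"], rotated]) simp
  qed
  with skel AE_space show ?thesis
  proof eventually_elim
    case (elim \<omega>)
    interpret skeleton_theta \<delta> "\<Phi> \<omega>" P l by (rule skeleton_theta[OF elim(1)])
    show ?case
    proof (intro impI allI)
      fix t assume fin: "T \<omega> < \<infinity>" and "real_of_ereal (T \<omega>) \<le> t"
      then have t: "\<tau> \<omega> \<le> t" by (simp add: \<tau>_def)
      define y where "y = snd (Z \<omega>) (\<tau> \<omega>)"
      let ?n = "\<lambda>k. theta_index \<delta> P (\<Phi> \<omega>) (\<tau> \<omega>) y k"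
      have started: "j \<in> started (\<Phi> \<omega>) u \<longleftrightarrow> fst (D j) \<le> u" for j u
        using paths_fromD(2)[OF Phi_paths[OF elim(2)], of j] by (simp add: started_def)
      have inA: "\<omega> \<in> A k (?n k)" for k
      proof -
        have "C k (?n k) (\<tau> \<omega>) \<omega>"
          using idx[of "\<tau> \<omega>" y k] by (simp add: C_def started y_def)
        moreover have "\<not> C k j (\<tau> \<omega>) \<omega>" if "j < ?n k" for j
          using not_less_Least[OF that[unfolded theta_index_def]] by (simp add: C_def started y_def)
        ultimately show ?thesis using fin elim(2) by (simp add: A_def)
      qed
      from elim(3) have "\<forall>\<^sub>F k in sequentially. gap 0 (Suc (?n k)) (\<tau> \<omega>) \<omega> < (1 / 2) ^ k"
      proof eventually_elim
        case (elim k)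
        then have "\<omega> \<in> space Pr" "\<omega> \<notin> B k (?n k)" by auto
        with inA[of k] show ?case by (simp add: B_def not_le)
      qed
      then have ub: "\<forall>\<^sub>F k in sequentially. path_dist \<delta> (path_shift (\<tau> \<omega>) (\<Phi> \<omega> (?n k))) (path_shift (\<tau> \<omega>) (Z \<omega>)) \<le> (1 / 2) ^ k"
        by eventually_elim (simp add: gap_def paths.commute[of "path_shift (\<tau> \<omega>) (Z \<omega>)"] less_imp_le)
      have p: "path_shift (\<tau> \<omega>) (\<Phi> \<omega> n) \<in> paths" "path_shift (\<tau> \<omega>) (Z \<omega>) \<in> paths" for n
        using path_shift_paths[OF V_paths[OF elim(2), of "Suc n"]] path_shift_paths[OF V_paths[OF elim(2), of 0]]
        by (auto simp: paths_from_def)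
      have "(\<lambda>k. (1 / 2 :: real) ^ k) \<longlonglongrightarrow> 0" by (rule LIMSEQ_power_zero) simp
      from tendsto_sandwich[OF _ ub tendsto_const this]
      have "(\<lambda>k. path_dist \<delta> (path_shift (\<tau> \<omega>) (\<Phi> \<omega> (?n k))) (path_shift (\<tau> \<omega>) (Z \<omega>))) \<longlonglongrightarrow> 0" by simp
      from path_dist_tendsto_eval[OF p(1) p(2) this, of "t - \<tau> \<omega>"]
      have lim: "(\<lambda>k. snd (\<Phi> \<omega> (?n k)) t) \<longlonglongrightarrow> snd (Z \<omega>) t" using t by simp
      \<comment> \<open>The full sequence converges to Z at time t, hence so does the subsequence
        behind the selector's choice.\<close>
      obtain r where r: "strict_mono r" "\<theta> (\<tau> \<omega>) y \<in> paths"
        "(\<lambda>k. path_dist \<delta> (approx (\<tau> \<omega>) y (r k)) (\<theta> (\<tau> \<omega>) y)) \<longlonglongrightarrow> 0"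
        by (rule theta_limit)
      have "(\<lambda>k. snd (\<Phi> \<omega> (?n (r k))) t) \<longlonglongrightarrow> snd (\<theta> (\<tau> \<omega>) y) t"
        using theta_eval_limit[OF r(1,3), of t] t by simp
      moreover have "(\<lambda>k. snd (\<Phi> \<omega> (?n (r k))) t) \<longlonglongrightarrow> snd (Z \<omega>) t"
        using LIMSEQ_subseq_LIMSEQ[OF lim r(1)] by (simp add: o_def)
      ultimately have "snd (\<theta> (\<tau> \<omega>) y) t = snd (Z \<omega>) t" by (rule LIMSEQ_unique)
      then show "snd (\<theta> (real_of_ereal (T \<omega>)) (snd (Z \<omega>) (real_of_ereal (T \<omega>)))) t = snd (Z \<omega>) t"
        by (simp add: \<tau>_def y_def)
    qed
  qed
qed

text \<open>The construction run with the constant family Z: switching times that depend on Z alone,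
  to be identified with those of \<open>theta\<close>.\<close>

definition hit_time :: "nat \<Rightarrow> 'w \<Rightarrow> ereal" where
  "hit_time k \<omega> = sigma_time (\<lambda>_ _. Z \<omega>) F s x k"

text \<open>A hit after the previous time and before r falls into some [a, b] with rational ends, b
  < r and the previous time below a; the latter event is known at time a by induction.\<close>

lemma hit_time_optional: "optional_time (hit_time k)"
proof (induction k)
  case 0
  have "{\<omega>\<in>space Pr. hit_time 0 \<omega> < ereal r} = (if s < r then space (filt r) else {})" for r
    by (auto simp: hit_time_def)
  then show ?case unfolding optional_time_def by (metis sets.empty_sets sets.top)
next
  case (Suc k)
  show ?case
    unfolding optional_time_def
  proof
    fix r
    have "{\<omega>\<in>space Pr. hit_time (Suc k) \<omega> < ereal r} =
      (\<Union>a\<in>\<rat>. \<Union>b\<in>{b\<in>\<rat>. b < r \<and> a \<le> b}. {\<omega>\<in>space Pr. hit_time k \<omega> < ereal a} \<inter>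
        {\<omega>\<in>space (filt r). \<exists>t\<in>{a..b}. (t, snd (Z \<omega>) t) \<in> F})"
      unfolding hit_time_def sigma_Suc_less_iff hit_rational_interval by auto
    also have "\<dots> \<in> sets (filt r)"
    proof (intro sets.countable_UN'' sets.Int)
      show "countable (\<rat> :: real set)" by (rule countable_rat)
      show "countable {b\<in>\<rat>. b < r \<and> a \<le> b}" for a
        by (rule countable_subset[OF _ countable_rat]) auto
      fix a b :: real assume a: "a \<in> \<rat>" and b: "b \<in> {b\<in>\<rat>. b < r \<and> a \<le> b}"
      show "{\<omega>\<in>space Pr. hit_time k \<omega> < ereal a} \<in> sets (filt r)"
        using Suc filt_mono[of a r] b unfolding optional_time_def by auto
      show "{\<omega>\<in>space (filt r). \<exists>t\<in>{a..b}. (t, snd (Z \<omega>) t) \<in> F} \<in> sets (filt r)"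
      proof (rule hit_measurable[OF F])
        show "continuous_on UNIV (snd (Z \<omega>))" if "\<omega> \<in> space (filt r)" for \<omega>
          using V_cont[of \<omega> 0] that by simp
        show "(\<lambda>\<omega>. snd (Z \<omega>) t) \<in> borel_measurable (filt r)" if "t \<le> b" for t
          using V_filt_le[of t r 0] that b by simp
      qed (use a b in auto)
    qed
    finally show "{\<omega>\<in>space Pr. hit_time (Suc k) \<omega> < ereal r} \<in> sets (filt r)" .
  qed
qed

text \<open>Outside one null set, \<open>theta\<close> started on Z at any of the hitting times
  follows Z. Hence the switching times and points of the construction are those of Z, and its value
  at t is read off the active stage.\<close>

lemma glued_flow_eq_path:
  assumes stop: "AE \<omega> in Pr. \<forall>s x. k_stop (theta \<delta> P l (\<Phi> \<omega>)) F s x < \<infinity>"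
  shows "AE \<omega> in Pr. \<forall>t\<ge>s. glued_flow (theta \<delta> P l (\<Phi> \<omega>)) F s t x = snd (Z \<omega>) t"
proof -
  have "AE \<omega> in Pr. \<forall>k. hit_time k \<omega> < \<infinity> \<longrightarrow> (\<forall>t\<ge>real_of_ereal (hit_time k \<omega>).
    snd (theta \<delta> P l (\<Phi> \<omega>) (real_of_ereal (hit_time k \<omega>)) (snd (Z \<omega>) (real_of_ereal (hit_time k \<omega>)))) t = snd (Z \<omega>) t)"
    unfolding AE_all_countable
    by (intro allI theta_at_optional_time hit_time_optional) (simp add: hit_time_def sigma_ge)
  with stop skel AE_space show ?thesis
  proof eventually_elim
    case (elim \<omega>)
    interpret S: skeleton_theta \<delta> "\<Phi> \<omega>" P l by (rule skeleton_theta[OF elim(2)])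
    let ?th = "theta \<delta> P l (\<Phi> \<omega>)"
    interpret G: gluing ?th F
      by unfold_locales (use F S.theta_paths S.theta_start elim(1) in auto)
    have start: "snd (Z \<omega>) s = x" using versionD(2)[OF Z elim(3)] .
    have agree: "snd (?th a (snd (Z \<omega>) a)) t = snd (Z \<omega>) t" if "hit_time k \<omega> = ereal a" "a \<le> t" for k a t
      using elim(4)[rule_format, of k t] that by simp
    have stages: "sigma_time ?th F s x k = hit_time k \<omega> \<and>
      (\<forall>a. hit_time k \<omega> = ereal a \<longrightarrow> z_point ?th F s x k = snd (Z \<omega>) a)" for k
    proof (induction k)
      case 0
      then show ?case using start by (simp add: hit_time_def)
    next
      case (Suc k)
      show ?case
      proof (cases "hit_time k \<omega>")
        case (real a)
        then have z: "sigma_time ?th F s x k = ereal a" "z_point ?th F s x k = snd (Z \<omega>) a" using Suc by auto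
        have "sigma_time ?th F s x (Suc k) = first_hit F (snd (Z \<omega>)) a"
          unfolding sigma_Suc_finite[OF z(1)] z(2) by (rule first_hit_cong) (use agree[OF real] in simp)
        also have "\<dots> = hit_time (Suc k) \<omega>"
          using sigma_Suc_finite[of "\<lambda>_ _. Z \<omega>" F s x k a] real by (simp add: hit_time_def)
        finally have sig: "sigma_time ?th F s x (Suc k) = hit_time (Suc k) \<omega>" .
        have "z_point ?th F s x (Suc k) = snd (Z \<omega>) b" if b: "hit_time (Suc k) \<omega> = ereal b" for b
        proof -
          have "ereal a \<le> ereal b" using sigma_mono_Suc[of ?th F s x k] sig b z by simp
          then show ?thesis using z_Suc_finite[OF z(1), of b] sig b z(2) agree[OF real] by simp
        qed
        with sig show ?thesis by simp
      next
        case PInf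
        then show ?thesis
          using Suc sigma_Suc_infinite[of ?th F s x k] sigma_Suc_infinite[of "\<lambda>_ _. Z \<omega>" F s x k]
          by (simp add: hit_time_def)
      next
        case MInf
        then show ?thesis using sigma_not_minf[of "\<lambda>_ _. Z \<omega>" F s x k] by (simp add: hit_time_def)
      qed
    qed
    show ?case
    proof (intro allI impI)
      fix t assume t: "s \<le> t"
      define L where "L = (LEAST k. G.stage_at s x t k)"
      have "sigma_time ?th F s x L \<le> ereal t" by (rule G.Least_stage_at(2)[OF t L_def])
      then obtain a where a: "sigma_time ?th F s x L = ereal a" "a \<le> t"
        using sigma_not_minf[of ?th F s x L] by (cases "sigma_time ?th F s x L") auto
      then have "G.piece s x L t = snd (?th a (snd (Z \<omega>) a)) t" using stages[of L] by (simp add: G.piece_def)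
      also have "\<dots> = snd (Z \<omega>) t" using agree[of L a t] stages[of L] a by simp
      finally show "glued_flow ?th F s t x = snd (Z \<omega>) t" unfolding G.glued_eq[OF t] L_def .
    qed
  qed
qed

end

section \<open>Joint measurability\<close>

lemma z_point_Suc:
  "z_point th F s x (Suc k) = (if sigma_time th F s x (Suc k) < \<infinity>
     then snd (th (real_of_ereal (sigma_time th F s x k)) (z_point th F s x k)) (real_of_ereal (sigma_time th F s x (Suc k)))
     else x)"
  by (simp add: sigma_time_def z_point_def Let_def split_beta)

context flow_setting
begin

text \<open>W, S and X are measurable functions of a parameter, because the stages evaluate
  \<open>theta\<close> at times and points that themselves depend on the parameter.\<close>

lemma theta_index_measurable:
  assumes W: "W \<in> K \<rightarrow>\<^sub>M Pr" and S: "S \<in> borel_measurable K" and X: "X \<in> borel_measurable K"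
  shows "(\<lambda>p. theta_index \<delta> P (\<Phi> (W p)) (S p) (X p) k) \<in> K \<rightarrow>\<^sub>M count_space UNIV"
  unfolding theta_index_def
proof (rule measurable_Least)
  fix i
  have \<Phi>: "(\<lambda>p. \<Phi> (W p) i) \<in> K \<rightarrow>\<^sub>M path_measure \<delta>"
    by (rule measurable_compose[OF W version_path_measurable[OF version_Phi]])
  have [measurable]: "(\<lambda>p. fst (\<Phi> (W p) i)) \<in> borel_measurable K"
    by (rule measurable_compose[OF \<Phi> start_measurable])
  have [measurable]: "(\<lambda>p. snd (\<Phi> (W p) i) (S p)) \<in> borel_measurable K"
    by (rule measurable_eval_at[OF \<Phi> S])
  have [measurable]: "(\<lambda>p. radius k (X p)) \<in> borel_measurable K"
    by (rule measurable_compose[OF X radius_measurable])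
  note [measurable] = S X
  show "Measurable.pred K (\<lambda>p. i \<in> started (\<Phi> (W p)) (S p) \<and>
      ereal (dist (snd (\<Phi> (W p) i) (S p)) (X p)) < radius k (X p))"
    unfolding started_def mem_Collect_eq by measurable
qed

lemma theta_measurable:
  assumes l: "limit_point_selector \<delta> l"
    and W: "W \<in> K \<rightarrow>\<^sub>M Pr" and S: "S \<in> borel_measurable K" and X: "X \<in> borel_measurable K"
  shows "(\<lambda>p. theta \<delta> P l (\<Phi> (W p)) (S p) (X p)) \<in> K \<rightarrow>\<^sub>M path_measure \<delta>"
proof -
  have "(\<lambda>p. path_tail (S p) (\<Phi> (W p) (theta_index \<delta> P (\<Phi> (W p)) (S p) (X p) k))) \<in> K \<rightarrow>\<^sub>M path_measure \<delta>" for k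
    by (rule measurable_compose_countable[OF _ theta_index_measurable[OF W S X]])
      (rule measurable_path_tail[OF measurable_compose[OF W version_path_measurable[OF version_Phi]] S])
  then have "(\<lambda>p k. path_tail (S p) (\<Phi> (W p) (theta_index \<delta> P (\<Phi> (W p)) (S p) (X p) k))) \<in>
      K \<rightarrow>\<^sub>M (\<Pi>\<^sub>M n\<in>UNIV. path_measure \<delta>)"
    by (rule measurable_abs_UNIV)
  from measurable_compose[OF this] l show ?thesis
    unfolding theta_def limit_point_selector_def by blast
qed

text \<open>Time and point are treated together because each feeds the next step; the new time is
  below c exactly if there is a hit in one of countably many rational intervals.\<close>

lemma stage_measurable:
  assumes l: "limit_point_selector \<delta> l" and F: "closed F"
    and W: "W \<in> K \<rightarrow>\<^sub>M Pr" and S: "S \<in> borel_measurable K" and X: "X \<in> borel_measurable K"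
  shows "(\<lambda>p. sigma_time (theta \<delta> P l (\<Phi> (W p))) F (S p) (X p) k) \<in> borel_measurable K \<and>
    (\<lambda>p. z_point (theta \<delta> P l (\<Phi> (W p))) F (S p) (X p) k) \<in> borel_measurable K"
proof (induction k)
  case 0
  then show ?case using S X by simp
next
  case (Suc k)
  let ?\<sigma> = "\<lambda>k p. sigma_time (theta \<delta> P l (\<Phi> (W p))) F (S p) (X p) k"
  let ?z = "\<lambda>k p. z_point (theta \<delta> P l (\<Phi> (W p))) F (S p) (X p) k"
  let ?\<Theta> = "\<lambda>p. theta \<delta> P l (\<Phi> (W p)) (real_of_ereal (?\<sigma> k p)) (?z k p)"
  have \<sigma>k: "?\<sigma> k \<in> borel_measurable K" using Suc by simp
  have \<Theta>: "?\<Theta> \<in> K \<rightarrow>\<^sub>M path_measure \<delta>"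
    using Suc by (intro theta_measurable l W) auto
  have \<sigma>: "?\<sigma> (Suc k) \<in> borel_measurable K"
  proof (rule borel_measurableI_less)
    fix c :: ereal
    have "{p\<in>space K. ?\<sigma> (Suc k) p < c} =
      (\<Union>a\<in>\<rat>. \<Union>b\<in>{b\<in>\<rat>. ereal b < c \<and> a \<le> b}. {p\<in>space K. ?\<sigma> k p \<in> {..<ereal a}} \<inter>
        {p\<in>space K. \<exists>t\<in>{a..b}. (t, snd (?\<Theta> p) t) \<in> F})"
      unfolding sigma_Suc_less_iff hit_rational_interval by auto
    also have "\<dots> \<in> sets K"
    proof (intro sets.countable_UN'' sets.Int)
      show "countable (\<rat> :: real set)" by (rule countable_rat)
      show "countable {b\<in>\<rat>. ereal b < c \<and> a \<le> b}" for a
        by (rule countable_subset[OF _ countable_rat]) auto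
      fix a b :: real assume a: "a \<in> \<rat>" and b: "b \<in> {b\<in>\<rat>. ereal b < c \<and> a \<le> b}"
      show "{p\<in>space K. ?\<sigma> k p \<in> {..<ereal a}} \<in> sets K"
        by (rule measurable_Collect_in[OF \<sigma>k]) simp
      show "{p\<in>space K. \<exists>t\<in>{a..b}. (t, snd (?\<Theta> p) t) \<in> F} \<in> sets K"
      proof (rule hit_measurable[OF F])
        show "continuous_on UNIV (snd (?\<Theta> p))" if "p \<in> space K" for p
          using measurable_space[OF \<Theta> that] by (intro paths_continuous) simp
        show "(\<lambda>p. snd (?\<Theta> p) t) \<in> borel_measurable K" for t
          by (rule measurable_compose[OF \<Theta> eval_measurable])
      qed (use a b in auto)
    qed
    finally show "{p\<in>space K. ?\<sigma> (Suc k) p < c} \<in> sets K" .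
  qed
  have "(\<lambda>p. snd (?\<Theta> p) (real_of_ereal (?\<sigma> (Suc k) p))) \<in> borel_measurable K"
    using \<sigma> by (intro measurable_eval_at[OF \<Theta>]) measurable
  moreover have "Measurable.pred K (\<lambda>p. ?\<sigma> (Suc k) p < \<infinity>)" using \<sigma> by measurable
  ultimately have "?z (Suc k) \<in> borel_measurable K"
    unfolding z_point_Suc using X by (intro measurable_If) (auto simp: pred_def)
  with \<sigma> show ?case by blast
qed

text \<open>By \<open>glued_eq\<close> the value is taken from a countable family of measurable
  functions by a measurable least number. That formula relies on a finite \<open>k_stop\<close>,
  which \<open>good\<close> provides for every parameter.\<close>

lemma glued_flow_measurable:
  assumes l: "limit_point_selector \<delta> l" and F: "closed F"
    and W: "W \<in> K \<rightarrow>\<^sub>M Pr" and S: "S \<in> borel_measurable K" and T: "T \<in> borel_measurable K"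
    and X: "X \<in> borel_measurable K" and ST: "\<And>p. p \<in> space K \<Longrightarrow> S p \<le> T p"
    and good: "\<And>p. p \<in> space K \<Longrightarrow> gluing (theta \<delta> P l (\<Phi> (W p))) F"
  shows "(\<lambda>p. glued_flow (theta \<delta> P l (\<Phi> (W p))) F (S p) (T p) (X p)) \<in> borel_measurable K"
proof -
  let ?\<sigma> = "\<lambda>k p. sigma_time (theta \<delta> P l (\<Phi> (W p))) F (S p) (X p) k"
  let ?z = "\<lambda>k p. z_point (theta \<delta> P l (\<Phi> (W p))) F (S p) (X p) k"
  let ?f = "\<lambda>k p. snd (theta \<delta> P l (\<Phi> (W p)) (real_of_ereal (?\<sigma> k p)) (?z k p)) (T p)"
  let ?L = "\<lambda>p. LEAST k. ereal (T p) < ?\<sigma> (Suc k) p \<or> ?\<sigma> k p = ?\<sigma> (Suc k) p"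
  have \<sigma> [measurable]: "?\<sigma> k \<in> borel_measurable K" and z: "?z k \<in> borel_measurable K" for k
    using stage_measurable[OF l F W S X] by auto
  note [measurable] = T
  have "?f k \<in> borel_measurable K" for k
    by (intro measurable_eval_at theta_measurable l W z T) measurable
  moreover have "?L \<in> K \<rightarrow>\<^sub>M count_space UNIV"
    by (rule measurable_Least) measurable
  ultimately have "(\<lambda>p. ?f (?L p) p) \<in> borel_measurable K" by (rule measurable_compose_countable)
  moreover have "glued_flow (theta \<delta> P l (\<Phi> (W p))) F (S p) (T p) (X p) = ?f (?L p) p" if "p \<in> space K" for p
    unfolding gluing.glued_eq[OF good[OF that] ST[OF that]] gluing.piece_def[OF good[OF that]]
      gluing.stage_at_def[OF good[OF that]] ..
  ultimately show ?thesis by (subst measurable_cong) auto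
qed

end

theorem theorem3p9:
  fixes P :: "nat \<Rightarrow> real \<Rightarrow> (nat \<Rightarrow> 'm::{heine_borel, polish_space}) \<Rightarrow> (nat \<Rightarrow> 'm) measure"
    and Pr :: "'w measure"
    and \<psi>0 :: "real \<Rightarrow> real \<Rightarrow> 'w \<Rightarrow> 'm \<Rightarrow> 'm"
    and \<delta> :: "(real \<Rightarrow> 'm) \<Rightarrow> (real \<Rightarrow> 'm) \<Rightarrow> real"
    and D :: "nat \<Rightarrow> real \<times> 'm"
    and \<Phi> :: "'w \<Rightarrow> nat \<Rightarrow> 'm path"
    and l :: "(nat \<Rightarrow> 'm path) \<Rightarrow> 'm path"
    and F :: "(real \<times> 'm) set"
  assumes transition: "consistent_coalescing_Feller P"
    and TF3: "TF3 P"
    and flow: "stochastic_flow Pr P \<psi>0"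
    and metric: "locally_uniform_metric \<delta>"
    and dense: "closure (range D) = UNIV"
    and \<Phi>: "continuous_modifications Pr \<psi>0 D \<Phi>"
    and TF4: "AE \<omega> in Pr. skeleton \<delta> (\<Phi> \<omega>)"
    and selector: "limit_point_selector \<delta> l"
    and shell: "closed_shell Pr \<Phi> F"
    and a: "AE \<omega> in Pr. \<forall>s x. k_stop (theta \<delta> P l (\<Phi> \<omega>)) F s x < \<infinity>"
    and b: "AE \<omega> in Pr. \<forall>s x. k_stop (theta \<delta> P l (\<Phi> \<omega>)) F s x = 0 \<longrightarrow>
              (\<forall>t>s. \<exists>n\<in>started (\<Phi> \<omega>) t.
                 path_tail t (theta \<delta> P l (\<Phi> \<omega>) s x) = path_tail t (\<Phi> \<omega> n))"
  shows "\<exists>\<Omega>0\<in>sets Pr. measure Pr \<Omega>0 = 1 \<and>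
           (\<forall>\<omega>\<in>\<Omega>0. skeleton \<delta> (\<Phi> \<omega>) \<and> bifurcation_points (\<Phi> \<omega>) \<subseteq> F \<and>
              (\<forall>s x. k_stop (theta \<delta> P l (\<Phi> \<omega>)) F s x < \<infinity>) \<and>
              (\<forall>s x. k_stop (theta \<delta> P l (\<Phi> \<omega>)) F s x = 0 \<longrightarrow>
                 (\<forall>t>s. \<exists>n\<in>started (\<Phi> \<omega>) t.
                    path_tail t (theta \<delta> P l (\<Phi> \<omega>) s x) = path_tail t (\<Phi> \<omega> n)))) \<and>
           strong_measurable_continuous_modification (restrict_space Pr \<Omega>0) \<psi>0
             (\<lambda>s t \<omega> x. glued_flow (theta \<delta> P l (\<Phi> \<omega>)) F s t x)"
proof -
  interpret prob_space Pr using flow by (simp add: stochastic_flow_def)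
  interpret flow_setting \<delta> Pr P \<psi>0 D \<Phi>
    by unfold_locales (use metric transition flow dense \<Phi> TF4 in auto)
  have F: "closed F" and B: "AE \<omega> in Pr. bifurcation_points (\<Phi> \<omega>) \<subseteq> F"
    using shell by (auto simp: closed_shell_def)
  let ?th = "\<lambda>\<omega>. theta \<delta> P l (\<Phi> \<omega>)"
  \<comment> \<open>Collects all the almost sure hypotheses; the probability space is then
    restricted to an event of probability one on which they hold everywhere.\<close>
  define good where "good = (\<lambda>\<omega>. skeleton \<delta> (\<Phi> \<omega>) \<and> bifurcation_points (\<Phi> \<omega>) \<subseteq> F \<and>
      (\<forall>s x. k_stop (?th \<omega>) F s x < \<infinity>) \<and>
      (\<forall>s x. k_stop (?th \<omega>) F s x = 0 \<longrightarrow>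
         (\<forall>t>s. \<exists>n\<in>started (\<Phi> \<omega>) t. path_tail t (?th \<omega> s x) = path_tail t (\<Phi> \<omega> n))))"
  have "AE \<omega> in Pr. good \<omega>" using TF4 B a b unfolding good_def by eventually_elim blast
  then obtain \<Omega>0 where \<Omega>0: "\<Omega>0 \<subseteq> {\<omega>\<in>space Pr. good \<omega>}" "\<Omega>0 \<in> sets Pr" "prob \<Omega>0 = 1"
    by (rule AE_E_prob)
  let ?N = "restrict_space Pr \<Omega>0"
  have spN: "space ?N = \<Omega>0" using \<Omega>0(1) by (auto simp: space_restrict_space)
  have flow_gluing: "flow_gluing (?th \<omega>) F (\<Phi> \<omega>)" if "\<omega> \<in> \<Omega>0" for \<omega>
  proof -
    have g: "good \<omega>" using that \<Omega>0(1) by blast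
    interpret skeleton_theta \<delta> "\<Phi> \<omega>" P l
      by unfold_locales (use g selector radius_pos in \<open>auto simp: good_def\<close>)
    show ?thesis
      by (rule flow_gluing_theta) (use g F in \<open>auto simp: good_def\<close>)
  qed
  then have gluing: "gluing (?th \<omega>) F" if "\<omega> \<in> \<Omega>0" for \<omega>
    using that flow_gluing.axioms(1) by blast
  \<comment> \<open>One statement for three purposes: measurability in x, in \<omega>, and jointly
    in all arguments.\<close>
  have meas: "(\<lambda>p. glued_flow (?th (W p)) F (S p) (T p) (X p)) \<in> borel_measurable K"
    if W: "W \<in> K \<rightarrow>\<^sub>M ?N" and "S \<in> borel_measurable K" "T \<in> borel_measurable K" "X \<in> borel_measurable K"
      "\<And>p. p \<in> space K \<Longrightarrow> S p \<le> T p" for W S T X and K :: "'k measure"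
  proof (rule glued_flow_measurable[OF selector F _ that(2-5)])
    show "W \<in> K \<rightarrow>\<^sub>M Pr" using W by (simp add: measurable_restrict_space2_iff)
    show "gluing (?th (W p)) F" if "p \<in> space K" for p
      using measurable_space[OF W that] by (intro gluing) (simp add: spN)
  qed
  have "strong_measurable_continuous_modification ?N \<psi>0 (\<lambda>s t \<omega> x. glued_flow (?th \<omega>) F s t x)"
    unfolding strong_measurable_continuous_modification_def
  proof (intro conjI allI impI ballI)
    fix s t :: real assume st: "s \<le> t"
    show "(\<lambda>\<omega> x. glued_flow (?th \<omega>) F s t x) \<in> ?N \<rightarrow>\<^sub>M maps_measure"
      unfolding maps_measure_def
    proof (rule measurable_restrict_space2)
      show "(\<lambda>\<omega> x. glued_flow (?th \<omega>) F s t x) \<in> space ?N \<rightarrow> borel \<rightarrow>\<^sub>M borel"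
      proof
        fix \<omega> assume "\<omega> \<in> space ?N"
        then have "(\<lambda>_. \<omega>) \<in> (borel :: 'm measure) \<rightarrow>\<^sub>M ?N" by simp
        then show "(\<lambda>x. glued_flow (?th \<omega>) F s t x) \<in> borel \<rightarrow>\<^sub>M borel"
          by (rule meas) (use st in auto)
      qed
      show "(\<lambda>\<omega> x. glued_flow (?th \<omega>) F s t x) \<in> ?N \<rightarrow>\<^sub>M (\<Pi>\<^sub>M x\<in>UNIV. borel)"
        by (rule measurable_abs_UNIV) (rule meas, use st in auto)
    qed
  next
    fix s x \<omega> assume "\<omega> \<in> space ?N"
    then interpret gluing "?th \<omega>" F by (intro gluing) (simp add: spN)
    show "glued_flow (?th \<omega>) F s s x = x" by (rule glued_start)
    show "continuous_on {s..} (\<lambda>t. glued_flow (?th \<omega>) F s t x)" by (rule glued_continuous)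
  next
    fix s t :: real and x assume st: "s \<le> t"
    \<comment> \<open>Z mediates between the two flows: the glued flow equals Z almost surely at all
      times after s, and Z is a version of the given flow.\<close>
    obtain Z where Z: "version s x Z" using ex_version by blast
    interpret tracked_path \<delta> Pr P \<psi>0 D \<Phi> l F s x Z
      by unfold_locales (use selector F Z in auto)
    have "AE \<omega> in Pr. glued_flow (?th \<omega>) F s t x = \<psi>0 s t \<omega> x"
      using glued_flow_eq_path[OF a] versionD(4)[OF Z st] by eventually_elim (use st in simp)
    then show "AE \<omega> in ?N. glued_flow (?th \<omega>) F s t x = \<psi>0 s t \<omega> x"
      using \<Omega>0(2) by (subst AE_restrict_space_iff) auto
  next
    let ?K = "restrict_space borel {(s :: real, t). s \<le> t} \<Otimes>\<^sub>M borel \<Otimes>\<^sub>M ?N"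
    have fs: "fst \<in> restrict_space borel {(s :: real, t). s \<le> t} \<rightarrow>\<^sub>M borel"
      "snd \<in> restrict_space borel {(s :: real, t). s \<le> t} \<rightarrow>\<^sub>M borel"
      by (auto intro!: measurable_restrict_space1 borel_measurable_continuous_onI continuous_intros)
    have "(\<lambda>p. glued_flow (?th (snd (snd p))) F (fst (fst p)) (snd (fst p)) (fst (snd p))) \<in> ?K \<rightarrow>\<^sub>M borel"
    proof (rule meas)
      show "(\<lambda>p. fst (fst p)) \<in> borel_measurable ?K"
        by (rule measurable_compose[OF measurable_fst fs(1)])
      show "(\<lambda>p. snd (fst p)) \<in> borel_measurable ?K"
        by (rule measurable_compose[OF measurable_fst fs(2)])
      show "fst (fst p) \<le> snd (fst p)" if "p \<in> space ?K" for p
        using that by (auto simp: space_pair_measure space_restrict_space)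
    qed auto
    then show "(\<lambda>((s, t), x, \<omega>). glued_flow (?th \<omega>) F s t x) \<in> ?K \<rightarrow>\<^sub>M borel"
      by (simp add: case_prod_beta')
  next
    fix s t u :: real and \<omega> assume \<omega>: "\<omega> \<in> space ?N" and stu: "s \<le> t \<and> t \<le> u"
    interpret flow_gluing "?th \<omega>" F "\<Phi> \<omega>" by (rule flow_gluing) (use \<omega> in \<open>simp add: spN\<close>)
    show "(\<lambda>x. glued_flow (?th \<omega>) F s u x) = (\<lambda>x. glued_flow (?th \<omega>) F t u x) \<circ> (\<lambda>x. glued_flow (?th \<omega>) F s t x)"
      using glued_flow_property stu by (auto simp: fun_eq_iff)
  qed
  then show ?thesis
    using \<Omega>0 unfolding good_def by (intro bexI[of _ \<Omega>0]) auto
qed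

end
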